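(* There is an FPT algorithm that decides the (decoupled) \textsc{Spanner} problem parameterized by the maximum number $\mu$ of nontrivial edges in the spanner and the bundle-breadth $b$ of the instance. Precisely: given a connected undirected graph $G=(V,E)$ with $n=|V|$, $m=|E|$, edge weights $w\colon E\to\mathbb{N}_{\ge0}$, edge lengths $\ell\colon E\to\mathbb{N}_{\ge1}$, a stretch factor $\alpha\ge1$, a weight bound $W\in\mathbb{N}$ and a number $\mu$, it decides whether $G$ has an $\alpha$-spanner $H=(V,F)$ with $w(H)\le W$ and $|F\cap N|\le\mu$, where $N$ is the set of nontrivial edges. It runs in $$\mathcal{O}\big(b^{\mu}\cdot\mathrm{APSP}(n,m)+nm+n^2\log n\big)$$ time, including finding a witness (such a spanner) for yes-instances.
   Context: For a subgraph $G'\subseteq G$ and $u,v\in V$, $\ell_{G'}[u,v]$ is the length of a shortest $u$-$v$-path in $G'$ w.r.t. $\ell$. A subgraph $H=(V,F)$, $F\subseteq E$, is an $\alpha$-spanner of $G$ if $\ell_H[u,v]\le\alpha\,\ell_G[u,v]$ for all $u,v\in V$; equivalently, for all $\{u,v\}\in E$. Its weight is $w(H)=\sum_{e\in F}w(e)$. The set of terminal pairs is $K=E$. For $\{u,v\}\in E$, a simple $u$-$v$-path $P$ is settling if $\ell(P)\le\alpha\,\ell_G[u,v]$; it is alternative if it does not contain the edge $\{u,v\}$. $\mathcal{P}_{uv}$ is the set of all settling $u$-$v$-paths. As a preprocessing convention, edges that do not settle themselves (i.e., $\ell(\{u,v\})>\alpha\,\ell_G[u,v]$) are assumed to have been removed from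 the instance. An edge $\{u,v\}$ is mandatory if $\mathcal{P}_{uv}$ contains no alternative path. The trivial edges $T\subseteq E$ are the mandatory edges and the edges of weight $0$; the nontrivial edges are $N=E\setminus T$. A terminal pair $\{u,v\}\in E$ is critical if no settling $u$-$v$-path consists only of trivial edges; $C$ denotes the set of critical terminal pairs. The bundle-breadth is $b=\max_{\{u,v\}\in C}|\mathcal{P}_{uv}|$, the maximum number of settling paths over all critical terminal pairs. $\mathrm{APSP}(n,m)$ denotes the running time of a suitable algorithm for the all-pairs shortest paths problem on a graph with $n$ nodes and $m$ edges. An algorithm is FPT w.r.t. a (possibly combined) parameter $k$ if on instance $I$ it runs in $\mathcal{O}(f(k)\cdot p(\langle I\rangle))$ time for a computable function $f$ and a polynomial $p$ in the encoding length $\langle I\rangle$. *)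

theory Defs
  imports
    Complex_Main
    "HOL-Library.Extended_Real"
    "HOL-Library.Log_Nat"
    "HOL-Computational_Algebra.Polynomial"
begin

section \<open>Graphs, paths and distances\<close>

text \<open>
  A graph on \<open>n\<close> nodes has node set \<open>{..<n}\<close> and a set \<open>E\<close> of edges, each of which is a
  two-element set of nodes. Subgraphs are spanning and hence given by a subset of \<open>E\<close>.
\<close>

definition simple_graph :: "nat \<Rightarrow> nat set set \<Rightarrow> bool" where
  "simple_graph n E \<longleftrightarrow> E \<subseteq> {{u, v} | u v. u < n \<and> v < n \<and> u \<noteq> v}"

definition path_edges :: "nat list \<Rightarrow> nat set list" where
  "path_edges p = map (\<lambda>(x, y). {x, y}) (zip p (tl p))"

definition simple_path :: "nat set set \<Rightarrow> nat \<Rightarrow> nat \<Rightarrow> nat list \<Rightarrow> bool" where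
  "simple_path E u v p \<longleftrightarrow>
     p \<noteq> [] \<and> hd p = u \<and> last p = v \<and> distinct p \<and> set (path_edges p) \<subseteq> E"

definition connected_graph :: "nat \<Rightarrow> nat set set \<Rightarrow> bool" where
  "connected_graph n E \<longleftrightarrow> n \<ge> 1 \<and> (\<forall>u<n. \<forall>v<n. \<exists>p. simple_path E u v p)"

definition path_length :: "(nat set \<Rightarrow> nat) \<Rightarrow> nat list \<Rightarrow> nat" where
  "path_length l p = sum_list (map l (path_edges p))"

text \<open>The distance is \<open>\<infinity>\<close> if there is no path.\<close>

definition distance :: "(nat set \<Rightarrow> nat) \<Rightarrow> nat set set \<Rightarrow> nat \<Rightarrow> nat \<Rightarrow> ereal" where
  "distance l E u v = (INF p \<in> {p. simple_path E u v p}. ereal (real (path_length l p)))"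


section \<open>Instances of the spanner problem\<close>

text \<open>The stretch factor is rational, since it is part of the input of an algorithm.\<close>

record spanner_instance =
  num_nodes :: nat
  edges :: "nat set set"
  weight :: "nat set \<Rightarrow> nat"
  len :: "nat set \<Rightarrow> nat"
  stretch :: rat
  weight_bound :: nat
  max_nontrivial :: nat

abbreviation stretch_ereal :: "spanner_instance \<Rightarrow> ereal" where
  "stretch_ereal I \<equiv> ereal (real_of_rat (stretch I))"

abbreviation dist_in :: "spanner_instance \<Rightarrow> nat set set \<Rightarrow> nat \<Rightarrow> nat \<Rightarrow> ereal" where
  "dist_in I F \<equiv> distance (len I) F"

definition settles_itself :: "spanner_instance \<Rightarrow> nat set \<Rightarrow> bool" where
  "settles_itself I e \<longleftrightarrow>
     (\<forall>u v. e = {u, v} \<longrightarrow> ereal (real (len I e)) \<le> stretch_ereal I * dist_in I (edges I) u v)"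

text \<open>The last conjunct says that edges that do not settle themselves have been removed.\<close>

definition valid_instance :: "spanner_instance \<Rightarrow> bool" where
  "valid_instance I \<longleftrightarrow>
     simple_graph (num_nodes I) (edges I) \<and> connected_graph (num_nodes I) (edges I) \<and>
     (\<forall>e\<in>edges I. len I e \<ge> 1) \<and> stretch I \<ge> 1 \<and>
     (\<forall>e\<in>edges I. settles_itself I e)"

definition is_spanner :: "spanner_instance \<Rightarrow> nat set set \<Rightarrow> bool" where
  "is_spanner I F \<longleftrightarrow> F \<subseteq> edges I \<and>
     (\<forall>u<num_nodes I. \<forall>v<num_nodes I. dist_in I F u v \<le> stretch_ereal I * dist_in I (edges I) u v)"

definition settling_paths :: "spanner_instance \<Rightarrow> nat \<Rightarrow> nat \<Rightarrow> nat list set" where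
  "settling_paths I u v =
     {p. simple_path (edges I) u v p \<and>
         ereal (real (path_length (len I) p)) \<le> stretch_ereal I * dist_in I (edges I) u v}"

definition alternative :: "nat \<Rightarrow> nat \<Rightarrow> nat list \<Rightarrow> bool" where
  "alternative u v p \<longleftrightarrow> {u, v} \<notin> set (path_edges p)"

definition mandatory_edges :: "spanner_instance \<Rightarrow> nat set set" where
  "mandatory_edges I =
     {{u, v} | u v. {u, v} \<in> edges I \<and> \<not> (\<exists>p\<in>settling_paths I u v. alternative u v p)}"

definition trivial_edges :: "spanner_instance \<Rightarrow> nat set set" where
  "trivial_edges I = mandatory_edges I \<union> {e \<in> edges I. weight I e = 0}"

definition nontrivial_edges :: "spanner_instance \<Rightarrow> nat set set" where
  "nontrivial_edges I = edges I - trivial_edges I"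

definition critical :: "spanner_instance \<Rightarrow> nat \<Rightarrow> nat \<Rightarrow> bool" where
  "critical I u v \<longleftrightarrow> {u, v} \<in> edges I \<and>
     \<not> (\<exists>p\<in>settling_paths I u v. set (path_edges p) \<subseteq> trivial_edges I)"

text \<open>
  If there is no critical terminal pair, the maximum over the empty set is taken to be \<open>1\<close>.
  This is the least value that the maximum can attain otherwise, because every edge is a
  settling path for its own end nodes; so inserting \<open>1\<close> has no effect if there is a critical pair.
\<close>

definition bundle_breadth :: "spanner_instance \<Rightarrow> nat" where
  "bundle_breadth I = Max (insert 1 {card (settling_paths I u v) | u v. critical I u v})"

definition is_solution :: "spanner_instance \<Rightarrow> nat set set \<Rightarrow> bool" where
  "is_solution I F \<longleftrightarrow> is_spanner I F \<and> sum (weight I) F \<le> weight_bound I \<and>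
     card (F \<inter> nontrivial_edges I) \<le> max_nontrivial I"


section \<open>Word RAM programs\<close>

text \<open>
  Programs run on a random access machine with unit cost per elementary operation. A state consists
  of registers and of arrays that are addressed indirectly; a program mentions only finitely many
  registers and arrays. Every value arising in a run (constants, intermediate results and
  addresses) must fit into a machine word, that is, must be at most the word bound \<open>B\<close>; a run in
  which a value exceeds \<open>B\<close> is stuck. This rules out packing large data into a single number.
\<close>

record state =
  regs :: "nat \<Rightarrow> nat"
  mem :: "nat \<Rightarrow> nat \<Rightarrow> nat"

datatype operator = Plus | Minus | Times | Divide | Modulo | LessThan | Equals

fun apply_operator :: "operator \<Rightarrow> nat \<Rightarrow> nat \<Rightarrow> nat" where
  "apply_operator Plus x y = x + y"
| "apply_operator Minus x y = x - y"
| "apply_operator Times x y = x * y"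
| "apply_operator Divide x y = x div y"
| "apply_operator Modulo x y = x mod y"
| "apply_operator LessThan x y = (if x < y then 1 else 0)"
| "apply_operator Equals x y = (if x = y then 1 else 0)"

datatype expr = Const nat | Reg nat | Cell nat expr | Op operator expr expr

fun value_of :: "expr \<Rightarrow> state \<Rightarrow> nat" where
  "value_of (Const k) s = k"
| "value_of (Reg r) s = regs s r"
| "value_of (Cell a e) s = mem s a (value_of e s)"
| "value_of (Op f e e') s = apply_operator f (value_of e s) (value_of e' s)"

fun fits :: "nat \<Rightarrow> expr \<Rightarrow> state \<Rightarrow> bool" where
  "fits B (Const k) s \<longleftrightarrow> k \<le> B"
| "fits B (Reg r) s \<longleftrightarrow> regs s r \<le> B"
| "fits B (Cell a e) s \<longleftrightarrow> fits B e s \<and> value_of (Cell a e) s \<le> B"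
| "fits B (Op f e e') s \<longleftrightarrow> fits B e s \<and> fits B e' s \<and> value_of (Op f e e') s \<le> B"

fun cost :: "expr \<Rightarrow> nat" where
  "cost (Const k) = 1"
| "cost (Reg r) = 1"
| "cost (Cell a e) = 1 + cost e"
| "cost (Op f e e') = 1 + cost e + cost e'"

datatype program =
    Skip
  | Assign nat expr
  | Store nat expr expr
  | Seq program program
  | If expr program program
  | While expr program

text \<open>\<open>exec B c s t s'\<close>: with word bound \<open>B\<close>, program \<open>c\<close> takes state \<open>s\<close> to \<open>s'\<close> in \<open>t\<close> steps.\<close>

inductive exec :: "nat \<Rightarrow> program \<Rightarrow> state \<Rightarrow> nat \<Rightarrow> state \<Rightarrow> bool" for B where
  exec_Skip: "exec B Skip s 1 s"
| exec_Assign: "fits B e s \<Longrightarrow>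
    exec B (Assign r e) s (1 + cost e) (s\<lparr>regs := (regs s)(r := value_of e s)\<rparr>)"
| exec_Store: "fits B i s \<Longrightarrow> fits B e s \<Longrightarrow>
    exec B (Store a i e) s (1 + cost i + cost e)
      (s\<lparr>mem := (mem s)(a := (mem s a)(value_of i s := value_of e s))\<rparr>)"
| exec_Seq: "exec B c s t s' \<Longrightarrow> exec B d s' t' s'' \<Longrightarrow> exec B (Seq c d) s (t + t') s''"
| exec_IfTrue: "fits B e s \<Longrightarrow> value_of e s \<noteq> 0 \<Longrightarrow> exec B c s t s' \<Longrightarrow>
    exec B (If e c d) s (1 + cost e + t) s'"
| exec_IfFalse: "fits B e s \<Longrightarrow> value_of e s = 0 \<Longrightarrow> exec B d s t s' \<Longrightarrow>
    exec B (If e c d) s (1 + cost e + t) s'"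
| exec_WhileFalse: "fits B e s \<Longrightarrow> value_of e s = 0 \<Longrightarrow>
    exec B (While e c) s (1 + cost e) s"
| exec_WhileTrue: "fits B e s \<Longrightarrow> value_of e s \<noteq> 0 \<Longrightarrow> exec B c s t s' \<Longrightarrow>
    exec B (While e c) s' t' s'' \<Longrightarrow>
    exec B (While e c) s (1 + cost e + t + t') s''"

inductive_cases exec_SkipE: "exec B Skip s t s'"
inductive_cases exec_AssignE: "exec B (Assign r e) s t s'"
inductive_cases exec_StoreE: "exec B (Store a i e) s t s'"
inductive_cases exec_SeqE: "exec B (Seq c d) s t s'"
inductive_cases exec_IfE: "exec B (If e c d) s t s'"
inductive_cases exec_WhileE: "exec B (While e c) s t s'"

lemma exec_deterministic:
  "exec B c s t s' \<Longrightarrow> exec B c s t' s'' \<Longrightarrow> t = t' \<and> s' = s''"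
proof (induction arbitrary: t' s'' rule: exec.induct)
  case (exec_Skip s)
  then show ?case by (elim exec_SkipE) simp
next
  case (exec_Assign e s r)
  from exec_Assign.prems show ?case by (elim exec_AssignE) simp
next
  case (exec_Store i s e a)
  from exec_Store.prems show ?case by (elim exec_StoreE) simp
next
  case (exec_Seq c s t s' d t2 s2)
  from exec_Seq.prems show ?case
  proof (rule exec_SeqE)
    fix t3 s3 t4
    assume eq: "t' = t3 + t4" and run: "exec B c s t3 s3" "exec B d s3 t4 s''"
    from exec_Seq.IH(1)[OF run(1)] have first: "t = t3" "s' = s3" by auto
    from run(2) have "exec B d s' t4 s''" unfolding first(2) .
    from exec_Seq.IH(2)[OF this] eq first(1) show ?thesis by auto
  qed
next
  case (exec_IfTrue e s c t s' d)
  from exec_IfTrue.prems show ?case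
  proof (rule exec_IfE)
    fix t3
    assume eq: "t' = Suc (cost e + t3)" and run: "exec B c s t3 s''"
    from eq exec_IfTrue.IH[OF run] show ?thesis by auto
  next
    assume "value_of e s = 0"
    with exec_IfTrue.hyps(2) show ?thesis by contradiction
  qed
next
  case (exec_IfFalse e s d t s' c)
  from exec_IfFalse.prems show ?case
  proof (rule exec_IfE)
    assume "0 < value_of e s"
    with exec_IfFalse.hyps(2) show ?thesis by simp
  next
    fix t3
    assume eq: "t' = Suc (cost e + t3)" and run: "exec B d s t3 s''"
    from eq exec_IfFalse.IH[OF run] show ?thesis by auto
  qed
next
  case (exec_WhileFalse e s c)
  from exec_WhileFalse.prems show ?case
  proof (rule exec_WhileE)
    assume "t' = Suc (cost e)" and "s'' = s"
    then show ?thesis by simp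
  next
    assume "0 < value_of e s"
    with exec_WhileFalse.hyps(2) show ?thesis by simp
  qed
next
  case (exec_WhileTrue e s c t s' t2 s2)
  from exec_WhileTrue.prems show ?case
  proof (rule exec_WhileE)
    assume "value_of e s = 0"
    with exec_WhileTrue.hyps(2) show ?thesis by contradiction
  next
    fix t3 s3 t4
    assume eq: "t' = Suc (cost e + t3 + t4)"
      and run: "exec B c s t3 s3" "exec B (While e c) s3 t4 s''"
    from exec_WhileTrue.IH(1)[OF run(1)] have first: "t = t3" "s' = s3" by auto
    from run(2) have "exec B (While e c) s' t4 s''" unfolding first(2) .
    from exec_WhileTrue.IH(2)[OF this] eq first(1) show ?thesis by auto
  qed
qed

definition all_words :: "nat \<Rightarrow> state \<Rightarrow> bool" where
  "all_words B s \<longleftrightarrow> (\<forall>r. regs s r \<le> B) \<and> (\<forall>a i. mem s a i \<le> B)"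


section \<open>Algorithms for all-pairs shortest paths\<close>

text \<open>
  A graph is stored with the numbers of nodes and edges in registers 0 and 1, the two end nodes of
  the \<open>i\<close>-th edge in arrays 0 and 1 and its length in array 2. The edges come in any order. All
  memory that does not hold the input has arbitrary contents.
\<close>

definition stored_edge :: "state \<Rightarrow> nat \<Rightarrow> nat set" where
  "stored_edge s i = {mem s 0 i, mem s 1 i}"

definition stores_graph :: "state \<Rightarrow> nat \<Rightarrow> nat set set \<Rightarrow> (nat set \<Rightarrow> nat) \<Rightarrow> bool" where
  "stores_graph s n E l \<longleftrightarrow>
     regs s 0 = n \<and> regs s 1 = card E \<and> bij_betw (stored_edge s) {..<card E} E \<and>
     (\<forall>i<card E. mem s 2 i = l (stored_edge s i))"

text \<open>
  \<open>A\<close> computes the distance matrix (row by row, into array 4) of every connected graph with \<open>n\<close>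
  nodes and \<open>m\<close> edges in time \<open>T n m\<close>. The word bound is polynomial in the numbers of the input,
  that is, the word length is logarithmic in them.
\<close>

definition apsp_algorithm :: "program \<Rightarrow> (nat \<Rightarrow> nat \<Rightarrow> nat) \<Rightarrow> bool" where
  "apsp_algorithm A T \<longleftrightarrow>
     (\<exists>k. \<forall>n E l B s.
        simple_graph n E \<and> connected_graph n E \<and> (\<forall>e\<in>E. l e \<ge> 1) \<and>
        stores_graph s n E l \<and> B \<ge> (2 + n + sum l E) ^ k \<and> all_words B s \<longrightarrow>
        (\<exists>t s'. exec B A s t s' \<and> t \<le> T n (card E) \<and>
           (\<forall>u<n. \<forall>v<n. distance l E u v = ereal (real (mem s' 4 (u * n + v))))))"


section \<open>Algorithms for the spanner problem\<close>

definition stretch_num :: "spanner_instance \<Rightarrow> nat" where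
  "stretch_num I = nat (fst (quotient_of (stretch I)))"

definition stretch_den :: "spanner_instance \<Rightarrow> nat" where
  "stretch_den I = nat (snd (quotient_of (stretch I)))"

definition stores_instance :: "state \<Rightarrow> spanner_instance \<Rightarrow> bool" where
  "stores_instance s I \<longleftrightarrow>
     stores_graph s (num_nodes I) (edges I) (len I) \<and>
     (\<forall>i<card (edges I). mem s 3 i = weight I (stored_edge s i)) \<and>
     regs s 2 = stretch_num I \<and> regs s 3 = stretch_den I \<and>
     regs s 4 = weight_bound I \<and> regs s 5 = max_nontrivial I"

definition magnitude :: "spanner_instance \<Rightarrow> nat" where
  "magnitude I = 2 + num_nodes I + sum (len I) (edges I) + sum (weight I) (edges I) +
     stretch_num I + stretch_den I + weight_bound I + max_nontrivial I"

text \<open>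
  The output is the answer in register 6 and, for yes-instances, the characteristic vector (with
  respect to the order of the edges in the input) of a solution in array 5.
\<close>

definition correct_output :: "spanner_instance \<Rightarrow> state \<Rightarrow> state \<Rightarrow> bool" where
  "correct_output I s s' \<longleftrightarrow>
     (if \<exists>F. is_solution I F
      then regs s' 6 = 1 \<and>
           is_solution I (stored_edge s ` {i. i < card (edges I) \<and> mem s' 5 i = 1})
      else regs s' 6 = 0)"

definition spanner_algorithm :: "program \<Rightarrow> (spanner_instance \<Rightarrow> real) \<Rightarrow> bool" where
  "spanner_algorithm P bound \<longleftrightarrow>
     (\<exists>k. \<forall>I B s.
        valid_instance I \<and> stores_instance s I \<and> B \<ge> magnitude I ^ k \<and> all_words B s \<longrightarrow>
        (\<exists>t s'. exec B P s t s' \<and> real t \<le> bound I \<and> correct_output I s s'))"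


section \<open>Fixed-parameter tractability\<close>

definition bits :: "nat \<Rightarrow> nat" where
  "bits x = max 1 (floorlog 2 x)"

definition encoding_length :: "spanner_instance \<Rightarrow> nat" where
  "encoding_length I =
     bits (num_nodes I) +
     (\<Sum>e\<in>edges I. 2 * bits (num_nodes I) + bits (len I e) + bits (weight I e)) +
     bits (stretch_num I) + bits (stretch_den I) + bits (weight_bound I) + bits (max_nontrivial I)"

text \<open>Here the word bound may depend on the arguments in any way.\<close>

definition computable2 :: "(nat \<Rightarrow> nat \<Rightarrow> nat) \<Rightarrow> bool" where
  "computable2 f \<longleftrightarrow>
     (\<exists>c. \<forall>x y. \<exists>B. \<forall>s. regs s 0 = x \<and> regs s 1 = y \<longrightarrow>
        (\<exists>t s'. exec B c s t s' \<and> regs s' 2 = f x y))"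

definition fpt_spanner_algorithm :: "program \<Rightarrow> bool" where
  "fpt_spanner_algorithm P \<longleftrightarrow>
     (\<exists>f (p :: nat poly). computable2 f \<and>
        spanner_algorithm P (\<lambda>I.
          real (f (max_nontrivial I) (bundle_breadth I)) * real (poly p (encoding_length I))))"

definition polynomially_bounded :: "(nat \<Rightarrow> nat \<Rightarrow> nat) \<Rightarrow> bool" where
  "polynomially_bounded T \<longleftrightarrow> (\<exists>p :: nat poly. \<forall>n m. T n m \<le> poly p (n + m))"

definition spanner_time_bound :: "(nat \<Rightarrow> nat \<Rightarrow> nat) \<Rightarrow> spanner_instance \<Rightarrow> real" where
  "spanner_time_bound apsp I =
     (let n = num_nodes I; m = card (edges I) in
        real (bundle_breadth I) ^ max_nontrivial I * real (apsp n m) +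
        real n * real m + real n ^ 2 * log 2 (real n))"

end

(* The search keeps a set F of edges, initially the trivial ones, that the spanner has to contain. If F
   leaves a pair unsettled, the pair is critical and the spanner contains one of its at most b settling
   paths, each of which adds a nontrivial edge to F. So the search tree over sets F has at most b^mu leaves.

   The settling paths are not listed in advance but found by binary branching on prefixes: take a shortest
   completion P of the current prefix and the first position at which another settling completion
   leaves P, and branch on whether the next edge of P is used. Both branches contain a settling path, so
   the total number of branching steps is O(b^mu). Each step needs one APSP computation on lengths in
   which forbidden edges have been made too long to be useful instead of being deleted, because the
   APSP algorithm is only known to work on connected graphs and its time depends on m.

   Since any APSP algorithm has to write n^2 numbers, its time bound absorbs all terms O(n^2 + m).
   The mandatory edges are determined in time O(nm) from the first edges of shortest paths. *)

theory Submission
  imports Defs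
begin

section \<open>Walks and distances\<close>

text \<open>The program never learns \<open>b\<close>, which enters only through
  \<open>potential\<close>. So the bound rests on branching without dead ends: each child of a path
  item must have a completion, and then a split distributes the completions of the parent among its
  children. This is why the first deviation is located exactly before branching. One distance matrix
  suffices for that: the graph is undirected, so the matrix gives the distances from the end of the
  prefix, to the target, and from all nodes of P.

  The machine adds an obstacle. The search may visit b^\<mu> items, but words are only polynomial in
  the numbers of the input. Hence the length that simulates deletion has to stay small, and the
  height of the stack needs a bound of its own, since addresses must fit into words.

  The given algorithm is known only through its specification. It runs on a renamed copy of the
  registers and arrays, and its time is compared with n^2 by what it has to write. The unconditional
  part of the theorem needs at least one such algorithm; Floyd-Warshall, verified on the same
  machine, provides it.\<close>

definition walk :: "nat set set \<Rightarrow> nat \<Rightarrow> nat \<Rightarrow> nat list \<Rightarrow> bool" where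
  "walk E u v p \<longleftrightarrow> p \<noteq> [] \<and> hd p = u \<and> last p = v \<and> set (path_edges p) \<subseteq> E"

text \<open>Walks are the working notion: they can be concatenated freely, and distances do not
  change when nodes may be repeated. Distinctness is restored only at the end, by
  \<open>walk_imp_simple_path\<close>.\<close>

lemma simple_path_iff_walk: "simple_path E u v p \<longleftrightarrow> walk E u v p \<and> distinct p"
  by (auto simp: simple_path_def walk_def)

lemma path_edges_simps [simp]:
  "path_edges [] = []" "path_edges [x] = []"
  "path_edges (x # y # p) = {x, y} # path_edges (y # p)"
  by (auto simp: path_edges_def)

lemma path_length_simps [simp]:
  "path_length l [] = 0" "path_length l [x] = 0"
  "path_length l (x # y # p) = l {x, y} + path_length l (y # p)"
  by (auto simp: path_length_def)

lemma path_edges_append: "path_edges (p @ x # q) = path_edges (p @ [x]) @ path_edges (x # q)"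
proof (induction p)
  case (Cons a p)
  then show ?case by (cases p) auto
qed simp

lemma path_length_append:
  "path_length l (p @ x # q) = path_length l (p @ [x]) + path_length l (x # q)"
  by (simp add: path_length_def path_edges_append[of p x q])

lemma path_edges_rev: "path_edges (rev p) = rev (path_edges p)"
proof (induction p rule: induct_list012)
  case (3 x y p)
  then show ?case using path_edges_append[of "rev p" y "[x]"] by (simp add: insert_commute)
qed auto

lemma path_length_rev: "path_length l (rev p) = path_length l p"
  by (simp add: path_length_def path_edges_rev rev_map[symmetric])

lemma path_edges_split:
  assumes "e \<in> set (path_edges p)"
  obtains p1 x y p2 where "p = p1 @ x # y # p2" "e = {x, y}"
  using assms
proof (induction p arbitrary: thesis rule: induct_list012)
  case (3 x y p)
  show ?case
  proof (cases "e = {x, y}")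
    case True
    then show ?thesis using 3(3)[of "[]" x y p] by simp
  next
    case False
    then have "e \<in> set (path_edges (y # p))" using 3(4) by simp
    then obtain p1 x' y' p2 where "y # p = p1 @ x' # y' # p2" "e = {x', y'}" using 3(2) by blast
    then show ?thesis using 3(3)[of "x # p1" x' y' p2] by simp
  qed
qed auto

lemma path_edges_mem: "{x, y} \<in> set (path_edges (p1 @ x # y # p2))"
  by (simp add: path_edges_append[of p1 x "y # p2"])

lemma path_edges_nodes: "e \<in> set (path_edges p) \<Longrightarrow> z \<in> e \<Longrightarrow> z \<in> set p"
  by (elim path_edges_split) auto

lemma node_on_path_edge:
  assumes "z \<in> set p" "length p \<ge> 2"
  obtains e where "e \<in> set (path_edges p)" "z \<in> e"
proof -
  obtain p1 p2 where p: "p = p1 @ z # p2" using assms(1) by (meson split_list)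
  show ?thesis
  proof (cases p2)
    case (Cons y ys)
    then show ?thesis using that[of "{z, y}"] path_edges_mem[of z y p1 ys] p by auto
  next
    case Nil
    then have "p1 \<noteq> []" using p assms(2) by auto
    then obtain p0 x where "p1 = p0 @ [x]" by (metis rev_exhaust)
    then show ?thesis using that[of "{x, z}"] path_edges_mem[of x z p0 "[]"] p Nil by auto
  qed
qed

lemma path_length_member: "e \<in> set (path_edges p) \<Longrightarrow> l e \<le> path_length l p"
  unfolding path_length_def by (simp add: member_le_sum_list)

lemma path_length_cong:
  "(\<And>e. e \<in> set (path_edges p) \<Longrightarrow> l e = l' e) \<Longrightarrow> path_length l p = path_length l' p"
  unfolding path_length_def by (metis map_cong)

lemma path_length_mono:
  "(\<And>e. e \<in> set (path_edges p) \<Longrightarrow> l e \<le> l' e) \<Longrightarrow> path_length l p \<le> path_length l' p"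
  unfolding path_length_def by (rule sum_list_mono)

lemma length_path_edges: "length (path_edges p) = length p - 1"
  by (simp add: path_edges_def)

lemma path_length_le:
  assumes "\<And>e. e \<in> set (path_edges p) \<Longrightarrow> l e \<le> L"
  shows "path_length l p \<le> (length p - 1) * L"
proof -
  have "path_length l p \<le> path_length (\<lambda>_. L) p" using assms by (rule path_length_mono)
  also have "\<dots> = (length p - 1) * L"
    by (simp add: path_length_def length_path_edges sum_list_triv)
  finally show ?thesis .
qed

lemma walk_Nil [simp]: "\<not> walk E u v []"
  by (simp add: walk_def)

lemma walk_single [simp]: "walk E u v [x] \<longleftrightarrow> u = x \<and> v = x"
  by (auto simp: walk_def)

lemma walk_Cons2: "walk E u v (x # y # p) \<longleftrightarrow> u = x \<and> {x, y} \<in> E \<and> walk E y v (y # p)"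
  by (auto simp: walk_def)

lemma walk_split: "walk E u v (p @ x # q) \<longleftrightarrow> walk E u x (p @ [x]) \<and> walk E x v (x # q)"
proof (induction p arbitrary: u)
  case (Cons a p)
  show ?case
  proof (cases p)
    case Nil
    then show ?thesis by (auto simp: walk_Cons2)
  next
    case p: (Cons b p')
    show ?thesis using Cons.IH[of b] by (auto simp: walk_Cons2 p)
  qed
qed (auto simp: walk_def)

lemma walk_rev: "walk E u v p \<Longrightarrow> walk E v u (rev p)"
  by (auto simp: walk_def path_edges_rev hd_rev last_rev)

lemma walk_join:
  assumes "walk E u v p" "walk E v w q"
  shows "walk E u w (p @ tl q)"
    and "path_length l (p @ tl q) = path_length l p + path_length l q"
    and "path_edges (p @ tl q) = path_edges p @ path_edges q"
proof -
  obtain p' where p: "p = p' @ [v]" using assms(1) unfolding walk_def by (metis append_butlast_last_id)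
  obtain q' where q: "q = v # q'" using assms(2) unfolding walk_def by (metis list.collapse)
  show "walk E u w (p @ tl q)" using assms walk_split[of E u w p' v q'] by (simp add: p q)
  show "path_length l (p @ tl q) = path_length l p + path_length l q"
    using path_length_append[of l p' v q'] by (simp add: p q)
  show "path_edges (p @ tl q) = path_edges p @ path_edges q"
    using path_edges_append[of p' v q'] by (simp add: p q)
qed

lemma walk_edge: "{x, y} \<in> E \<Longrightarrow> walk E x y [x, y]"
  by (simp add: walk_def)

text \<open>Cutting out the part between two visits of a node leaves a shorter walk without new
  edges. The inclusion of the edge sets is kept in the conclusion because it carries over that an
  edge is avoided or that a subgraph is not left.\<close>

lemma walk_imp_simple_path:
  assumes "walk E u v p"
  obtains q where "simple_path E u v q" "set (path_edges q) \<subseteq> set (path_edges p)"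
    "path_length l q \<le> path_length l p"
  using assms
proof (induction "length p" arbitrary: p thesis rule: less_induct)
  case less
  show ?case
  proof (cases "distinct p")
    case True
    then show ?thesis using less.prems by (auto simp: simple_path_iff_walk)
  next
    case False
    then obtain xs y ys zs where p: "p = xs @ [y] @ ys @ [y] @ zs"
      using not_distinct_decomp by blast
    let ?q = "xs @ y # zs"
    have p': "p = xs @ y # ((ys @ [y]) @ zs)" by (simp add: p)
    have *: "path_edges p = path_edges (xs @ [y]) @ path_edges ((y # ys) @ [y]) @ path_edges (y # zs)"
      unfolding p' path_edges_append[of xs y "(ys @ [y]) @ zs"]
      using path_edges_append[of "y # ys" y zs] by simp
    have **: "path_edges ?q = path_edges (xs @ [y]) @ path_edges (y # zs)"
      by (rule path_edges_append)
    have "set (path_edges ?q) \<subseteq> set (path_edges p)" unfolding * ** by auto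
    then have "walk E u v ?q" using less.prems(2) unfolding walk_def by (cases xs) (auto simp: p)
    moreover have "length ?q < length p" by (simp add: p)
    ultimately obtain q where "simple_path E u v q" "set (path_edges q) \<subseteq> set (path_edges ?q)"
      "path_length l q \<le> path_length l ?q" using less.hyps[of ?q] by blast
    moreover have "set (path_edges ?q) \<subseteq> set (path_edges p)" by fact
    moreover have "path_length l ?q \<le> path_length l p" unfolding path_length_def * ** by simp
    ultimately show ?thesis using less.prems(1) by (meson order_trans subset_trans)
  qed
qed

text \<open>A discrete intermediate value argument. It is applied to the label of a node exceeding a
  position on a shortest path, and to the set of nodes whose chosen shortest path starts with a
  given edge.\<close>

lemma walk_crossing:
  assumes "walk E u v p" "\<not> P u" "P v"
  obtains p1 x y p2 where "p = p1 @ x # y # p2" "\<not> P x" "P y"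
  using assms
proof (induction p arbitrary: u thesis rule: induct_list012)
  case (3 x y p)
  then have x: "x = u" "walk E y v (y # p)" by (auto simp: walk_Cons2)
  show ?case
  proof (cases "P y")
    case True
    then show ?thesis using 3(3)[of "[]" x y p] x 3(5) by simp
  next
    case False
    then obtain p1 x' y' p2 where "y # p = p1 @ x' # y' # p2" "\<not> P x'" "P y'"
      using 3(2)[OF _ x(2)] 3(6) by blast
    then show ?thesis using 3(3)[of "x # p1" x' y' p2] by simp
  qed
qed auto

text \<open>Inside a connected graph the infimum is attained, so this is the distance as a natural number.\<close>

definition ndist :: "(nat set \<Rightarrow> nat) \<Rightarrow> nat set set \<Rightarrow> nat \<Rightarrow> nat \<Rightarrow> nat" where
  "ndist l E u v = Inf (path_length l ` {p. simple_path E u v p})"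

section \<open>Distances in a connected graph\<close>

locale cgraph =
  fixes n :: nat and E :: "nat set set"
  assumes simple_graph: "simple_graph n E" and connected: "connected_graph n E"
begin

lemma edge_nodes: "{x, y} \<in> E \<Longrightarrow> x < n \<and> y < n \<and> x \<noteq> y"
  using simple_graph unfolding simple_graph_def by (auto simp: doubleton_eq_iff)


lemma n_pos: "n \<ge> 1"
  using connected by (simp add: connected_graph_def)

lemma finite_E: "finite E"
proof -
  have "E \<subseteq> (\<lambda>(u, v). {u, v}) ` ({..<n} \<times> {..<n})"
    using simple_graph by (force simp: simple_graph_def)
  then show ?thesis by (rule finite_subset) auto
qed

lemma card_E: "card E \<le> n * n"
proof -
  have "E \<subseteq> (\<lambda>(u, v). {u, v}) ` ({..<n} \<times> {..<n})"
    using simple_graph by (force simp: simple_graph_def)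
  then have "card E \<le> card ({..<n} \<times> {..<n})"
    by (metis (no_types, lifting) card_image_le card_mono finite_SigmaI finite_imageI finite_lessThan le_trans)
  then show ?thesis by simp
qed

lemma walk_nodes: "walk E u v p \<Longrightarrow> u < n \<Longrightarrow> set p \<subseteq> {..<n}"
proof (induction p arbitrary: u rule: induct_list012)
  case (3 x y p)
  then show ?case using edge_nodes[of x y] by (auto simp: walk_Cons2)
qed auto

lemma simple_path_length: "simple_path E u v p \<Longrightarrow> u < n \<Longrightarrow> length p \<le> n"
  using walk_nodes[of u v p] card_mono[of "{..<n}" "set p"]
  by (auto simp: simple_path_iff_walk distinct_card)

lemma finite_simple_paths: "u < n \<Longrightarrow> finite {p. simple_path E u v p}"
  by (rule finite_subset[OF _ finite_lists_length_le[of "{..<n}" n]])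
    (use walk_nodes simple_path_length in \<open>auto simp: simple_path_iff_walk\<close>)

lemma ndist_attained:
  assumes "u < n" "v < n"
  obtains p where "simple_path E u v p" "path_length l p = ndist l E u v"
proof -
  have "{p. simple_path E u v p} \<noteq> {}"
    using connected assms by (auto simp: connected_graph_def)
  then have "ndist l E u v \<in> path_length l ` {p. simple_path E u v p}"
    unfolding ndist_def by (intro Inf_nat_def1) auto
  then show ?thesis using that by auto
qed

lemma ndist_le_walk: "walk E u v p \<Longrightarrow> ndist l E u v \<le> path_length l p"
proof -
  assume "walk E u v p"
  then obtain q where q: "simple_path E u v q" "path_length l q \<le> path_length l p"
    by (rule walk_imp_simple_path)
  then have "ndist l E u v \<le> path_length l q"
    unfolding ndist_def by (intro wellorder_Inf_le1) auto
  with q show ?thesis by simp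
qed

lemma distance_ndist:
  assumes "u < n" "v < n"
  shows "distance l E u v = ereal (real (ndist l E u v))"
proof -
  obtain p where p: "simple_path E u v p" "path_length l p = ndist l E u v"
    using ndist_attained[OF assms] .
  show ?thesis unfolding distance_def
  proof (rule antisym)
    show "(INF p\<in>{p. simple_path E u v p}. ereal (real (path_length l p))) \<le> ereal (real (ndist l E u v))"
      by (rule INF_lower2[of p]) (use p in auto)
    show "ereal (real (ndist l E u v)) \<le> (INF p\<in>{p. simple_path E u v p}. ereal (real (path_length l p)))"
      by (rule INF_greatest) (use ndist_le_walk in \<open>auto simp: simple_path_iff_walk\<close>)
  qed
qed

lemma ndist_self [simp]: "ndist l E u u = 0"
  using ndist_le_walk[of u u "[u]" l] by simp

lemma ndist_edge: "{x, y} \<in> E \<Longrightarrow> ndist l E x y \<le> l {x, y}"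
  using ndist_le_walk[OF walk_edge, of x y l] by simp

lemma ndist_sym: "u < n \<Longrightarrow> v < n \<Longrightarrow> ndist l E u v = ndist l E v u"
proof -
  have *: "ndist l E v u \<le> ndist l E u v" if uv: "u < n" "v < n" for u v
  proof -
    obtain p where p: "simple_path E u v p" "path_length l p = ndist l E u v"
      using ndist_attained[OF uv] .
    then have "walk E v u (rev p)" by (simp add: simple_path_iff_walk walk_rev)
    from ndist_le_walk[OF this, of l] p show ?thesis by (simp add: path_length_rev)
  qed
  assume "u < n" "v < n"
  with *[of u v] *[of v u] show ?thesis by simp
qed

lemma ndist_triangle:
  assumes "u < n" "v < n" "w < n"
  shows "ndist l E u w \<le> ndist l E u v + ndist l E v w"
proof -
  obtain p where p: "simple_path E u v p" "path_length l p = ndist l E u v"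
    using ndist_attained[OF assms(1,2)] .
  obtain q where q: "simple_path E v w q" "path_length l q = ndist l E v w"
    using ndist_attained[OF assms(2,3)] .
  have "walk E u v p" "walk E v w q" using p q by (auto simp: simple_path_iff_walk)
  from ndist_le_walk[OF walk_join(1)[OF this], of l] walk_join(2)[OF this, of l] p q
  show ?thesis by simp
qed

lemma ndist_bound:
  assumes "u < n" "v < n" "\<And>e. e \<in> E \<Longrightarrow> l e \<le> L"
  shows "ndist l E u v \<le> n * L"
proof -
  obtain p where p: "simple_path E u v p" "path_length l p = ndist l E u v"
    using ndist_attained[OF assms(1,2)] .
  have "path_length l p \<le> (length p - 1) * L"
    using p assms(3) by (intro path_length_le) (auto simp: simple_path_def)
  also have "\<dots> \<le> n * L" using simple_path_length[OF p(1) assms(1)] by (intro mult_right_mono) auto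
  finally show ?thesis using p by simp
qed

lemma ndist_pos:
  assumes "\<And>e. e \<in> E \<Longrightarrow> l e \<ge> 1" "u < n" "v < n" "u \<noteq> v"
  shows "ndist l E u v \<ge> 1"
proof -
  obtain p where p: "simple_path E u v p" "path_length l p = ndist l E u v"
    using ndist_attained[OF assms(2,3)] .
  have "\<exists>x y q. p = x # y # q" using p(1) assms(4)
    by (cases p rule: list.exhaust; cases "tl p") (auto simp: simple_path_def)
  then obtain x y q where q: "p = x # y # q" by blast
  then have "{x, y} \<in> E" using p(1) by (auto simp: simple_path_def)
  with p(2) q assms(1) show ?thesis by fastforce
qed

text \<open>The second node of a shortest path. This local form is what a program can test with a
  distance matrix, both when it follows a shortest path and when it records first edges.\<close>

lemma ndist_step:
  assumes "u < n" "v < n" "u \<noteq> v"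
  obtains y where "{u, y} \<in> E" "ndist l E u v = l {u, y} + ndist l E y v"
proof -
  obtain p where p: "simple_path E u v p" "path_length l p = ndist l E u v"
    using ndist_attained[OF assms(1,2)] .
  have "\<exists>y q. p = u # y # q" using p(1) assms(3)
    by (cases p rule: list.exhaust; cases "tl p") (auto simp: simple_path_def)
  then obtain y q where q: "p = u # y # q" by blast
  have e: "{u, y} \<in> E" "walk E y v (y # q)"
    using p(1) unfolding q simple_path_iff_walk walk_Cons2 by auto
  from ndist_le_walk[OF e(2), of l] p(2) q have "ndist l E u v \<ge> l {u, y} + ndist l E y v" by simp
  moreover have "ndist l E u v \<le> ndist l E u y + ndist l E y v"
    using edge_nodes[OF e(1)] assms ndist_triangle by simp
  ultimately show ?thesis using that[OF e(1)] ndist_edge[OF e(1), of l] by linarith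
qed

lemma walk_through_edge:
  assumes "walk E u v (p @ x # y # q)" 
  shows "{x, y} \<in> E" "walk E u x (p @ [x])" "walk E y v (y # q)"
    "ndist l E u x + l {x, y} + ndist l E y v \<le> path_length l (p @ x # y # q)"
proof -
  have w: "walk E u x (p @ [x])" "walk E x v (x # y # q)"
    using assms walk_split[of E u v p x "y # q"] by blast+
  then have w2: "walk E y v (y # q)" "{x, y} \<in> E" by (auto simp: walk_Cons2)
  show "ndist l E u x + l {x, y} + ndist l E y v \<le> path_length l (p @ x # y # q)"
    using ndist_le_walk[OF w(1), of l] ndist_le_walk[OF w2(1), of l]
    by (simp add: path_length_append[of l p x "y # q"])
  show "{x, y} \<in> E" "walk E u x (p @ [x])" "walk E y v (y # q)" using w w2 by auto
qed

text \<open>A shortest path through the edge would be at least as long as one of the two right-hand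
  sides, depending on the direction in which the edge is traversed. So no shortest path uses it, and
  any of them will do.\<close>

lemma shortest_path_avoiding:
  assumes "x < n" "y < n"
    and "ndist l E x y < ndist l E x a + l {a, b} + ndist l E b y"
    and "ndist l E x y < ndist l E x b + l {a, b} + ndist l E a y"
  obtains p where "walk E x y p" "path_length l p = ndist l E x y" "{a, b} \<notin> set (path_edges p)"
proof -
  obtain p where p: "simple_path E x y p" "path_length l p = ndist l E x y"
    using ndist_attained[OF assms(1,2)] .
  then have w: "walk E x y p" by (simp add: simple_path_iff_walk)
  have "{a, b} \<notin> set (path_edges p)"
  proof
    assume "{a, b} \<in> set (path_edges p)"
    then obtain p1 c d p2 where s: "p = p1 @ c # d # p2" "{a, b} = {c, d}" by (rule path_edges_split)
    have "ndist l E x c + l {a, b} + ndist l E d y \<le> ndist l E x y"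
      using walk_through_edge(4)[of x y p1 c d p2 l] w s p by simp
    with assms(3,4) s(2) show False by (auto simp: doubleton_eq_iff insert_commute)
  qed
  with w p that show ?thesis by blast
qed

text \<open>Joining two avoiding walks by an edge other than \<open>f\<close> may repeat nodes, but
  shortcutting to a simple path cannot bring \<open>f\<close> back.\<close>

lemma avoiding_combine:
  assumes xy: "{x, y} \<in> E" "{x, y} \<noteq> f"
    and p: "walk E s x p" "f \<notin> set (path_edges p)"
    and q: "walk E y t q" "f \<notin> set (path_edges q)"
  obtains r where "simple_path E s t r" "f \<notin> set (path_edges r)"
    "path_length l r \<le> path_length l p + l {x, y} + path_length l q"
proof -
  note j1 = walk_join[OF p(1) walk_edge[OF xy(1)]]
  note j2 = walk_join[OF j1(1) q(1)]
  obtain r where "simple_path E s t r" "set (path_edges r) \<subseteq> set (path_edges ((p @ tl [x, y]) @ tl q))"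
    "path_length l r \<le> path_length l ((p @ tl [x, y]) @ tl q)"
    by (rule walk_imp_simple_path[OF j2(1)])
  then show ?thesis
    using that[of r] xy(2) p(2) q(2) unfolding j1(2,3) j2(2,3) by auto
qed

end

section \<open>The first deviation from a shortest path\<close>

text \<open>
  The label \<open>h y\<close> is the largest position on \<open>P\<close> through which some shortest path from \<open>s\<close> to \<open>y\<close>
  passes. An \<open>s\<close>-\<open>t\<close>-path that leaves \<open>P\<close> has to move to a larger label over an edge outside of \<open>P\<close>.
  So a single pass over the edges finds the first position at which a path of bounded length can
  leave \<open>P\<close>.
\<close>

locale shortest_path = cgraph +
  fixes l :: "nat set \<Rightarrow> nat" and s t :: nat and P :: "nat list" and h :: "nat \<Rightarrow> nat"
  assumes len_pos: "\<And>e. e \<in> E \<Longrightarrow> l e \<ge> 1"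
    and s: "s < n" and t: "t < n"
    and P: "simple_path E s t P" "path_length l P = ndist l E s t"
    and h: "\<And>y. y < n \<Longrightarrow> h y < length P \<and>
      ndist l E s (P ! h y) + ndist l E (P ! h y) y = ndist l E s y \<and>
      (\<forall>j. h y < j \<longrightarrow> j < length P \<longrightarrow>
         ndist l E s (P ! j) + ndist l E (P ! j) y \<noteq> ndist l E s y)"
begin

abbreviation d :: "nat \<Rightarrow> nat \<Rightarrow> nat" where "d \<equiv> ndist l E"

lemma P_ends: "P ! 0 = s" "P ! (length P - 1) = t" "P \<noteq> []" "length P \<ge> 1" "distinct P"
  using P(1) by (auto simp: simple_path_def hd_conv_nth last_conv_nth Suc_leI)

lemma P_node: "i < length P \<Longrightarrow> P ! i < n"
  using walk_nodes[of s t P] P(1) s by (auto simp: simple_path_iff_walk subset_iff)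

text \<open>The pieces into which two positions cut \<open>P\<close> have total length
  \<open>d s t\<close>, and each is at least the distance of its ends. The triangle inequality
  leaves no slack, so every piece is itself shortest.\<close>

lemma P_dist3:
  assumes "i \<le> j" "j < length P"
  shows "d s (P ! i) + d (P ! i) (P ! j) + d (P ! j) t = d s t"
proof (rule antisym)
  have w: "walk E s t P" using P(1) by (simp add: simple_path_iff_walk)
  show "d s (P ! i) + d (P ! i) (P ! j) + d (P ! j) t \<le> d s t"
  proof (cases "i = j")
    case True
    have "P = take i P @ P ! i # drop (Suc i) P" using assms by (simp add: id_take_nth_drop)
    then have "walk E s (P ! i) (take i P @ [P ! i])" "walk E (P ! i) t (P ! i # drop (Suc i) P)"
      "path_length l P = path_length l (take i P @ [P ! i]) + path_length l (P ! i # drop (Suc i) P)"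
      using w walk_split[of E s t "take i P" "P ! i" "drop (Suc i) P"]
        path_length_append[of l "take i P" "P ! i" "drop (Suc i) P"] by (metis+)
    with ndist_le_walk[OF this(1), of l] ndist_le_walk[OF this(2), of l] True P(2) show ?thesis by simp
  next
    case False
    then have ij: "i < j" using assms by simp
    have P1: "P = take j P @ P ! j # drop (Suc j) P" using assms by (simp add: id_take_nth_drop)
    have P2: "take j P = take i P @ P ! i # drop (Suc i) (take j P)"
      using ij assms id_take_nth_drop[of i "take j P"] by (simp add: min_def)
    let ?q = "P ! i # drop (Suc i) (take j P) @ [P ! j]"
    have *: "take j P @ [P ! j] = take i P @ ?q" using P2 by simp
    have w1: "walk E s (P ! j) (take j P @ [P ! j])" "walk E (P ! j) t (P ! j # drop (Suc j) P)"
      using w walk_split[of E s t "take j P" "P ! j" "drop (Suc j) P"] P1 by (metis+)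
    have l1: "path_length l P = path_length l (take j P @ [P ! j]) + path_length l (P ! j # drop (Suc j) P)"
      using path_length_append[of l "take j P" "P ! j" "drop (Suc j) P"] P1 by metis
    have w2: "walk E s (P ! i) (take i P @ [P ! i])" "walk E (P ! i) (P ! j) ?q"
      using w1(1) unfolding * using walk_split by blast+
    have l2: "path_length l (take j P @ [P ! j]) = path_length l (take i P @ [P ! i]) + path_length l ?q"
      unfolding * by (rule path_length_append)
    show ?thesis
      using l1 l2 P(2) ndist_le_walk[OF w1(2), of l] ndist_le_walk[OF w2(1), of l]
        ndist_le_walk[OF w2(2), of l] by linarith
  qed
  have "P ! i < n" "P ! j < n" using assms P_node by auto
  then show "d s t \<le> d s (P ! i) + d (P ! i) (P ! j) + d (P ! j) t"
    using ndist_triangle[of s "P ! i" t l] ndist_triangle[of "P ! i" "P ! j" t l] s t by linarith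
qed

lemma P_dist:
  assumes "i \<le> j" "j < length P"
  shows "d s (P ! j) = d s (P ! i) + d (P ! i) (P ! j)"
    and "d (P ! i) t = d (P ! i) (P ! j) + d (P ! j) t"
    and "d s (P ! i) + d (P ! i) t = d s t"
proof -
  have "P ! i < n" "P ! j < n" using assms P_node by auto
  then have "d s t \<le> d s (P ! j) + d (P ! j) t" "d s (P ! j) \<le> d s (P ! i) + d (P ! i) (P ! j)"
    "d (P ! i) t \<le> d (P ! i) (P ! j) + d (P ! j) t" "d s t \<le> d s (P ! i) + d (P ! i) t"
    using s t ndist_triangle by blast+
  with P_dist3[OF assms] show "d s (P ! j) = d s (P ! i) + d (P ! i) (P ! j)"
    "d (P ! i) t = d (P ! i) (P ! j) + d (P ! j) t" "d s (P ! i) + d (P ! i) t = d s t"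
    by linarith+
qed

lemma P_split: "Suc i < length P \<Longrightarrow> P = take i P @ P ! i # P ! Suc i # drop (Suc (Suc i)) P"
  by (metis Cons_nth_drop_Suc Suc_lessD append_take_drop_id)

lemma P_edge:
  assumes "Suc i < length P"
  shows "{P ! i, P ! Suc i} \<in> E" "d (P ! i) (P ! Suc i) = l {P ! i, P ! Suc i}"
proof -
  have w: "walk E s t P" using P(1) by (simp add: simple_path_iff_walk)
  note thru = walk_through_edge[of s t "take i P" "P ! i" "P ! Suc i" "drop (Suc (Suc i)) P",
      folded P_split[OF assms], OF w]
  show "{P ! i, P ! Suc i} \<in> E" by (rule thru(1))
  then show "d (P ! i) (P ! Suc i) = l {P ! i, P ! Suc i}"
    using thru(4)[of l] P(2) P_dist3[of i "Suc i"] ndist_edge[of "P ! i" "P ! Suc i" l] assms by simp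
qed

lemma P_dist_pos: "i < j \<Longrightarrow> j < length P \<Longrightarrow> d (P ! i) (P ! j) \<ge> 1"
  using P_node P_ends by (intro ndist_pos len_pos) (auto simp: nth_eq_iff_index_eq)

text \<open>Position \<open>i\<close> itself qualifies, and a node further along \<open>P\<close> is
  strictly farther from \<open>s\<close>, since lengths are positive, so it cannot lie on a shortest
  path to \<open>P ! i\<close>.\<close>

lemma h_path: "i < length P \<Longrightarrow> h (P ! i) = i"
proof -
  assume i: "i < length P"
  note hi = h[OF P_node[OF i]]
  have "\<not> h (P ! i) < i" using hi i by fastforce
  moreover have "\<not> i < h (P ! i)"
  proof
    assume "i < h (P ! i)"
    then show False using P_dist(1)[of i "h (P ! i)"] P_dist_pos[of i "h (P ! i)"] hi by simp
  qed
  ultimately show "h (P ! i) = i" by simp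
qed

text \<open>The edge is directed from \<open>x\<close> to \<open>y\<close>. The edges of
  \<open>P\<close> also increase the label, by exactly one, and have to be excluded.\<close>

abbreviation deviating :: "nat \<Rightarrow> nat \<Rightarrow> bool" where
  "deviating x y \<equiv> {x, y} \<in> E \<and> h x < h y \<and> \<not> (x = P ! h x \<and> y = P ! Suc (h x))"

text \<open>Labels are 0 at \<open>s\<close> and the last position at \<open>t\<close>, so
  \<open>Q\<close> has to step from a label at most \<open>j\<close> to a larger one. The only edge
  of \<open>P\<close> that makes this step is the one at position \<open>j\<close>, which
  \<open>Q\<close> avoids.\<close>

lemma avoiding_imp_deviating:
  assumes Q: "walk E s t Q" and j: "Suc j < length P"
    and avoid: "{P ! j, P ! Suc j} \<notin> set (path_edges Q)"
  obtains x y where "deviating x y" "h x \<le> j" "d s x + l {x, y} + d y t \<le> path_length l Q"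
proof -
  have "h s = 0" "h t = length P - 1"
    using h_path[of 0] h_path[of "length P - 1"] P_ends by auto
  then obtain p1 x y p2 where q: "Q = p1 @ x # y # p2" "\<not> j < h x" "j < h y"
    using walk_crossing[OF Q, of "\<lambda>x. j < h x"] j by (metis less_diff_conv not_less_zero Suc_eq_plus1)
  note thru = walk_through_edge[OF Q[unfolded q(1)]]
  have "\<not> (x = P ! h x \<and> y = P ! Suc (h x))"
  proof
    assume xy: "x = P ! h x \<and> y = P ! Suc (h x)"
    with q j have "h y = Suc (h x)" using h_path[of "Suc (h x)"] by auto
    with q have "h x = j" by simp
    with xy q(1) path_edges_mem[of x y p1 p2] avoid show False by simp
  qed
  with that[of x y] thru q show ?thesis by auto
qed

text \<open>The path is composed of a shortest path to \<open>x\<close>, the edge, and a shortest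
  path from \<open>y\<close>. The maximality of the label of \<open>x\<close> keeps the edge of
  \<open>P\<close> out of the first piece, the larger label of \<open>y\<close> keeps it out of the
  last one.\<close>

lemma deviating_imp_avoiding:
  assumes dev: "deviating x y"
  obtains Q where "simple_path E s t Q" "path_length l Q \<le> d s x + l {x, y} + d y t"
    "{P ! h x, P ! Suc (h x)} \<notin> set (path_edges Q)"
proof -
  define i where "i = h x"
  define a where "a = P ! i"
  define b where "b = P ! Suc i"
  have xy: "x < n" "y < n" using dev edge_nodes by auto
  have i: "Suc i < length P" using dev h[of y] xy by (auto simp: i_def)
  have ab: "a < n" "b < n" using i P_node by (auto simp: a_def b_def)
  have e: "d a b = l {a, b}" "{a, b} \<in> E" using P_edge[OF i] by (auto simp: a_def b_def)
  then have e1: "l {a, b} \<ge> 1" using len_pos by simp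
  have sb: "d s b = d s a + d a b" and at: "d a t = d a b + d b t"
    using P_dist[of i "Suc i"] i by (auto simp: a_def b_def)
  obtain p where p: "walk E s x p" "path_length l p = d s x" "{a, b} \<notin> set (path_edges p)"
  proof (rule shortest_path_avoiding[OF s xy(1)])
    \<comment> \<open>\<open>b\<close> lies beyond the label of \<open>x\<close>, so by the choice
      of \<open>h\<close> no shortest path to \<open>x\<close> passes through it.\<close>
    have "d s b + d b x \<noteq> d s x" using h[OF xy(1)] i by (auto simp: i_def b_def)
    then show "d s x < d s a + l {a, b} + d b x"
      using ndist_triangle[of s b x l] s ab xy sb e by simp
    show "d s x < d s b + l {a, b} + d a x"
      using ndist_triangle[of s a x l] s ab xy sb e e1 by simp
  qed
  define c where "c = P ! h y"
  have hy: "h y < length P" "d s c + d c y = d s y" "c < n"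
    using h[OF xy(2)] P_node by (auto simp: c_def)
  have ac: "d s c = d s a + d a c" "d a t = d a c + d c t" "d a c \<ge> 1"
    using P_dist[of i "h y"] P_dist_pos[of i "h y"] hy dev by (auto simp: a_def c_def i_def)
  obtain q where q: "walk E y t q" "path_length l q = d y t" "{a, b} \<notin> set (path_edges q)"
  proof (rule shortest_path_avoiding[OF xy(2) t])
    \<comment> \<open>Going back from \<open>y\<close> to \<open>a\<close> cannot pay off. Some
      shortest path from \<open>s\<close> to \<open>y\<close> passes \<open>c\<close>, which lies
      behind \<open>a\<close> on \<open>P\<close>, so the distance from \<open>a\<close> to
      \<open>y\<close> is at least the way over \<open>c\<close>; walking directly to
      \<open>c\<close> and on to \<open>t\<close> saves the detour.\<close>
    have "d y t \<le> d y c + d c t" "d s y \<le> d s a + d a y" using ndist_triangle s t xy ab hy by blast+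
    then show "d y t < d y a + l {a, b} + d b t"
      using ac at e hy ndist_sym[of y c l] ndist_sym[of y a l] xy ab by linarith
    show "d y t < d y b + l {a, b} + d a t"
      using ndist_triangle[of y b t l] xy ab t at e e1 by simp
  qed
  have "{x, y} \<noteq> {a, b}"
  proof
    assume "{x, y} = {a, b}"
    then consider "x = a" "y = b" | "x = b" "y = a" by (auto simp: doubleton_eq_iff)
    then show False
    proof cases
      case 1
      then show False using dev by (auto simp: a_def b_def i_def)
    next
      case 2
      then have "h x = Suc i" using h_path[OF i] by (simp add: b_def)
      then show False by (simp add: i_def)
    qed
  qed
  from avoiding_combine[OF _ this p(1,3) q(1,3), of l] dev p q that show ?thesis
    by (auto simp: a_def b_def i_def)
qed

text \<open>Only membership of the edges is assumed, neither order nor direction. As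
  \<open>Q\<close> is simple and starts at \<open>s\<close>, its nodes are determined inductively:
  traversing the next edge backwards would make its far end the predecessor of \<open>P ! j\<close>
  in \<open>Q\<close>, but that predecessor is \<open>P ! (j - 1)\<close>.\<close>

lemma common_prefix:
  assumes Q: "simple_path E s t Q" and a: "a < length P"
    and edges: "\<And>j. j < a \<Longrightarrow> {P ! j, P ! Suc j} \<in> set (path_edges Q)"
  shows "a < length Q" "take (Suc a) Q = take (Suc a) P"
proof -
  have Q0: "Q \<noteq> []" "Q ! 0 = s" "distinct Q" using Q by (auto simp: simple_path_def hd_conv_nth)
  have "j < length Q \<and> (\<forall>i\<le>j. Q ! i = P ! i)" if "j \<le> a" for j
    using that
  proof (induction j)
    case 0
    then show ?case using Q0 P_ends by auto
  next
    case (Suc j)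
    then have IH: "j < length Q" "\<And>i. i \<le> j \<Longrightarrow> Q ! i = P ! i" by auto
    obtain p1 x y p2 where q: "Q = p1 @ x # y # p2" "{P ! j, P ! Suc j} = {x, y}"
      using edges[of j] Suc.prems by (auto elim: path_edges_split)
    let ?k = "length p1"
    have k: "Q ! ?k = x" "Q ! Suc ?k = y" "Suc ?k < length Q" by (auto simp: q(1) nth_append)
    consider "P ! j = x" "P ! Suc j = y" | "P ! j = y" "P ! Suc j = x"
      using q(2) by (auto simp: doubleton_eq_iff)
    then show ?case
    proof cases
      case 1
      then have "Q ! j = Q ! ?k" using IH k by simp
      then have "j = ?k" using nth_eq_iff_index_eq[OF Q0(3), of j ?k] IH(1) k(3) by linarith
      then show ?thesis using k 1 IH by (auto simp: le_Suc_eq)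
    next
      case 2
      then have "Q ! j = Q ! Suc ?k" using IH k by simp
      then have "j = Suc ?k" using nth_eq_iff_index_eq[OF Q0(3), of j "Suc ?k"] IH(1) k(3) by linarith
      then have "P ! ?k = P ! Suc j" using IH(2)[of ?k] k 2 by simp
      then have "?k = Suc j" using P_ends(5) \<open>j = Suc ?k\<close> Suc.prems a by (simp add: nth_eq_iff_index_eq)
      with \<open>j = Suc ?k\<close> show ?thesis by simp
    qed
  qed
  then have *: "a < length Q" "\<And>i. i \<le> a \<Longrightarrow> Q ! i = P ! i" by auto
  show "a < length Q" by (rule *)
  show "take (Suc a) Q = take (Suc a) P"
    by (rule nth_equalityI) (use * a in auto)
qed

end

section \<open>Paths avoiding an edge\<close>

text \<open>
  Here \<open>tp y\<close> is the second node of some shortest path from \<open>u\<close> to \<open>y\<close>. A path from \<open>u\<close>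
  to \<open>v\<close> that avoids the edge between them has to enter the set of nodes with label \<open>v\<close>.
\<close>

lemma (in cgraph) alternative_path_iff:
  assumes pos: "\<And>e. e \<in> E \<Longrightarrow> l e \<ge> 1" and uv: "{u, v} \<in> E"
    and tp: "\<And>y. y < n \<Longrightarrow> y \<noteq> u \<Longrightarrow>
      {u, tp y} \<in> E \<and> l {u, tp y} + ndist l E (tp y) y = ndist l E u y"
    and \<beta>: "ndist l E u v \<le> \<beta>" 
  shows "(\<exists>p. simple_path E u v p \<and> {u, v} \<notin> set (path_edges p) \<and> path_length l p \<le> \<beta>) \<longleftrightarrow>
    tp v \<noteq> v \<or>
    (\<exists>x y. {x, y} \<in> E \<and> {x, y} \<noteq> {u, v} \<and> (x = u \<or> tp x \<noteq> v) \<and> y \<noteq> u \<and> tp y = v \<and>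
       ndist l E u x + l {x, y} + ndist l E y v \<le> \<beta>)" (is "?L \<longleftrightarrow> _ \<or> ?R")
proof
  let ?d = "ndist l E"
  have uvn: "u < n" "v < n" "u \<noteq> v" using edge_nodes[OF uv] by auto
  have luv: "l {u, v} \<ge> 1" using pos uv by simp
  show "tp v \<noteq> v \<or> ?R" if ?L
  proof (cases "tp v = v")
    case True
    obtain p where p: "simple_path E u v p" "{u, v} \<notin> set (path_edges p)" "path_length l p \<le> \<beta>"
      using \<open>?L\<close> by blast
    have w: "walk E u v p" using p(1) by (simp add: simple_path_iff_walk)
    \<comment> \<open>The path starts outside the set of nodes with label \<open>v\<close> and ends
      inside, so some edge enters the set. The distances to the ends of that edge bound the length
      of the path from below.\<close>
    obtain p1 x y p2 where q: "p = p1 @ x # y # p2" "\<not> (x \<noteq> u \<and> tp x = v)" "y \<noteq> u \<and> tp y = v"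
      using walk_crossing[OF w, of "\<lambda>x. x \<noteq> u \<and> tp x = v"] True uvn by metis
    note thru = walk_through_edge[OF w[unfolded q(1)]]
    have "{x, y} \<noteq> {u, v}" using p(2) path_edges_mem[of x y p1 p2] q(1) by metis
    then show ?thesis using thru(1) thru(4)[of l] q p(3) by (metis order_trans)
  qed simp
  \<comment> \<open>A shortest path to \<open>x\<close> that starts with the edge to
    \<open>tp x\<close>. The rest starts closer to \<open>x\<close> than \<open>u\<close> is, so it
    never returns to \<open>u\<close>, as using \<open>{u, v}\<close> would require.\<close>
  have top_avoiding: "\<exists>p. walk E u x p \<and> path_length l p = ?d u x \<and> {u, v} \<notin> set (path_edges p)"
    if x: "x < n" "x = u \<or> tp x \<noteq> v" for x
  proof (cases "x = u")
    case True
    then show ?thesis by (intro exI[of _ "[u]"]) auto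
  next
    case False
    let ?t = "tp x"
    have t: "{u, ?t} \<in> E" "l {u, ?t} + ?d ?t x = ?d u x" using tp[OF x(1) False] by auto
    have tn: "?t < n" using edge_nodes t by blast
    have t1: "l {u, ?t} \<ge> 1" using pos t by simp
    obtain q where q: "walk E ?t x q" "path_length l q = ?d ?t x" "{u, v} \<notin> set (path_edges q)"
    proof (rule shortest_path_avoiding[OF tn x(1)])
      show "?d ?t x < ?d ?t u + l {u, v} + ?d v x"
      proof -
        have "?d u x \<le> ?d u v + ?d v x" using ndist_triangle uvn x by blast
        then show ?thesis using ndist_edge[OF uv, of l] t(2) t1 by linarith
      qed
      show "?d ?t x < ?d ?t v + l {u, v} + ?d u x" using t(2) t1 luv by linarith
    qed
    have "{u, ?t} \<noteq> {u, v}" using False x by (auto simp: doubleton_eq_iff)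
    then show ?thesis using walk_join[OF walk_edge[OF t(1)] q(1)] q t
      by (intro exI[of _ "[u, ?t] @ tl q"]) auto
  qed
  show ?L if R: "tp v \<noteq> v \<or> ?R"
  proof (cases "tp v = v")
    case False
    then obtain p where p: "walk E u v p" "path_length l p = ?d u v" "{u, v} \<notin> set (path_edges p)"
      using top_avoiding[of v] uvn by auto
    obtain q where "simple_path E u v q" "set (path_edges q) \<subseteq> set (path_edges p)"
      "path_length l q \<le> path_length l p" by (rule walk_imp_simple_path[OF p(1)])
    then show ?thesis using p \<beta> by (intro exI[of _ q]) auto
  next
    case True
    then obtain x y where xy: "{x, y} \<in> E" "{x, y} \<noteq> {u, v}" "x = u \<or> tp x \<noteq> v" "y \<noteq> u" "tp y = v"
      "?d u x + l {x, y} + ?d y v \<le> \<beta>" using R by blast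
    have n: "x < n" "y < n" using edge_nodes xy by auto
    obtain p where p: "walk E u x p" "path_length l p = ?d u x" "{u, v} \<notin> set (path_edges p)"
      using top_avoiding[OF n(1) xy(3)] by auto
    have y: "l {u, v} + ?d v y = ?d u y" using tp[OF n(2) xy(4)] xy(5) by auto
    \<comment> \<open>A shortest path from \<open>u\<close> to \<open>y\<close> starts with
      \<open>{u, v}\<close>, so \<open>y\<close> is closer to \<open>v\<close> than to
      \<open>u\<close>, and no shortest way to \<open>v\<close> uses that edge.\<close>
    obtain q where q: "walk E y v q" "path_length l q = ?d y v" "{u, v} \<notin> set (path_edges q)"
    proof (rule shortest_path_avoiding[OF n(2) uvn(2)])
      show "?d y v < ?d y u + l {u, v} + ?d v v"
        using y ndist_sym n uvn luv by (simp add: ndist_sym[of y])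
      show "?d y v < ?d y v + l {u, v} + ?d u v" using luv by simp
    qed
    from avoiding_combine[OF xy(1,2) p(1,3) q(1,3), of l] p q xy(6) show ?thesis
      by (metis order_trans)
  qed
qed

section \<open>Total correctness with time bounds\<close>


text \<open>
  \<open>wp\<close> passes the unused part of the time budget on to the postcondition, which makes it
  compositional; \<open>run\<close> forgets it.
\<close>

definition wp :: "nat \<Rightarrow> program \<Rightarrow> state \<Rightarrow> nat \<Rightarrow> (state \<Rightarrow> nat \<Rightarrow> bool) \<Rightarrow> bool" where
  "wp B c s T Q \<longleftrightarrow> (\<exists>t s'. exec B c s t s' \<and> t \<le> T \<and> Q s' (T - t))"

definition run :: "nat \<Rightarrow> program \<Rightarrow> state \<Rightarrow> nat \<Rightarrow> (state \<Rightarrow> bool) \<Rightarrow> bool" where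
  "run B c s T Q \<longleftrightarrow> (\<exists>t s'. exec B c s t s' \<and> t \<le> T \<and> Q s')"

lemma run_wp: "run B c s T Q = wp B c s T (\<lambda>s' _. Q s')"
  by (simp add: run_def wp_def)

lemma wp_Skip: "wp B Skip s T Q \<longleftrightarrow> 1 \<le> T \<and> Q s (T - 1)"
  unfolding wp_def
  by (auto elim!: exec_SkipE intro!: exI[of _ "Suc 0"] exI[of _ s] exec_Skip[unfolded One_nat_def])

lemma wp_Assign: "wp B (Assign r e) s T Q \<longleftrightarrow>
    fits B e s \<and> 1 + cost e \<le> T \<and> Q (s\<lparr>regs := (regs s)(r := value_of e s)\<rparr>) (T - (1 + cost e))"
  unfolding wp_def
proof safe
  fix t s' assume "exec B (Assign r e) s t s'" "t \<le> T" "Q s' (T - t)"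
  then show "fits B e s" "1 + cost e \<le> T" "Q (s\<lparr>regs := (regs s)(r := value_of e s)\<rparr>) (T - (1 + cost e))"
    by (auto elim!: exec_AssignE)
next
  assume "fits B e s" "1 + cost e \<le> T" "Q (s\<lparr>regs := (regs s)(r := value_of e s)\<rparr>) (T - (1 + cost e))"
  then show "\<exists>t s'. exec B (Assign r e) s t s' \<and> t \<le> T \<and> Q s' (T - t)"
    using exec_Assign by blast
qed

lemma wp_Store: "wp B (Store a i e) s T Q \<longleftrightarrow>
    fits B i s \<and> fits B e s \<and> 1 + cost i + cost e \<le> T \<and>
    Q (s\<lparr>mem := (mem s)(a := (mem s a)(value_of i s := value_of e s))\<rparr>) (T - (1 + cost i + cost e))"
  unfolding wp_def
proof safe
  fix t s' assume "exec B (Store a i e) s t s'" "t \<le> T" "Q s' (T - t)"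
  then show "fits B i s" "fits B e s" "1 + cost i + cost e \<le> T"
    "Q (s\<lparr>mem := (mem s)(a := (mem s a)(value_of i s := value_of e s))\<rparr>) (T - (1 + cost i + cost e))"
    by (auto elim!: exec_StoreE)
next
  assume "fits B i s" "fits B e s" "1 + cost i + cost e \<le> T"
    "Q (s\<lparr>mem := (mem s)(a := (mem s a)(value_of i s := value_of e s))\<rparr>) (T - (1 + cost i + cost e))"
  then show "\<exists>t s'. exec B (Store a i e) s t s' \<and> t \<le> T \<and> Q s' (T - t)"
    using exec_Store by blast
qed

lemma wp_Seq: "wp B (Seq c d) s T Q \<longleftrightarrow> wp B c s T (\<lambda>s' T'. wp B d s' T' Q)"
proof
  assume "wp B (Seq c d) s T Q"
  then obtain t s'' where "exec B (Seq c d) s t s''" "t \<le> T" "Q s'' (T - t)"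
    unfolding wp_def by blast
  then obtain t1 s' t2 where *: "exec B c s t1 s'" "exec B d s' t2 s''" "t1 + t2 \<le> T" "Q s'' (T - (t1 + t2))"
    by (auto elim: exec_SeqE)
  then have "t2 \<le> T - t1" "Q s'' (T - t1 - t2)" "t1 \<le> T" by auto
  with * show "wp B c s T (\<lambda>s' T'. wp B d s' T' Q)" unfolding wp_def by blast
next
  assume "wp B c s T (\<lambda>s' T'. wp B d s' T' Q)"
  then obtain t s' t' s'' where "exec B c s t s'" "t \<le> T" "exec B d s' t' s''" "t' \<le> T - t" "Q s'' (T - t - t')"
    unfolding wp_def by blast
  then show "wp B (Seq c d) s T Q"
    unfolding wp_def using exec_Seq by (intro exI[of _ "t + t'"] exI[of _ s'']) auto
qed

lemma wp_If: "wp B (If e c d) s T Q \<longleftrightarrow> fits B e s \<and> 1 + cost e \<le> T \<and>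
    (if value_of e s \<noteq> 0 then wp B c s (T - (1 + cost e)) Q else wp B d s (T - (1 + cost e)) Q)"
proof
  assume "wp B (If e c d) s T Q"
  then obtain t s' where t: "exec B (If e c d) s t s'" "t \<le> T" "Q s' (T - t)" unfolding wp_def by blast
  from t(1) show "fits B e s \<and> 1 + cost e \<le> T \<and>
    (if value_of e s \<noteq> 0 then wp B c s (T - (1 + cost e)) Q else wp B d s (T - (1 + cost e)) Q)"
  proof (rule exec_IfE)
    fix t' assume *: "t = Suc (cost e + t')" "fits B e s" "0 < value_of e s" "exec B c s t' s'"
    then have "T - (1 + cost e) - t' = T - t" by simp
    with * t show ?thesis unfolding wp_def by (auto intro!: exI[of _ t'] exI[of _ s'])
  next
    fix t' assume *: "t = Suc (cost e + t')" "fits B e s" "value_of e s = 0" "exec B d s t' s'"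
    then have "T - (1 + cost e) - t' = T - t" by simp
    with * t show ?thesis unfolding wp_def by (auto intro!: exI[of _ t'] exI[of _ s'])
  qed
next
  assume *: "fits B e s \<and> 1 + cost e \<le> T \<and>
    (if value_of e s \<noteq> 0 then wp B c s (T - (1 + cost e)) Q else wp B d s (T - (1 + cost e)) Q)"
  show "wp B (If e c d) s T Q"
  proof (cases "value_of e s = 0")
    case True
    with * obtain t s' where "exec B d s t s'" "t \<le> T - (1 + cost e)" "Q s' (T - (1 + cost e) - t)"
      unfolding wp_def by auto
    then show ?thesis unfolding wp_def using * exec_IfFalse[OF _ True, of B d t s' c]
      by (intro exI[of _ "1 + cost e + t"] exI[of _ s']) auto
  next
    case False
    with * obtain t s' where "exec B c s t s'" "t \<le> T - (1 + cost e)" "Q s' (T - (1 + cost e) - t)"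
      unfolding wp_def by auto
    then show ?thesis unfolding wp_def using * exec_IfTrue[OF _ False, of B c t s' d]
      by (intro exI[of _ "1 + cost e + t"] exI[of _ s']) auto
  qed
qed

lemmas wp_simps = run_wp wp_Skip wp_Assign wp_Store wp_Seq wp_If

lemma run_mono: "run B c s T Q \<Longrightarrow> T \<le> T' \<Longrightarrow> (\<And>s'. Q s' \<Longrightarrow> Q' s') \<Longrightarrow> run B c s T' Q'"
  unfolding run_def by (meson le_trans)


section \<open>Frame conditions and rules for loops\<close>

fun wr :: "program \<Rightarrow> nat set" where
  "wr Skip = {}"
| "wr (Assign r e) = {r}"
| "wr (Store a i e) = {}"
| "wr (Seq c d) = wr c \<union> wr d"
| "wr (If e c d) = wr c \<union> wr d"
| "wr (While e c) = wr c"

fun wa :: "program \<Rightarrow> nat set" where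
  "wa Skip = {}"
| "wa (Assign r e) = {}"
| "wa (Store a i e) = {a}"
| "wa (Seq c d) = wa c \<union> wa d"
| "wa (If e c d) = wa c \<union> wa d"
| "wa (While e c) = wa c"


text \<open>The frame of a run. Respecting the word bound is part of it, since every value is
  checked to fit before it is stored. An invariant about unmodified registers and arrays thus
  survives without a separate proof.\<close>

definition agree :: "nat \<Rightarrow> nat set \<Rightarrow> nat set \<Rightarrow> state \<Rightarrow> state \<Rightarrow> bool" where
  "agree B W A s s' \<longleftrightarrow> (\<forall>r. r \<notin> W \<longrightarrow> regs s' r = regs s r) \<and> (\<forall>a. a \<notin> A \<longrightarrow> mem s' a = mem s a) \<and>
     (all_words B s \<longrightarrow> all_words B s')"

lemma agree_reg: "agree B W A s s' \<Longrightarrow> r \<notin> W \<Longrightarrow> regs s' r = regs s r"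
  and agree_mem: "agree B W A s s' \<Longrightarrow> a \<notin> A \<Longrightarrow> mem s' a = mem s a"
  and agree_words: "agree B W A s s' \<Longrightarrow> all_words B s \<Longrightarrow> all_words B s'"
  by (auto simp: agree_def)


lemma agree_trans:
  "agree B W A s s' \<Longrightarrow> agree B W' A' s' s'' \<Longrightarrow> W \<subseteq> W'' \<Longrightarrow> W' \<subseteq> W'' \<Longrightarrow> A \<subseteq> A'' \<Longrightarrow> A' \<subseteq> A'' \<Longrightarrow>
    agree B W'' A'' s s''"
  unfolding agree_def by (metis subsetD)

lemma agree_mono: "agree B W A s s' \<Longrightarrow> W \<subseteq> W' \<Longrightarrow> A \<subseteq> A' \<Longrightarrow> agree B W' A' s s'"
  unfolding agree_def by (meson subsetD)

lemma all_words_reg: "all_words B s \<Longrightarrow> regs s r \<le> B"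
  and all_words_mem: "all_words B s \<Longrightarrow> mem s a i \<le> B"
  by (auto simp: all_words_def)

lemma fits_value: "fits B e s \<Longrightarrow> value_of e s \<le> B"
  by (cases e) auto

lemma exec_agree: "exec B c s t s' \<Longrightarrow> agree B (wr c) (wa c) s s'"
proof (induction rule: exec.induct)
  case (exec_Seq c s t s' d t' s'')
  then show ?case by (auto intro: agree_trans)
next
  case (exec_WhileTrue e s c t s' t' s'')
  then show ?case by (auto intro: agree_trans)
qed (auto simp: agree_def all_words_def fits_value)

lemma run_agree: "run B c s T Q \<Longrightarrow> run B c s T (\<lambda>s'. Q s' \<and> agree B (wr c) (wa c) s s')"
  unfolding run_def using exec_agree by meson

text \<open>The frame of the first program is handed on to the second. So a specification only has
  to mention what a program computes, not what it leaves alone.\<close>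

lemma run_Seq:
  assumes "run B c s T1 P"
    and "\<And>s'. P s' \<Longrightarrow> agree B (wr c) (wa c) s s' \<Longrightarrow> run B d s' T2 Q"
  shows "run B (Seq c d) s (T1 + T2) Q"
proof -
  obtain t s' where 1: "exec B c s t s'" "t \<le> T1" "P s'" using assms(1) unfolding run_def by blast
  obtain t' s'' where 2: "exec B d s' t' s''" "t' \<le> T2" "Q s''"
    using assms(2)[OF 1(3) exec_agree[OF 1(1)]] unfolding run_def by blast
  show ?thesis unfolding run_def using exec_Seq[OF 1(1) 2(1)] 1 2 by (meson add_mono)
qed

lemma run_If:
  assumes "fits B e s" "value_of e s \<noteq> 0 \<Longrightarrow> run B c s T Q" "value_of e s = 0 \<Longrightarrow> run B d s T Q"
  shows "run B (If e c d) s (1 + cost e + T) Q"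
proof (cases "value_of e s = 0")
  case True
  then show ?thesis using assms(1,3) exec_IfFalse[OF assms(1) True] unfolding run_def
    by (meson add_left_mono)
next
  case False
  then show ?thesis using assms(1,2) exec_IfTrue[OF assms(1) False] unfolding run_def
    by (meson add_left_mono)
qed

text \<open>The index of the invariant is a variant and a bound on the number of remaining
  iterations at once. It may drop by more than one, as the total potential does in the main
  loop.\<close>

lemma run_While:
  assumes "I x s" and fits: "\<And>x s. I x s \<Longrightarrow> fits B e s"
    and step: "\<And>x s. I x s \<Longrightarrow> value_of e s \<noteq> 0 \<Longrightarrow> run B c s T (\<lambda>s'. \<exists>y<x. I y s')"
  shows "run B (While e c) s (x * (1 + cost e + T) + (1 + cost e)) (\<lambda>s'. \<exists>y. I y s' \<and> value_of e s' = 0)"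
  using assms(1)
proof (induction x arbitrary: s rule: less_induct)
  case (less x)
  show ?case
  proof (cases "value_of e s = 0")
    case True
    then have "exec B (While e c) s (1 + cost e) s" using exec_WhileFalse fits less.prems by blast
    then show ?thesis unfolding run_def using True less.prems by (intro exI conjI) auto
  next
    case False
    obtain t s' y where 1: "exec B c s t s'" "t \<le> T" "y < x" "I y s'"
      using step[OF less.prems False] unfolding run_def by blast
    obtain t' s'' where 2: "exec B (While e c) s' t' s''" "t' \<le> y * (1 + cost e + T) + (1 + cost e)"
      "\<exists>y. I y s'' \<and> value_of e s'' = 0"
      using less.IH[OF 1(3,4)] unfolding run_def by blast
    have "Suc y * (1 + cost e + T) \<le> x * (1 + cost e + T)" using 1(3) by (intro mult_right_mono) auto
    then have "1 + cost e + t + t' \<le> x * (1 + cost e + T) + (1 + cost e)" using 1 2 by simp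
    with exec_WhileTrue[OF fits[OF less.prems] False 1(1) 2(1)] 2(3) show ?thesis
      unfolding run_def by blast
  qed
qed

definition For :: "nat \<Rightarrow> nat \<Rightarrow> program \<Rightarrow> program" where
  "For i N c = Seq (Assign i (Const 0)) (While (Op LessThan (Reg i) (Reg N))
     (Seq c (Assign i (Op Plus (Reg i) (Const 1)))))"

lemma wr_For [simp]: "wr (For i N c) = insert i (wr c)"
  and wa_For [simp]: "wa (For i N c) = wa c"
  by (auto simp: For_def)

text \<open>The test and the increment cost 4 steps each, which gives the 8 per iteration; the
  initialisation and the last test cost 6. The invariant after the body is stated for the
  incremented counter. \<open>k < B\<close> makes both the counter and the truth value 1 of the test
  fit.\<close>

lemma run_For:
  assumes N: "N \<notin> wr c" "i \<notin> wr c" "i \<noteq> N" "regs s N = k" "k < B"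
    and init: "I 0 (s\<lparr>regs := (regs s)(i := 0)\<rparr>)"
    and step: "\<And>j s'. j < k \<Longrightarrow> I j s' \<Longrightarrow> regs s' i = j \<Longrightarrow> agree B (insert i (wr c)) (wa c) s s' \<Longrightarrow>
      run B c s' T (\<lambda>s''. I (Suc j) (s''\<lparr>regs := (regs s'')(i := Suc j)\<rparr>))"
    and post: "\<And>s'. I k s' \<Longrightarrow> regs s' i = k \<Longrightarrow> agree B (insert i (wr c)) (wa c) s s' \<Longrightarrow> Q s'"
  shows "run B (For i N c) s (k * (T + 8) + 8) Q"
proof -
  define c' where "c' = Seq c (Assign i (Op Plus (Reg i) (Const 1)))"
  define e where "e = Op LessThan (Reg i) (Reg N)"
  define s0 where "s0 = s\<lparr>regs := (regs s)(i := 0)\<rparr>"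
  have c': "wr c' = insert i (wr c)" "wa c' = wa c" by (auto simp: c'_def)
  define J where "J = (\<lambda>x s'. \<exists>j. x + j = k \<and> I j s' \<and> regs s' i = j \<and> agree B (wr c') (wa c') s s')"
  have s0: "J k s0" unfolding J_def
    using init by (intro exI[of _ 0]) (auto simp: s0_def agree_def all_words_def c')
  have Nk: "regs s' N = k" if "agree B (wr c') (wa c') s s'" for s'
    using agree_reg[OF that, of N] N by (simp add: c')
  have "run B (While e c') s0 (k * (1 + cost e + (T + 4)) + (1 + cost e))
     (\<lambda>s'. \<exists>x. J x s' \<and> value_of e s' = 0)"
  proof (rule run_While[where I = J, OF s0])
    show "fits B e s'" if "J x s'" for x s'
      using that N Nk[of s'] by (auto simp: J_def e_def)
    show "run B c' s' (T + 4) (\<lambda>s''. \<exists>y<x. J y s'')" if J: "J x s'" "value_of e s' \<noteq> 0" for x s'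
      unfolding c'_def
    proof -
      obtain j where j: "x + j = k" "I j s'" "regs s' i = j" "agree B (wr c') (wa c') s s'"
        using J unfolding J_def by blast
      then have jk: "j < k" using J(2) Nk by (auto simp: e_def split: if_splits)
      show "run B (Seq c (Assign i (Op Plus (Reg i) (Const 1)))) s' (T + 4) (\<lambda>s''. \<exists>y<x. J y s'')"
      proof (rule run_Seq)
        show "run B c s' T (\<lambda>s''. I (Suc j) (s''\<lparr>regs := (regs s'')(i := Suc j)\<rparr>))"
          using step[OF jk j(2,3)] j(4) by (simp add: c')
        fix s'' assume s'': "I (Suc j) (s''\<lparr>regs := (regs s'')(i := Suc j)\<rparr>)" "agree B (wr c) (wa c) s' s''"
        have i: "regs s'' i = j" using agree_reg[OF s''(2) N(2)] j by simp
        have "agree B (wr c') (wa c') s s''" using agree_trans[OF j(4) s''(2)] c' by auto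
        then have "J (x - 1) (s''\<lparr>regs := (regs s'')(i := Suc j)\<rparr>)"
          unfolding J_def using s'' jk j(1) N(5)
          by (intro exI[of _ "Suc j"]) (auto simp: agree_def c' all_words_def)
        then show "run B (Assign i (Op Plus (Reg i) (Const 1))) s'' 4 (\<lambda>s''. \<exists>y<x. J y s'')"
          using i jk j(1) N(5) by (auto simp: wp_simps intro!: exI[of _ "x - 1"])
      qed
    qed
  qed
  then have "run B (While e c') s0 (k * (1 + cost e + (T + 4)) + (1 + cost e)) Q"
  proof (rule run_mono)
    fix s' assume "\<exists>x. J x s' \<and> value_of e s' = 0"
    then obtain x j where "x + j = k" "I j s'" "regs s' i = j" "agree B (wr c') (wa c') s s'" "\<not> j < regs s' N"
      unfolding J_def by (auto simp: e_def split: if_splits)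
    then show "Q s'" using Nk[of s'] post[of s'] by (auto simp: c')
  qed simp
  then have "run B (Seq (Assign i (Const 0)) (While e c')) s (2 + (k * (1 + cost e + (T + 4)) + (1 + cost e))) Q"
    by (intro run_Seq[where P = "\<lambda>s'. s' = s0"]) (auto simp: wp_simps s0_def)
  then show ?thesis unfolding For_def c'_def[symmetric] e_def[symmetric]
    by (rule run_mono) (auto simp: e_def algebra_simps)
qed

section \<open>Renaming registers and arrays\<close>

text \<open>It is unknown which registers and arrays the given algorithm uses. Moving all of them up
  by \<open>k\<close> reserves the names below \<open>k\<close> for the caller.\<close>

fun shift_expr :: "nat \<Rightarrow> expr \<Rightarrow> expr" where
  "shift_expr k (Const c) = Const c"
| "shift_expr k (Reg r) = Reg (r + k)"
| "shift_expr k (Cell a e) = Cell (a + k) (shift_expr k e)"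
| "shift_expr k (Op f e e') = Op f (shift_expr k e) (shift_expr k e')"

fun shift :: "nat \<Rightarrow> program \<Rightarrow> program" where
  "shift k Skip = Skip"
| "shift k (Assign r e) = Assign (r + k) (shift_expr k e)"
| "shift k (Store a i e) = Store (a + k) (shift_expr k i) (shift_expr k e)"
| "shift k (Seq c d) = Seq (shift k c) (shift k d)"
| "shift k (If e c d) = If (shift_expr k e) (shift k c) (shift k d)"
| "shift k (While e c) = While (shift_expr k e) (shift k c)"

text \<open>The part of the state that a program shifted by \<open>k\<close> can see;
  \<open>merge\<close> puts a changed view back above the untouched lower part.\<close>

definition view :: "nat \<Rightarrow> state \<Rightarrow> state" where
  "view k s = \<lparr>regs = (\<lambda>r. regs s (r + k)), mem = (\<lambda>a. mem s (a + k))\<rparr>"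

definition merge :: "nat \<Rightarrow> state \<Rightarrow> state \<Rightarrow> state" where
  "merge k s v = \<lparr>regs = (\<lambda>r. if r < k then regs s r else regs v (r - k)),
     mem = (\<lambda>a. if a < k then mem s a else mem v (a - k))\<rparr>"

lemma view_merge [simp]: "view k (merge k s v) = v"
  by (simp add: view_def merge_def)

lemma merge_view [simp]: "merge k s (view k s) = s"
  by (cases s) (auto simp: view_def merge_def fun_eq_iff)

lemma merge_merge [simp]: "merge k (merge k s v) v' = merge k s v'"
  by (auto simp: merge_def fun_eq_iff)

lemma shift_expr [simp]:
  "value_of (shift_expr k e) s = value_of e (view k s)"
  "fits B (shift_expr k e) s = fits B e (view k s)"
  "cost (shift_expr k e) = cost e"
proof -
  show 1: "value_of (shift_expr k e) s = value_of e (view k s)" for e by (induction e) (auto simp: view_def)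
  show "fits B (shift_expr k e) s = fits B e (view k s)" by (induction e) (auto simp: 1, auto simp: view_def)
  show "cost (shift_expr k e) = cost e" by (induction e) auto
qed

lemma exec_shift:
  "exec B c v t v' \<Longrightarrow> view k s = v \<Longrightarrow> exec B (shift k c) s t (merge k s v')"
proof (induction arbitrary: s rule: exec.induct)
  case (exec_Skip s)
  then show ?case using exec.exec_Skip by auto
next
  case (exec_Assign e v r)
  have "merge k s (v\<lparr>regs := (regs v)(r := value_of e v)\<rparr>) =
    s\<lparr>regs := (regs s)(r + k := value_of (shift_expr k e) s)\<rparr>"
    using exec_Assign by (cases s) (auto simp: merge_def view_def fun_eq_iff)
  with exec_Assign exec.exec_Assign[of B "shift_expr k e" s "r + k"] show ?case by simp
next
  case (exec_Store i v e a)
  have "merge k s (v\<lparr>mem := (mem v)(a := (mem v a)(value_of i v := value_of e v))\<rparr>) =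
    s\<lparr>mem := (mem s)(a + k := (mem s (a + k))(value_of (shift_expr k i) s := value_of (shift_expr k e) s))\<rparr>"
    using exec_Store by (cases s) (auto simp: merge_def view_def fun_eq_iff)
  with exec_Store exec.exec_Store[of B "shift_expr k i" s "shift_expr k e" "a + k"] show ?case by simp
next
  case (exec_Seq c v t v' d t' v'')
  then show ?case using exec.exec_Seq[OF exec_Seq.IH(1)[of s] exec_Seq.IH(2)[of "merge k s v'"]] by simp
next
  case (exec_IfTrue e v c t v' d)
  then show ?case using exec.exec_IfTrue[of B "shift_expr k e" s "shift k c"] by simp
next
  case (exec_IfFalse e v d t v' c)
  then show ?case using exec.exec_IfFalse[of B "shift_expr k e" s "shift k d"] by simp
next
  case (exec_WhileFalse e v c)
  then have "merge k s v = s" using merge_view by blast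
  with exec_WhileFalse show ?case using exec.exec_WhileFalse[of B "shift_expr k e" s "shift k c"] by simp
next
  case (exec_WhileTrue e v c t v' t' v'')
  from exec_WhileTrue.IH(2)[of "merge k s v'"]
  have "exec B (While (shift_expr k e) (shift k c)) (merge k s v') t' (merge k s v'')" by simp
  with exec_WhileTrue show ?case
    using exec.exec_WhileTrue[of B "shift_expr k e" s "shift k c" t "merge k s v'"] by simp
qed

lemma wr_shift: "wr (shift k c) \<subseteq> {k..}" and wa_shift: "wa (shift k c) \<subseteq> {k..}"
  by (induction c) auto

section \<open>Every changed cell costs time\<close>

text \<open>A store changes one cell and takes time, everything else changes none. This turns the
  size of the required output into a lower bound on the running time of an algorithm whose code is
  unknown.\<close>

lemma exec_changed_cells:
  "exec B c s t s' \<Longrightarrow> finite {i. mem s' a i \<noteq> mem s a i} \<and> card {i. mem s' a i \<noteq> mem s a i} \<le> t"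
proof (induction rule: exec.induct)
  case (exec_Store i s e a')
  have "{j. mem (s\<lparr>mem := (mem s)(a' := (mem s a')(value_of i s := value_of e s))\<rparr>) a j \<noteq> mem s a j}
    \<subseteq> {value_of i s}" by auto
  from finite_subset[OF this] card_mono[OF _ this] show ?case by simp
next
  case (exec_Seq c s t s' d t' s'')
  let ?A = "{i. mem s' a i \<noteq> mem s a i}" and ?B = "{i. mem s'' a i \<noteq> mem s' a i}"
  have sub: "{i. mem s'' a i \<noteq> mem s a i} \<subseteq> ?A \<union> ?B" by auto
  then have "finite {i. mem s'' a i \<noteq> mem s a i}" using exec_Seq finite_subset by blast
  moreover have "card {i. mem s'' a i \<noteq> mem s a i} \<le> card ?A + card ?B"
    using card_mono[OF _ sub] card_Un_le[of ?A ?B] exec_Seq by (meson finite_UnI le_trans)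
  ultimately show ?case using exec_Seq by linarith
next
  case (exec_WhileTrue e s c t s' t' s'')
  let ?A = "{i. mem s' a i \<noteq> mem s a i}" and ?B = "{i. mem s'' a i \<noteq> mem s' a i}"
  have sub: "{i. mem s'' a i \<noteq> mem s a i} \<subseteq> ?A \<union> ?B" by auto
  then have "finite {i. mem s'' a i \<noteq> mem s a i}" using exec_WhileTrue finite_subset by blast
  moreover have "card {i. mem s'' a i \<noteq> mem s a i} \<le> card ?A + card ?B"
    using card_mono[OF _ sub] card_Un_le[of ?A ?B] exec_WhileTrue by (meson finite_UnI le_trans)
  ultimately show ?case using exec_WhileTrue by linarith
qed auto

section \<open>Spanners\<close>

text \<open>A finite bound excludes the infimum of the empty set, and an infimum of natural numbers
  is attained.\<close>

lemma distance_leD: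
  assumes "distance l F u v \<le> ereal r"
  obtains p where "simple_path F u v p" "real (path_length l p) \<le> r"
proof -
  let ?S = "path_length l ` {p. simple_path F u v p}"
  have "{p. simple_path F u v p} \<noteq> {}"
  proof
    assume "{p. simple_path F u v p} = {}"
    then show False using assms by (simp add: distance_def top_ereal_def)
  qed
  then have ne: "?S \<noteq> {}" by simp
  then have "Inf ?S \<in> ?S" by (rule Inf_nat_def1)
  then obtain p where p: "simple_path F u v p" "path_length l p = Inf ?S" by auto
  have "ereal (real (Inf ?S)) \<le> distance l F u v"
    unfolding distance_def by (rule INF_greatest) (auto intro: wellorder_Inf_le1)
  then have "ereal (real (Inf ?S)) \<le> ereal r" using assms by (rule order_trans)
  with p that show ?thesis by simp
qed

lemma distance_leI: "simple_path F u v p \<Longrightarrow> distance l F u v \<le> ereal (real (path_length l p))"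
  unfolding distance_def by (rule INF_lower) auto

locale spanner =
  fixes I :: spanner_instance
  assumes valid: "valid_instance I"
begin

abbreviation "n \<equiv> num_nodes I"
abbreviation "E \<equiv> edges I"
abbreviation "len0 \<equiv> len I"
abbreviation "sn \<equiv> stretch_num I"
abbreviation "sd \<equiv> stretch_den I"
abbreviation "\<mu> \<equiv> max_nontrivial I"
abbreviation "T \<equiv> trivial_edges I"
abbreviation "N \<equiv> nontrivial_edges I"
abbreviation "b \<equiv> bundle_breadth I"
abbreviation "d0 \<equiv> ndist len0 E"

sublocale cgraph n E
  using valid by unfold_locales (auto simp: valid_instance_def)

lemma len_pos: "e \<in> E \<Longrightarrow> len0 e \<ge> 1"
  using valid by (auto simp: valid_instance_def)

lemma stretch_fraction: "sd \<ge> 1" "sn \<ge> sd" "real_of_rat (stretch I) = real sn / real sd"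
proof -
  obtain a c where q: "quotient_of (stretch I) = (a, c)" by (metis surj_pair)
  have c: "c > 0" and r: "stretch I = of_int a / of_int c"
    using quotient_of_denom_pos[OF q] quotient_of_div[OF q] by auto
  have "stretch I \<ge> 1" using valid by (simp add: valid_instance_def)
  then have ac: "a \<ge> c" using r c by (simp add: le_divide_eq)
  have sn: "sn = nat a" and sd: "sd = nat c" by (auto simp: stretch_num_def stretch_den_def q)
  show "sd \<ge> 1" "sn \<ge> sd" using c ac by (auto simp: sn sd)
  show "real_of_rat (stretch I) = real sn / real sd"
    using c ac by (simp add: r sn sd of_rat_divide)
qed

text \<open>Clearing the denominator of the stretch factor turns the condition into a comparison of
  products of natural numbers, which the machine can test.\<close>

lemma stretch_le_iff:
  "ereal (real x) \<le> stretch_ereal I * ereal (real y) \<longleftrightarrow> sd * x \<le> sn * y"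
proof -
  have "ereal (real x) \<le> stretch_ereal I * ereal (real y) \<longleftrightarrow> real x \<le> real sn / real sd * real y"
    by (simp add: stretch_fraction)
  also have "\<dots> \<longleftrightarrow> real (sd * x) \<le> real (sn * y)"
    using stretch_fraction(1) by (simp add: field_simps)
  finally show ?thesis by (simp only: of_nat_le_iff)
qed

abbreviation settled :: "nat set set \<Rightarrow> nat \<Rightarrow> nat \<Rightarrow> bool" where
  "settled F u v \<equiv> (\<exists>p. simple_path F u v p \<and> sd * path_length len0 p \<le> sn * d0 u v)"

lemma settling_paths_eq:
  "u < n \<Longrightarrow> v < n \<Longrightarrow>
    settling_paths I u v = {p. simple_path E u v p \<and> sd * path_length len0 p \<le> sn * d0 u v}"
  by (simp only: settling_paths_def distance_ndist stretch_le_iff)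

lemma edge_settling: "{u, v} \<in> E \<Longrightarrow> sd * len0 {u, v} \<le> sn * d0 u v"
proof -
  assume uv: "{u, v} \<in> E"
  then have "ereal (real (len0 {u, v})) \<le> stretch_ereal I * dist_in I E u v"
    using valid unfolding valid_instance_def settles_itself_def by blast
  then show ?thesis using uv edge_nodes[OF uv] by (simp only: distance_ndist stretch_le_iff)
qed

lemma simple_path_mono: "simple_path F u v p \<Longrightarrow> F \<subseteq> F' \<Longrightarrow> simple_path F' u v p"
  by (auto simp: simple_path_def)

text \<open>Replacing each edge of a walk by a settling path in \<open>F\<close> stretches every
  edge, hence the whole walk, by at most the allowed factor. This is why only adjacent pairs have to
  be checked.\<close>

lemma replace_edges:
  assumes "F \<subseteq> E" "\<And>u v. {u, v} \<in> E \<Longrightarrow> settled F u v" "walk E u v p"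
  shows "\<exists>p'. walk F u v p' \<and> sd * path_length len0 p' \<le> sn * path_length len0 p"
  using assms(3)
proof (induction p arbitrary: u rule: induct_list012)
  case (2 x)
  then show ?case by (intro exI[of _ "[x]"]) auto
next
  case (3 x y p)
  then have x: "x = u" "{x, y} \<in> E" "walk E y v (y # p)" by (auto simp: walk_Cons2)
  obtain p' where p': "walk F y v p'" "sd * path_length len0 p' \<le> sn * path_length len0 (y # p)"
    using 3(2)[OF x(3)] by blast
  obtain r where r: "walk F x y r" "sd * path_length len0 r \<le> sn * d0 x y"
    using assms(2)[OF x(2)] by (auto simp: simple_path_iff_walk)
  have "sn * d0 x y \<le> sn * len0 {x, y}" using ndist_edge[OF x(2)] by simp
  then have "sd * path_length len0 (r @ tl p') \<le> sn * path_length len0 (x # y # p)"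
    unfolding walk_join(2)[OF r(1) p'(1)] path_length_simps distrib_left using p'(2) r(2) by linarith
  with walk_join(1)[OF r(1) p'(1)] x(1) show ?case by blast
qed simp

lemma is_spanner_iff: "is_spanner I F \<longleftrightarrow> F \<subseteq> E \<and> (\<forall>u v. {u, v} \<in> E \<longrightarrow> settled F u v)"
proof
  assume F: "is_spanner I F"
  have "settled F u v" if uv: "{u, v} \<in> E" for u v
  proof -
    have uvn: "u < n" "v < n" using edge_nodes[OF uv] by auto
    then have "dist_in I F u v \<le> stretch_ereal I * dist_in I E u v"
      using F by (auto simp: is_spanner_def)
    also have "\<dots> = ereal (real sn / real sd * real (d0 u v))"
      using uvn by (simp add: distance_ndist stretch_fraction)
    finally obtain p where p: "simple_path F u v p" "real (path_length len0 p) \<le> real sn / real sd * real (d0 u v)"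
      by (rule distance_leD)
    then have "sd * path_length len0 p \<le> sn * d0 u v"
      using stretch_le_iff[of "path_length len0 p" "d0 u v"] by (simp add: stretch_fraction)
    with p show ?thesis by blast
  qed
  with F show "F \<subseteq> E \<and> (\<forall>u v. {u, v} \<in> E \<longrightarrow> settled F u v)" by (auto simp: is_spanner_def)
next
  assume F: "F \<subseteq> E \<and> (\<forall>u v. {u, v} \<in> E \<longrightarrow> settled F u v)"
  have "dist_in I F u v \<le> stretch_ereal I * dist_in I E u v" if uv: "u < n" "v < n" for u v
  proof -
    obtain p where p: "simple_path E u v p" "path_length len0 p = d0 u v"
      using ndist_attained[OF uv] .
    then obtain p' where p': "walk F u v p'" "sd * path_length len0 p' \<le> sn * path_length len0 p"
      using replace_edges[of F u v p] F by (auto simp: simple_path_iff_walk)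
    obtain q where q: "simple_path F u v q" "path_length len0 q \<le> path_length len0 p'"
      using walk_imp_simple_path[OF p'(1)] by metis
    have "sd * path_length len0 q \<le> sn * d0 u v"
      using p p' q by (metis le_trans mult_le_mono2)
    then have "ereal (real (path_length len0 q)) \<le> stretch_ereal I * ereal (real (d0 u v))"
      by (simp only: stretch_le_iff)
    with distance_leI[OF q(1), of len0] show ?thesis
      using distance_ndist[OF uv, of len0] order_trans by metis
  qed
  with F show "is_spanner I F" by (auto simp: is_spanner_def)
qed

text \<open>
  A length exceeding every bound on a settling path. Giving it to an edge has the effect of deleting
  the edge, but keeps the graph connected and its size unchanged.
\<close>

definition heavy :: nat where
  "heavy = sn * sum len0 E + 1"

definition restricted :: "nat set set \<Rightarrow> nat set \<Rightarrow> nat" where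
  "restricted F e = (if e \<in> F then len0 e else heavy)"

lemma sn_pos: "sn \<ge> 1"
  using stretch_fraction by simp

lemma len_le_sum: "e \<in> E \<Longrightarrow> len0 e \<le> sum len0 E"
  using finite_E by (simp add: member_le_sum)

lemma len_less_heavy: "e \<in> E \<Longrightarrow> len0 e < heavy"
  unfolding heavy_def using len_le_sum[of e] sn_pos
  by (metis le_imp_less_Suc Suc_eq_plus1 le_trans mult_le_mono1 nat_mult_1)

lemma bound_less_heavy: "{u, v} \<in> E \<Longrightarrow> sn * d0 u v < heavy"
proof -
  assume uv: "{u, v} \<in> E"
  have "d0 u v \<le> sum len0 E" using ndist_edge[OF uv, of len0] len_le_sum[OF uv] by simp
  then show ?thesis by (simp add: heavy_def le_imp_less_Suc)
qed

text \<open>\<open>k\<close> leaves room for a prefix that is measured separately. A single heavy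
  edge already exceeds the right-hand side, because \<open>sd\<close> is at least 1.\<close>

lemma no_heavy_edge:
  assumes "{u, v} \<in> E" "sd * (k + path_length l p) \<le> sn * d0 u v" "e \<in> set (path_edges p)"
  shows "l e < heavy"
proof -
  have "l e \<le> path_length l p" by (rule path_length_member[OF assms(3)])
  also have "\<dots> \<le> sd * (k + path_length l p)" using stretch_fraction(1)
    by (metis add.commute le_add1 le_trans mult_le_mono1 nat_mult_1)
  finally show ?thesis using assms(2) bound_less_heavy[OF assms(1)] by simp
qed

lemma restricted_pos: "e \<in> E \<Longrightarrow> restricted F e \<ge> 1"
  using len_pos by (auto simp: restricted_def heavy_def)

text \<open>A shortest path under the modified lengths is within the bound only if it has no heavy
  edge, and then it lies in \<open>F\<close>. So distances in a subgraph that may be disconnected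
  are tested on the whole connected graph.\<close>

lemma settled_iff_ndist:
  assumes "F \<subseteq> E" "{u, v} \<in> E"
  shows "settled F u v \<longleftrightarrow> sd * ndist (restricted F) E u v \<le> sn * d0 u v"
proof
  assume "settled F u v"
  then obtain p where p: "simple_path F u v p" "sd * path_length len0 p \<le> sn * d0 u v" by blast
  have "path_length (restricted F) p = path_length len0 p"
    using p(1) by (intro path_length_cong) (auto simp: restricted_def simple_path_def)
  moreover have "walk E u v p" using p(1) assms(1) by (auto simp: simple_path_iff_walk walk_def)
  ultimately have "ndist (restricted F) E u v \<le> path_length len0 p" by (metis ndist_le_walk)
  with p(2) show "sd * ndist (restricted F) E u v \<le> sn * d0 u v" by (meson le_trans mult_le_mono2)
next
  assume *: "sd * ndist (restricted F) E u v \<le> sn * d0 u v"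
  obtain p where p: "simple_path E u v p" "path_length (restricted F) p = ndist (restricted F) E u v"
    using edge_nodes[OF assms(2)] ndist_attained by metis
  have *: "sd * (0 + path_length (restricted F) p) \<le> sn * d0 u v" using * p by simp
  have in_F: "e \<in> F" if "e \<in> set (path_edges p)" for e
    using no_heavy_edge[OF assms(2) * that] by (auto simp: restricted_def split: if_splits)
  then have "path_length (restricted F) p = path_length len0 p"
    by (intro path_length_cong) (auto simp: restricted_def)
  with in_F * p show "settled F u v" by (auto simp: simple_path_def intro!: exI[of _ p])
qed

section \<open>Trivial edges, solutions and critical pairs\<close>

lemma trivial_subset: "T \<subseteq> E"
  by (auto simp: trivial_edges_def mandatory_edges_def)

lemma nontrivial_subset: "N \<subseteq> E"
  by (auto simp: nontrivial_edges_def)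

lemma settled_mono: "settled F u v \<Longrightarrow> F \<subseteq> F' \<Longrightarrow> settled F' u v"
  using simple_path_mono by blast

lemma spanner_mono: "is_spanner I F \<Longrightarrow> F \<subseteq> F' \<Longrightarrow> F' \<subseteq> E \<Longrightarrow> is_spanner I F'"
  unfolding is_spanner_iff using settled_mono by metis

lemma mandatory_in_spanner:
  assumes F: "is_spanner I F" and e: "e \<in> mandatory_edges I"
  shows "e \<in> F"
proof -
  obtain u v where uv: "e = {u, v}" "{u, v} \<in> E" "\<not> (\<exists>p\<in>settling_paths I u v. alternative u v p)"
    using e unfolding mandatory_edges_def by auto
  obtain p where p: "simple_path F u v p" "sd * path_length len0 p \<le> sn * d0 u v"
    using F uv unfolding is_spanner_iff by blast
  have "p \<in> settling_paths I u v"
    using p F edge_nodes[OF uv(2)] simple_path_mono by (auto simp: settling_paths_eq is_spanner_iff)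
  then have "e \<in> set (path_edges p)" using uv by (auto simp: alternative_def)
  with p(1) show ?thesis by (auto simp: simple_path_def)
qed

text \<open>The definition of mandatory edges asks for some orientation of the edge without an
  alternative path. Reversing paths shows that both orientations agree, so one may be fixed.\<close>

lemma mandatory_iff:
  assumes uv: "{u, v} \<in> E"
  shows "{u, v} \<in> mandatory_edges I \<longleftrightarrow>
    \<not> (\<exists>p. simple_path E u v p \<and> {u, v} \<notin> set (path_edges p) \<and> sd * path_length len0 p \<le> sn * d0 u v)"
proof -
  let ?alt = "\<lambda>u v. \<exists>p. simple_path E u v p \<and> {u, v} \<notin> set (path_edges p) \<and>
    sd * path_length len0 p \<le> sn * d0 u v"
  have rev: "?alt v u" if "?alt u v" "u < n" "v < n" for u v
  proof -
    obtain p where "simple_path E u v p" "{u, v} \<notin> set (path_edges p)" "sd * path_length len0 p \<le> sn * d0 u v"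
      using \<open>?alt u v\<close> by blast
    then show ?thesis using ndist_sym[of u v len0] that walk_rev[of E u v p]
      by (intro exI[of _ "rev p"])
        (auto simp: simple_path_iff_walk path_edges_rev path_length_rev insert_commute)
  qed
  have "{u, v} \<in> mandatory_edges I \<longleftrightarrow> (\<exists>x y. {u, v} = {x, y} \<and> {x, y} \<in> E \<and> \<not> ?alt x y)"
    unfolding mandatory_edges_def alternative_def
    using edge_nodes settling_paths_eq by (smt (verit, ccfv_threshold) mem_Collect_eq)
  also have "\<dots> \<longleftrightarrow> \<not> ?alt u v"
    using rev edge_nodes[OF uv] uv by (auto simp: doubleton_eq_iff insert_commute) blast+
  finally show ?thesis .
qed

text \<open>Mandatory edges belong to every spanner and the other trivial edges weigh nothing, so
  adding them changes neither the weight nor the number of nontrivial edges. Hence the search may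
  start from \<open>T\<close>.\<close>

lemma solution_with_trivial:
  assumes "is_solution I S"
  shows "is_solution I (S \<union> T)"
proof -
  have S: "is_spanner I S" "S \<subseteq> E" using assms by (auto simp: is_solution_def is_spanner_def)
  have "sum (weight I) (S \<union> T) = sum (weight I) S + sum (weight I) (T - S)"
    using finite_E S trivial_subset finite_subset by (metis Diff_disjoint Un_Diff_cancel finite_Diff sum.union_disjoint)
  also have "sum (weight I) (T - S) = 0"
    using mandatory_in_spanner[OF S(1)] by (intro sum.neutral) (auto simp: trivial_edges_def)
  finally have "sum (weight I) (S \<union> T) = sum (weight I) S" by simp
  moreover have "(S \<union> T) \<inter> N = S \<inter> N" by (auto simp: nontrivial_edges_def)
  ultimately show ?thesis
    using assms spanner_mono[OF S(1), of "S \<union> T"] S(2) trivial_subset by (auto simp: is_solution_def)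
qed

lemma finite_settling: "u < n \<Longrightarrow> finite (settling_paths I u v)"
  using finite_simple_paths by (rule finite_subset[rotated]) (auto simp: settling_paths_def)

lemma finite_breadths: "finite {card (settling_paths I u v) | u v. critical I u v}"
proof -
  have "{card (settling_paths I u v) | u v. critical I u v} \<subseteq>
    (\<lambda>(u, v). card (settling_paths I u v)) ` ({..<n} \<times> {..<n})"
    using edge_nodes by (force simp: critical_def)
  then show ?thesis by (rule finite_subset) auto
qed

lemma breadth_pos: "b \<ge> 1"
  unfolding bundle_breadth_def using finite_breadths by (intro Max_ge) auto

text \<open>A critical pair has two settling paths: its own edge, as every edge settles itself, and
  an alternative path, as otherwise its edge would be trivial and would settle the pair. The
  estimates on the potential rest on \<open>b \<ge> 2\<close>.\<close>

lemma critical_breadth: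
  assumes "critical I u v"
  shows "card (settling_paths I u v) \<le> b" "b \<ge> 2"
proof -
  show le: "card (settling_paths I u v) \<le> b"
    unfolding bundle_breadth_def using finite_breadths assms by (intro Max_ge) auto
  have uv: "{u, v} \<in> E" "u < n" "v < n" "u \<noteq> v" using assms edge_nodes by (auto simp: critical_def)
  have edge: "[u, v] \<in> settling_paths I u v"
    using uv edge_settling by (auto simp: settling_paths_eq simple_path_def)
  then have "{u, v} \<notin> mandatory_edges I"
    using assms by (auto simp: critical_def trivial_edges_def)
  then obtain p where p: "p \<in> settling_paths I u v" "alternative u v p"
    unfolding mandatory_edges_def using uv by blast
  then have "p \<noteq> [u, v]" by (auto simp: alternative_def)
  then have "2 = card {p, [u, v]}" by simp
  also have "\<dots> \<le> card (settling_paths I u v)"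
    using p edge finite_settling[OF uv(2)] by (intro card_mono) auto
  finally show "b \<ge> 2" using le by simp
qed

lemma unsettled_critical:
  assumes "{u, v} \<in> E" "T \<subseteq> F" "\<not> settled F u v"
  shows "critical I u v"
  using assms edge_nodes[OF assms(1)]
  by (auto simp: critical_def settling_paths_eq simple_path_def) (metis subset_trans)

section \<open>The search tree\<close>

text \<open>
  An item \<open>(F, l, \<pi>, t)\<close> stands for the task of extending \<open>F\<close> to a solution. If \<open>\<pi>\<close> is not empty,
  the solution has to contain a settling path from \<open>hd \<pi>\<close> to \<open>t\<close> that extends \<open>\<pi>\<close> and uses no further
  edges that are heavy with respect to \<open>l\<close>.
\<close>

type_synonym item = "nat set set \<times> (nat set \<Rightarrow> nat) \<times> nat list \<times> nat"

text \<open>\<open>R\<close> shares its first node with the end of the prefix. The prefix is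
  measured with the original lengths because \<open>l\<close> makes its edges heavy in order to keep
  \<open>R\<close> away from it.\<close>

definition completions :: "(nat set \<Rightarrow> nat) \<Rightarrow> nat list \<Rightarrow> nat \<Rightarrow> nat list set" where
  "completions l \<pi> t = {R. simple_path E (last \<pi>) t R \<and>
     sd * (path_length len0 \<pi> + path_length l R) \<le> sn * d0 (hd \<pi>) t}"

text \<open>Blocking all edges at the nodes of the prefix other than the last keeps completions from
  returning to it, which makes the completed paths simple. The last conjunct excludes dead ends. The
  unsettled pair guarantees that a completed path adds a nontrivial edge, and the bound on
  \<open>card (F \<inter> N)\<close> that the budget is not yet exhausted.\<close>

definition path_item :: "nat set set \<Rightarrow> (nat set \<Rightarrow> nat) \<Rightarrow> nat list \<Rightarrow> nat \<Rightarrow> bool" where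
  "path_item F l \<pi> t \<longleftrightarrow> T \<subseteq> F \<and> F \<subseteq> E \<and> card (F \<inter> N) < \<mu> \<and>
     simple_path E (hd \<pi>) (last \<pi>) \<pi> \<and> {hd \<pi>, t} \<in> E \<and> \<not> settled F (hd \<pi>) t \<and>
     (\<forall>e\<in>E. l e = len0 e \<or> l e = heavy) \<and>
     (\<forall>x\<in>set (butlast \<pi>). \<forall>e\<in>E. x \<in> e \<longrightarrow> l e = heavy) \<and>
     completions l \<pi> t \<noteq> {}"

definition set_item :: "nat set set \<Rightarrow> (nat set \<Rightarrow> nat) \<Rightarrow> bool" where
  "set_item F l \<longleftrightarrow> T \<subseteq> F \<and> F \<subseteq> E \<and> (\<forall>e\<in>E. l e = restricted F e)"

fun item_ok :: "item \<Rightarrow> bool" where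
  "item_ok (F, l, \<pi>, t) = (if \<pi> = [] then set_item F l else path_item F l \<pi> t)"

fun solvable :: "item \<Rightarrow> bool" where
  "solvable (F, l, \<pi>, t) \<longleftrightarrow> (\<exists>S. is_solution I S \<and> F \<subseteq> S \<and>
     (\<pi> \<noteq> [] \<longrightarrow> (\<exists>R\<in>completions l \<pi> t. set (path_edges (\<pi> @ tl R)) \<subseteq> S)))"

text \<open>The constants are such that the potential of an item exceeds the sum of the potentials of its
  children. So the search tree below \<open>T\<close> has at most \<open>5 * b ^ \<mu> - 4\<close> items.\<close>

fun potential :: "item \<Rightarrow> nat" where
  "potential (F, l, \<pi>, t) =
     (if \<pi> = [] then 5 * b ^ (\<mu> - card (F \<inter> N)) - 4
      else card (completions l \<pi> t) * (5 * b ^ (\<mu> - card (F \<inter> N) - 1) - 2) - 1)"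

text \<open>A measure that increases along the search tree and thereby bounds the height of the stack.\<close>

fun level :: "item \<Rightarrow> nat" where
  "level (F, l, \<pi>, t) = card (F \<inter> N) * (card E + 2) +
     (if \<pi> = [] then 0 else 1 + card {e \<in> E. l e = heavy})"

text \<open>The weight \<open>card E + 2\<close> exceeds the second summand of the level, which is
  at most \<open>card E + 1\<close>. So one more nontrivial edge outweighs what is lost when a
  prefix is given up.\<close>

lemma level_bound: "F \<subseteq> E \<Longrightarrow> level (F, l, \<pi>, t) \<le> (card E + 1) * (card E + 2)"
proof -
  have "card (F \<inter> N) \<le> card E" "card {e \<in> E. l e = heavy} \<le> card E"
    using finite_E nontrivial_subset by (auto intro!: card_mono)
  then show ?thesis using mult_right_mono[of "card (F \<inter> N)" "card E" "card E + 2"] by simp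
qed

lemma finite_F: "F \<subseteq> E \<Longrightarrow> finite (F \<inter> N)"
  using finite_E finite_subset by blast

lemma card_nontrivial_mono: "F \<subseteq> F' \<Longrightarrow> F' \<subseteq> E \<Longrightarrow> card (F \<inter> N) \<le> card (F' \<inter> N)"
  using finite_F[of F'] by (intro card_mono) auto

text \<open>Settling an unsettled pair adds a nontrivial edge, because all trivial edges are present.\<close>

lemma settling_adds_edge:
  assumes "T \<subseteq> F" "F \<subseteq> F'" "F' \<subseteq> E" "\<not> settled F u v" "settled F' u v"
  shows "card (F \<inter> N) < card (F' \<inter> N)"
proof -
  obtain p where p: "simple_path F' u v p" "sd * path_length len0 p \<le> sn * d0 u v"
    using assms(5) by blast
  then obtain e where "e \<in> set (path_edges p)" "e \<notin> F" using assms(4) by (auto simp: simple_path_def)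
  then have "e \<in> F' \<inter> N" "e \<notin> F" using p(1) assms by (auto simp: simple_path_def nontrivial_edges_def)
  then have "F \<inter> N \<subset> F' \<inter> N" using assms by auto
  then show ?thesis using finite_F[OF assms(3)] by (rule psubset_card_mono[rotated])
qed

lemma set_item_leaf:
  assumes "set_item F l" "\<forall>u v. {u, v} \<in> E \<longrightarrow> settled F u v"
  shows "solvable (F, l', [], t) \<longleftrightarrow> is_solution I F"
proof
  assume "solvable (F, l', [], t)"
  then obtain S where S: "is_solution I S" "F \<subseteq> S" by auto
  then have "S \<subseteq> E" by (auto simp: is_solution_def is_spanner_def)
  with S finite_E have "sum (weight I) F \<le> sum (weight I) S" "card (F \<inter> N) \<le> card (S \<inter> N)"
    by (auto intro!: sum_mono2 card_nontrivial_mono intro: finite_subset)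
  with S assms show "is_solution I F" by (auto simp: is_solution_def is_spanner_iff set_item_def)
qed auto

text \<open>The budget of nontrivial edges is used up, but settling one more pair would take another
  one.\<close>

lemma set_item_full:
  assumes "set_item F l" "{u, v} \<in> E" "\<not> settled F u v" "\<mu> \<le> card (F \<inter> N)"
  shows "\<not> solvable (F, l', [], t)"
proof
  assume "solvable (F, l', [], t)"
  then obtain S where S: "is_solution I S" "F \<subseteq> S" by auto
  then have "S \<subseteq> E" "settled S u v" using assms(2) by (auto simp: is_solution_def is_spanner_iff)
  from settling_adds_edge[OF _ S(2) this(1) assms(3) this(2)] S assms show False
    by (auto simp: set_item_def is_solution_def)
qed

lemma completions_settling:
  "{u, v} \<in> E \<Longrightarrow> completions len0 [u] v = settling_paths I u v"
  using edge_nodes[of u v] by (auto simp: completions_def settling_paths_eq)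

text \<open>For the prefix \<open>[u]\<close> and the original lengths the completions are exactly
  the settling paths of the pair, hence at most \<open>b\<close> in number.\<close>

lemma set_item_branch:
  assumes F: "set_item F l" and uv: "{u, v} \<in> E" "\<not> settled F u v" and c: "card (F \<inter> N) < \<mu>"
  shows "item_ok (F, len0, [u], v)" "solvable (F, l, [], t) \<Longrightarrow> solvable (F, len0, [u], v)"
    "potential (F, len0, [u], v) < potential (F, l, [], t)" "level (F, l, [], t) \<le> level (F, len0, [u], v)"
proof -
  have uvn: "u < n" "v < n" "u \<noteq> v" using edge_nodes[OF uv(1)] by auto
  have edge: "[u, v] \<in> completions len0 [u] v"
    using uv uvn edge_settling unfolding completions_settling[OF uv(1)]
    by (auto simp: settling_paths_eq simple_path_def)
  then show "item_ok (F, len0, [u], v)"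
    using F uv c by (auto simp: path_item_def set_item_def simple_path_def)
  show "solvable (F, l, [], t) \<Longrightarrow> solvable (F, len0, [u], v)"
  proof -
    assume "solvable (F, l, [], t)"
    then obtain S where S: "is_solution I S" "F \<subseteq> S" by auto
    then have "settled S u v" using uv(1) by (simp add: is_solution_def is_spanner_iff)
    then obtain p where p: "simple_path S u v p" "sd * path_length len0 p \<le> sn * d0 u v" by blast
    have "S \<subseteq> E" using S by (auto simp: is_solution_def is_spanner_def)
    then have "p \<in> completions len0 [u] v" using p simple_path_mono by (auto simp: completions_def)
    moreover have "[u] @ tl p = p" using p(1) by (cases p) (auto simp: simple_path_def)
    ultimately show ?thesis using S p(1) by (auto simp: simple_path_def simp del: append.simps intro!: exI[of _ S] bexI[of _ p])
  qed
  have crit: "critical I u v" using unsettled_critical uv F by (auto simp: set_item_def)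
  \<comment> \<open>Since \<open>b \<ge> 2\<close>, the value \<open>j * (5 * X - 2) - 1\<close> is
    at most \<open>5 * b * X - 2 * b - 1\<close>, which is less than
    \<open>5 * b * X - 4\<close>.\<close>
  define j where "j = card (completions len0 [u] v)"
  define X where "X = b ^ (\<mu> - Suc (card (F \<inter> N)))"
  have "1 \<le> j" using edge finite_settling[OF uvn(1)] unfolding j_def completions_settling[OF uv(1)]
    by (metis One_nat_def Suc_leI card_gt_0_iff empty_iff)
  moreover have "j \<le> b" unfolding j_def completions_settling[OF uv(1)] by (rule critical_breadth[OF crit])
  moreover have b2: "b \<ge> 2" by (rule critical_breadth[OF crit])
  moreover have "X \<ge> 1" using b2 by (simp add: X_def)
  moreover have "b ^ (\<mu> - card (F \<inter> N)) = b * X"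
    using c by (simp add: X_def power_eq_if)
  moreover have "j * (5 * X - 2) \<le> b * (5 * X - 2)" using \<open>j \<le> b\<close> by (rule mult_right_mono) simp
  moreover have "b * (5 * X - 2) = 5 * (b * X) - 2 * b" by (simp add: diff_mult_distrib2 algebra_simps)
  moreover have "b * X \<ge> b" using \<open>X \<ge> 1\<close> by simp
  ultimately have "j * (5 * X - 2) - 1 < 5 * b ^ (\<mu> - card (F \<inter> N)) - 4" by linarith
  then show "potential (F, len0, [u], v) < potential (F, l, [], t)"
    by (simp add: j_def[symmetric] X_def[symmetric])
  show "level (F, l, [], t) \<le> level (F, len0, [u], v)" by simp
qed

lemma completion_light:
  assumes "path_item F l \<pi> t" "R \<in> completions l \<pi> t" "e \<in> set (path_edges R)"
  shows "l e = len0 e" "l e < heavy" "e \<in> E"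
proof -
  have R: "simple_path E (last \<pi>) t R" "sd * (path_length len0 \<pi> + path_length l R) \<le> sn * d0 (hd \<pi>) t"
    and ht: "{hd \<pi>, t} \<in> E" and l: "\<forall>e\<in>E. l e = len0 e \<or> l e = heavy"
    using assms by (auto simp: completions_def path_item_def)
  show "l e < heavy" using no_heavy_edge[OF ht R(2) assms(3)] .
  show "e \<in> E" using R(1) assms(3) by (auto simp: simple_path_def)
  with l \<open>l e < heavy\<close> show "l e = len0 e" by auto
qed

text \<open>Each node of \<open>tl R\<close> lies on an edge of \<open>R\<close>. Edges of a
  completion are light, whereas all edges at the earlier nodes of the prefix are heavy. So
  \<open>R\<close> meets the prefix only in its last node.\<close>

lemma completion_path:
  assumes "path_item F l \<pi> t" "R \<in> completions l \<pi> t"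
  shows "simple_path E (hd \<pi>) t (\<pi> @ tl R)" "sd * path_length len0 (\<pi> @ tl R) \<le> sn * d0 (hd \<pi>) t"
    "path_length len0 (\<pi> @ tl R) = path_length len0 \<pi> + path_length l R"
    "set (path_edges (\<pi> @ tl R)) = set (path_edges \<pi>) \<union> set (path_edges R)"
proof -
  have R: "walk E (last \<pi>) t R" "distinct R" "sd * (path_length len0 \<pi> + path_length l R) \<le> sn * d0 (hd \<pi>) t"
    and \<pi>: "walk E (hd \<pi>) (last \<pi>) \<pi>" "distinct \<pi>"
    and h: "\<And>x e. x \<in> set (butlast \<pi>) \<Longrightarrow> e \<in> E \<Longrightarrow> x \<in> e \<Longrightarrow> l e = heavy"
    using assms by (auto simp: completions_def path_item_def simple_path_iff_walk)
  note light = completion_light[OF assms]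
  have disj: "x \<notin> set (butlast \<pi>)" if x: "x \<in> set (tl R)" for x
  proof
    assume x': "x \<in> set (butlast \<pi>)"
    have "length R \<ge> 2" "x \<in> set R" using x by (cases R; cases "tl R"; auto)+
    then obtain e where "e \<in> set (path_edges R)" "x \<in> e" using node_on_path_edge by metis
    then show False using light[of e] h[OF x', of e] by simp
  qed
  have "\<pi> \<noteq> []" "R = last \<pi> # tl R" using \<pi> R by (auto simp: walk_def) (metis list.collapse)
  then have "last \<pi> \<notin> set (tl R)" "set \<pi> = insert (last \<pi>) (set (butlast \<pi>))"
    using R(2) by (metis distinct.simps(2), metis append_butlast_last_id insert_is_Un list.set(1) list.simps(15) set_append sup_commute)
  then have "distinct (\<pi> @ tl R)" using disj \<pi>(2) R(2) by (auto simp: distinct_tl)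
  then show "simple_path E (hd \<pi>) t (\<pi> @ tl R)"
    using walk_join(1)[OF \<pi>(1) R(1)] by (simp add: simple_path_iff_walk)
  have "path_length l R = path_length len0 R" using light by (intro path_length_cong) auto
  then show len: "path_length len0 (\<pi> @ tl R) = path_length len0 \<pi> + path_length l R"
    using walk_join(2)[OF \<pi>(1) R(1)] by simp
  show "sd * path_length len0 (\<pi> @ tl R) \<le> sn * d0 (hd \<pi>) t" using len R(3) by simp
  show "set (path_edges (\<pi> @ tl R)) = set (path_edges \<pi>) \<union> set (path_edges R)"
    using walk_join(3)[OF \<pi>(1) R(1)] by simp
qed

lemma finite_completions: "path_item F l \<pi> t \<Longrightarrow> finite (completions l \<pi> t)"
proof -
  assume p: "path_item F l \<pi> t"
  then have "walk E (hd \<pi>) (last \<pi>) \<pi>" "{hd \<pi>, t} \<in> E" by (auto simp: path_item_def simple_path_iff_walk)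
  then have "set \<pi> \<subseteq> {..<n}" "\<pi> \<noteq> []" using walk_nodes edge_nodes by (blast, auto)
  then have "last \<pi> < n" by (auto simp: subset_iff)
  from finite_simple_paths[OF this] show ?thesis
    by (rule finite_subset[rotated]) (auto simp: completions_def)
qed

lemma path_item_pot:
  assumes "path_item F l \<pi> t"
  shows "b \<ge> 2" "card (completions l \<pi> t) \<ge> 1"
proof -
  have "critical I (hd \<pi>) t" using unsettled_critical assms by (auto simp: path_item_def)
  then show "b \<ge> 2" by (rule critical_breadth)
  have "completions l \<pi> t \<noteq> {}" using assms by (simp add: path_item_def)
  then have "0 < card (completions l \<pi> t)"
    unfolding card_gt_0_iff using finite_completions[OF assms] by blast
  then show "card (completions l \<pi> t) \<ge> 1" by simp
qed

text \<open>A single completion is forced, so its edges are added to \<open>F\<close> without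
  branching. Settling the pair adds a nontrivial edge, which lowers the exponent in the
  potential.\<close>

lemma path_item_unique:
  assumes P: "path_item F l \<pi> t" "completions l \<pi> t = {R}"
    and F': "F' = F \<union> set (path_edges (\<pi> @ tl R))" and l': "\<forall>e\<in>E. l' e = restricted F' e"
  shows "item_ok (F', l', [], t')" "solvable (F, l, \<pi>, t) \<Longrightarrow> \<pi> \<noteq> [] \<Longrightarrow> solvable (F', l', [], t')"
    "\<pi> \<noteq> [] \<Longrightarrow> potential (F', l', [], t') < potential (F, l, \<pi>, t)"
    "level (F, l, \<pi>, t) \<le> level (F', l', [], t')"
proof -
  have R: "R \<in> completions l \<pi> t" using P by simp
  note cp = completion_path[OF P(1) R]
  have F: "T \<subseteq> F" "F \<subseteq> E" "\<not> settled F (hd \<pi>) t" "card (F \<inter> N) < \<mu>" using P by (auto simp: path_item_def)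
  have E': "F' \<subseteq> E" using F cp(1) by (auto simp: F' simple_path_def)
  then show "item_ok (F', l', [], t')" using F l' by (auto simp: set_item_def F')
  show "solvable (F, l, \<pi>, t) \<Longrightarrow> \<pi> \<noteq> [] \<Longrightarrow> solvable (F', l', [], t')"
    using P(2) by (auto simp: F')
  have "settled F' (hd \<pi>) t" using cp by (intro exI[of _ "\<pi> @ tl R"]) (auto simp: F' simple_path_def)
  then have less: "card (F \<inter> N) < card (F' \<inter> N)"
    using settling_adds_edge[of F F'] F E' by (auto simp: F')
  \<comment> \<open>The old potential is \<open>5 * X - 3\<close>, the new one at most
    \<open>5 * X - 4\<close>.\<close>
  define X where "X = b ^ (\<mu> - Suc (card (F \<inter> N)))"
  have b: "b \<ge> 2" using path_item_pot[OF P(1)] by simp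
  then have "b ^ (\<mu> - card (F' \<inter> N)) \<le> X" "X \<ge> 1"
    unfolding X_def using less by (auto intro!: power_increasing)
  then show "\<pi> \<noteq> [] \<Longrightarrow> potential (F', l', [], t') < potential (F, l, \<pi>, t)"
    using P(2) by (simp add: X_def[symmetric])
  have "card {e \<in> E. l e = heavy} \<le> card E" using finite_E by (auto intro!: card_mono)
  moreover have "card (F \<inter> N) * (card E + 2) + (card E + 2) \<le> card (F' \<inter> N) * (card E + 2)"
    using mult_right_mono[of "Suc (card (F \<inter> N))" "card (F' \<inter> N)" "card E + 2"] less by simp
  ultimately show "level (F, l, \<pi>, t) \<le> level (F', l', [], t')" by simp
qed

end

text \<open>
  A child of a path item: the completions that start with \<open>take (Suc j) P\<close> and avoid the edges in \<open>H\<close>.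
\<close>

locale path_child = spanner +
  fixes F :: "nat set set" and l :: "nat set \<Rightarrow> nat" and \<pi> :: "nat list" and t :: nat
    and P :: "nat list" and j :: nat and H :: "nat set set" and l' :: "nat set \<Rightarrow> nat" and \<pi>' :: "nat list"
  assumes item: "path_item F l \<pi> t" and P: "P \<in> completions l \<pi> t" and j: "j < length P"
    and l': "\<And>e. e \<in> E \<Longrightarrow> l' e = (if e \<inter> set (take j P) \<noteq> {} \<or> e \<in> H then heavy else l e)"
    and \<pi>': "\<pi>' = \<pi> @ tl (take (Suc j) P)"
begin

lemma P_facts: "P \<noteq> []" "hd P = last \<pi>" "last P = t" "distinct P" "set (path_edges P) \<subseteq> E"
  using P by (auto simp: completions_def simple_path_def)

lemma \<pi>_facts: "\<pi> \<noteq> []" "distinct \<pi>" "{hd \<pi>, t} \<in> E"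
  using item by (auto simp: path_item_def simple_path_def)

lemma split:
  assumes "take (Suc j) R = take (Suc j) P"
  shows "R = take j P @ P ! j # drop (Suc j) R" "drop j R = P ! j # drop (Suc j) R"
    "\<pi> @ tl R = \<pi>' @ tl (drop j R)" "length R > j"
proof -
  have len: "min (length R) (Suc j) = Suc j" using j arg_cong[OF assms, of length] by simp
  then show len': "length R > j" by (simp add: min_def split: if_splits)
  have "R ! j = P ! j" using assms by (metis lessI nth_take)
  moreover have t: "take j R = take j P" using assms by (metis lessI min.strict_order_iff take_take)
  ultimately show 1: "drop j R = P ! j # drop (Suc j) R" "R = take j P @ P ! j # drop (Suc j) R"
    using len' by (metis Cons_nth_drop_Suc, metis Cons_nth_drop_Suc append_take_drop_id)
  have "tl R = tl (take (Suc j) R) @ drop (Suc j) R"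
    by (metis append_take_drop_id len' length_greater_0_conv take_eq_Nil tl_append2 nat.distinct(1) neq0_conv list.size(3) not_less_zero)
  then show "\<pi> @ tl R = \<pi>' @ tl (drop j R)" using assms by (simp add: \<pi>' 1(1))
qed

lemma split_P:
  "hd \<pi>' = hd \<pi>" "last \<pi>' = P ! j" "\<pi>' \<noteq> []" "take (Suc j) P = take j P @ [P ! j]"
proof -
  show t: "take (Suc j) P = take j P @ [P ! j]" using j by (simp add: take_Suc_conv_app_nth)
  show "hd \<pi>' = hd \<pi>" "\<pi>' \<noteq> []" using \<pi>_facts by (auto simp: \<pi>')
  show "last \<pi>' = P ! j"
  proof (cases j)
    case 0
    then show ?thesis using P_facts by (cases P) (auto simp: \<pi>')
  next
    case (Suc k)
    then have "take j P \<noteq> []" using P_facts by auto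
    then show ?thesis by (simp add: \<pi>' t)
  qed
qed

lemma walk_\<pi>': "walk E (hd \<pi>) (P ! j) \<pi>'" "path_length len0 \<pi>' = path_length len0 \<pi> + path_length len0 (take (Suc j) P)"
proof -
  have "walk E (last \<pi>) t (take j P @ P ! j # drop (Suc j) P)"
    using P j by (simp add: completions_def simple_path_iff_walk id_take_nth_drop[symmetric])
  then have "walk E (last \<pi>) (P ! j) (take (Suc j) P)"
    using walk_split[of E "last \<pi>" t "take j P" "P ! j" "drop (Suc j) P"] split_P(4) by simp
  moreover have "walk E (hd \<pi>) (last \<pi>) \<pi>" using item by (simp add: path_item_def simple_path_iff_walk)
  ultimately show "walk E (hd \<pi>) (P ! j) \<pi>'" "path_length len0 \<pi>' = path_length len0 \<pi> + path_length len0 (take (Suc j) P)"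
    unfolding \<pi>' using walk_join by blast+
qed

text \<open>\<open>drop j\<close> takes completions of the parent to completions of the child;
  \<open>backward\<close> prepends \<open>take j P\<close> again. The newly heavy edges do no harm
  here: the rest of a simple path does not touch \<open>take j P\<close> again and avoids
  \<open>H\<close> by assumption.\<close>

lemma forward:
  assumes R: "R \<in> completions l \<pi> t" "take (Suc j) R = take (Suc j) P" "set (path_edges R) \<inter> H = {}"
  shows "drop j R \<in> completions l' \<pi>' t"
proof -
  note s = split[OF R(2)]
  note light = completion_light[OF item R(1)]
  have R': "walk E (last \<pi>) t R" "distinct R" "sd * (path_length len0 \<pi> + path_length l R) \<le> sn * d0 (hd \<pi>) t"
    using R(1) by (auto simp: completions_def simple_path_iff_walk)
  have w: "walk E (P ! j) t (drop j R)"
    using R'(1) s(1,2) walk_split[of E "last \<pi>" t "take j P" "P ! j" "drop (Suc j) R"] by simp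
  have edges: "path_edges R = path_edges (take (Suc j) P) @ path_edges (drop j R)"
    using path_edges_append[of "take j P" "P ! j" "drop (Suc j) R"] s(1,2) split_P(4) by simp
  have "l' e = len0 e" if e: "e \<in> set (path_edges (drop j R))" for e
  proof -
    have eR: "e \<in> set (path_edges R)" using e edges by simp
    have "e \<inter> set (take j P) = {}"
    proof -
      have "distinct (take j P @ drop j R)" using R'(2) s(1,2) by simp
      then show ?thesis using path_edges_nodes[OF e] by auto
    qed
    then show ?thesis using l' light[OF eR] R(3) eR by auto
  qed
  then have "path_length l' (drop j R) = path_length len0 (drop j R)" by (rule path_length_cong)
  moreover have "path_length l R = path_length len0 R" using light by (intro path_length_cong) auto
  moreover have "path_length len0 R = path_length len0 (take (Suc j) P) + path_length len0 (drop j R)"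
    by (simp add: path_length_def edges)
  ultimately show ?thesis using R'(2,3) w walk_\<pi>'(2) split_P
    by (simp add: completions_def simple_path_iff_walk add.assoc)
qed

text \<open>A completion of the child has no heavy edge, so it avoids \<open>H\<close> and all nodes
  in front of position \<open>j\<close>. This makes the concatenation simple, and \<open>l\<close>
  and \<open>l'\<close> agree on the edges of \<open>R'\<close>.\<close>

lemma backward:
  assumes R': "R' \<in> completions l' \<pi>' t"
  shows "take j P @ R' \<in> completions l \<pi> t" "set (path_edges R') \<inter> H = {}"
    "R' = P ! j # tl R'" "drop j (take j P @ R') = R'"
proof -
  have w: "walk E (P ! j) t R'" "distinct R'"
    and len: "sd * (path_length len0 \<pi>' + path_length l' R') \<le> sn * d0 (hd \<pi>) t"
    using R' split_P by (auto simp: completions_def simple_path_iff_walk)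
  then show R'c: "R' = P ! j # tl R'" by (metis list.collapse walk_def)
  show "drop j (take j P @ R') = R'" using j by simp
  have light: "e \<inter> set (take j P) = {} \<and> e \<notin> H \<and> l' e = l e \<and> l e = len0 e" if e: "e \<in> set (path_edges R')" for e
  proof -
    have eE: "e \<in> E" using w(1) e by (auto simp: walk_def)
    have "l' e < heavy" using no_heavy_edge[OF \<pi>_facts(3) len e] .
    moreover have "l e = len0 e \<or> l e = heavy" using item eE by (auto simp: path_item_def)
    ultimately show ?thesis using l'[OF eE] by (auto split: if_splits)
  qed
  then show "set (path_edges R') \<inter> H = {}" by auto
  have disj: "set (take j P) \<inter> set R' = {}"
  proof (rule ccontr)
    assume "set (take j P) \<inter> set R' \<noteq> {}"
    then obtain x where x: "x \<in> set (take j P)" "x \<in> set R'" by blast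
    have "distinct (take j P @ [P ! j])" using P_facts(4) split_P(4) by (metis distinct_take)
    then have "x \<noteq> P ! j" using x by auto
    then have "length R' \<ge> 2" using x R'c by (cases R'; cases "tl R'") auto
    then obtain e where "e \<in> set (path_edges R')" "x \<in> e" using node_on_path_edge x by metis
    then show False using light[of e] x by auto
  qed
  let ?R = "take j P @ R'"
  have edges: "path_edges ?R = path_edges (take (Suc j) P) @ path_edges R'"
    using path_edges_append[of "take j P" "P ! j" "tl R'"] R'c split_P(4) by simp
  have "hd ?R = last \<pi>"
  proof (cases j)
    case 0
    then show ?thesis using R'c P_facts by (metis append_Nil hd_conv_nth list.sel(1) take0)
  qed (use P_facts in \<open>cases P; auto\<close>)
  moreover have "last ?R = t" using w(1) by (simp add: walk_def)
  moreover have "set (path_edges ?R) \<subseteq> E"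
  proof -
    have "set (path_edges (take (Suc j) P)) \<subseteq> set (path_edges P)"
      using path_edges_append[of "take j P" "P ! j" "drop (Suc j) P"] split_P(4) j
      by (simp add: id_take_nth_drop[symmetric])
    then show ?thesis using P_facts(5) w(1) edges by (auto simp: walk_def)
  qed
  moreover have "distinct ?R" using P_facts(4) w(2) disj by simp
  moreover have "sd * (path_length len0 \<pi> + path_length l ?R) \<le> sn * d0 (hd \<pi>) t"
  proof -
    have "path_length l' R' = path_length l R'" using light by (intro path_length_cong) auto
    moreover have "path_length l (take (Suc j) P) = path_length len0 (take (Suc j) P)"
    proof (rule path_length_cong)
      fix e assume "e \<in> set (path_edges (take (Suc j) P))"
      then have "e \<in> set (path_edges P)"
        using path_edges_append[of "take j P" "P ! j" "drop (Suc j) P"] split_P(4) j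
        by (simp add: id_take_nth_drop[symmetric])
      then show "l e = len0 e" by (rule completion_light[OF item P])
    qed
    moreover have "path_length l ?R = path_length l (take (Suc j) P) + path_length l R'"
      by (simp add: path_length_def edges)
    ultimately show ?thesis using len walk_\<pi>'(2) by (simp add: add.assoc)
  qed
  ultimately show "?R \<in> completions l \<pi> t"
    using w(1) by (auto simp: completions_def simple_path_def walk_def)
qed

text \<open>The longer prefix is an initial part of a completed path of the parent and therefore
  simple. This is where the existence of a completion of the child is needed.\<close>

lemma child_item:
  assumes "completions l' \<pi>' t \<noteq> {}"
  shows "path_item F l' \<pi>' t"
proof -
  obtain R' where R': "R' \<in> completions l' \<pi>' t" using assms by blast
  note bw = backward[OF R']
  have "simple_path E (hd \<pi>) t (\<pi> @ tl (take j P @ R'))" by (rule completion_path[OF item bw(1)])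
  moreover have "\<pi> @ tl (take j P @ R') = \<pi>' @ tl R'"
  proof -
    have "take (Suc j) (take j P @ R') = take (Suc j) P"
      using j by (subst bw(3)) (simp add: split_P(4))
    from split(3)[OF this] bw(4) show ?thesis by simp
  qed
  ultimately have "distinct \<pi>'" by (simp add: simple_path_def)
  then have "simple_path E (hd \<pi>') (last \<pi>') \<pi>'"
    using walk_\<pi>' split_P by (simp add: simple_path_iff_walk)
  moreover have "\<forall>e\<in>E. l' e = len0 e \<or> l' e = heavy" using l' item by (auto simp: path_item_def)
  moreover have "l' e = heavy" if x: "x \<in> set (butlast \<pi>')" "e \<in> E" "x \<in> e" for x e
  proof -
    have "set (butlast \<pi>') \<subseteq> set (butlast \<pi>) \<union> set (take j P)"
    proof (cases j)
      case 0
      then have "tl (take (Suc j) P) = []" by (cases P) auto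
      then show ?thesis by (simp add: \<pi>')
    next
      case (Suc k)
      then have "take j P \<noteq> []" using P_facts by auto
      then have hd: "take j P = last \<pi> # tl (take j P)"
        using P_facts(1,2) Suc by (cases P) auto
      have "\<pi>' = (butlast \<pi> @ [last \<pi>]) @ tl (take j P) @ [P ! j]"
        unfolding \<pi>' split_P(4) using \<pi>_facts(1) \<open>take j P \<noteq> []\<close> by simp
      also have "\<dots> = butlast \<pi> @ take j P @ [P ! j]" by (subst (2) hd) simp
      finally show ?thesis by (simp add: butlast_append)
    qed
    then have "x \<in> set (butlast \<pi>) \<or> x \<in> set (take j P)" using x by blast
    then show ?thesis using l'[OF x(2)] item x by (auto simp: path_item_def)
  qed
  ultimately show ?thesis using item assms split_P unfolding path_item_def by auto
qed

text \<open>The edges of \<open>P\<close> are light for the parent, so blocking one of them strictly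
  enlarges the set of heavy edges.\<close>

lemma child_level:
  assumes "e \<in> set (path_edges P)" "e \<inter> set (take j P) \<noteq> {} \<or> e \<in> H"
  shows "level (F, l, \<pi>, t) < level (F, l', \<pi>', t)"
proof -
  have e: "e \<in> E" "l e \<noteq> heavy" "l' e = heavy"
    using completion_light[OF item P assms(1)] l' assms(2) by auto
  have "{e \<in> E. l e = heavy} \<subset> {e \<in> E. l' e = heavy}" using e l' by auto
  then have "card {e \<in> E. l e = heavy} < card {e \<in> E. l' e = heavy}"
    using finite_E by (intro psubset_card_mono) auto
  then show ?thesis using split_P(3) \<pi>_facts(1) by simp
qed

end

text \<open>The completions are divided by whether they use the edge of \<open>P\<close> at position
  \<open>a\<close>. Up to that position all of them agree with \<open>P\<close>, and
  \<open>P\<close> itself and \<open>Q\<close> show that neither half is empty.\<close>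

lemma (in spanner) path_item_split:
  assumes P: "path_item F l \<pi> t" "P \<in> completions l \<pi> t" and ne: "\<pi> \<noteq> []"
    and a: "Suc a < length P"
    and common: "\<And>R. R \<in> completions l \<pi> t \<Longrightarrow> take (Suc a) R = take (Suc a) P"
    and follow: "\<And>R. R \<in> completions l \<pi> t \<Longrightarrow> {P ! a, P ! Suc a} \<in> set (path_edges R) \<Longrightarrow>
      take (Suc (Suc a)) R = take (Suc (Suc a)) P"
    and Q: "Q \<in> completions l \<pi> t" "{P ! a, P ! Suc a} \<notin> set (path_edges Q)"
    and l1: "\<And>e. e \<in> E \<Longrightarrow> l1 e = (if e \<inter> set (take (Suc a) P) \<noteq> {} then heavy else l e)"
    and l2: "\<And>e. e \<in> E \<Longrightarrow>
      l2 e = (if e \<inter> set (take a P) \<noteq> {} \<or> e = {P ! a, P ! Suc a} then heavy else l e)"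
    and \<pi>1: "\<pi>1 = \<pi> @ tl (take (Suc (Suc a)) P)" and \<pi>2: "\<pi>2 = \<pi> @ tl (take (Suc a) P)"
  shows "item_ok (F, l1, \<pi>1, t)" "item_ok (F, l2, \<pi>2, t)"
    "solvable (F, l, \<pi>, t) \<Longrightarrow> solvable (F, l1, \<pi>1, t) \<or> solvable (F, l2, \<pi>2, t)"
    "potential (F, l1, \<pi>1, t) + potential (F, l2, \<pi>2, t) < potential (F, l, \<pi>, t)"
    "level (F, l, \<pi>, t) < level (F, l1, \<pi>1, t)" "level (F, l, \<pi>, t) < level (F, l2, \<pi>2, t)"
proof -
  let ?e = "{P ! a, P ! Suc a}"
  interpret c1: path_child I F l \<pi> t P "Suc a" "{}" l1 \<pi>1
    using P a l1 \<pi>1 by unfold_locales auto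
  interpret c2: path_child I F l \<pi> t P a "{?e}" l2 \<pi>2
    using P a l2 \<pi>2 by unfold_locales auto
  have "P = take a P @ P ! a # P ! Suc a # drop (Suc (Suc a)) P"
    using a by (metis Cons_nth_drop_Suc Suc_lessD append_take_drop_id)
  then have eP: "?e \<in> set (path_edges P)" by (metis path_edges_mem)
  have into1: "drop (Suc a) R \<in> completions l1 \<pi>1 t"
    if "R \<in> completions l \<pi> t" "?e \<in> set (path_edges R)" for R
    using c1.forward[OF that(1) follow[OF that]] by simp
  have into2: "drop a R \<in> completions l2 \<pi>2 t"
    if "R \<in> completions l \<pi> t" "?e \<notin> set (path_edges R)" for R
    using c2.forward[OF that(1) common[OF that(1)]] that(2) by simp
  have ok1: "path_item F l1 \<pi>1 t" using c1.child_item into1[OF P(2) eP] by blast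
  have ok2: "path_item F l2 \<pi>2 t" using c2.child_item into2[OF Q] by blast
  show "item_ok (F, l1, \<pi>1, t)" "item_ok (F, l2, \<pi>2, t)"
    using ok1 ok2 c1.split_P(3) c2.split_P(3) by auto
  have aP: "P ! a \<in> set (take (Suc a) P)" using a by (simp add: take_Suc_conv_app_nth)
  show "level (F, l, \<pi>, t) < level (F, l1, \<pi>1, t)"
    by (rule c1.child_level[OF eP]) (use aP in blast)
  show "level (F, l, \<pi>, t) < level (F, l2, \<pi>2, t)" by (rule c2.child_level[OF eP]) simp
  show "solvable (F, l1, \<pi>1, t) \<or> solvable (F, l2, \<pi>2, t)" if sol: "solvable (F, l, \<pi>, t)"
  proof -
    obtain S R where S: "is_solution I S" "F \<subseteq> S" "R \<in> completions l \<pi> t" "set (path_edges (\<pi> @ tl R)) \<subseteq> S"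
      using sol ne by auto
    show ?thesis
    proof (cases "?e \<in> set (path_edges R)")
      case True
      then have "solvable (F, l1, \<pi>1, t)"
        using S into1[OF S(3)] c1.split(3)[OF follow[OF S(3)]] by auto
      then show ?thesis by simp
    next
      case False
      then have "solvable (F, l2, \<pi>2, t)"
        using S into2[OF S(3)] c2.split(3)[OF common[OF S(3)]] by auto
      then show ?thesis by simp
    qed
  qed
  let ?C = "completions l \<pi> t" and ?C1 = "completions l1 \<pi>1 t" and ?C2 = "completions l2 \<pi>2 t"
  let ?f1 = "\<lambda>R. take (Suc a) P @ R" and ?f2 = "\<lambda>R. take a P @ R"
  have fin: "finite ?C" using finite_completions[OF P(1)] .
  \<comment> \<open>Paths of the first half continue from \<open>P ! a\<close> along
    \<open>?e\<close>, which is forbidden in the second.\<close>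
  have disj: "?f1 ` ?C1 \<inter> ?f2 ` ?C2 = {}"
  proof (rule ccontr)
    assume "?f1 ` ?C1 \<inter> ?f2 ` ?C2 \<noteq> {}"
    then obtain R1 R2 where R: "R1 \<in> ?C1" "R2 \<in> ?C2" "?f1 R1 = ?f2 R2" by blast
    note b1 = c1.backward[OF R(1)] and b2 = c2.backward[OF R(2)]
    have "R2 = drop a (?f1 R1)" using b2(4) R(3) by simp
    also have "\<dots> = P ! a # P ! Suc a # tl R1" using a b1(3) by (simp add: take_Suc_conv_app_nth)
    finally have "?e \<in> set (path_edges R2)" by simp
    with b2(2) show False by simp
  qed
  have sub: "?f1 ` ?C1 \<subseteq> ?C" "?f2 ` ?C2 \<subseteq> ?C" using c1.backward(1) c2.backward(1) by blast+
  have "card (?f1 ` ?C1 \<union> ?f2 ` ?C2) = card (?f1 ` ?C1) + card (?f2 ` ?C2)"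
    by (intro card_Un_disjoint finite_subset[OF sub(1) fin] finite_subset[OF sub(2) fin] disj)
  moreover have "card (?f1 ` ?C1) = card ?C1" "card (?f2 ` ?C2) = card ?C2"
    by (auto intro!: card_image inj_onI)
  moreover have "card (?f1 ` ?C1 \<union> ?f2 ` ?C2) \<le> card ?C"
    using sub fin by (intro card_mono) auto
  ultimately have card: "card ?C1 + card ?C2 \<le> card ?C" by simp
  define X where "X = 5 * b ^ (\<mu> - Suc (card (F \<inter> N))) - 2"
  have "b \<ge> 2" using path_item_pot[OF P(1)] by simp
  then have "b ^ (\<mu> - Suc (card (F \<inter> N))) \<ge> 1" by simp
  then have X: "X \<ge> 1" by (simp add: X_def)
  have "card ?C1 \<ge> 1" "card ?C2 \<ge> 1" using path_item_pot ok1 ok2 by auto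
  then have "card ?C1 * X \<ge> 1" "card ?C2 * X \<ge> 1" using X by (simp_all add: Suc_le_eq)
  moreover have "card ?C1 * X + card ?C2 * X \<le> card ?C * X"
    using card by (metis distrib_right mult_le_mono1)
  \<comment> \<open>The final \<open>- 1\<close> in the potential of a path item pays for the
    branching: it occurs twice in the children but only once in the parent.\<close>
  ultimately have "(card ?C1 * X - 1) + (card ?C2 * X - 1) < card ?C * X - 1" by linarith
  then show "potential (F, l1, \<pi>1, t) + potential (F, l2, \<pi>2, t) < potential (F, l, \<pi>, t)"
    using ne c1.split_P(3) c2.split_P(3) by (simp add: X_def[symmetric])
qed

section \<open>The program\<close>

abbreviation Then :: "program \<Rightarrow> program \<Rightarrow> program" (infixr ";;" 60) where
  "c ;; d \<equiv> Seq c d"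

abbreviation Plus2 :: "expr \<Rightarrow> expr \<Rightarrow> expr" (infixl "\<oplus>" 65) where "a \<oplus> b \<equiv> Op Plus a b"
abbreviation Minus2 :: "expr \<Rightarrow> expr \<Rightarrow> expr" (infixl "\<ominus>" 65) where "a \<ominus> b \<equiv> Op Minus a b"
abbreviation Times2 :: "expr \<Rightarrow> expr \<Rightarrow> expr" (infixl "\<otimes>" 70) where "a \<otimes> b \<equiv> Op Times a b"
abbreviation Less2 :: "expr \<Rightarrow> expr \<Rightarrow> expr" (infix "\<prec>" 50) where "a \<prec> b \<equiv> Op LessThan a b"
abbreviation Eq2 :: "expr \<Rightarrow> expr \<Rightarrow> expr" (infix "\<doteq>" 50) where "a \<doteq> b \<equiv> Op Equals a b"

lemma run_Assign_Seq:
  "fits B e s \<Longrightarrow> run B d (s\<lparr>regs := (regs s)(r := value_of e s)\<rparr>) T Q \<Longrightarrow>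
    run B (Assign r e ;; d) s (1 + cost e + T) Q"
  by (simp add: wp_simps)

text \<open>
  Registers: 2 to 5 hold the input, 6 the answer, 7 the number \<open>heavy\<close>, 8 the height of the stack,
  9 and 10 the length of \<open>\<pi>\<close> and the node \<open>t\<close> of the current item, 20 to 22 the numbers
  \<open>n\<close>, \<open>m\<close> and \<open>n\<^sup>2\<close>; the others below 100 are temporary.

  Arrays: 2 and 3 hold the lengths and weights, 4 the distances of the instance, 5 to 7 the components
  \<open>F\<close>, \<open>l\<close> and \<open>\<pi>\<close> of the current item, 8 the labels of the nodes, 9 the matrix of edge indices plus
  1, 10 the flags of the nontrivial edges, 11 to 15 the stack, 16 the marks of nodes, 17 the first
  edges of shortest paths, 20 and 21 the end nodes of the edges.

  Everything from 100 on belongs to the given algorithm, so array 104 holds the distances with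
  respect to \<open>l\<close>.
\<close>

definition call_apsp :: "program \<Rightarrow> program" where
  "call_apsp A =
     Assign 100 (Reg 20) ;; Assign 101 (Reg 21) ;;
     For 11 21 (Store 100 (Reg 11) (Cell 20 (Reg 11)) ;; Store 101 (Reg 11) (Cell 21 (Reg 11)) ;;
       Store 102 (Reg 11) (Cell 6 (Reg 11))) ;;
     shift 100 A"

lemma wr_call: "wr (call_apsp A) \<subseteq> {11} \<union> {100..}" and wa_call: "wa (call_apsp A) \<subseteq> {100..}"
  using wr_shift[of 100 A] wa_shift[of 100 A] by (auto simp: call_apsp_def)

definition copy_lengths :: program where
  "copy_lengths = For 11 21 (Store 6 (Reg 11) (Cell 2 (Reg 11)))"

definition save_distances :: program where
  "save_distances = For 11 22 (Store 4 (Reg 11) (Cell 104 (Reg 11)))"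

definition adjacency :: program where
  "adjacency = For 11 22 (Store 9 (Reg 11) (Const 0)) ;;
     For 11 21 (Store 9 (Cell 20 (Reg 11) \<otimes> Reg 20 \<oplus> Cell 21 (Reg 11)) (Reg 11 \<oplus> Const 1) ;;
       Store 9 (Cell 21 (Reg 11) \<otimes> Reg 20 \<oplus> Cell 20 (Reg 11)) (Reg 11 \<oplus> Const 1))"

text \<open>What the verification needs from the given algorithm, the order of the stored edges and
  the word bound. \<open>B1\<close> and \<open>B2\<close> cover the stretch tests, whose sums have
  at most four terms, each bounded by \<open>n * heavy\<close>. \<open>B3\<close> covers the
  addresses of the stack, \<open>B4\<close> those of the matrices and the loop counters,
  \<open>B5\<close> the weights.\<close>

locale machine = spanner +
  fixes A :: program and TA B :: nat and eu ev :: "nat \<Rightarrow> nat"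
  assumes A: "\<And>l s. (\<And>e. e \<in> E \<Longrightarrow> 1 \<le> l e \<and> l e \<le> heavy) \<Longrightarrow> stores_graph s n E l \<Longrightarrow> all_words B s \<Longrightarrow>
      run B A s TA (\<lambda>s'. \<forall>u<n. \<forall>v<n. mem s' 4 (u * n + v) = ndist l E u v)"
    and ed: "bij_betw (\<lambda>i. {eu i, ev i}) {..<card E} E"
    and B1: "sd * (5 * (n * heavy)) \<le> B" and B2: "sn * (n * heavy) \<le> B"
    and B3: "((card E + 1) * (card E + 2) + 3) * (n + card E + 1) \<le> B"
    and B4: "n * n + n + card E + 10 \<le> B" and B5: "sum (weight I) E \<le> B"
begin

abbreviation "m \<equiv> card E"
abbreviation "ed i \<equiv> {eu i, ev i}"

definition el :: "nat \<Rightarrow> nat" where "el i = len0 (ed i)"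
definition ew :: "nat \<Rightarrow> nat" where "ew i = weight I (ed i)"

lemma ed_mem: "i < m \<Longrightarrow> {eu i, ev i} \<in> E"
  using ed by (auto simp: bij_betw_def)

lemma ed_nodes: "i < m \<Longrightarrow> eu i < n" "i < m \<Longrightarrow> ev i < n" "i < m \<Longrightarrow> eu i \<noteq> ev i"
  using ed_mem edge_nodes by blast+

lemma ed_eq_iff: "i < m \<Longrightarrow> j < m \<Longrightarrow> ed i = ed j \<longleftrightarrow> i = j"
  using ed unfolding bij_betw_def inj_on_def by auto

lemma edE:
  assumes "e \<in> E" obtains i where "i < m" "e = ed i"
  using assms ed by (auto simp: bij_betw_def)

definition base :: "state \<Rightarrow> bool" where
  "base s \<longleftrightarrow> all_words B s \<and> regs s 20 = n \<and> regs s 21 = m \<and> regs s 2 = sn \<and> regs s 3 = sd \<and>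
     regs s 4 = weight_bound I \<and> regs s 5 = \<mu> \<and> regs s 7 = heavy \<and> regs s 22 = n * n \<and>
     (\<forall>i<m. mem s 20 i = eu i \<and> mem s 21 i = ev i \<and> mem s 2 i = el i \<and> mem s 3 i = ew i)"

lemma base_agree:
  assumes "base s" "agree B W X s s'"
    "20 \<notin> W \<and> 21 \<notin> W \<and> 22 \<notin> W \<and> 2 \<notin> W \<and> 3 \<notin> W \<and> 4 \<notin> W \<and> 5 \<notin> W \<and> 7 \<notin> W"
    "20 \<notin> X \<and> 21 \<notin> X \<and> 2 \<notin> X \<and> 3 \<notin> X"
  shows "base s'"
  using assms unfolding base_def agree_def by metis

lemma base_regs:
  assumes "base s"
  shows "regs s 20 = n" "regs s 21 = m" "regs s 2 = sn" "regs s 3 = sd"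
    "regs s 4 = weight_bound I" "regs s 5 = \<mu>" "regs s 7 = heavy" "regs s 22 = n * n"
    "\<And>r. regs s r \<le> B" "\<And>a i. mem s a i \<le> B"
    "\<And>i. i < m \<Longrightarrow> mem s 20 i = eu i" "\<And>i. i < m \<Longrightarrow> mem s 21 i = ev i"
    "\<And>i. i < m \<Longrightarrow> mem s 2 i = el i" "\<And>i. i < m \<Longrightarrow> mem s 3 i = ew i"
  using assms by (auto simp: base_def all_words_def)

lemma heavy_pos: "heavy \<ge> 1"
  by (simp add: heavy_def)

lemma m_less_B: "m < B" and n_less_B: "n < B" and nn_less_B: "n * n < B" and B_ge10: "10 \<le> B" "2 \<le> B" "1 \<le> B"
  using B4 by auto

lemma index_bound: "u < n \<Longrightarrow> v < n \<Longrightarrow> u * n + v < n * n"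
proof -
  assume "u < n" "v < n"
  then have "u * n + v < (u + 1) * n" by simp
  also have "\<dots> \<le> n * n" using \<open>u < n\<close> by (intro mult_right_mono) auto
  finally show ?thesis .
qed

lemma index_eq_iff: "v < n \<Longrightarrow> v' < n \<Longrightarrow> u * n + v = u' * n + v' \<longleftrightarrow> u = u' \<and> v = v'"
proof
  assume v: "v < n" "v' < n" and eq: "u * n + v = u' * n + v'"
  have "(u * n + v) div n = u" "(u' * n + v') div n = u'" using v by auto
  with eq have "u = u'" by simp
  with eq show "u = u' \<and> v = v'" by simp
qed simp

lemma index_le_B: "u < n \<Longrightarrow> v < n \<Longrightarrow> u * n + v \<le> B"
  using index_bound[of u v] nn_less_B by simp

lemma index_le_B': "u < n \<Longrightarrow> u * n \<le> B"
  using nn_less_B mult_le_mono1[of u n n] by linarith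

lemma node_le_B: "u < n \<Longrightarrow> u \<le> B" and nodes_le_B: "u < n \<Longrightarrow> v < n \<Longrightarrow> u + v \<le> B"
  and edge_le_B: "i < m \<Longrightarrow> i \<le> B" "i < m \<Longrightarrow> i + 1 \<le> B" "i < m \<Longrightarrow> Suc i \<le> B"
proof -
  have "1 * n \<le> n * n" using n_pos by (intro mult_right_mono) auto
  then show "u < n \<Longrightarrow> u \<le> B" "u < n \<Longrightarrow> v < n \<Longrightarrow> u + v \<le> B"
    "i < m \<Longrightarrow> i \<le> B" "i < m \<Longrightarrow> i + 1 \<le> B" "i < m \<Longrightarrow> Suc i \<le> B"
    using B4 by linarith+
qed

lemma size_le_B: "n \<le> B" "m \<le> B" "n * n \<le> B"
  using n_less_B m_less_B nn_less_B by simp_all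

lemma el_bounds: "i < m \<Longrightarrow> 1 \<le> el i" "i < m \<Longrightarrow> el i \<le> heavy"
  using len_pos[OF ed_mem] len_less_heavy[OF ed_mem] by (auto simp: el_def less_imp_le)

lemma scaled_le_B: "x \<le> 5 * (n * heavy) \<Longrightarrow> sd * x \<le> B" and unscaled_le_B: "x \<le> 5 * (n * heavy) \<Longrightarrow> x \<le> B"
proof -
  have *: "sd * x \<le> B" if "x \<le> 5 * (n * heavy)" for x
    using mult_le_mono2[OF that, of sd] B1 by (rule order_trans)
  then show "x \<le> 5 * (n * heavy) \<Longrightarrow> sd * x \<le> B" .
  assume "x \<le> 5 * (n * heavy)"
  then have "sd * x \<le> B" by (rule *)
  moreover have "1 * x \<le> sd * x" using stretch_fraction(1) by (rule mult_right_mono) simp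
  ultimately show "x \<le> B" unfolding mult_1 by (rule order_trans[rotated])
qed

lemma heavy_le: "heavy \<le> n * heavy"
  using n_pos by simp

lemma heavy_le_B: "heavy \<le> B"
  using unscaled_le_B[of heavy] heavy_le by simp

lemma el_le_B: "i < m \<Longrightarrow> el i \<le> B"
  using el_bounds(2)[of i] heavy_le_B by simp

lemma d0_bound: "u < n \<Longrightarrow> v < n \<Longrightarrow> d0 u v \<le> n * heavy"
  using len_less_heavy by (intro ndist_bound) (auto intro: less_imp_le)

lemma bound_le_B: "x \<le> n * heavy \<Longrightarrow> sn * x \<le> B"
  using B2 by (meson le_trans mult_le_mono2)

lemmas le_B = size_le_B index_le_B index_le_B' node_le_B nodes_le_B edge_le_B ed_nodes el_le_B heavy_le_B B_ge10

text \<open>Edges and current lengths are copied before every call, because the algorithm may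
  overwrite its own input.\<close>

lemma run_call:
  assumes "base s" and l: "\<And>e. e \<in> E \<Longrightarrow> 1 \<le> l e \<and> l e \<le> heavy"
    and X: "\<And>i. i < m \<Longrightarrow> mem s 6 i = l (ed i)"
  shows "run B (call_apsp A) s (30 * m + 30 + TA)
    (\<lambda>s'. \<forall>u<n. \<forall>v<n. mem s' 104 (u * n + v) = ndist l E u v)"
proof -
  note bs = base_regs[OF assms(1)]
  let ?s = "s\<lparr>regs := (regs s)(100 := n, 101 := m)\<rparr>"
  define Q where "Q s' \<longleftrightarrow> all_words B s' \<and> regs s' 100 = n \<and> regs s' 101 = m \<and>
    (\<forall>i<m. mem s' 100 i = eu i \<and> mem s' 101 i = ev i \<and> mem s' 102 i = l (ed i))" for s'
  have "run B (For 11 21 (Store 100 (Reg 11) (Cell 20 (Reg 11)) ;; Store 101 (Reg 11) (Cell 21 (Reg 11)) ;;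
       Store 102 (Reg 11) (Cell 6 (Reg 11)))) ?s (m * (22 + 8) + 8) Q"
  proof (rule run_For[where I = "\<lambda>j s'. \<forall>i<j. mem s' 100 i = eu i \<and> mem s' 101 i = ev i \<and> mem s' 102 i = l (ed i)"])
    fix j and s' :: state assume j: "j < m" "\<forall>i<j. mem s' 100 i = eu i \<and> mem s' 101 i = ev i \<and> mem s' 102 i = l (ed i)"
      "regs s' 11 = j" and ag: "agree B (insert 11 (wr (Store 100 (Reg 11) (Cell 20 (Reg 11)) ;; Store 101 (Reg 11) (Cell 21 (Reg 11)) ;;
       Store 102 (Reg 11) (Cell 6 (Reg 11))))) (wa (Store 100 (Reg 11) (Cell 20 (Reg 11)) ;; Store 101 (Reg 11) (Cell 21 (Reg 11)) ;;
       Store 102 (Reg 11) (Cell 6 (Reg 11)))) ?s s'"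
    have "base ?s" using assms(1) m_less_B n_less_B by (auto simp: base_def all_words_def)
    from base_regs[OF base_agree[OF this ag]] agree_mem[OF ag, of 6] l[OF ed_mem[OF j(1)]]
    show "run B (Store 100 (Reg 11) (Cell 20 (Reg 11)) ;; Store 101 (Reg 11) (Cell 21 (Reg 11)) ;;
       Store 102 (Reg 11) (Cell 6 (Reg 11))) s' 22
       (\<lambda>s''. \<forall>i<Suc j. mem (s''\<lparr>regs := (regs s'')(11 := Suc j)\<rparr>) 100 i = eu i \<and>
          mem (s''\<lparr>regs := (regs s'')(11 := Suc j)\<rparr>) 101 i = ev i \<and>
          mem (s''\<lparr>regs := (regs s'')(11 := Suc j)\<rparr>) 102 i = l (ed i))"
      using j m_less_B X[of j] by (auto simp: wp_simps less_Suc_eq le_B intro: order_trans[OF _ heavy_le_B])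
  qed (use m_less_B n_less_B bs assms(1) in \<open>auto simp: Q_def agree_def base_def all_words_def\<close>)
  moreover have "run B (shift 100 A) s' TA (\<lambda>s''. \<forall>u<n. \<forall>v<n. mem s'' 104 (u * n + v) = ndist l E u v)"
    if Q: "Q s'" for s'
  proof -
    have st: "stored_edge (view 100 s') i = ed i" if "i < m" for i
      using Q that by (simp add: stored_edge_def view_def Q_def)
    have "bij_betw (stored_edge (view 100 s')) {..<m} E"
      using ed st by (subst bij_betw_cong[where g = "\<lambda>i. {eu i, ev i}"]) auto
    then have "stores_graph (view 100 s') n E l"
      using Q st by (auto simp: stores_graph_def) (auto simp: view_def Q_def)
    moreover have "all_words B (view 100 s')" using Q by (auto simp: Q_def all_words_def view_def)
    ultimately obtain t v where v: "exec B A (view 100 s') t v" "t \<le> TA"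
      "\<forall>u<n. \<forall>w<n. mem v 4 (u * n + w) = ndist l E u w"
      using A[of l "view 100 s'"] l unfolding run_def by blast
    then show ?thesis unfolding run_def using exec_shift[OF v(1) refl]
      by (intro exI conjI) (auto simp: merge_def)
  qed
  ultimately have "run B (For 11 21 (Store 100 (Reg 11) (Cell 20 (Reg 11)) ;; Store 101 (Reg 11) (Cell 21 (Reg 11)) ;;
       Store 102 (Reg 11) (Cell 6 (Reg 11))) ;; shift 100 A) ?s ((m * (22 + 8) + 8) + TA)
       (\<lambda>s'. \<forall>u<n. \<forall>v<n. mem s' 104 (u * n + v) = ndist l E u v)"
    by (rule run_Seq)
  from run_mono[OF this, of "30 * m + 8 + TA"]
  have *: "run B (For 11 21 (Store 100 (Reg 11) (Cell 20 (Reg 11)) ;; Store 101 (Reg 11) (Cell 21 (Reg 11)) ;;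
       Store 102 (Reg 11) (Cell 6 (Reg 11))) ;; shift 100 A) ?s (30 * m + 8 + TA)
       (\<lambda>s'. \<forall>u<n. \<forall>v<n. mem s' 104 (u * n + v) = ndist l E u v)" by simp
  have "run B (Assign 101 (Reg 21) ;; For 11 21 (Store 100 (Reg 11) (Cell 20 (Reg 11)) ;; Store 101 (Reg 11) (Cell 21 (Reg 11)) ;;
       Store 102 (Reg 11) (Cell 6 (Reg 11))) ;; shift 100 A) (s\<lparr>regs := (regs s)(100 := n)\<rparr>) (1 + cost (Reg 21) + (30 * m + 8 + TA))
       (\<lambda>s'. \<forall>u<n. \<forall>v<n. mem s' 104 (u * n + v) = ndist l E u v)"
    by (rule run_Assign_Seq) (use bs(2) size_le_B * in auto)
  then have "run B (call_apsp A) s (1 + cost (Reg 20) + (1 + cost (Reg 21) + (30 * m + 8 + TA)))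
       (\<lambda>s'. \<forall>u<n. \<forall>v<n. mem s' 104 (u * n + v) = ndist l E u v)"
    unfolding call_apsp_def using bs(1) size_le_B by (subst run_wp, subst wp_Seq, subst wp_Assign) (simp add: run_wp)
  then show ?thesis by (rule run_mono) auto
qed

section \<open>Preprocessing\<close>

lemma run_copy_lengths:
  assumes "base s"
  shows "run B copy_lengths s (13 * m + 8) (\<lambda>s'. \<forall>i<m. mem s' 6 i = el i)"
proof -
  have "run B copy_lengths s (m * (5 + 8) + 8) (\<lambda>s'. \<forall>i<m. mem s' 6 i = el i)"
    unfolding copy_lengths_def
  proof (rule run_For[where I = "\<lambda>j s'. \<forall>i<j. mem s' 6 i = el i"])
    fix j and s' :: state assume j: "j < m" "\<forall>i<j. mem s' 6 i = el i" "regs s' 11 = j"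
      and ag: "agree B (insert 11 (wr (Store 6 (Reg 11) (Cell 2 (Reg 11))))) (wa (Store 6 (Reg 11) (Cell 2 (Reg 11)))) s s'"
    note b = base_regs[OF base_agree[OF assms ag]]
    show "run B (Store 6 (Reg 11) (Cell 2 (Reg 11))) s' 5
        (\<lambda>s''. \<forall>i<Suc j. mem (s''\<lparr>regs := (regs s'')(11 := Suc j)\<rparr>) 6 i = el i)"
      using j b by (auto simp: wp_simps less_Suc_eq le_B)
  qed (use base_regs[OF assms] m_less_B in auto)
  then show ?thesis by (rule run_mono) auto
qed

lemma run_save_distances:
  assumes "base s"
  shows "run B save_distances s (13 * (n * n) + 8) (\<lambda>s'. \<forall>i<n*n. mem s' 4 i = mem s 104 i)"
proof -
  have "run B save_distances s (n * n * (5 + 8) + 8) (\<lambda>s'. \<forall>i<n*n. mem s' 4 i = mem s 104 i)"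
    unfolding save_distances_def
  proof (rule run_For[where I = "\<lambda>j s'. \<forall>i<j. mem s' 4 i = mem s 104 i"])
    fix j and s' :: state assume j: "j < n * n" "\<forall>i<j. mem s' 4 i = mem s 104 i" "regs s' 11 = j"
      and ag: "agree B (insert 11 (wr (Store 4 (Reg 11) (Cell 104 (Reg 11))))) (wa (Store 4 (Reg 11) (Cell 104 (Reg 11)))) s s'"
    note b = base_regs[OF base_agree[OF assms ag]]
    show "run B (Store 4 (Reg 11) (Cell 104 (Reg 11))) s' 5
        (\<lambda>s''. \<forall>i<Suc j. mem (s''\<lparr>regs := (regs s'')(11 := Suc j)\<rparr>) 4 i = mem s 104 i)"
      using j b agree_mem[OF ag, of 104] base_regs[OF assms] by (auto simp: wp_simps less_Suc_eq)
  qed (use base_regs[OF assms] nn_less_B in auto)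
  then show ?thesis by (rule run_mono) auto
qed

definition adj_ok :: "state \<Rightarrow> bool" where
  "adj_ok s \<longleftrightarrow> (\<forall>x<n. \<forall>y<n. (\<forall>i<m. ed i = {x, y} \<longrightarrow> mem s 9 (x * n + y) = i + 1) \<and>
     ({x, y} \<notin> E \<longrightarrow> mem s 9 (x * n + y) = 0))"

lemma run_adjacency:
  assumes "base s"
  shows "run B adjacency s (12 * (n * n) + 30 * m + 16) adj_ok"
proof -
  let ?c1 = "Store 9 (Reg 11) (Const 0)"
  let ?c2 = "Store 9 (Cell 20 (Reg 11) \<otimes> Reg 20 \<oplus> Cell 21 (Reg 11)) (Reg 11 \<oplus> Const 1) ;;
       Store 9 (Cell 21 (Reg 11) \<otimes> Reg 20 \<oplus> Cell 20 (Reg 11)) (Reg 11 \<oplus> Const 1)"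
  have "run B (For 11 22 ?c1) s (n * n * (4 + 8) + 8) (\<lambda>s'. \<forall>i<n*n. mem s' 9 i = 0)"
  proof (rule run_For[where I = "\<lambda>j s'. \<forall>i<j. mem s' 9 i = 0"])
    fix j and s' :: state assume j: "j < n * n" "\<forall>i<j. mem s' 9 i = 0" "regs s' 11 = j"
    show "run B ?c1 s' 4 (\<lambda>s''. \<forall>i<Suc j. mem (s''\<lparr>regs := (regs s'')(11 := Suc j)\<rparr>) 9 i = 0)"
      using j nn_less_B by (auto simp: wp_simps less_Suc_eq)
  qed (use base_regs[OF assms] nn_less_B in auto)
  moreover have "run B (For 11 21 ?c2) s1 (m * (22 + 8) + 8) adj_ok"
    if z: "\<forall>i<n*n. mem s1 9 i = 0" and ag1: "agree B (wr (For 11 22 ?c1)) (wa (For 11 22 ?c1)) s s1" for s1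
  proof (rule run_For[where I = "\<lambda>j s'. \<forall>x<n. \<forall>y<n. (\<forall>i<j. ed i = {x, y} \<longrightarrow> mem s' 9 (x * n + y) = i + 1) \<and>
     ((\<forall>i<j. ed i \<noteq> {x, y}) \<longrightarrow> mem s' 9 (x * n + y) = 0)"])
    have b1: "base s1" by (rule base_agree[OF assms ag1]) auto
    show "regs s1 21 = m" "m < B" using base_regs[OF b1] m_less_B by auto
    fix j and s' :: state assume j: "j < m" and I: "\<forall>x<n. \<forall>y<n. (\<forall>i<j. ed i = {x, y} \<longrightarrow> mem s' 9 (x * n + y) = i + 1) \<and>
     ((\<forall>i<j. ed i \<noteq> {x, y}) \<longrightarrow> mem s' 9 (x * n + y) = 0)" and r: "regs s' 11 = j"
      and ag: "agree B (insert 11 (wr ?c2)) (wa ?c2) s1 s'"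
    have b: "base s'" by (rule base_agree[OF b1 ag]) auto
    define x0 where "x0 = eu j"
    define y0 where "y0 = ev j"
    have xy: "x0 < n" "y0 < n" "x0 \<noteq> y0" using ed_nodes[OF j] by (auto simp: x0_def y0_def)
    have ji: "{x0, y0} \<noteq> ed i" if "i < j" for i
      using ed_eq_iff[of i j] that j by (auto simp: x0_def y0_def)
    have e: "mem s' 20 j = x0" "mem s' 21 j = y0" using base_regs[OF b] j by (auto simp: x0_def y0_def)
    define M where "M = (mem s' 9)(x0 * n + y0 := j + 1, y0 * n + x0 := j + 1)"
    have M1: "M (x * n + y) = (if {x, y} = {x0, y0} then j + 1 else mem s' 9 (x * n + y))"
      if "x < n" "y < n" for x y
      using that xy index_eq_iff[of y x0 x y0] index_eq_iff[of y y0 x x0]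
      by (auto simp: M_def doubleton_eq_iff)
    have "(\<forall>i<Suc j. ed i = {x, y} \<longrightarrow> M (x * n + y) = i + 1) \<and>
       ((\<forall>i<Suc j. ed i \<noteq> {x, y}) \<longrightarrow> M (x * n + y) = 0)" if "x < n" "y < n" for x y
    proof (cases "{x, y} = {x0, y0}")
      case True
      then show ?thesis using M1[OF that] ji by (metis less_Suc_eq x0_def y0_def)
    next
      case False
      then have "M (x * n + y) = mem s' 9 (x * n + y)" "ed j \<noteq> {x, y}" using M1[OF that] by (auto simp: x0_def y0_def)
      then show ?thesis using I that by (metis less_Suc_eq)
    qed
    moreover have "run B ?c2 s' 22 (\<lambda>s''. mem s'' 9 = M)"
      using r e xy j base_regs(1,2)[OF b] by (simp add: wp_simps le_B M_def)
    ultimately show "run B ?c2 s' 22 (\<lambda>s''. \<forall>x<n. \<forall>y<n. (\<forall>i<Suc j. ed i = {x, y} \<longrightarrow>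
      mem (s''\<lparr>regs := (regs s'')(11 := Suc j)\<rparr>) 9 (x * n + y) = i + 1) \<and>
      ((\<forall>i<Suc j. ed i \<noteq> {x, y}) \<longrightarrow> mem (s''\<lparr>regs := (regs s'')(11 := Suc j)\<rparr>) 9 (x * n + y) = 0))"
      by (elim run_mono) auto
  next
    show "\<forall>x<n. \<forall>y<n. (\<forall>i<0. ed i = {x, y} \<longrightarrow> mem (s1\<lparr>regs := (regs s1)(11 := 0)\<rparr>) 9 (x * n + y) = i + 1) \<and>
      ((\<forall>i<0. ed i \<noteq> {x, y}) \<longrightarrow> mem (s1\<lparr>regs := (regs s1)(11 := 0)\<rparr>) 9 (x * n + y) = 0)"
      using z index_bound by auto
  next
    fix s' :: state assume I: "\<forall>x<n. \<forall>y<n. (\<forall>i<m. ed i = {x, y} \<longrightarrow> mem s' 9 (x * n + y) = i + 1) \<and>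
     ((\<forall>i<m. ed i \<noteq> {x, y}) \<longrightarrow> mem s' 9 (x * n + y) = 0)"
    then show "adj_ok s'" unfolding adj_ok_def using ed_mem by metis
  qed auto
  ultimately have "run B adjacency s ((n * n * (4 + 8) + 8) + (m * (22 + 8) + 8)) adj_ok"
    unfolding adjacency_def by (rule run_Seq)
  then show ?thesis by (rule run_mono) auto
qed

end

section \<open>First edges of shortest paths and mandatory edges\<close>

definition top_half :: "nat \<Rightarrow> nat \<Rightarrow> program" where
  "top_half x y = If (Reg 14 \<oplus> Cell 4 (Reg y \<otimes> Reg 20 \<oplus> Reg 15) \<doteq> Cell 4 (Reg x \<otimes> Reg 20 \<oplus> Reg 15))
     (Store 17 (Reg x \<otimes> Reg 20 \<oplus> Reg 15) (Reg 11)) Skip"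

definition load_edge :: program where
  "load_edge = Assign 12 (Cell 20 (Reg 11)) ;; Assign 13 (Cell 21 (Reg 11)) ;; Assign 14 (Cell 2 (Reg 11))"

definition tops :: program where
  "tops = For 11 21 (load_edge ;; For 15 20 (top_half 12 13 ;; top_half 13 12))"

text \<open>For a fixed source in register 15, the edge directed from \<open>x\<close> to
  \<open>y\<close> can enter only one label class, namely that of the recorded first edge of a
  shortest path to \<open>y\<close>. So one pass over edges and sources treats all pairs at once, in
  time O(nm). If \<open>x\<close> is the source and \<open>y\<close> is reached over another first
  edge, the edge itself is shown not to be mandatory as well.\<close>

definition mand_half :: "nat \<Rightarrow> nat \<Rightarrow> program" where
  "mand_half x y = If (Reg y \<doteq> Reg 15) Skip
     (Assign 16 (Cell 17 (Reg 15 \<otimes> Reg 20 \<oplus> Reg y)) ;;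
      If (Reg 16 \<doteq> Reg 11) Skip
        (Assign 18 (Cell 20 (Reg 16) \<oplus> Cell 21 (Reg 16) \<ominus> Reg 15) ;;
         If (Reg x \<doteq> Reg 15) (Store 10 (Reg 11) (Const 1) ;; Assign 19 (Const 1))
           (Assign 19 (Const 1 \<ominus> (Cell 17 (Reg 15 \<otimes> Reg 20 \<oplus> Reg x) \<doteq> Reg 16))) ;;
         If (Reg 19) (If (Reg 2 \<otimes> Cell 4 (Reg 15 \<otimes> Reg 20 \<oplus> Reg 18) \<prec>
             Reg 3 \<otimes> (Cell 4 (Reg 15 \<otimes> Reg 20 \<oplus> Reg x) \<oplus> Reg 14 \<oplus> Cell 4 (Reg y \<otimes> Reg 20 \<oplus> Reg 18)))
           Skip (Store 10 (Reg 16) (Const 1))) Skip))"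

definition clear_flags :: program where
  "clear_flags = For 11 21 (Store 10 (Reg 11) (Const 0))"

definition alternatives :: program where
  "alternatives = For 11 21 (load_edge ;; For 15 20 (mand_half 12 13 ;; mand_half 13 12))"

definition drop_weightless :: program where
  "drop_weightless = For 11 21 (If (Cell 3 (Reg 11)) Skip (Store 10 (Reg 11) (Const 0)))"

lemma frame_sets [simp]:
  "wr (top_half x y) = {}" "wa (top_half x y) = {17}"
  "wr load_edge = {12, 13, 14}" "wa load_edge = {}"
  "wr tops = {11, 12, 13, 14, 15}" "wa tops = {17}"
  "wr (mand_half x y) = {16, 18, 19}" "wa (mand_half x y) = {10}"
  "wr clear_flags = {11}" "wa clear_flags = {10}"
  "wr alternatives = {11, 12, 13, 14, 15, 16, 18, 19}" "wa alternatives = {10}"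
  "wr drop_weightless = {11}" "wa drop_weightless = {10}"
  "wr copy_lengths = {11}" "wa copy_lengths = {6}"
  "wr save_distances = {11}" "wa save_distances = {4}"
  "wr adjacency = {11}" "wa adjacency = {9}"
  by (auto simp: top_half_def load_edge_def tops_def mand_half_def clear_flags_def alternatives_def
      drop_weightless_def copy_lengths_def save_distances_def adjacency_def)

context machine
begin

definition dist_ok :: "state \<Rightarrow> bool" where
  "dist_ok s \<longleftrightarrow> (\<forall>u<n. \<forall>v<n. mem s 4 (u * n + v) = d0 u v)"

definition towards :: "nat \<Rightarrow> nat \<Rightarrow> nat \<Rightarrow> bool" where
  "towards i u z \<longleftrightarrow> (\<exists>v. ed i = {u, v} \<and> len0 {u, v} + d0 v z = d0 u z)"

definition tops_ok :: "(nat \<Rightarrow> nat \<Rightarrow> nat) \<Rightarrow> bool" where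
  "tops_ok tp \<longleftrightarrow> (\<forall>u<n. \<forall>z<n. u \<noteq> z \<longrightarrow> tp u z < m \<and> towards (tp u z) u z)"

lemma towards_iff:
  "i < m \<Longrightarrow> towards i u z \<longleftrightarrow>
    u = eu i \<and> el i + d0 (ev i) z = d0 (eu i) z \<or> u = ev i \<and> el i + d0 (eu i) z = d0 (ev i) z"
  unfolding towards_def el_def using ed_nodes(3)[of i]
  by (auto simp: doubleton_eq_iff insert_commute)

lemma run_load_edge:
  assumes "base s" "regs s 11 = i" "i < m"
  shows "run B load_edge s 9 (\<lambda>s'. s' = s\<lparr>regs := (regs s)(12 := eu i, 13 := ev i, 14 := el i)\<rparr>)"
  using assms base_regs[OF assms(1)] by (auto simp: load_edge_def wp_simps le_B)

lemma run_top_half: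
  assumes b: "base s" and D: "dist_ok s" and r: "regs s 11 = i" "regs s 14 = el i" "regs s 15 = z"
    "regs s x = u" "regs s y = v" and i: "i < m" "z < n" "u < n" "v < n"
  shows "run B (top_half x y) s 30
    (\<lambda>s'. s' = s\<lparr>mem := (mem s)(17 := if el i + d0 v z = d0 u z then (mem s 17)(u * n + z := i) else mem s 17)\<rparr>)"
proof -
  note bs = base_regs[OF b]
  have D: "mem s 4 (u * n + z) = d0 u z" "mem s 4 (v * n + z) = d0 v z"
    using D i by (auto simp: dist_ok_def)
  have "d0 v z \<le> n * heavy" "d0 u z \<le> n * heavy" using d0_bound i by auto
  then have "d0 v z \<le> B" "d0 u z \<le> B" "el i + d0 v z \<le> B"
    using el_bounds(2)[OF i(1)] heavy_le by (intro unscaled_le_B; linarith)+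
  then show ?thesis
    unfolding top_half_def using r i D bs(1,9) by (auto simp: wp_simps le_B)
qed

text \<open>An entry may be overwritten many times, but only by edges that qualify too. So it
  suffices that every qualifying edge processed so far has left a qualifying entry.\<close>

lemma run_tops:
  assumes b: "base s" and D: "dist_ok s"
  shows "run B tops s (100 * (n * m) + 30 * m + 8) (\<lambda>s'. tops_ok (\<lambda>u z. mem s' 17 (u * n + z)))"
proof -
  define good where "good M u z \<longleftrightarrow> M (u * n + z) < m \<and> towards (M (u * n + z)) u z" for M u z
  define inv where "inv M j k \<longleftrightarrow> (\<forall>u<n. \<forall>z<n. \<forall>i<m. (i < j \<or> i = j \<and> z < k) \<and> towards i u z \<longrightarrow> good M u z)"
    for M j k
  have upd: "good (M(u * n + z := i)) u' z'" if "good M u' z' \<or> u = u' \<and> z = z'" "towards i u z" "i < m"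
    "z < n" "z' < n" for M u z i u' z'
    using that index_eq_iff[of z z' u u'] by (auto simp: good_def)
  let ?c = "top_half 12 13 ;; top_half 13 12"
  have inner: "run B ?c s' 60 (\<lambda>s''. inv (mem s'' 17) j (Suc k))"
    if b: "base s'" and D: "dist_ok s'" and I: "inv (mem s' 17) j k"
      and r: "regs s' 11 = j" "regs s' 12 = eu j" "regs s' 13 = ev j" "regs s' 14 = el j" "regs s' 15 = k"
      and j: "j < m" "k < n" for j k s'
  proof -
    note en = ed_nodes[OF j(1)]
    define M where "M = mem s' 17"
    define M1 where "M1 = (if el j + d0 (ev j) k = d0 (eu j) k then M(eu j * n + k := j) else M)"
    define M2 where "M2 = (if el j + d0 (eu j) k = d0 (ev j) k then M1(ev j * n + k := j) else M1)"
    let ?s1 = "s'\<lparr>mem := (mem s')(17 := M1)\<rparr>"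
    have "inv M2 j (Suc k)"
      unfolding inv_def
    proof (intro allI impI)
      fix u z i assume a: "u < n" "z < n" "i < m" "(i < j \<or> i = j \<and> z < Suc k) \<and> towards i u z"
      have g: "good M u z \<or> i = j \<and> z = k" using a I by (auto simp: inv_def M_def less_Suc_eq)
      have keep: "good M u z \<Longrightarrow> good M1 u z" "good M1 u z \<Longrightarrow> good M2 u z"
        unfolding M1_def M2_def using upd j en a towards_iff[OF j(1)] by (auto simp: if_splits)
      show "good M2 u z"
      proof (cases "good M u z")
        case False
        with g a have t: "towards j u k" "z = k" by auto
        then consider "u = eu j" "el j + d0 (ev j) k = d0 (eu j) k" | "u = ev j" "el j + d0 (eu j) k = d0 (ev j) k"
          using towards_iff[OF j(1)] by blast
        then show ?thesis
        proof cases
          case 1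
          then have "good M1 u z" unfolding M1_def using t upd[of M u z u z j] j a by auto
          then show ?thesis by (rule keep)
        next
          case 2
          then show ?thesis unfolding M2_def using t upd[of M1 u z u z j] j a by auto
        qed
      qed (use keep in blast)
    qed
    moreover have "run B (top_half 12 13) s' 30 (\<lambda>s1. s1 = ?s1)"
      by (rule run_mono[OF run_top_half[OF b D r(1,4,5,2,3) j en(1,2)]]) (simp_all add: M1_def M_def)
    moreover have "run B (top_half 13 12) ?s1 30 (\<lambda>s''. mem s'' 17 = M2)"
    proof -
      have "agree B {} {17} s' ?s1" using exec_agree \<open>run B (top_half 12 13) s' 30 (\<lambda>s1. s1 = ?s1)\<close>
        unfolding run_def by (metis frame_sets(1,2))
      then have "base ?s1" by (rule base_agree[OF b]) auto
      moreover have "dist_ok ?s1" using D by (simp add: dist_ok_def)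
      ultimately show ?thesis
        using r j en by (intro run_mono[OF run_top_half[of ?s1 j k 13 "ev j" 12 "eu j"]]) (auto simp: M2_def)
    qed
    ultimately have "run B ?c s' (30 + 30) (\<lambda>s''. inv (mem s'' 17) j (Suc k))"
      by (intro run_Seq[where P = "\<lambda>s1. s1 = ?s1"]) (auto elim: run_mono)
    then show ?thesis by simp
  qed
  let ?d = "load_edge ;; For 15 20 ?c"
  have "run B tops s (m * ((9 + (n * (60 + 8) + 8)) + 8) + 8) (\<lambda>s'. inv (mem s' 17) m 0)"
    unfolding tops_def
  proof (rule run_For[where I = "\<lambda>j s'. inv (mem s' 17) j 0"])
    fix j and s' :: state assume j: "j < m" "inv (mem s' 17) j 0" "regs s' 11 = j"
      and ag: "agree B (insert 11 (wr ?d)) (wa ?d) s s'"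
    have b': "base s'" by (rule base_agree[OF b ag]) auto
    have D': "dist_ok s'" using D agree_mem[OF ag, of 4] by (simp add: dist_ok_def)
    show "run B ?d s' (9 + (n * (60 + 8) + 8)) (\<lambda>s''. inv (mem (s''\<lparr>regs := (regs s'')(11 := Suc j)\<rparr>) 17) (Suc j) 0)"
    proof (rule run_Seq[OF run_load_edge[OF b' j(3,1)]])
      fix s1 assume s1: "s1 = s'\<lparr>regs := (regs s')(12 := eu j, 13 := ev j, 14 := el j)\<rparr>"
        and ag1: "agree B (wr load_edge) (wa load_edge) s' s1"
      have b1: "base s1" by (rule base_agree[OF b' ag1]) auto
      show "run B (For 15 20 ?c) s1 (n * (60 + 8) + 8) (\<lambda>s''. inv (mem (s''\<lparr>regs := (regs s'')(11 := Suc j)\<rparr>) 17) (Suc j) 0)"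
      proof (rule run_For[where I = "\<lambda>k s''. inv (mem s'' 17) j k"])
        fix k and s2 :: state assume k: "k < n" "inv (mem s2 17) j k" "regs s2 15 = k"
          and ag2: "agree B (insert 15 (wr ?c)) (wa ?c) s1 s2"
        have "base s2" by (rule base_agree[OF b1 ag2]) auto
        moreover have "dist_ok s2" using D' s1 agree_mem[OF ag2, of 4] by (simp add: dist_ok_def)
        ultimately show "run B ?c s2 60 (\<lambda>s''. inv (mem (s''\<lparr>regs := (regs s'')(15 := Suc k)\<rparr>) 17) j (Suc k))"
          using inner[of s2 j k] k j s1 agree_reg[OF ag2] by simp
      next
        fix s2 assume "inv (mem s2 17) j n"
        then show "inv (mem (s2\<lparr>regs := (regs s2)(11 := Suc j)\<rparr>) 17) (Suc j) 0"
          by (auto simp: inv_def less_Suc_eq)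
      qed (use base_regs[OF b1] n_less_B j s1 in auto)
    qed
  qed (use base_regs[OF b] m_less_B in \<open>auto simp: inv_def\<close>)
  then show ?thesis
  proof (rule run_mono)
    fix s' assume I: "inv (mem s' 17) m 0"
    show "tops_ok (\<lambda>u z. mem s' 17 (u * n + z))"
      unfolding tops_ok_def
    proof (intro allI impI)
      fix u z assume uz: "u < n" "z < n" "u \<noteq> z"
      obtain y where y: "{u, y} \<in> E" "d0 u z = len0 {u, y} + d0 y z" using ndist_step[OF uz] by metis
      obtain i where "i < m" "{u, y} = ed i" using edE[OF y(1)] .
      then have "i < m" "towards i u z" unfolding towards_def using y by (blast, metis)
      then show "mem s' 17 (u * n + z) < m \<and> towards (mem s' 17 (u * n + z)) u z"
        using I uz unfolding inv_def good_def by blast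
    qed
  qed (simp add: algebra_simps)
qed

text \<open>The indices of the edges at \<open>u\<close> for which the edge \<open>{x, y}\<close> with index \<open>i\<close> yields an alternative
  settling path by \<open>alternative_path_iff\<close>. If \<open>u\<close> is an end node of the edge \<open>j\<close>, the other one is
  \<open>eu j + ev j - u\<close>.\<close>

definition shown :: "(nat \<Rightarrow> nat \<Rightarrow> nat) \<Rightarrow> nat \<Rightarrow> nat \<Rightarrow> nat \<Rightarrow> nat \<Rightarrow> nat set" where
  "shown tp i u x y = (if y = u \<or> tp u y = i then {} else
     (if x = u then {i} else {}) \<union>
     (let j = tp u y; v = eu j + ev j - u in
      if (x = u \<or> tp u x \<noteq> j) \<and> sd * (d0 u x + el i + d0 y v) \<le> sn * d0 u v then {j} else {}))"

text \<open>The program stores edge indices where \<open>alternative_path_iff\<close> speaks of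
  second nodes; \<open>f\<close> translates between them. Each witness of that characterisation is
  met when its edge and its source are processed.\<close>

lemma not_mandatory_iff:
  assumes tp: "tops_ok tp" and i: "i < m"
  shows "ed i \<notin> mandatory_edges I \<longleftrightarrow>
    (\<exists>k<m. \<exists>u<n. i \<in> shown tp k u (eu k) (ev k) \<union> shown tp k u (ev k) (eu k))"
proof -
  define f where "f u y = eu (tp u y) + ev (tp u y) - u" for u y
  have f: "{u, f u y} = ed (tp u y)" "tp u y < m" "{u, f u y} \<in> E" "len0 {u, f u y} + d0 (f u y) y = d0 u y"
    if uy: "u < n" "y < n" "u \<noteq> y" for u y
  proof -
    have t: "tp u y < m" "towards (tp u y) u y" using tp uy by (auto simp: tops_ok_def)
    then obtain v where v: "ed (tp u y) = {u, v}" "len0 {u, v} + d0 v y = d0 u y"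
      by (auto simp: towards_def)
    then have "f u y = v" by (auto simp: f_def doubleton_eq_iff)
    with v t ed_mem[OF t(1)] show "{u, f u y} = ed (tp u y)" "tp u y < m" "{u, f u y} \<in> E"
      "len0 {u, f u y} + d0 (f u y) y = d0 u y" by auto
  qed
  have f_tp: "tp u y = k \<longleftrightarrow> f u y = v" if "u < n" "y < n" "u \<noteq> y" "k < m" "ed k = {u, v}" for u y k v
    using f(1,2)[OF that(1-3)] ed_eq_iff[OF f(2)[OF that(1-3)] that(4)] that(5)
    by (auto simp: doubleton_eq_iff)
  have alt: "{u, v} \<notin> mandatory_edges I \<longleftrightarrow> f u v \<noteq> v \<or>
    (\<exists>x y. {x, y} \<in> E \<and> {x, y} \<noteq> {u, v} \<and> (x = u \<or> f u x \<noteq> v) \<and> y \<noteq> u \<and> f u y = v \<and>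
       sd * (d0 u x + len0 {x, y} + d0 y v) \<le> sn * d0 u v)" if uv: "{u, v} \<in> E" for u v
  proof -
    \<comment> \<open>The test on multiples of \<open>sd\<close> becomes a bound on the length
      itself, the form that \<open>alternative_path_iff\<close> expects.\<close>
    have div: "x \<le> sn * d0 u v div sd \<longleftrightarrow> sd * x \<le> sn * d0 u v" for x
      using stretch_fraction(1) by (simp add: less_eq_div_iff_mult_less_eq mult.commute)
    have "sd * d0 u v \<le> sn * d0 u v" using stretch_fraction(2) by (rule mult_right_mono) simp
    then have "d0 u v \<le> sn * d0 u v div sd" by (simp add: div)
    from alternative_path_iff[where tp = "f u", OF len_pos uv _ this]
    have "(\<exists>p. simple_path E u v p \<and> {u, v} \<notin> set (path_edges p) \<and> sd * path_length len0 p \<le> sn * d0 u v) \<longleftrightarrow>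
      f u v \<noteq> v \<or> (\<exists>x y. {x, y} \<in> E \<and> {x, y} \<noteq> {u, v} \<and> (x = u \<or> f u x \<noteq> v) \<and> y \<noteq> u \<and> f u y = v \<and>
       sd * (d0 u x + len0 {x, y} + d0 y v) \<le> sn * d0 u v)"
      unfolding div using f(3,4)[of u] edge_nodes[OF uv] by blast
    then show ?thesis using mandatory_iff[OF uv] by blast
  qed
  have sound: "ed i \<notin> mandatory_edges I"
    if sh: "i \<in> shown tp k u x y" and k: "k < m" "u < n" "ed k = {x, y}" "x < n" "y < n" for k u x y
  proof -
    have yu: "u \<noteq> y" "tp u y \<noteq> k" using sh by (auto simp: shown_def split: if_splits)
    note fy = f[OF k(2,5) yu(1)]
    consider "x = u" "i = k" | "i = tp u y" "x = u \<or> tp u x \<noteq> tp u y"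
      "sd * (d0 u x + el k + d0 y (f u y)) \<le> sn * d0 u (f u y)"
      using sh by (auto simp: shown_def Let_def f_def split: if_splits)
    then show ?thesis
    proof cases
      case 1
      then have "f u y \<noteq> y" using f_tp[OF k(2,5) yu(1) k(1)] yu k by blast
      then show ?thesis using alt[of u y] 1 k ed_mem[OF k(1)] by simp
    next
      case 2
      have "{x, y} \<noteq> {u, f u y}" using fy(1,2) yu(2) k ed_eq_iff by metis
      moreover have "x = u \<or> f u x \<noteq> f u y"
        using 2(2) f_tp[OF k(2,4) _ fy(2) fy(1)[symmetric]] by blast
      moreover have "{x, y} \<in> E" using ed_mem k by metis
      moreover have "el k = len0 {x, y}" using k by (simp add: el_def)
      ultimately have "{u, f u y} \<notin> mandatory_edges I" using alt[OF fy(3)] 2(3) yu by auto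
      then show ?thesis using 2(1) fy(1) by simp
    qed
  qed
  show ?thesis
  proof
    assume "ed i \<notin> mandatory_edges I"
    then consider "f (eu i) (ev i) \<noteq> ev i" | x y where "{x, y} \<in> E" "{x, y} \<noteq> ed i" "x = eu i \<or> f (eu i) x \<noteq> ev i"
      "y \<noteq> eu i" "f (eu i) y = ev i" "sd * (d0 (eu i) x + len0 {x, y} + d0 y (ev i)) \<le> sn * d0 (eu i) (ev i)"
      using alt[OF ed_mem[OF i]] by blast
    then show "\<exists>k<m. \<exists>u<n. i \<in> shown tp k u (eu k) (ev k) \<union> shown tp k u (ev k) (eu k)"
    proof cases
      case 1
      then have "tp (eu i) (ev i) \<noteq> i" using f_tp[of "eu i" "ev i" i "ev i"] ed_nodes[OF i] i by blast
      then have "i \<in> shown tp i (eu i) (eu i) (ev i)" using ed_nodes[OF i] by (auto simp: shown_def)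
      then show ?thesis using i ed_nodes[OF i] by blast
    next
      case (2 x y)
      obtain k where k: "k < m" "{x, y} = ed k" using edE[OF 2(1)] .
      have xy: "x < n" "y < n" using edge_nodes[OF 2(1)] by auto
      have ty: "tp (eu i) y = i" using f_tp[of "eu i" y i "ev i"] ed_nodes[OF i] i 2 xy by auto
      have "x = eu i \<or> tp (eu i) x \<noteq> i" using f_tp[of "eu i" x i "ev i"] ed_nodes[OF i] i 2 xy by auto
      moreover have "k \<noteq> i" using 2 k by blast
      moreover have "el k = len0 {x, y}" using k by (simp add: el_def)
      moreover have "eu i + ev i - eu i = ev i" by simp
      ultimately have "i \<in> shown tp k (eu i) x y" unfolding shown_def Let_def ty using 2 by auto
      moreover have "x = eu k \<and> y = ev k \<or> x = ev k \<and> y = eu k" using k by (auto simp: doubleton_eq_iff)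
      ultimately show ?thesis using k(1) ed_nodes[OF i] by blast
    qed
  next
    assume "\<exists>k<m. \<exists>u<n. i \<in> shown tp k u (eu k) (ev k) \<union> shown tp k u (ev k) (eu k)"
    then obtain k u where k: "k < m" "u < n" "i \<in> shown tp k u (eu k) (ev k) \<union> shown tp k u (ev k) (eu k)" by blast
    show "ed i \<notin> mandatory_edges I"
      using k(3) sound[of k u "eu k" "ev k"] sound[of k u "ev k" "eu k"] k(1,2) ed_nodes[OF k(1)]
      by (auto simp: insert_commute)
  qed
qed

lemma run_mand_half:
  assumes b: "base s" and D: "dist_ok s" and tp: "tops_ok tp" "\<And>u z. tp u z = mem s 17 (u * n + z)"
    and r: "regs s 11 = i" "regs s 14 = el i" "regs s 15 = u" "regs s x = x'" "regs s y = y'"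
    and xy: "x \<in> {12, 13}" "y \<in> {12, 13}"
    and i: "i < m" "u < n" "x' < n" "y' < n"
  shows "run B (mand_half x y) s 100
    (\<lambda>s'. mem s' 10 = (\<lambda>c. if c \<in> shown tp i u x' y' then 1 else mem s 10 c))"
proof (cases "y' = u")
  case True
  then show ?thesis using r base_regs(9)[OF b] le_B by (auto simp: mand_half_def wp_simps shown_def)
next
  case False
  note bs = base_regs[OF b]
  define j where "j = tp u y'"
  define v where "v = eu j + ev j - u"
  have j: "j < m" "towards j u y'" using tp(1) False i by (auto simp: tops_ok_def j_def)
  have v: "v < n" using towards_iff[OF j(1), of u y'] j ed_nodes[OF j(1)] by (auto simp: v_def)
  have D: "mem s 4 (u * n + x') = d0 u x'" "mem s 4 (y' * n + v) = d0 y' v" "mem s 4 (u * n + v) = d0 u v"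
    using D i v by (auto simp: dist_ok_def)
  have "d0 u x' \<le> n * heavy" "d0 y' v \<le> n * heavy" and duv: "d0 u v \<le> n * heavy" using d0_bound i v by auto
  then have bounds: "d0 u x' \<le> B" "d0 y' v \<le> B" "d0 u v \<le> B" "d0 u x' + el i \<le> B" "d0 u x' + el i + d0 y' v \<le> B"
    "sd * (d0 u x' + el i + d0 y' v) \<le> B" "sn * d0 u v \<le> B"
    using el_bounds(2)[OF i(1)] heavy_le duv
    by - (rule unscaled_le_B, linarith | rule scaled_le_B, linarith | rule bound_le_B, linarith)+
  have t: "mem s 17 (u * n + y') = j" "mem s 17 (u * n + x') = tp u x'" by (simp_all add: j_def tp(2))
  have "sn \<le> B" "sd \<le> B" "tp u x' \<le> B" using bs(9)[of 2] bs(9)[of 3] bs(10)[of 17 "u * n + x'"] bs(3,4) t by auto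
  moreover have "eu j + ev j \<le> B" "eu j \<le> B" "ev j \<le> B" "v \<le> B" "j \<le> B"
    using ed_nodes[OF j(1)] v j(1) by (auto simp: le_B)
  moreover have "u * n + y' \<le> B" "u * n + x' \<le> B" "u * n + v \<le> B" "y' * n + v \<le> B" "u * n \<le> B" "y' * n \<le> B"
    "u \<le> B" "x' \<le> B" "y' \<le> B" "i \<le> B" "el i \<le> B" "n \<le> B" "1 \<le> B" using i v by (auto simp: le_B)
  moreover have "mem s 20 j = eu j" "mem s 21 j = ev j" using bs(11,12) j by auto
  ultimately have *: "sn \<le> B" "sd \<le> B" "tp u x' \<le> B" "eu j + ev j \<le> B" "eu j \<le> B" "ev j \<le> B" "v \<le> B" "j \<le> B"
    "u * n + y' \<le> B" "u * n + x' \<le> B" "u * n + v \<le> B" "y' * n + v \<le> B" "u * n \<le> B" "y' * n \<le> B"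
    "u \<le> B" "x' \<le> B" "y' \<le> B" "i \<le> B" "el i \<le> B" "n \<le> B" "1 \<le> B"
    "mem s 20 j = eu j" "mem s 21 j = ev j" by simp_all
  note xr = xy[unfolded insert_iff empty_iff]
  have xne: "x \<noteq> 16" "x \<noteq> 18" "x \<noteq> 19" "y \<noteq> 16" "y \<noteq> 18" "y \<noteq> 19" using xy by auto
  have "Suc 0 \<le> B" using le_B by simp
  note facts = r bs(1,3,4) D bounds t * False xne v_def[symmetric] this
  show ?thesis
  proof (cases "x' = u")
    case True
    note facts' = facts[unfolded True] facts[unfolded True ndist_self add_0]
    show ?thesis
      unfolding mand_half_def shown_def Let_def j_def[symmetric] v_def[symmetric] True
      by (cases "j = i"; cases "tp u u = j"; cases "sn * d0 u v < sd * (el i + d0 y' v)")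
        (simp_all add: wp_simps fun_eq_iff facts')
  next
    case x: False
    show ?thesis
      unfolding mand_half_def shown_def Let_def j_def[symmetric] v_def[symmetric]
      by (cases "j = i"; cases "tp u x' = j"; cases "sn * d0 u v < sd * (d0 u x' + el i + d0 y' v)")
        (simp_all add: wp_simps fun_eq_iff facts x)
  qed
qed

definition nontrivial_ok :: "state \<Rightarrow> bool" where
  "nontrivial_ok s \<longleftrightarrow> (\<forall>i<m. mem s 10 i = (if ed i \<in> N then 1 else 0))"

lemma run_clear_flags:
  assumes "base s"
  shows "run B clear_flags s (12 * m + 8) (\<lambda>s'. \<forall>i<m. mem s' 10 i = 0)"
proof -
  have "run B clear_flags s (m * (4 + 8) + 8) (\<lambda>s'. \<forall>i<m. mem s' 10 i = 0)"
    unfolding clear_flags_def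
  proof (rule run_For[where I = "\<lambda>j s'. \<forall>i<j. mem s' 10 i = 0"])
    fix j and s' :: state assume "j < m" "\<forall>i<j. mem s' 10 i = 0" "regs s' 11 = j"
    then show "run B (Store 10 (Reg 11) (Const 0)) s' 4
      (\<lambda>s''. \<forall>i<Suc j. mem (s''\<lparr>regs := (regs s'')(11 := Suc j)\<rparr>) 10 i = 0)"
      by (auto simp: wp_simps less_Suc_eq le_B)
  qed (use base_regs[OF assms] m_less_B in auto)
  then show ?thesis by (rule run_mono) auto
qed

text \<open>Flags are only ever set, so after each round the flagged edges are the union of the sets
  \<open>shown\<close> over the edges and sources processed.\<close>

lemma run_alternatives:
  assumes b: "base s" and D: "dist_ok s" and tp: "tops_ok tp" "\<And>u z. tp u z = mem s 17 (u * n + z)"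
    and Z: "\<forall>i<m. mem s 10 i = 0"
  shows "run B alternatives s (220 * (n * m) + 30 * m + 8)
    (\<lambda>s'. \<forall>i<m. mem s' 10 i = (if ed i \<in> mandatory_edges I then 0 else 1))"
proof -
  define sh where "sh i u = shown tp i u (eu i) (ev i) \<union> shown tp i u (ev i) (eu i)" for i u
  define S where "S j k = {c. \<exists>i<m. \<exists>u<n. (i < j \<or> i = j \<and> u < k) \<and> c \<in> sh i u}" for j k
  define Q where "Q j k s' \<longleftrightarrow> mem s' 10 = (\<lambda>c. if c \<in> S j k then 1 else mem s 10 c)" for j k and s' :: state
  let ?c = "mand_half 12 13 ;; mand_half 13 12"
  let ?d = "load_edge ;; For 15 20 ?c"
  have S_Suc: "S j (Suc k) = S j k \<union> sh j k" if "j < m" "k < n" for j k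
    using that by (auto simp: S_def less_Suc_eq)
  have inner: "run B ?c s' 200 (Q j (Suc k))"
    if b: "base s'" and D: "dist_ok s'" and tp2: "mem s' 17 = mem s 17" and I: "Q j k s'"
      and r: "regs s' 11 = j" "regs s' 12 = eu j" "regs s' 13 = ev j" "regs s' 14 = el j" "regs s' 15 = k"
      and j: "j < m" "k < n" for j k s'
  proof -
    note en = ed_nodes[OF j(1)]
    have tp': "\<And>u z. tp u z = mem s' 17 (u * n + z)" using tp(2) tp2 by simp
    have 1: "run B (mand_half 12 13) s' 100
      (\<lambda>s1. mem s1 10 = (\<lambda>c. if c \<in> shown tp j k (eu j) (ev j) then 1 else mem s' 10 c))"
      by (rule run_mand_half[OF b D tp(1) tp' r(1,4,5,2,3) _ _ j en(1,2)]) auto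
    have "run B ?c s' (100 + 100) (Q j (Suc k))"
    proof (rule run_Seq[OF 1])
      fix s1 assume s1: "mem s1 10 = (\<lambda>c. if c \<in> shown tp j k (eu j) (ev j) then 1 else mem s' 10 c)"
        and ag: "agree B (wr (mand_half 12 13)) (wa (mand_half 12 13)) s' s1"
      have b1: "base s1" by (rule base_agree[OF b ag]) auto
      have "dist_ok s1" using D agree_mem[OF ag, of 4] by (simp add: dist_ok_def)
      moreover have "\<And>u z. tp u z = mem s1 17 (u * n + z)" using tp' agree_mem[OF ag, of 17] by simp
      moreover have "regs s1 11 = j" "regs s1 14 = el j" "regs s1 15 = k" "regs s1 13 = ev j" "regs s1 12 = eu j"
        using r agree_reg[OF ag] by auto
      ultimately have "run B (mand_half 13 12) s1 100
        (\<lambda>s2. mem s2 10 = (\<lambda>c. if c \<in> shown tp j k (ev j) (eu j) then 1 else mem s1 10 c))"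
        using run_mand_half[OF b1 _ tp(1)] j en by blast
      then show "run B (mand_half 13 12) s1 100 (Q j (Suc k))"
        by (rule run_mono) (use s1 I S_Suc[OF j] in \<open>auto simp: Q_def sh_def\<close>)
    qed
    then show ?thesis by simp
  qed
  have "run B alternatives s (m * ((9 + (n * (200 + 8) + 8)) + 8) + 8) (Q m 0)"
    unfolding alternatives_def
  proof (rule run_For[where I = "\<lambda>j. Q j 0"])
    fix j and s' :: state assume j: "j < m" "Q j 0 s'" "regs s' 11 = j"
      and ag: "agree B (insert 11 (wr ?d)) (wa ?d) s s'"
    have b': "base s'" by (rule base_agree[OF b ag]) auto
    have D': "dist_ok s'" using D agree_mem[OF ag, of 4] by (simp add: dist_ok_def)
    have t': "mem s' 17 = mem s 17" using agree_mem[OF ag] by simp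
    show "run B ?d s' (9 + (n * (200 + 8) + 8)) (\<lambda>s''. Q (Suc j) 0 (s''\<lparr>regs := (regs s'')(11 := Suc j)\<rparr>))"
    proof (rule run_Seq[OF run_load_edge[OF b' j(3,1)]])
      fix s1 assume s1: "s1 = s'\<lparr>regs := (regs s')(12 := eu j, 13 := ev j, 14 := el j)\<rparr>"
        and ag1: "agree B (wr load_edge) (wa load_edge) s' s1"
      have b1: "base s1" by (rule base_agree[OF b' ag1]) auto
      show "run B (For 15 20 ?c) s1 (n * (200 + 8) + 8) (\<lambda>s''. Q (Suc j) 0 (s''\<lparr>regs := (regs s'')(11 := Suc j)\<rparr>))"
      proof (rule run_For[where I = "Q j"])
        fix k and s2 :: state assume k: "k < n" "Q j k s2" "regs s2 15 = k"
          and ag2: "agree B (insert 15 (wr ?c)) (wa ?c) s1 s2"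
        have "base s2" by (rule base_agree[OF b1 ag2]) auto
        moreover have "dist_ok s2" using D' s1 agree_mem[OF ag2, of 4] by (simp add: dist_ok_def)
        moreover have "mem s2 17 = mem s 17" using t' s1 agree_mem[OF ag2, of 17] by simp
        ultimately have "run B ?c s2 200 (Q j (Suc k))"
          using inner[of s2 j k] k j s1 agree_reg[OF ag2] by simp
        then show "run B ?c s2 200 (\<lambda>s''. Q j (Suc k) (s''\<lparr>regs := (regs s'')(15 := Suc k)\<rparr>))"
          by (rule run_mono) (auto simp: Q_def)
      next
        fix s2 assume "Q j n s2"
        moreover have "S j n = S (Suc j) 0" by (auto simp: S_def less_Suc_eq)
        ultimately show "Q (Suc j) 0 (s2\<lparr>regs := (regs s2)(11 := Suc j)\<rparr>)" by (simp add: Q_def)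
      qed (use base_regs[OF b1] n_less_B j s1 in \<open>auto simp: Q_def\<close>)
    qed
  qed (use base_regs[OF b] m_less_B in \<open>auto simp: Q_def S_def\<close>)
  then show ?thesis
  proof (rule run_mono)
    fix s' assume "Q m 0 s'"
    moreover have "i \<in> S m 0 \<longleftrightarrow> ed i \<notin> mandatory_edges I" if "i < m" for i
      using not_mandatory_iff[OF tp(1) that] by (auto simp: S_def sh_def)
    ultimately show "\<forall>i<m. mem s' 10 i = (if ed i \<in> mandatory_edges I then 0 else 1)"
      using Z by (auto simp: Q_def)
  qed (simp add: algebra_simps)
qed

lemma run_drop_weightless:
  assumes b: "base s" and M: "\<forall>i<m. mem s 10 i = (if ed i \<in> mandatory_edges I then 0 else 1)"
  shows "run B drop_weightless s (18 * m + 8) nontrivial_ok"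
proof -
  let ?c = "If (Cell 3 (Reg 11)) Skip (Store 10 (Reg 11) (Const 0))"
  have N: "ed i \<in> N \<longleftrightarrow> ed i \<notin> mandatory_edges I \<and> ew i \<noteq> 0" if "i < m" for i
    using ed_mem[OF that] by (auto simp: nontrivial_edges_def trivial_edges_def ew_def)
  have "run B drop_weightless s (m * (10 + 8) + 8) nontrivial_ok"
    unfolding drop_weightless_def
  proof (rule run_For[where I = "\<lambda>j s'. \<forall>i<m. mem s' 10 i = (if ed i \<in> mandatory_edges I \<or> i < j \<and> ew i = 0 then 0 else 1)"])
    fix j and s' :: state assume j: "j < m"
      "\<forall>i<m. mem s' 10 i = (if ed i \<in> mandatory_edges I \<or> i < j \<and> ew i = 0 then 0 else 1)" "regs s' 11 = j"
      and ag: "agree B (insert 11 (wr ?c)) (wa ?c) s s'"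
    have b': "base s'" by (rule base_agree[OF b ag]) auto
    have "mem s' 3 j \<le> B" using base_regs(10)[OF b'] .
    then show "run B ?c s' 10 (\<lambda>s''. \<forall>i<m. mem (s''\<lparr>regs := (regs s'')(11 := Suc j)\<rparr>) 10 i =
        (if ed i \<in> mandatory_edges I \<or> i < Suc j \<and> ew i = 0 then 0 else 1))"
      using j base_regs(14)[OF b' j(1)] by (auto simp: wp_simps less_Suc_eq le_B)
  next
    fix s' :: state
    assume "\<forall>i<m. mem s' 10 i = (if ed i \<in> mandatory_edges I \<or> i < m \<and> ew i = 0 then 0 else 1)"
    then show "nontrivial_ok s'" using N by (auto simp: nontrivial_ok_def)
  qed (use base_regs[OF b] m_less_B M in auto)
  then show ?thesis by (rule run_mono) auto
qed

end

section \<open>The stack\<close>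

definition push :: program where
  "push = For 11 21 (Store 11 (Reg 8 \<otimes> Reg 21 \<oplus> Reg 11) (Cell 5 (Reg 11)) ;;
       Store 12 (Reg 8 \<otimes> Reg 21 \<oplus> Reg 11) (Cell 6 (Reg 11))) ;;
     For 11 20 (Store 13 (Reg 8 \<otimes> Reg 20 \<oplus> Reg 11) (Cell 7 (Reg 11))) ;;
     Store 14 (Reg 8) (Reg 9) ;; Store 15 (Reg 8) (Reg 10) ;; Assign 8 (Reg 8 \<oplus> Const 1)"

definition pop :: program where
  "pop = Assign 8 (Reg 8 \<ominus> Const 1) ;;
     For 11 21 (Store 5 (Reg 11) (Cell 11 (Reg 8 \<otimes> Reg 21 \<oplus> Reg 11)) ;;
       Store 6 (Reg 11) (Cell 12 (Reg 8 \<otimes> Reg 21 \<oplus> Reg 11))) ;;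
     For 11 20 (Store 7 (Reg 11) (Cell 13 (Reg 8 \<otimes> Reg 20 \<oplus> Reg 11))) ;;
     Assign 9 (Cell 14 (Reg 8)) ;; Assign 10 (Cell 15 (Reg 8))"

text \<open>Register 14 receives the index of an unsettled edge plus 1, so that 0 can signal that
  there is none.\<close>

definition scan :: program where
  "scan = Assign 12 (Const 0) ;; Assign 13 (Const 0) ;; Assign 14 (Const 0) ;;
     For 11 21 (
       If (Cell 5 (Reg 11)) (Assign 12 (Reg 12 \<oplus> Cell 10 (Reg 11)) ;; Assign 13 (Reg 13 \<oplus> Cell 3 (Reg 11))) Skip ;;
       If (Reg 2 \<otimes> Cell 4 (Cell 20 (Reg 11) \<otimes> Reg 20 \<oplus> Cell 21 (Reg 11)) \<prec>
           Reg 3 \<otimes> Cell 104 (Cell 20 (Reg 11) \<otimes> Reg 20 \<oplus> Cell 21 (Reg 11)))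
         (Assign 14 (Reg 11 \<oplus> Const 1)) Skip)"

definition start_path :: program where
  "start_path = copy_lengths ;; Store 7 (Const 0) (Cell 20 (Reg 14 \<ominus> Const 1)) ;;
     Assign 9 (Const 1) ;; Assign 10 (Cell 21 (Reg 14 \<ominus> Const 1))"

text \<open>Success is reported by emptying the stack, which also ends the main loop; a failure
  pushes nothing. The number of nontrivial edges is tested even when all pairs are settled, because
  a path adds several edges at once and may exceed the budget.\<close>

definition set_step :: program where
  "set_step = scan ;;
     If (Reg 14) (If (Reg 12 \<prec> Reg 5) (start_path ;; push) Skip)
       (If ((Reg 4 \<prec> Reg 13) \<oplus> (Reg 5 \<prec> Reg 12)) Skip (Assign 6 (Const 1) ;; Assign 8 (Const 0)))"

lemma frame_sets_stack [simp]:
  "wr push = {8, 11}" "wa push = {11, 12, 13, 14, 15}"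
  "wr pop = {8, 9, 10, 11}" "wa pop = {5, 6, 7}"
  "wr scan = {11, 12, 13, 14}" "wa scan = {}"
  "wr start_path = {9, 10, 11}" "wa start_path = {6, 7}"
  by (auto simp: push_def pop_def scan_def start_path_def)

context machine
begin

definition env :: "state \<Rightarrow> bool" where
  "env s \<longleftrightarrow> base s \<and> dist_ok s \<and> adj_ok s \<and> nontrivial_ok s"

lemma env_agree:
  assumes "env s" "agree B W X s s'"
    "20 \<notin> W \<and> 21 \<notin> W \<and> 22 \<notin> W \<and> 2 \<notin> W \<and> 3 \<notin> W \<and> 4 \<notin> W \<and> 5 \<notin> W \<and> 7 \<notin> W"
    "20 \<notin> X \<and> 21 \<notin> X \<and> 2 \<notin> X \<and> 3 \<notin> X \<and> 4 \<notin> X \<and> 9 \<notin> X \<and> 10 \<notin> X"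
  shows "env s'"
proof -
  have "base s'" using assms base_agree[of s W X s'] by (auto simp: env_def)
  moreover have "mem s' 4 = mem s 4" "mem s' 9 = mem s 9" "mem s' 10 = mem s 10"
    using agree_mem[OF assms(2)] assms(4) by auto
  ultimately show ?thesis using assms(1) by (simp add: env_def dist_ok_def adj_ok_def nontrivial_ok_def)
qed

lemma env_base: "env s \<Longrightarrow> base s"
  by (simp add: env_def)

text \<open>\<open>k \<le> n\<close> keeps a prefix within the \<open>n\<close> cells of its slot.
  For an empty prefix the target register may hold anything.\<close>

fun represents :: "item \<Rightarrow> (nat \<Rightarrow> nat) \<Rightarrow> (nat \<Rightarrow> nat) \<Rightarrow> (nat \<Rightarrow> nat) \<Rightarrow> nat \<Rightarrow> nat \<Rightarrow> bool" where
  "represents (F, l, \<pi>, t) f x p k t' \<longleftrightarrow> (\<forall>i<m. f i = (if ed i \<in> F then 1 else 0)) \<and>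
     (\<forall>i<m. x i = l (ed i)) \<and> k = length \<pi> \<and> k \<le> n \<and> (\<forall>i<k. p i = \<pi> ! i) \<and> (\<pi> \<noteq> [] \<longrightarrow> t' = t)"

definition current :: "state \<Rightarrow> item \<Rightarrow> bool" where
  "current s it \<longleftrightarrow> represents it (mem s 5) (mem s 6) (mem s 7) (regs s 9) (regs s 10)"

definition slot :: "state \<Rightarrow> nat \<Rightarrow> item \<Rightarrow> bool" where
  "slot s k it \<longleftrightarrow> represents it (\<lambda>i. mem s 11 (k * m + i)) (\<lambda>i. mem s 12 (k * m + i))
     (\<lambda>i. mem s 13 (k * n + i)) (mem s 14 k) (mem s 15 k)"

definition stack :: "state \<Rightarrow> item list \<Rightarrow> bool" where
  "stack s its \<longleftrightarrow> regs s 8 = length its \<and> (\<forall>k<length its. slot s k (its ! k))"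

lemma represents_cong:
  "represents it f x p k t' \<Longrightarrow> (\<And>i. i < m \<Longrightarrow> f' i = f i) \<Longrightarrow> (\<And>i. i < m \<Longrightarrow> x' i = x i) \<Longrightarrow>
    (\<And>i. i < n \<Longrightarrow> p' i = p i) \<Longrightarrow> represents it f' x' p' k t'"
  by (cases it) auto

text \<open>The position of an item on the stack is at most its level, hence at most
  \<open>(m + 1) * (m + 2)\<close>; counting from 0 adds 1.\<close>

abbreviation "max_height \<equiv> (m + 1) * (m + 2) + 1"

lemma slot_le_B:
  assumes "k \<le> max_height"
  shows "k \<le> B" "Suc k \<le> B" "k * m \<le> B" "k * n \<le> B" "i < m \<Longrightarrow> k * m + i \<le> B" "i < n \<Longrightarrow> k * n + i \<le> B"
proof -
  have "k + 2 \<le> (m + 1) * (m + 2) + 3" using assms by linarith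
  then have "(k + 2) * (n + m + 1) \<le> ((m + 1) * (m + 2) + 3) * (n + m + 1)" by (rule mult_le_mono1)
  then have 1: "(k + 2) * (n + m + 1) \<le> B" using B3 by (rule order_trans)
  have 2: "(k + 2) * (n + m + 1) = k * n + k * m + k + 2 * n + 2 * m + 2"
    by (simp add: add_mult_distrib add_mult_distrib2)
  show "k \<le> B" "Suc k \<le> B" "k * m \<le> B" "k * n \<le> B" "i < m \<Longrightarrow> k * m + i \<le> B" "i < n \<Longrightarrow> k * n + i \<le> B"
    using 1 unfolding 2 by simp_all
qed

lemma run_push:
  assumes b: "base s" and cur: "current s it" and st: "stack s its" and len: "length its \<le> max_height"
  shows "run B push s (30 * m + 20 * n + 40) (\<lambda>s'. stack s' (its @ [it]))"
proof -
  define k where "k = length its"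
  note k = slot_le_B[OF len, folded k_def]
  have r8: "regs s 8 = k" using st by (simp add: stack_def k_def)
  note bs = base_regs[OF b]
  let ?c1 = "Store 11 (Reg 8 \<otimes> Reg 21 \<oplus> Reg 11) (Cell 5 (Reg 11)) ;;
       Store 12 (Reg 8 \<otimes> Reg 21 \<oplus> Reg 11) (Cell 6 (Reg 11))"
  let ?c2 = "Store 13 (Reg 8 \<otimes> Reg 20 \<oplus> Reg 11) (Cell 7 (Reg 11))"
  let ?c3 = "Store 14 (Reg 8) (Reg 9) ;; Store 15 (Reg 8) (Reg 10) ;; Assign 8 (Reg 8 \<oplus> Const 1)"
  define I1 where "I1 j s' \<longleftrightarrow> (\<forall>i<j. mem s' 11 (k * m + i) = mem s 5 i \<and> mem s' 12 (k * m + i) = mem s 6 i) \<and>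
    (\<forall>c<k*m. mem s' 11 c = mem s 11 c \<and> mem s' 12 c = mem s 12 c)" for j and s' :: state
  define I2 where "I2 j s' \<longleftrightarrow> (\<forall>i<j. mem s' 13 (k * n + i) = mem s 7 i) \<and>
    (\<forall>c<k*n. mem s' 13 c = mem s 13 c)" for j and s' :: state
  have 1: "run B (For 11 21 ?c1) s (m * (18 + 8) + 8) (I1 m)"
  proof (rule run_For[where I = I1])
    fix j and s' :: state assume j: "j < m" "I1 j s'" "regs s' 11 = j" and ag: "agree B (insert 11 (wr ?c1)) (wa ?c1) s s'"
    note b' = base_regs[OF base_agree[OF b ag]]
    have 1: "regs s' 8 = k" "mem s' 5 = mem s 5" "mem s' 6 = mem s 6" using agree_reg[OF ag] agree_mem[OF ag] r8 by auto
    have "mem s 5 j \<le> B" "mem s 6 j \<le> B" using bs by auto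
    then show "run B ?c1 s' 18 (\<lambda>s''. I1 (Suc j) (s''\<lparr>regs := (regs s'')(11 := Suc j)\<rparr>))"
      using j b'(2) k 1 by (auto simp: wp_simps I1_def less_Suc_eq le_B)
  qed (use bs m_less_B in \<open>auto simp: I1_def\<close>)
  have 2: "run B (For 11 20 ?c2) s1 (n * (12 + 8) + 8) (I2 n)"
    if ag1: "agree B (wr (For 11 21 ?c1)) (wa (For 11 21 ?c1)) s s1" for s1
  proof (rule run_For[where I = I2])
    have b1: "base s1" by (rule base_agree[OF b ag1]) auto
    show "regs s1 20 = n" "n < B" using base_regs[OF b1] n_less_B by auto
    show "I2 0 (s1\<lparr>regs := (regs s1)(11 := 0)\<rparr>)" using agree_mem[OF ag1] by (auto simp: I2_def)
    fix j and s' :: state assume j: "j < n" "I2 j s'" "regs s' 11 = j" and ag: "agree B (insert 11 (wr ?c2)) (wa ?c2) s1 s'"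
    note b' = base_regs[OF base_agree[OF b1 ag]]
    have 1: "regs s' 8 = k" "mem s' 7 = mem s 7"
      using agree_reg[OF ag] agree_mem[OF ag] agree_reg[OF ag1] agree_mem[OF ag1] r8 by auto
    have "mem s 7 j \<le> B" using bs by auto
    then show "run B ?c2 s' 12 (\<lambda>s''. I2 (Suc j) (s''\<lparr>regs := (regs s'')(11 := Suc j)\<rparr>))"
      using j b'(1) k 1 by (auto simp: wp_simps I2_def less_Suc_eq le_B)
  qed (auto simp: I2_def)
  have "run B push s ((m * (18 + 8) + 8) + ((n * (12 + 8) + 8) + 20)) (\<lambda>s'. stack s' (its @ [it]))"
    unfolding push_def
  proof (rule run_Seq[OF 1], rule run_Seq[OF 2])
    fix s1 s2 assume I1: "I1 m s1" and ag1: "agree B (wr (For 11 21 ?c1)) (wa (For 11 21 ?c1)) s s1"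
      and I2: "I2 n s2" and ag2: "agree B (wr (For 11 20 ?c2)) (wa (For 11 20 ?c2)) s1 s2"
    have b2: "base s2" by (rule base_agree[OF base_agree[OF b ag1] ag2]) auto
    have r: "regs s2 8 = k" "regs s2 9 = regs s 9" "regs s2 10 = regs s 10" "mem s2 11 = mem s1 11"
      "mem s2 12 = mem s1 12" "mem s2 14 = mem s 14" "mem s2 15 = mem s 15"
      using agree_reg[OF ag1] agree_reg[OF ag2] agree_mem[OF ag1] agree_mem[OF ag2] r8 by auto
    let ?s3 = "s2\<lparr>mem := (mem s2)(14 := (mem s2 14)(k := regs s 9), 15 := (mem s2 15)(k := regs s 10)),
      regs := (regs s2)(8 := Suc k)\<rparr>"
    have "stack ?s3 (its @ [it])"
      unfolding stack_def
    proof (intro conjI allI impI)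
      fix k' assume k': "k' < length (its @ [it])"
      show "slot ?s3 k' ((its @ [it]) ! k')"
      proof (cases "k' = k")
        case True
        then show ?thesis using cur I1 I2 r unfolding slot_def current_def I1_def I2_def
          by (simp add: nth_append k_def) (erule represents_cong; simp)
      next
        case False
        then have k2: "k' < k" using k' by (simp add: k_def)
        \<comment> \<open>The slots below the new one end before it begins, so pushing does not
          overwrite them.\<close>
        have mono: "k' * c + i < k * c" if "i < c" for c i
        proof -
          have "k' * c + i < Suc k' * c" using that by simp
          also have "\<dots> \<le> k * c" using k2 by (intro mult_right_mono) auto
          finally show ?thesis .
        qed
        have "slot s k' (its ! k')" using st k2 by (simp add: stack_def k_def)
        then show ?thesis using mono I1 I2 r k2 unfolding slot_def I1_def I2_def
          by (simp add: nth_append k_def) (erule represents_cong; simp)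
      qed
    qed (simp add: k_def)
    then show "run B ?c3 s2 20 (\<lambda>s'. stack s' (its @ [it]))"
      using k r bs(9)[of 9] bs(9)[of 10] by (simp add: wp_simps le_B)
  qed
  then show ?thesis by (rule run_mono) auto
qed

lemma run_pop:
  assumes b: "base s" and st: "stack s (its @ [it])" and len: "length its \<le> max_height"
  shows "run B pop s (30 * m + 20 * n + 40) (\<lambda>s'. current s' it \<and> stack s' its)"
proof -
  define k where "k = length its"
  note k = slot_le_B[OF len, folded k_def]
  have r8: "regs s 8 = Suc k" using st by (simp add: stack_def k_def)
  let ?c1 = "Store 5 (Reg 11) (Cell 11 (Reg 8 \<otimes> Reg 21 \<oplus> Reg 11)) ;;
       Store 6 (Reg 11) (Cell 12 (Reg 8 \<otimes> Reg 21 \<oplus> Reg 11))"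
  let ?c2 = "Store 7 (Reg 11) (Cell 13 (Reg 8 \<otimes> Reg 20 \<oplus> Reg 11))"
  let ?s0 = "s\<lparr>regs := (regs s)(8 := k)\<rparr>"
  have 0: "run B (Assign 8 (Reg 8 \<ominus> Const 1)) s 4 (\<lambda>s'. s' = ?s0)"
    using r8 k by (simp add: wp_simps le_B)
  then have "agree B {8} {} s ?s0" unfolding run_def using exec_agree by (metis wa.simps(2) wr.simps(2))
  then have b0: "base ?s0" by (rule base_agree[OF b]) auto
  note bs = base_regs[OF b0]
  define I1 where "I1 j s' \<longleftrightarrow> (\<forall>i<j. mem s' 5 i = mem s 11 (k * m + i) \<and> mem s' 6 i = mem s 12 (k * m + i))"
    for j and s' :: state
  define I2 where "I2 j s' \<longleftrightarrow> (\<forall>i<j. mem s' 7 i = mem s 13 (k * n + i))" for j and s' :: state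
  have 1: "run B (For 11 21 ?c1) ?s0 (m * (18 + 8) + 8) (I1 m)"
  proof (rule run_For[where I = I1])
    fix j and s' :: state assume j: "j < m" "I1 j s'" "regs s' 11 = j" and ag: "agree B (insert 11 (wr ?c1)) (wa ?c1) ?s0 s'"
    note b' = base_regs[OF base_agree[OF b0 ag]]
    have 1: "regs s' 8 = k" "mem s' 11 = mem s 11" "mem s' 12 = mem s 12" using agree_reg[OF ag] agree_mem[OF ag] by auto
    have "mem s 11 (k * m + j) \<le> B" "mem s 12 (k * m + j) \<le> B" using base_regs[OF b] by auto
    then show "run B ?c1 s' 18 (\<lambda>s''. I1 (Suc j) (s''\<lparr>regs := (regs s'')(11 := Suc j)\<rparr>))"
      using j b'(2) k 1 by (auto simp: wp_simps I1_def less_Suc_eq le_B)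
  qed (use bs m_less_B in \<open>auto simp: I1_def\<close>)
  have 2: "run B (For 11 20 ?c2) s1 (n * (12 + 8) + 8) (I2 n)"
    if ag1: "agree B (wr (For 11 21 ?c1)) (wa (For 11 21 ?c1)) ?s0 s1" for s1
  proof (rule run_For[where I = I2])
    have b1: "base s1" by (rule base_agree[OF b0 ag1]) auto
    show "regs s1 20 = n" "n < B" using base_regs[OF b1] n_less_B by auto
    fix j and s' :: state assume j: "j < n" "I2 j s'" "regs s' 11 = j" and ag: "agree B (insert 11 (wr ?c2)) (wa ?c2) s1 s'"
    note b' = base_regs[OF base_agree[OF b1 ag]]
    have 1: "regs s' 8 = k" "mem s' 13 = mem s 13"
      using agree_reg[OF ag] agree_mem[OF ag] agree_reg[OF ag1] agree_mem[OF ag1] by auto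
    have "mem s 13 (k * n + j) \<le> B" using base_regs[OF b] by auto
    then show "run B ?c2 s' 12 (\<lambda>s''. I2 (Suc j) (s''\<lparr>regs := (regs s'')(11 := Suc j)\<rparr>))"
      using j b'(1) k 1 by (auto simp: wp_simps I2_def less_Suc_eq le_B)
  qed (auto simp: I2_def)
  have "run B pop s (4 + ((m * (18 + 8) + 8) + ((n * (12 + 8) + 8) + 20))) (\<lambda>s'. current s' it \<and> stack s' its)"
    unfolding pop_def
  proof (rule run_Seq[OF 0], hypsubst, rule run_Seq[OF 1], rule run_Seq[OF 2])
    fix s1 s2 assume I1: "I1 m s1" and ag1: "agree B (wr (For 11 21 ?c1)) (wa (For 11 21 ?c1)) ?s0 s1"
      and I2: "I2 n s2" and ag2: "agree B (wr (For 11 20 ?c2)) (wa (For 11 20 ?c2)) s1 s2"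
    have r: "regs s2 8 = k" "mem s2 5 = mem s1 5" "mem s2 6 = mem s1 6" "mem s2 11 = mem s 11"
      "mem s2 12 = mem s 12" "mem s2 13 = mem s 13" "mem s2 14 = mem s 14" "mem s2 15 = mem s 15"
      using agree_reg[OF ag1] agree_reg[OF ag2] agree_mem[OF ag1] agree_mem[OF ag2] by auto
    let ?s3 = "s2\<lparr>regs := (regs s2)(9 := mem s 14 k, 10 := mem s 15 k)\<rparr>"
    have "slot s k it" using st by (auto simp: stack_def k_def nth_append)
    then have "current ?s3 it" using I1 I2 r unfolding slot_def current_def I1_def I2_def
      by simp (erule represents_cong; simp)
    moreover have "slot s k' (its ! k')" if "k' < k" for k'
      using st that by (auto simp: stack_def k_def nth_append dest!: spec[of _ k'])
    then have "stack ?s3 its" using r by (auto simp: stack_def k_def[symmetric] slot_def)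
    ultimately show "run B (Assign 9 (Cell 14 (Reg 8)) ;; Assign 10 (Cell 15 (Reg 8))) s2 20
        (\<lambda>s'. current s' it \<and> stack s' its)"
      using k r base_regs(10)[OF b, of 14 k] base_regs(10)[OF b, of 15 k] by (simp add: wp_simps le_B)
  qed
  then show ?thesis by (rule run_mono) auto
qed

section \<open>Testing all pairs with one distance matrix\<close>

definition table :: "state \<Rightarrow> (nat set \<Rightarrow> nat) \<Rightarrow> bool" where
  "table s l \<longleftrightarrow> (\<forall>u<n. \<forall>v<n. mem s 104 (u * n + v) = ndist l E u v)"

definition length_ok :: "(nat set \<Rightarrow> nat) \<Rightarrow> bool" where
  "length_ok l \<longleftrightarrow> (\<forall>e\<in>E. 1 \<le> l e \<and> l e \<le> heavy)"

lemma dist_bound: "length_ok l \<Longrightarrow> u < n \<Longrightarrow> v < n \<Longrightarrow> ndist l E u v \<le> n * heavy"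
  by (rule ndist_bound) (auto simp: length_ok_def)

lemma sum_edges: "(\<Sum>i<m. f (ed i)) = sum f E"
  using sum.reindex_bij_betw[OF ed] by simp

lemma run_scan:
  assumes e: "env s" and l: "length_ok l" and tab: "table s l"
    and F: "\<forall>i<m. mem s 5 i = (if ed i \<in> F then 1 else 0)" "F \<subseteq> E"
  shows "run B scan s (60 * m + 20) (\<lambda>s'. regs s' 12 = card (F \<inter> N) \<and> regs s' 13 = sum (weight I) F \<and>
    (regs s' 14 = 0 \<and> (\<forall>i<m. sd * ndist l E (eu i) (ev i) \<le> sn * d0 (eu i) (ev i)) \<or>
     (\<exists>i<m. regs s' 14 = Suc i \<and> \<not> sd * ndist l E (eu i) (ev i) \<le> sn * d0 (eu i) (ev i))))"
proof -
  have b: "base s" using e by (simp add: env_def)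
  note bs = base_regs[OF b]
  define c where "c e = (if e \<in> F \<inter> N then 1 else 0 :: nat)" for e
  define w where "w e = (if e \<in> F then weight I e else 0)" for e
  define ok where "ok i \<longleftrightarrow> sd * ndist l E (eu i) (ev i) \<le> sn * d0 (eu i) (ev i)" for i
  have "E \<inter> (F \<inter> N) = F \<inter> N" "E \<inter> F = F" using F(2) by auto
  with sum.inter_restrict[OF finite_E, of "\<lambda>_. 1::nat" "F \<inter> N"] sum.inter_restrict[OF finite_E, of "weight I" F]
  have "sum c E = card (F \<inter> N)" and wE: "sum w E = sum (weight I) F"
    by (simp_all add: c_def w_def)
  then have c: "(\<Sum>i<m. c (ed i)) = card (F \<inter> N)" by (simp add: sum_edges)
  from wE have w: "(\<Sum>i<m. w (ed i)) = sum (weight I) F" by (simp add: sum_edges)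
  \<comment> \<open>Intermediate sums have to fit into words as well. They are bounded by the sums
    over all edges.\<close>
  have cB: "(\<Sum>i<j. c (ed i)) \<le> B" if "j \<le> m" for j
  proof -
    have "(\<Sum>i<j. c (ed i)) \<le> (\<Sum>i<j. 1)" by (intro sum_mono) (simp add: c_def)
    then show ?thesis using that size_le_B by simp
  qed
  have wB: "(\<Sum>i<j. w (ed i)) \<le> B" if "j \<le> m" for j
  proof -
    have "(\<Sum>i<j. w (ed i)) \<le> (\<Sum>i<m. w (ed i))" using that by (intro sum_mono2) auto
    also have "\<dots> \<le> (\<Sum>i<m. weight I (ed i))" by (intro sum_mono) (simp add: w_def)
    finally show ?thesis using B5 by (simp add: sum_edges)
  qed
  let ?c = "If (Cell 5 (Reg 11)) (Assign 12 (Reg 12 \<oplus> Cell 10 (Reg 11)) ;; Assign 13 (Reg 13 \<oplus> Cell 3 (Reg 11))) Skip ;;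
       If (Reg 2 \<otimes> Cell 4 (Cell 20 (Reg 11) \<otimes> Reg 20 \<oplus> Cell 21 (Reg 11)) \<prec>
           Reg 3 \<otimes> Cell 104 (Cell 20 (Reg 11) \<otimes> Reg 20 \<oplus> Cell 21 (Reg 11)))
         (Assign 14 (Reg 11 \<oplus> Const 1)) Skip"
  define Q where "Q j s' \<longleftrightarrow> regs s' 12 = (\<Sum>i<j. c (ed i)) \<and> regs s' 13 = (\<Sum>i<j. w (ed i)) \<and>
    (regs s' 14 = 0 \<and> (\<forall>i<j. ok i) \<or> (\<exists>i<m. regs s' 14 = Suc i \<and> \<not> ok i))" for j and s' :: state
  let ?s0 = "s\<lparr>regs := (regs s)(12 := 0, 13 := 0, 14 := 0)\<rparr>"
  have "agree B {12, 13, 14} {} s ?s0" using b by (auto simp: agree_def base_def all_words_def)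
  then have e0: "env ?s0" by (rule env_agree[OF e]) auto
  have "run B (For 11 21 ?c) ?s0 (m * (50 + 8) + 8) (Q m)"
  proof (rule run_For[where I = Q])
    fix j and s' :: state assume j: "j < m" "Q j s'" "regs s' 11 = j" and ag: "agree B (insert 11 (wr ?c)) (wa ?c) ?s0 s'"
    have e': "env s'" by (rule env_agree[OF e0 ag]) auto
    note b' = base_regs[OF env_base[OF e']]
    have n: "eu j < n" "ev j < n" using ed_nodes[OF j(1)] by auto
    have v: "mem s' 4 (eu j * n + ev j) = d0 (eu j) (ev j)" "mem s' 104 (eu j * n + ev j) = ndist l E (eu j) (ev j)"
      "mem s' 10 j = (if ed j \<in> N then 1 else 0)" "mem s' 5 j = (if ed j \<in> F then 1 else 0)"
      using e' n tab F(1) j agree_mem[OF ag] by (auto simp: env_def dist_ok_def nontrivial_ok_def table_def)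
    have d: "d0 (eu j) (ev j) \<le> n * heavy" "ndist l E (eu j) (ev j) \<le> n * heavy"
      using d0_bound dist_bound[OF l] n by auto
    have "d0 (eu j) (ev j) \<le> 5 * (n * heavy)" "ndist l E (eu j) (ev j) \<le> 5 * (n * heavy)" using d by linarith+
    then have d': "d0 (eu j) (ev j) \<le> B" "ndist l E (eu j) (ev j) \<le> B" "sd * ndist l E (eu j) (ev j) \<le> B"
      by (auto intro: unscaled_le_B scaled_le_B)
    have d'': "sn * d0 (eu j) (ev j) \<le> B" "sn \<le> B" "sd \<le> B" "Suc 0 \<le> B" "weight I (ed j) \<le> B"
      using bound_le_B[OF d(1)] b'(9)[of 2] b'(9)[of 3] b'(3,4) B_ge10 b'(10)[of 3 j] b'(14)[OF j(1)]
      by (simp_all add: ew_def)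
    have cw: "(\<Sum>i<j. c (ed i)) \<le> B" "(\<Sum>i<j. w (ed i)) \<le> B" "(\<Sum>i<j. c (ed i)) + c (ed j) \<le> B"
      "(\<Sum>i<j. w (ed i)) + w (ed j) \<le> B"
      using cB[of j] wB[of j] cB[of "Suc j"] wB[of "Suc j"] j(1) by auto
    have ew: "mem s' 3 j = weight I (ed j)" using b'(14)[OF j(1)] by (simp add: ew_def)
    note facts = j(3) v ew b'(1,3,4) d' d'' b'(11,12)[OF j(1)] le_B(1-12) n j(1)
    have q: "regs s' 12 = (\<Sum>i<j. c (ed i))" "regs s' 13 = (\<Sum>i<j. w (ed i))"
      "regs s' 14 = 0 \<and> (\<forall>i<j. ok i) \<or> (\<exists>i<m. regs s' 14 = Suc i \<and> \<not> ok i)"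
      using j(2) by (auto simp: Q_def)
    define s1 where "s1 = s'\<lparr>regs := (regs s')(12 := (\<Sum>i<Suc j. c (ed i)), 13 := (\<Sum>i<Suc j. w (ed i)))\<rparr>"
    have 1: "run B (If (Cell 5 (Reg 11)) (Assign 12 (Reg 12 \<oplus> Cell 10 (Reg 11)) ;; Assign 13 (Reg 13 \<oplus> Cell 3 (Reg 11))) Skip)
       s' 20 (\<lambda>s''. s'' = s1)"
    proof (cases "ed j \<in> F")
      case True
      then have "c (ed j) = (if ed j \<in> N then 1 else 0)" "w (ed j) = weight I (ed j)" by (auto simp: c_def w_def)
      with True show ?thesis using cw unfolding s1_def by (simp add: wp_simps facts q(1,2))
    next
      case False
      then have "c (ed j) = 0" "w (ed j) = 0" by (auto simp: c_def w_def)
      with False have "s1 = s'" using q(1,2) by (cases s') (auto simp: s1_def fun_eq_iff)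
      with False show ?thesis by (simp add: wp_simps facts)
    qed
    have "run B ?c s' (20 + 30) (\<lambda>s''. Q (Suc j) (s''\<lparr>regs := (regs s'')(11 := Suc j)\<rparr>))"
    proof (rule run_Seq[OF 1], hypsubst)
      show "run B (If (Reg 2 \<otimes> Cell 4 (Cell 20 (Reg 11) \<otimes> Reg 20 \<oplus> Cell 21 (Reg 11)) \<prec>
           Reg 3 \<otimes> Cell 104 (Cell 20 (Reg 11) \<otimes> Reg 20 \<oplus> Cell 21 (Reg 11)))
         (Assign 14 (Reg 11 \<oplus> Const 1)) Skip) s1 30 (\<lambda>s''. Q (Suc j) (s''\<lparr>regs := (regs s'')(11 := Suc j)\<rparr>))"
      proof (cases "ok j")
        case True
        then have le: "\<not> sn * d0 (eu j) (ev j) < sd * ndist l E (eu j) (ev j)" by (simp add: ok_def)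
        have "regs s' 14 = 0 \<and> (\<forall>i<Suc j. ok i) \<or> (\<exists>i<m. regs s' 14 = Suc i \<and> \<not> ok i)"
          using q(3) True by (auto simp: less_Suc_eq)
        with le show ?thesis unfolding s1_def by (simp add: wp_simps facts Q_def)
      next
        case False
        then have le: "sn * d0 (eu j) (ev j) < sd * ndist l E (eu j) (ev j)" by (simp add: ok_def)
        with False show ?thesis unfolding s1_def using j(1) by (simp add: wp_simps facts Q_def)
      qed
    qed
    then show "run B ?c s' 50 (\<lambda>s''. Q (Suc j) (s''\<lparr>regs := (regs s'')(11 := Suc j)\<rparr>))" by simp
  qed (use base_regs[OF env_base[OF e0]] m_less_B in \<open>auto simp: Q_def\<close>)
  then have "run B scan s (1 + cost (Const 0) + (1 + cost (Const 0) + (1 + cost (Const 0) + (m * (50 + 8) + 8)))) (Q m)"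
    unfolding scan_def
    by (intro run_Assign_Seq) auto
  then show ?thesis by (rule run_mono) (auto simp: Q_def c w ok_def)
qed

end

lemma ndist_cong: "(\<And>e. e \<in> E \<Longrightarrow> l e = l' e) \<Longrightarrow> ndist l E u v = ndist l' E u v"
  unfolding ndist_def by (intro arg_cong[where f = Inf] image_cong path_length_cong) (auto simp: simple_path_def)

lemma path_edges_take_Suc:
  "Suc j < length p \<Longrightarrow> path_edges (take (Suc (Suc j)) p) = path_edges (take (Suc j) p) @ [{p ! j, p ! Suc j}]"
  using path_edges_append[of "take j p" "p ! j" "[p ! Suc j]"] by (simp add: take_Suc_conv_app_nth)

lemma path_edges_take_subset: "set (path_edges (take k p)) \<subseteq> set (path_edges p)"
proof (cases k)
  case (Suc j)
  show ?thesis
  proof (cases "j < length p")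
    case True
    then have p: "p = take j p @ p ! j # drop (Suc j) p" "take (Suc j) p = take j p @ [p ! j]"
      by (simp_all add: id_take_nth_drop[symmetric] take_Suc_conv_app_nth)
    show ?thesis
      unfolding Suc p(2) using path_edges_append[of "take j p" "p ! j" "drop (Suc j) p"] p(1)
      by (metis Un_upper1 set_append)
  qed (use Suc in simp)
qed simp

lemma path_edges_nth: "Suc j < length p \<Longrightarrow> {p ! j, p ! Suc j} \<in> set (path_edges p)"
  using path_edges_take_Suc[of j p] path_edges_take_subset[of "Suc (Suc j)" p] by auto

section \<open>One step of the search\<close>

text \<open>The length is recomputed from the original lengths, since the current ones are heavy on
  the prefix.\<close>

definition prefix_length :: program where
  "prefix_length = Assign 14 (Reg 9 \<ominus> Const 1) ;; Assign 13 (Const 0) ;;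
     For 11 14 (Assign 13 (Reg 13 \<oplus>
       Cell 2 (Cell 9 (Cell 7 (Reg 11) \<otimes> Reg 20 \<oplus> Cell 7 (Reg 11 \<oplus> Const 1)) \<ominus> Const 1)))"

definition find_next_body :: program where
  "find_next_body = Assign 18 (Cell 9 (Reg 16 \<otimes> Reg 20 \<oplus> Reg 17)) ;;
     If (Reg 18)
       (If (Cell 104 (Reg 16 \<otimes> Reg 20 \<oplus> Reg 10) \<doteq>
            Cell 6 (Reg 18 \<ominus> Const 1) \<oplus> Cell 104 (Reg 17 \<otimes> Reg 20 \<oplus> Reg 10))
         (Assign 19 (Reg 17)) Skip) Skip"

definition find_next :: program where
  "find_next = For 17 20 find_next_body"

definition path_advance :: program where
  "path_advance = Assign 15 (Reg 15 \<oplus> Const 1) ;; Store 7 (Reg 15) (Reg 19) ;; Assign 16 (Reg 19)"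

text \<open>The path is written behind the prefix, with which it shares a node. Array 7 then holds a
  completed path, and the prefixes of both children are initial parts of it. The number of rounds is
  fixed at \<open>n\<close>; after the target is reached they are idle.\<close>

definition shortest_path_search :: program where
  "shortest_path_search = Assign 12 (Cell 7 (Reg 14)) ;; Assign 16 (Reg 12) ;; Assign 15 (Reg 14) ;;
     For 11 20 (If (Reg 16 \<doteq> Reg 10) Skip (find_next ;; path_advance))"

lemma frame_sets_path [simp]:
  "wr prefix_length = {11, 13, 14}" "wa prefix_length = {}"
  "wr find_next_body = {18, 19}" "wa find_next_body = {}"
  "wr find_next = {17, 18, 19}" "wa find_next = {}"
  "wr path_advance = {15, 16}" "wa path_advance = {7}"
  "wr shortest_path_search = {11, 12, 15, 16, 17, 18, 19}" "wa shortest_path_search = {7}"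
  by (auto simp: prefix_length_def find_next_body_def find_next_def path_advance_def shortest_path_search_def)

context machine
begin

text \<open>A step either finds a solution and empties the stack or replaces \<open>it\<close> by its children \<open>cs\<close>.\<close>

definition outcome :: "item list \<Rightarrow> item \<Rightarrow> state \<Rightarrow> bool" where
  "outcome its it s \<longleftrightarrow>
     regs s 8 = 0 \<and> regs s 6 = 1 \<and> is_solution I {ed i | i. i < m \<and> mem s 5 i = 1} \<or>
     regs s 6 = 0 \<and> (\<exists>cs. stack s (its @ cs) \<and> (\<forall>c\<in>set cs. item_ok c) \<and>
       sum_list (map potential cs) < potential it \<and> (solvable it \<longrightarrow> (\<exists>c\<in>set cs. solvable c)) \<and>
       (cs = [] \<or> (\<exists>c. cs = [c] \<and> level it \<le> level c) \<or>
        (\<exists>c d. cs = [c, d] \<and> level it < level c \<and> level it < level d)))"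

lemma outcome_none:
  assumes "regs s 6 = 0" "stack s its" "\<not> solvable it" "potential it > 0"
  shows "outcome its it s"
  unfolding outcome_def using assms by (intro disjI2[of _ "_ \<and> _"] conjI exI[of _ "[]"]) simp_all

lemma outcome_single:
  assumes "regs s 6 = 0" "stack s (its @ [c])" "item_ok c" "potential c < potential it"
    "solvable it \<Longrightarrow> solvable c" "level it \<le> level c"
  shows "outcome its it s"
proof -
  have "\<exists>c'. [c] = [c'] \<and> level it \<le> level c'" using assms by simp
  then show ?thesis unfolding outcome_def using assms by (intro disjI2[of _ "_ \<and> _"] conjI exI[of _ "[c]"]) simp_all
qed

lemma outcome_pair:
  assumes "regs s 6 = 0" "stack s (its @ [c, d])" "item_ok c" "item_ok d" "potential c + potential d < potential it"
    "solvable it \<Longrightarrow> solvable c \<or> solvable d" "level it < level c" "level it < level d"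
  shows "outcome its it s"
proof -
  have "\<exists>c' d'. [c, d] = [c', d'] \<and> level it < level c' \<and> level it < level d'" using assms by simp
  then show ?thesis unfolding outcome_def using assms by (intro disjI2[of _ "_ \<and> _"] conjI exI[of _ "[c, d]"]) simp_all
qed

lemma run_start_path:
  assumes b: "base s" and cur: "current s (F, l, \<pi>, t)" and i: "i < m" "regs s 14 = Suc i"
  shows "run B start_path s (13 * m + 40) (\<lambda>s'. current s' (F, len0, [eu i], ev i))"
proof -
  have "run B start_path s ((13 * m + 8) + 30) (\<lambda>s'. current s' (F, len0, [eu i], ev i))"
    unfolding start_path_def
  proof (rule run_Seq[OF run_copy_lengths[OF b]])
    fix s1 assume X: "\<forall>i<m. mem s1 6 i = el i" and ag: "agree B (wr copy_lengths) (wa copy_lengths) s s1"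
    have b1: "base s1" by (rule base_agree[OF b ag]) auto
    have "mem s1 5 = mem s 5" "regs s1 14 = Suc i" using agree_reg[OF ag] agree_mem[OF ag] i by auto
    then show "run B (Store 7 (Const 0) (Cell 20 (Reg 14 \<ominus> Const 1)) ;;
     Assign 9 (Const 1) ;; Assign 10 (Cell 21 (Reg 14 \<ominus> Const 1))) s1 30
       (\<lambda>s'. current s' (F, len0, [eu i], ev i))"
      using base_regs(11,12)[OF b1 i(1)] X cur n_pos i(1) edge_le_B[OF i(1)] B_ge10
        node_le_B[OF ed_nodes(1)[OF i(1)]] node_le_B[OF ed_nodes(2)[OF i(1)]]
      by (simp add: wp_simps current_def el_def)
  qed
  then show ?thesis by (rule run_mono) auto
qed

lemma stored_set: "F \<subseteq> E \<Longrightarrow> \<forall>i<m. f i = (if ed i \<in> F then 1 else 0) \<Longrightarrow> {ed i | i. i < m \<and> f i = (1::nat)} = F"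
proof (rule set_eqI, rule iffI)
  fix e assume F: "F \<subseteq> E" "\<forall>i<m. f i = (if ed i \<in> F then 1 else 0)"
  {
    assume "e \<in> {ed i | i. i < m \<and> f i = 1}"
    then obtain i where "e = ed i" "i < m" "f i = 1" by blast
    then show "e \<in> F" using F(2) by (metis zero_neq_one)
  next
    assume "e \<in> F"
    moreover from this obtain i where "i < m" "e = ed i" using F(1) edE by blast
    ultimately show "e \<in> {ed i | i. i < m \<and> f i = 1}" using F(2) by auto
  }
qed

lemma run_set_step:
  assumes e: "env s" and it: "set_item F l" and cur: "current s (F, l, [], t)" and tab: "table s l"
    and st: "stack s its" "length its \<le> max_height" and r6: "regs s 6 = 0"
  shows "run B set_step s (110 * m + 20 * n + 150) (outcome its (F, l, [], t))"
proof -
  have F: "T \<subseteq> F" "F \<subseteq> E" "\<And>e. e \<in> E \<Longrightarrow> l e = restricted F e" using it by (auto simp: set_item_def)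
  have f: "\<forall>i<m. mem s 5 i = (if ed i \<in> F then 1 else 0)" using cur by (simp add: current_def)
  have l: "length_ok l"
    unfolding length_ok_def
    using F(3) restricted_pos len_less_heavy by (fastforce simp: restricted_def intro: less_imp_le)
  have ok_iff: "sd * ndist l E (eu i) (ev i) \<le> sn * d0 (eu i) (ev i) \<longleftrightarrow> settled F (eu i) (ev i)" if "i < m" for i
    using settled_iff_ndist[OF F(2) ed_mem[OF that]] ndist_cong[of E l "restricted F"] F(3) by simp
  have pot: "potential (F, l, [], t) > 0"
  proof -
    have "b ^ (\<mu> - card (F \<inter> N)) \<ge> 1" using breadth_pos by simp
    then show ?thesis by simp
  qed
  define c where "c = card (F \<inter> N)"
  define w where "w = sum (weight I) F"
  have "run B set_step s ((60 * m + 20) + (1 + cost (Reg 14) + (50 * m + 20 * n + 120))) (outcome its (F, l, [], t))"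
    unfolding set_step_def
  proof (rule run_Seq[OF run_scan[OF e l tab f F(2)]], rule run_If)
    fix s1 assume sc: "regs s1 12 = card (F \<inter> N) \<and> regs s1 13 = sum (weight I) F \<and>
      (regs s1 14 = 0 \<and> (\<forall>i<m. sd * ndist l E (eu i) (ev i) \<le> sn * d0 (eu i) (ev i)) \<or>
       (\<exists>i<m. regs s1 14 = Suc i \<and> \<not> sd * ndist l E (eu i) (ev i) \<le> sn * d0 (eu i) (ev i)))"
      and ag: "agree B (wr scan) (wa scan) s s1"
    have e1: "env s1" by (rule env_agree[OF e ag]) auto
    note bs = base_regs[OF env_base[OF e1]]
    have cur1: "current s1 (F, l, [], t)" using cur agree_reg[OF ag] agree_mem[OF ag] by (auto simp: current_def)
    have st1: "stack s1 its" "regs s1 6 = 0" using st r6 agree_reg[OF ag] agree_mem[OF ag]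
      by (auto simp: stack_def slot_def)
    have r: "regs s1 12 = c" "regs s1 13 = w" using sc by (auto simp: c_def w_def)
    have cw: "c \<le> B" "w \<le> B" "\<mu> \<le> B" "weight_bound I \<le> B" using bs(9) r bs(5,6) by metis+
    show "fits B (Reg 14) s1" using bs(9) by simp
    {
      assume "value_of (Reg 14) s1 \<noteq> 0"
      then obtain i where i: "i < m" "regs s1 14 = Suc i" "\<not> settled F (eu i) (ev i)" using sc ok_iff by auto
      let ?it = "(F, len0, [eu i], ev i)"
      show "run B (If (Reg 12 \<prec> Reg 5) (start_path ;; push) Skip) s1 (50 * m + 20 * n + 120) (outcome its (F, l, [], t))"
      proof (cases "c < \<mu>")
        case True
        note br = set_item_branch[OF it ed_mem[OF i(1)] i(3) True[unfolded c_def]]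
        have "run B (start_path ;; push) s1 ((13 * m + 40) + (30 * m + 20 * n + 40)) (outcome its (F, l, [], t))"
        proof (rule run_Seq[OF run_start_path[OF env_base[OF e1] cur1 i(1,2)]])
          fix s2 assume cur2: "current s2 ?it" and ag2: "agree B (wr start_path) (wa start_path) s1 s2"
          have b2: "base s2" by (rule base_agree[OF env_base[OF e1] ag2]) auto
          have st2: "stack s2 its" "regs s2 6 = 0" using st1 agree_reg[OF ag2] agree_mem[OF ag2]
            by (auto simp: stack_def slot_def)
          show "run B push s2 (30 * m + 20 * n + 40) (outcome its (F, l, [], t))"
          proof (rule run_mono[OF run_agree[OF run_push[OF b2 cur2 st2(1) st(2)]]])
            fix s3 assume "stack s3 (its @ [?it]) \<and> agree B (wr push) (wa push) s2 s3"
            then have s3: "stack s3 (its @ [?it])" "regs s3 6 = 0" using agree_reg[of B "wr push" _ s2 s3 6] st2 by auto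
            show "outcome its (F, l, [], t) s3"
              by (rule outcome_single[OF s3(2,1) br(1,3,2,4)])
          qed simp
        qed
        then have "run B (If (Reg 12 \<prec> Reg 5) (start_path ;; push) Skip) s1
          (1 + cost (Reg 12 \<prec> Reg 5) + ((13 * m + 40) + (30 * m + 20 * n + 40))) (outcome its (F, l, [], t))"
          using cw r bs(6) B_ge10 True by (intro run_If) auto
        then show ?thesis by (rule run_mono) auto
      next
        case False
        then have "\<not> solvable (F, l, [], t)"
          using set_item_full[OF it ed_mem[OF i(1)] i(3)] by (simp add: c_def)
        then have "outcome its (F, l, [], t) s1" by (rule outcome_none[OF st1(2,1) _ pot])
        then show ?thesis using False cw r bs(6) B_ge10 by (simp add: wp_simps)
      qed
    next
      assume "value_of (Reg 14) s1 = 0"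
      then have all: "\<forall>i<m. settled F (eu i) (ev i)" using sc ok_iff by auto
      \<comment> \<open>Only one orientation of each edge is tested; the other follows from the
        symmetry of distances.\<close>
      have "settled F u v" if uv: "{u, v} \<in> E" for u v
      proof -
        obtain i where i: "i < m" "{u, v} = ed i" using edE[OF uv] .
        then have *: "u = eu i \<and> v = ev i \<or> u = ev i \<and> v = eu i" by (auto simp: doubleton_eq_iff)
        have "ed i \<in> E" using ed_mem[OF i(1)] .
        then have "settled F (eu i) (ev i) \<longleftrightarrow> settled F (ev i) (eu i)"
          using settled_iff_ndist[OF F(2), of "eu i" "ev i"] settled_iff_ndist[OF F(2), of "ev i" "eu i"]
            ndist_sym ed_nodes[OF i(1)] by (simp add: insert_commute)
        with * all i(1) show ?thesis by metis
      qed
      then have leaf: "solvable (F, l, [], t) \<longleftrightarrow> is_solution I F" and sp: "is_spanner I F"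
        using set_item_leaf[OF it] F(2) by (auto simp: is_spanner_iff)
      show "run B (If ((Reg 4 \<prec> Reg 13) \<oplus> (Reg 5 \<prec> Reg 12)) Skip (Assign 6 (Const 1) ;; Assign 8 (Const 0))) s1
        (50 * m + 20 * n + 120) (outcome its (F, l, [], t))"
      proof (cases "is_solution I F")
        case True
        then have "\<not> weight_bound I < w" "\<not> \<mu> < c" by (auto simp: is_solution_def w_def c_def)
        moreover have "{ed i | i. i < m \<and> mem s1 5 i = 1} = F"
          using stored_set[OF F(2)] cur1 by (simp add: current_def)
        then have "is_solution I {ed i | i. i < m \<and> mem s1 5 i = 1}" using True by (simp only:)
        ultimately show ?thesis using cw r bs(5,6) B_ge10
          by (simp add: wp_simps outcome_def)
      next
        case False
        then have "weight_bound I < w \<or> \<mu> < c" using sp by (auto simp: is_solution_def w_def c_def)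
        moreover have "outcome its (F, l, [], t) s1"
          by (rule outcome_none[OF st1(2,1) _ pot]) (use leaf False in blast)
        ultimately show ?thesis using cw r bs(5,6) B_ge10 by (auto simp: wp_simps)
      qed
    }
  qed
  then show ?thesis by (rule run_mono) auto
qed

lemma two_n_le_B: "k \<le> 2 * n \<Longrightarrow> k \<le> B"
proof -
  have "1 * n \<le> n * n" using n_pos by (intro mult_right_mono) auto
  then show "k \<le> 2 * n \<Longrightarrow> k \<le> B" using B4 by linarith
qed

lemma adjacent_index:
  assumes "adj_ok s" "{x, y} \<in> E"
  obtains i where "i < m" "ed i = {x, y}" "mem s 9 (x * n + y) = Suc i"
proof -
  obtain i where i: "i < m" "{x, y} = ed i" using edE[OF assms(2)] .
  then have "mem s 9 (x * n + y) = Suc i"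
    using assms edge_nodes[OF assms(2)] by (auto simp: adj_ok_def)
  with i that show ?thesis by metis
qed

lemma run_prefix_length:
  assumes e: "env s" and p: "walk E u v \<pi>" "u < n" "length \<pi> \<le> n" and r: "regs s 9 = length \<pi>" "\<forall>i<length \<pi>. mem s 7 i = \<pi> ! i"
  shows "run B prefix_length s (40 * n + 30) (\<lambda>s'. regs s' 13 = path_length len0 \<pi> \<and> regs s' 14 = length \<pi> - 1)"
proof -
  note bs = base_regs[OF env_base[OF e]]
  have nodes: "\<pi> ! i < n" if "i < length \<pi>" for i using walk_nodes[OF p(1,2)] that by (auto simp: subset_iff)
  have ne: "\<pi> \<noteq> []" using p by auto
  let ?c = "Assign 13 (Reg 13 \<oplus>
       Cell 2 (Cell 9 (Cell 7 (Reg 11) \<otimes> Reg 20 \<oplus> Cell 7 (Reg 11 \<oplus> Const 1)) \<ominus> Const 1))"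
  let ?s0 = "s\<lparr>regs := (regs s)(14 := length \<pi> - 1, 13 := 0)\<rparr>"
  have lB: "length \<pi> \<le> B" "length \<pi> - 1 \<le> B" "length \<pi> - 1 < B" using two_n_le_B[of "length \<pi>"] p(3) n_less_B by auto
  have "agree B {13, 14} {} s ?s0" using env_base[OF e] lB by (auto simp: agree_def base_def all_words_def)
  then have e0: "env ?s0" by (rule env_agree[OF e]) auto
  have len_take: "path_length len0 (take k \<pi>) \<le> n * heavy" for k
  proof -
    have "path_length len0 (take k \<pi>) \<le> (length (take k \<pi>) - 1) * heavy"
      using path_edges_take_subset[of k \<pi>] p(1) len_less_heavy
      by (intro path_length_le) (auto simp: walk_def subset_iff intro: less_imp_le)
    also have "\<dots> \<le> n * heavy" using p(3) by (intro mult_right_mono) auto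
    finally show ?thesis .
  qed
  have "run B (For 11 14 ?c) ?s0 ((length \<pi> - 1) * (20 + 8) + 8)
    (\<lambda>s'. regs s' 13 = path_length len0 \<pi> \<and> regs s' 14 = length \<pi> - 1)"
  proof (rule run_For[where I = "\<lambda>j s'. regs s' 13 = path_length len0 (take (Suc j) \<pi>)"])
    fix j s' assume j: "j < length \<pi> - 1" "regs s' 13 = path_length len0 (take (Suc j) \<pi>)" "regs s' 11 = j"
      and ag: "agree B (insert 11 (wr ?c)) (wa ?c) ?s0 s'"
    have e': "env s'" by (rule env_agree[OF e0 ag]) auto
    have j': "Suc j < length \<pi>" using j by simp
    have xy: "{\<pi> ! j, \<pi> ! Suc j} \<in> E" using path_edges_nth[OF j'] p(1) by (auto simp: walk_def)
    have "adj_ok s'" using e' by (simp add: env_def)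
    from adjacent_index[OF this xy] obtain i where i: "i < m" "ed i = {\<pi> ! j, \<pi> ! Suc j}"
      "mem s' 9 (\<pi> ! j * n + \<pi> ! Suc j) = Suc i" .
    have m7: "mem s' 7 j = \<pi> ! j" "mem s' 7 (Suc j) = \<pi> ! Suc j" using agree_mem[OF ag, of 7] r(2) j' by auto
    have len: "path_length len0 (take (Suc (Suc j)) \<pi>) = path_length len0 (take (Suc j) \<pi>) + el i"
      using path_edges_take_Suc[OF j'] i(2) by (simp add: path_length_def el_def)
    have le: "path_length len0 (take k \<pi>) \<le> B" for k
      using len_take[of k] by (intro unscaled_le_B) linarith
    have n: "\<pi> ! j < n" "\<pi> ! Suc j < n" using nodes j' by auto
    have "Suc j \<le> B" "j \<le> B" using j' lB by auto
    then show "run B ?c s' 20 (\<lambda>s''. regs (s''\<lparr>regs := (regs s'')(11 := Suc j)\<rparr>) 13 = path_length len0 (take (Suc (Suc j)) \<pi>))"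
      using j(2,3) m7 i base_regs(1,13)[OF env_base[OF e']] n len le[of "Suc j"] le[of "Suc (Suc j)"] edge_le_B[OF i(1)] el_le_B[OF i(1)]
      by (simp add: wp_simps le_B)
  next
    fix s' assume "regs s' 13 = path_length len0 (take (Suc (length \<pi> - 1)) \<pi>)"
      and ag: "agree B (insert 11 (wr ?c)) (wa ?c) ?s0 s'"
    then show "regs s' 13 = path_length len0 \<pi> \<and> regs s' 14 = length \<pi> - 1"
      using ne agree_reg[OF ag, of 14] by simp
  qed (use ne lB in \<open>auto simp: take_Suc neq_Nil_conv\<close>)
  then have "run B prefix_length s (1 + cost (Reg 9 \<ominus> Const 1) + (1 + cost (Const 0) + ((length \<pi> - 1) * (20 + 8) + 8)))
    (\<lambda>s'. regs s' 13 = path_length len0 \<pi> \<and> regs s' 14 = length \<pi> - 1)"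
    unfolding prefix_length_def using r(1) lB B_ge10 by (intro run_Assign_Seq) auto
  moreover have "(length \<pi> - 1) * 28 \<le> n * 28" using p(3) by (intro mult_right_mono) auto
  ultimately show ?thesis by (elim run_mono) auto
qed

lemma run_find_next:
  assumes e: "env s" and l: "length_ok l" "\<forall>i<m. mem s 6 i = l (ed i)" and tab: "table s l"
    and r: "regs s 16 = x" "regs s 10 = t" and x: "x < n" "t < n" "x \<noteq> t"
  shows "run B find_next s (60 * n + 8)
    (\<lambda>s'. {x, regs s' 19} \<in> E \<and> ndist l E x t = l {x, regs s' 19} + ndist l E (regs s' 19) t)"
proof -
  define good where "good y \<longleftrightarrow> {x, y} \<in> E \<and> ndist l E x t = l {x, y} + ndist l E y t" for y
  have "run B find_next s (n * (50 + 8) + 8) (\<lambda>s'. good (regs s' 19))"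
    unfolding find_next_def
  proof (rule run_For[where I = "\<lambda>j s'. (\<exists>y<j. good y) \<longrightarrow> good (regs s' 19)"])
    show "regs s 20 = n" "n < B" using base_regs[OF env_base[OF e]] n_less_B by auto
    fix j s' assume j: "j < n" "(\<exists>y<j. good y) \<longrightarrow> good (regs s' 19)" "regs s' 17 = j"
      and ag: "agree B (insert 17 (wr find_next_body)) (wa find_next_body) s s'"
    have e': "env s'" by (rule env_agree[OF e ag]) auto
    note b' = base_regs[OF env_base[OF e']]
    have s': "regs s' 16 = x" "regs s' 10 = t" "mem s' 6 = mem s 6" "mem s' 104 = mem s 104"
      using r agree_reg[OF ag] agree_mem[OF ag] by auto
    have d: "mem s' 104 (x * n + t) = ndist l E x t" "mem s' 104 (j * n + t) = ndist l E j t"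
      using tab x j s' by (auto simp: table_def)
    have db: "ndist l E x t \<le> n * heavy" "ndist l E j t \<le> n * heavy" using dist_bound[OF l(1)] x j by auto
    show "run B find_next_body s' 50 (\<lambda>s''. (\<exists>y<Suc j. good y) \<longrightarrow> good (regs (s''\<lparr>regs := (regs s'')(17 := Suc j)\<rparr>) 19))"
    proof (cases "{x, j} \<in> E")
      case True
      have "adj_ok s'" using e' by (simp add: env_def)
      from adjacent_index[OF this True] obtain i where i: "i < m" "ed i = {x, j}" "mem s' 9 (x * n + j) = Suc i" .
      have X: "mem s' 6 i = l {x, j}" using l(2) i s' by simp
      have lb: "l {x, j} \<le> heavy" using l(1) True by (auto simp: length_ok_def)
      have "l {x, j} \<le> 5 * (n * heavy)" "ndist l E x t \<le> 5 * (n * heavy)" "ndist l E j t \<le> 5 * (n * heavy)"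
        "l {x, j} + ndist l E j t \<le> 5 * (n * heavy)"
        using lb heavy_le db by linarith+
      note bounds = this[THEN unscaled_le_B]
      have "good j \<longleftrightarrow> ndist l E x t = l {x, j} + ndist l E j t" using True by (simp add: good_def)
      then show ?thesis using j x s' d X i b'(1) bounds edge_le_B[OF i(1)]
        by (auto simp: find_next_body_def wp_simps le_B less_Suc_eq)
    next
      case False
      then have "mem s' 9 (x * n + j) = 0" using e' x j by (auto simp: env_def adj_ok_def)
      moreover have "\<not> good j" using False by (simp add: good_def)
      ultimately show ?thesis using j x s' b'(1)
        by (auto simp: find_next_body_def wp_simps le_B less_Suc_eq)
    qed
  next
    fix s' assume I: "(\<exists>y<n. good y) \<longrightarrow> good (regs s' 19)"
    obtain y where "{x, y} \<in> E" "ndist l E x t = l {x, y} + ndist l E y t" using ndist_step[OF x] .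
    then have "good y" "y < n" using edge_nodes by (auto simp: good_def)
    with I show "good (regs s' 19)" by blast
  qed auto
  then show ?thesis by (rule run_mono) (auto simp: good_def)
qed

lemma run_shortest_path_search:
  assumes e: "env s" and l: "length_ok l" "\<forall>i<m. mem s 6 i = l (ed i)" and tab: "table s l"
    and r: "regs s 14 = k" "regs s 10 = t" "mem s 7 k = u" and x: "k < n" "t < n" "u < n"
  shows "run B shortest_path_search s (60 * (n * n) + 60 * n + 30)
    (\<lambda>s'. regs s' 12 = u \<and> (\<forall>i<k. mem s' 7 i = mem s 7 i) \<and>
      (\<exists>P. simple_path E u t P \<and> path_length l P = ndist l E u t \<and> regs s' 15 = k + (length P - 1) \<and>
        (\<forall>i<length P. mem s' 7 (k + i) = P ! i)))"
proof -
  note bs = base_regs[OF env_base[OF e]]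
  let ?d = "ndist l E"
  let ?c = "If (Reg 16 \<doteq> Reg 10) Skip (find_next ;; path_advance)"
  let ?s0 = "s\<lparr>regs := (regs s)(12 := u, 16 := u, 15 := k)\<rparr>"
  have kB: "k \<le> B" "u \<le> B" using x le_B by auto
  have "agree B {12, 15, 16} {} s ?s0" using env_base[OF e] kB by (auto simp: agree_def base_def all_words_def)
  then have e0: "env ?s0" by (rule env_agree[OF e]) auto
  \<comment> \<open>The last conjunct, by which the current node is closest to \<open>t\<close> so
    far, keeps \<open>Q\<close> simple. Until \<open>t\<close> is reached \<open>Q\<close> grows in
    every round, so missing \<open>t\<close> for \<open>n\<close> rounds would give
    \<open>n + 1\<close> distinct nodes.\<close>
  define J where "J i s' \<longleftrightarrow> (\<forall>i<k. mem s' 7 i = mem s 7 i) \<and>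
    (\<exists>Q. walk E u (regs s' 16) Q \<and> distinct Q \<and> path_length l Q + ?d (regs s' 16) t = ?d u t \<and>
      regs s' 15 = k + (length Q - 1) \<and> (\<forall>i<length Q. mem s' 7 (k + i) = Q ! i) \<and>
      (regs s' 16 = t \<or> length Q = Suc i) \<and> (\<forall>z\<in>set Q. ?d (regs s' 16) t \<le> ?d z t))" for i and s' :: state
  have "run B (For 11 20 ?c) ?s0 (n * ((1 + cost (Reg 16 \<doteq> Reg 10) + ((60 * n + 8) + 20)) + 8) + 8)
    (\<lambda>s'. J n s' \<and> regs s' 12 = u)"
  proof (rule run_For[where I = J])
    show "regs ?s0 20 = n" "n < B" using bs n_less_B by auto
    show "J 0 (?s0\<lparr>regs := (regs ?s0)(11 := 0)\<rparr>)"
      unfolding J_def using r by (intro conjI exI[of _ "[u]"]) auto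
    fix j s' assume j: "j < n" "J j s'" "regs s' 11 = j" and ag: "agree B (insert 11 (wr ?c)) (wa ?c) ?s0 s'"
    have e': "env s'" by (rule env_agree[OF e0 ag]) auto
    note b' = base_regs[OF env_base[OF e']]
    have s': "regs s' 10 = t" "mem s' 6 = mem s 6" "mem s' 104 = mem s 104"
      using r agree_reg[OF ag] agree_mem[OF ag] by auto
    obtain Q where k0: "\<forall>i<k. mem s' 7 i = mem s 7 i" and Q: "walk E u (regs s' 16) Q" "distinct Q"
      "path_length l Q + ?d (regs s' 16) t = ?d u t"
      "regs s' 15 = k + (length Q - 1)" "\<forall>i<length Q. mem s' 7 (k + i) = Q ! i"
      "regs s' 16 = t \<or> length Q = Suc j" "\<forall>z\<in>set Q. ?d (regs s' 16) t \<le> ?d z t"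
      using j(2) unfolding J_def by blast
    have Qn: "set Q \<subseteq> {..<n}" "Q \<noteq> []" using walk_nodes[OF Q(1) x(3)] Q(1) by auto
    then have xn: "regs s' 16 < n" using Q(1) last_in_set[of Q] by (auto simp: walk_def)
    have lQ: "length Q \<le> n" using Qn(1) Q(2) by (metis card_lessThan card_mono distinct_card finite_lessThan)
    have lQ1: "length Q \<ge> 1" using Qn(2) by (simp add: Suc_le_eq)
    show "run B ?c s' (1 + cost (Reg 16 \<doteq> Reg 10) + ((60 * n + 8) + 20))
      (\<lambda>s''. J (Suc j) (s''\<lparr>regs := (regs s'')(11 := Suc j)\<rparr>))"
    proof (rule run_If)
      show "fits B (Reg 16 \<doteq> Reg 10) s'" using b'(9) B_ge10 by simp
      {
        assume "value_of (Reg 16 \<doteq> Reg 10) s' \<noteq> 0"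
        then have "regs s' 16 = t" using s' by (simp split: if_splits)
        then have "J (Suc j) (s'\<lparr>regs := (regs s')(11 := Suc j)\<rparr>)"
          unfolding J_def using k0 Q by (intro conjI exI[of _ Q]) auto
        then show "run B Skip s' (60 * n + 8 + 20) (\<lambda>s''. J (Suc j) (s''\<lparr>regs := (regs s'')(11 := Suc j)\<rparr>))"
          by (simp add: wp_simps)
      next
        assume "value_of (Reg 16 \<doteq> Reg 10) s' = 0"
        then have ne: "regs s' 16 \<noteq> t" using s' by (simp split: if_splits)
        have tab': "table s' l" using tab s' by (simp add: table_def)
        have X': "\<forall>i<m. mem s' 6 i = l (ed i)" using l(2) s' by simp
        show "run B (find_next ;; path_advance) s' (60 * n + 8 + 20) (\<lambda>s''. J (Suc j) (s''\<lparr>regs := (regs s'')(11 := Suc j)\<rparr>))"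
        proof (rule run_Seq[OF run_find_next[OF e' l(1) X' tab' refl s'(1) xn x(2) ne]])
          fix s1 assume y: "{regs s' 16, regs s1 19} \<in> E \<and>
            ?d (regs s' 16) t = l {regs s' 16, regs s1 19} + ?d (regs s1 19) t"
            and ag1: "agree B (wr find_next) (wa find_next) s' s1"
          define y' where "y' = regs s1 19"
          have y: "{regs s' 16, y'} \<in> E" "?d (regs s' 16) t = l {regs s' 16, y'} + ?d y' t" "y' < n"
            using y edge_nodes by (auto simp: y'_def)
          have s1: "regs s1 15 = k + (length Q - 1)" "mem s1 7 = mem s' 7"
            using Q(4) agree_reg[OF ag1] agree_mem[OF ag1] by auto
          have lt: "?d y' t < ?d (regs s' 16) t" using y l(1) by (force simp: length_ok_def)
          have w: "walk E u y' (Q @ [y'])" "path_length l (Q @ [y']) = path_length l Q + l {regs s' 16, y'}"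
            using walk_join(1,2)[OF Q(1) walk_edge[OF y(1)]] by auto
          have "y' \<notin> set Q" using Q(7) lt by force
          have last: "Suc (k + length Q - Suc 0) = k + length Q" using lQ1 by simp
          let ?s2 = "s1\<lparr>regs := (regs s1)(15 := k + length Q), mem := (mem s1)(7 := (mem s1 7)(k + length Q := y'))\<rparr>"
          let ?s3 = "?s2\<lparr>regs := (regs s1)(15 := k + length Q, 16 := y')\<rparr>"
          have "J (Suc j) (?s3\<lparr>regs := (regs ?s3)(11 := Suc j)\<rparr>)"
            unfolding J_def
          proof (intro conjI exI[of _ "Q @ [y']"])
            show "\<forall>i<k. mem (?s3\<lparr>regs := (regs ?s3)(11 := Suc j)\<rparr>) 7 i = mem s 7 i" using k0 s1 by simp
            show "distinct (Q @ [y'])" using Q(2) \<open>y' \<notin> set Q\<close> by simp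
            show "\<forall>i<length (Q @ [y']). mem (?s3\<lparr>regs := (regs ?s3)(11 := Suc j)\<rparr>) 7 (k + i) = (Q @ [y']) ! i"
              using Q(5) s1 by (auto simp: nth_append less_Suc_eq)
            show "\<forall>z\<in>set (Q @ [y']). ?d (regs (?s3\<lparr>regs := (regs ?s3)(11 := Suc j)\<rparr>) 16) t \<le> ?d z t"
              using Q(7) lt by (auto intro: order_trans less_imp_le)
            show "regs (?s3\<lparr>regs := (regs ?s3)(11 := Suc j)\<rparr>) 16 = t \<or> length (Q @ [y']) = Suc (Suc j)"
              using Q(6) ne by simp
          qed (use w Q(3) y in auto)
          moreover have "k + length Q \<le> B" using x(1) lQ by (intro two_n_le_B) simp
          moreover have "y' \<le> B" using y(3) by (simp add: le_B)
          ultimately show "run B path_advance s1 20 (\<lambda>s''. J (Suc j) (s''\<lparr>regs := (regs s'')(11 := Suc j)\<rparr>))"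
            using s1 B_ge10 lQ1 last by (simp add: path_advance_def wp_simps y'_def[symmetric])
        qed
      }
    qed
  next
    fix s' assume "J n s'" and ag: "agree B (insert 11 (wr ?c)) (wa ?c) ?s0 s'"
    then show "J n s' \<and> regs s' 12 = u" using agree_reg[OF ag, of 12] by simp
  qed auto
  then have "run B shortest_path_search s (1 + cost (Cell 7 (Reg 14)) + (1 + cost (Reg 12) + (1 + cost (Reg 14) +
    (n * ((1 + cost (Reg 16 \<doteq> Reg 10) + ((60 * n + 8) + 20)) + 8) + 8)))) (\<lambda>s'. J n s' \<and> regs s' 12 = u)"
    unfolding shortest_path_search_def using r kB by (intro run_Assign_Seq) auto
  then show ?thesis
  proof (rule run_mono)
    fix s' assume J: "J n s' \<and> regs s' 12 = u"
    then obtain Q where Q: "walk E u (regs s' 16) Q" "distinct Q" "path_length l Q + ?d (regs s' 16) t = ?d u t"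
      "regs s' 15 = k + (length Q - 1)" "\<forall>i<length Q. mem s' 7 (k + i) = Q ! i"
      "regs s' 16 = t \<or> length Q = Suc n"
      unfolding J_def by blast
    have "set Q \<subseteq> {..<n}" using walk_nodes[OF Q(1) x(3)] .
    then have "length Q \<le> n" using Q(2) by (metis card_lessThan card_mono distinct_card finite_lessThan)
    then have "regs s' 16 = t" using Q(6) by simp
    then show "regs s' 12 = u \<and> (\<forall>i<k. mem s' 7 i = mem s 7 i) \<and>
      (\<exists>P. simple_path E u t P \<and> path_length l P = ?d u t \<and> regs s' 15 = k + (length P - 1) \<and>
        (\<forall>i<length P. mem s' 7 (k + i) = P ! i))"
      using J Q by (auto simp: J_def simple_path_iff_walk intro!: exI[of _ Q])
  qed (simp add: algebra_simps)
qed

end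

section \<open>Labels, the first deviation and modified lengths\<close>

definition label_body :: program where
  "label_body = If (Cell 104 (Reg 12 \<otimes> Reg 20 \<oplus> Reg 18) \<oplus> Cell 104 (Reg 18 \<otimes> Reg 20 \<oplus> Reg 16) \<doteq>
       Cell 104 (Reg 12 \<otimes> Reg 20 \<oplus> Reg 16)) (Store 8 (Reg 16) (Reg 11)) Skip"

definition clear_labels :: program where
  "clear_labels = For 11 20 (Store 8 (Reg 11) (Const 0))"

text \<open>Positions are processed in increasing order, so the largest one that qualifies is
  written last. The initial value 0 is correct because every path from the first node passes through
  it.\<close>

definition labels :: program where
  "labels = Assign 17 (Reg 15 \<ominus> Reg 14 \<oplus> Const 1) ;; clear_labels ;;
     For 11 17 (Assign 18 (Cell 7 (Reg 14 \<oplus> Reg 11)) ;; For 16 20 label_body)"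

definition dev_half :: "nat \<Rightarrow> nat \<Rightarrow> program" where
  "dev_half x y = If (Cell 8 (Reg x) \<prec> Cell 8 (Reg y)) (If (Cell 8 (Reg x) \<prec> Reg 19)
     (If (Reg 2 \<otimes> Cell 4 (Cell 7 (Const 0) \<otimes> Reg 20 \<oplus> Reg 10) \<prec>
          Reg 3 \<otimes> (Reg 13 \<oplus> Cell 104 (Reg 12 \<otimes> Reg 20 \<oplus> Reg x) \<oplus> Cell 6 (Reg 11) \<oplus>
            Cell 104 (Reg y \<otimes> Reg 20 \<oplus> Reg 10))) Skip
       (If ((Reg x \<doteq> Cell 7 (Reg 14 \<oplus> Cell 8 (Reg x))) \<otimes> (Reg y \<doteq> Cell 7 (Reg 14 \<oplus> Cell 8 (Reg x) \<oplus> Const 1)))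
         Skip (Assign 19 (Cell 8 (Reg x))))) Skip) Skip"

text \<open>The start value of register 19 is the last position on the path. No deviation has it as
  label, so it signals that there is none.\<close>

definition first_deviation :: program where
  "first_deviation = Assign 19 (Reg 15 \<ominus> Reg 14) ;;
     For 11 21 (Assign 16 (Cell 20 (Reg 11)) ;; Assign 18 (Cell 21 (Reg 11)) ;; dev_half 16 18 ;; dev_half 18 16)"

definition add_path :: program where
  "add_path = For 11 15 (Store 5 (Cell 9 (Cell 7 (Reg 11) \<otimes> Reg 20 \<oplus> Cell 7 (Reg 11 \<oplus> Const 1)) \<ominus> Const 1) (Const 1))"

definition restrict :: program where
  "restrict = For 11 21 (If (Cell 5 (Reg 11)) (Store 6 (Reg 11) (Cell 2 (Reg 11))) (Store 6 (Reg 11) (Reg 7)))"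

text \<open>Marking nodes in an array lets \<open>block\<close> test each edge in constant
  time.\<close>

definition clear_marks :: program where
  "clear_marks = For 11 20 (Store 16 (Reg 11) (Const 0))"

definition mark :: program where
  "mark = For 11 19 (Store 16 (Cell 7 (Reg 14 \<oplus> Reg 11)) (Const 1))"

definition block :: program where
  "block = For 11 21 (If (Cell 16 (Cell 20 (Reg 11)) \<oplus> Cell 16 (Cell 21 (Reg 11))) (Store 6 (Reg 11) (Reg 7)) Skip)"

text \<open>Register 18 keeps the node of the deviation for the later
  \<open>block_node\<close>.\<close>

definition block_edge :: program where
  "block_edge = Assign 18 (Cell 7 (Reg 14 \<oplus> Reg 19)) ;;
     Store 6 (Cell 9 (Reg 18 \<otimes> Reg 20 \<oplus> Cell 7 (Reg 14 \<oplus> Reg 19 \<oplus> Const 1)) \<ominus> Const 1) (Reg 7) ;;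
     Assign 9 (Reg 9 \<oplus> Reg 19)"

definition block_node :: program where
  "block_node = For 11 21 (If ((Cell 20 (Reg 11) \<doteq> Reg 18) \<oplus> (Cell 21 (Reg 11) \<doteq> Reg 18)) (Store 6 (Reg 11) (Reg 7)) Skip)"

lemma frame_sets_step [simp]:
  "wr label_body = {}" "wa label_body = {8}" "wr clear_labels = {11}" "wa clear_labels = {8}"
  "wr labels = {11, 16, 17, 18}" "wa labels = {8}"
  "wr (dev_half x y) = {19}" "wa (dev_half x y) = {}"
  "wr first_deviation = {11, 16, 18, 19}" "wa first_deviation = {}"
  "wr add_path = {11}" "wa add_path = {5}" "wr restrict = {11}" "wa restrict = {6}"
  "wr clear_marks = {11}" "wa clear_marks = {16}" "wr mark = {11}" "wa mark = {16}"
  "wr block = {11}" "wa block = {6}" "wr block_edge = {9, 18}" "wa block_edge = {6}"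
  "wr block_node = {11}" "wa block_node = {6}"
  by (auto simp: label_body_def clear_labels_def labels_def dev_half_def first_deviation_def add_path_def
      restrict_def clear_marks_def mark_def block_def block_edge_def block_node_def)

context machine
begin

lemma run_clear_labels:
  assumes "base s"
  shows "run B clear_labels s (12 * n + 8) (\<lambda>s'. \<forall>y<n. mem s' 8 y = 0)"
proof -
  have "run B clear_labels s (n * (4 + 8) + 8) (\<lambda>s'. \<forall>y<n. mem s' 8 y = 0)"
    unfolding clear_labels_def
  proof (rule run_For[where I = "\<lambda>j s'. \<forall>i<j. mem s' 8 i = 0"])
    fix j and s' :: state assume "j < n" "\<forall>i<j. mem s' 8 i = 0" "regs s' 11 = j"
    then show "run B (Store 8 (Reg 11) (Const 0)) s' 4
      (\<lambda>s''. \<forall>i<Suc j. mem (s''\<lparr>regs := (regs s'')(11 := Suc j)\<rparr>) 8 i = 0)"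
      by (auto simp: wp_simps less_Suc_eq le_B)
  qed (use base_regs[OF assms] n_less_B in auto)
  then show ?thesis by (rule run_mono) auto
qed

lemma run_labels:
  assumes b: "base s" and l: "length_ok l" and tab: "table s l"
    and r: "regs s 12 = u" "regs s 14 = k" "regs s 15 = k + (length P - 1)" "\<forall>i<length P. mem s 7 (k + i) = P ! i"
    and P: "P \<noteq> []" "P ! 0 = u" "set P \<subseteq> {..<n}" "length P \<le> n" "k < n"
  shows "run B labels s (60 * (n * n) + 60 * n + 40)
    (\<lambda>s'. \<forall>y<n. mem s' 8 y < length P \<and>
      ndist l E u (P ! mem s' 8 y) + ndist l E (P ! mem s' 8 y) y = ndist l E u y \<and>
      (\<forall>j. mem s' 8 y < j \<longrightarrow> j < length P \<longrightarrow> ndist l E u (P ! j) + ndist l E (P ! j) y \<noteq> ndist l E u y))"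
proof -
  let ?d = "ndist l E"
  define C where "C i y \<longleftrightarrow> ?d u (P ! i) + ?d (P ! i) y = ?d u y" for i y
  define lab where "lab j y h \<longleftrightarrow> h < length P \<and> C h y \<and> (\<forall>i. h < i \<longrightarrow> i < j \<longrightarrow> \<not> C i y)" for j y h
  have C0: "C 0 y" for y by (simp add: C_def P(2))
  have Pn: "P ! i < n" if "i < length P" for i using P(3) that nth_mem by blast
  have un: "u < n" using Pn[of 0] P(1,2) by simp
  have Pl: "length P \<ge> 1" "Suc (length P - Suc 0) = length P" using P(1) by (simp_all add: Suc_le_eq)
  let ?c = "Assign 18 (Cell 7 (Reg 14 \<oplus> Reg 11)) ;; For 16 20 label_body"
  let ?s0 = "s\<lparr>regs := (regs s)(17 := length P)\<rparr>"
  have lB: "length P \<le> B" "length P < B" "k + (length P - 1) \<le> B"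
    using P(4,5) n_less_B by (auto intro!: two_n_le_B)
  have "agree B {17} {} s ?s0" using b lB by (auto simp: agree_def base_def all_words_def)
  then have b0: "base ?s0" by (rule base_agree[OF b]) auto
  have loop: "run B (For 11 17 ?c) s1 (length P * ((6 + (n * (30 + 8) + 8)) + 8) + 8) (\<lambda>s'. \<forall>y<n. lab (length P) y (mem s' 8 y))"
    if z: "\<forall>y<n. mem s1 8 y = 0" and ag1: "agree B (wr clear_labels) (wa clear_labels) ?s0 s1" for s1
  proof (rule run_For[where I = "\<lambda>j s'. \<forall>y<n. lab j y (mem s' 8 y)"])
    have b1: "base s1" by (rule base_agree[OF b0 ag1]) auto
    show "regs s1 17 = length P" using agree_reg[OF ag1, of 17] by simp
    show "\<forall>y<n. lab 0 y (mem (s1\<lparr>regs := (regs s1)(11 := 0)\<rparr>) 8 y)" using z C0 P(1) by (simp add: lab_def)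
    fix j s2 assume j: "j < length P" "\<forall>y<n. lab j y (mem s2 8 y)" "regs s2 11 = j"
      and ag2: "agree B (insert 11 (wr ?c)) (wa ?c) s1 s2"
    have b2: "base s2" by (rule base_agree[OF b1 ag2]) auto
    have s2: "regs s2 12 = u" "regs s2 14 = k" "mem s2 7 = mem s 7" "mem s2 104 = mem s 104"
      using r agree_reg[OF ag1] agree_mem[OF ag1] agree_reg[OF ag2] agree_mem[OF ag2] by auto
    let ?s3 = "s2\<lparr>regs := (regs s2)(18 := P ! j)\<rparr>"
    have Pj: "P ! j < n" using Pn j by simp
    have 3: "run B (Assign 18 (Cell 7 (Reg 14 \<oplus> Reg 11))) s2 6 (\<lambda>s'. s' = ?s3)"
      using s2 j r(4) P(4,5) node_le_B[OF Pj] two_n_le_B[of k] two_n_le_B[of j] two_n_le_B[of "k + j"]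
      by (simp add: wp_simps)
    show "run B ?c s2 (6 + (n * (30 + 8) + 8)) (\<lambda>s''. \<forall>y<n. lab (Suc j) y (mem (s''\<lparr>regs := (regs s'')(11 := Suc j)\<rparr>) 8 y))"
    proof (rule run_Seq[OF 3], hypsubst)
      assume ag3: "agree B (wr (Assign 18 (Cell 7 (Reg 14 \<oplus> Reg 11)))) (wa (Assign 18 (Cell 7 (Reg 14 \<oplus> Reg 11)))) s2 ?s3"
      have b3: "base ?s3" by (rule base_agree[OF b2 ag3]) auto
      show "run B (For 16 20 label_body) ?s3 (n * (30 + 8) + 8)
        (\<lambda>s''. \<forall>y<n. lab (Suc j) y (mem (s''\<lparr>regs := (regs s'')(11 := Suc j)\<rparr>) 8 y))"
      proof (rule run_For[where I = "\<lambda>z s'. \<forall>y<n. lab (if y < z then Suc j else j) y (mem s' 8 y)"])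
        show "regs ?s3 20 = n" "n < B" using base_regs[OF b3] n_less_B by auto
        fix z s4 assume z: "z < n" "\<forall>y<n. lab (if y < z then Suc j else j) y (mem s4 8 y)" "regs s4 16 = z"
          and ag4: "agree B (insert 16 (wr label_body)) (wa label_body) ?s3 s4"
        have b4: "base s4" by (rule base_agree[OF b3 ag4]) auto
        have s4: "regs s4 12 = u" "regs s4 18 = P ! j" "mem s4 104 = mem s 104" "regs s4 11 = j"
          using s2 j agree_reg[OF ag4] agree_mem[OF ag4] by auto
        have d: "mem s4 104 (u * n + P ! j) = ?d u (P ! j)" "mem s4 104 (P ! j * n + z) = ?d (P ! j) z"
          "mem s4 104 (u * n + z) = ?d u z"
          using tab s4(3) un Pj z(1) by (auto simp: table_def)
        have "?d u (P ! j) \<le> n * heavy" "?d (P ! j) z \<le> n * heavy" "?d u z \<le> n * heavy"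
          using dist_bound[OF l] un Pj z(1) by auto
        then have "?d u (P ! j) \<le> 5 * (n * heavy)" "?d (P ! j) z \<le> 5 * (n * heavy)" "?d u z \<le> 5 * (n * heavy)"
          "?d u (P ! j) + ?d (P ! j) z \<le> 5 * (n * heavy)" by linarith+
        note db = this[THEN unscaled_le_B]
        have jB: "j \<le> B" using j(1) lB by simp
        have lz: "lab j z (mem s4 8 z)" using z by auto
        define M where "M = (if C j z then (mem s4 8)(z := j) else mem s4 8)"
        have "run B label_body s4 30 (\<lambda>s'. mem s' 8 = M)"
          using s4 z(1,3) d db jB un Pj base_regs(1)[OF b4] B_ge10(3)
          by (simp add: label_body_def wp_simps le_B M_def C_def)
        moreover have "lab (if y < Suc z then Suc j else j) y (M y)" if "y < n" for y
        proof (cases "y = z")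
          case True
          then show ?thesis using lz j(1) by (auto simp: M_def lab_def less_Suc_eq)
        next
          case False
          then show ?thesis using z(2) that by (auto simp: M_def less_Suc_eq)
        qed
        ultimately show "run B label_body s4 30
          (\<lambda>s''. \<forall>y<n. lab (if y < Suc z then Suc j else j) y (mem (s''\<lparr>regs := (regs s'')(16 := Suc z)\<rparr>) 8 y))"
          by (elim run_mono) auto
      qed (use j in auto)
    qed
  qed (use lB in auto)
  have "run B (clear_labels ;; For 11 17 ?c) ?s0 ((12 * n + 8) + (length P * ((6 + (n * (30 + 8) + 8)) + 8) + 8))
    (\<lambda>s'. \<forall>y<n. lab (length P) y (mem s' 8 y))"
    by (rule run_Seq[OF run_clear_labels[OF b0] loop])
  then have "run B labels s (1 + cost (Reg 15 \<ominus> Reg 14 \<oplus> Const 1) + ((12 * n + 8) + (length P * ((6 + (n * (30 + 8) + 8)) + 8) + 8)))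
    (\<lambda>s'. \<forall>y<n. lab (length P) y (mem s' 8 y))"
    unfolding labels_def using r lB B_ge10 Pl two_n_le_B[of k] P(5) by (intro run_Assign_Seq) auto
  moreover have "length P * ((6 + (n * (30 + 8) + 8)) + 8) \<le> n * ((6 + (n * (30 + 8) + 8)) + 8)"
    using P(4) by (intro mult_right_mono) auto
  ultimately show ?thesis
    by (elim run_mono) (auto simp: lab_def C_def algebra_simps)
qed

lemma run_dev_half:
  assumes b: "base s" and D: "dist_ok s" and l: "length_ok l" and tab: "table s l"
    and r: "regs s 10 = t" "regs s 11 = i" "regs s 12 = u" "regs s 13 = c" "regs s 14 = k" "mem s 7 0 = u0"
      "regs s x = x'" "regs s y = y'" "mem s 6 i = l (ed i)" "\<forall>i<length P. mem s 7 (k + i) = P ! i"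
    and h: "\<And>y. y < n \<Longrightarrow> mem s 8 y = h y \<and> h y < length P"
    and bd: "length P \<le> n" "k < n" "u0 < n" "t < n" "u < n" "x' < n" "y' < n" "i < m" "c \<le> n * heavy"
  shows "run B (dev_half x y) s 80 (\<lambda>s'. regs s' 19 =
    (if h x' < h y' \<and> sd * (c + ndist l E u x' + l (ed i) + ndist l E y' t) \<le> sn * d0 u0 t \<and>
        \<not> (x' = P ! h x' \<and> y' = P ! Suc (h x')) then min (regs s 19) (h x') else regs s 19))"
proof -
  let ?d = "ndist l E"
  note bs = base_regs[OF b]
  have "?d u x' \<le> n * heavy" "?d y' t \<le> n * heavy" and d0b: "d0 u0 t \<le> n * heavy"
    using dist_bound[OF l] d0_bound bd by auto
  moreover have "l (ed i) \<le> heavy" using l ed_mem[OF bd(8)] by (auto simp: length_ok_def)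
  ultimately have
    "?d u x' \<le> 5 * (n * heavy)" "?d y' t \<le> 5 * (n * heavy)" "d0 u0 t \<le> 5 * (n * heavy)" "l (ed i) \<le> 5 * (n * heavy)"
    "c + ?d u x' \<le> 5 * (n * heavy)" "c + ?d u x' + l (ed i) \<le> 5 * (n * heavy)" "c \<le> 5 * (n * heavy)"
    and sum: "c + ?d u x' + l (ed i) + ?d y' t \<le> 5 * (n * heavy)"
    using heavy_le bd(9) by linarith+
  note B1 = this(1-8)[THEN unscaled_le_B]
  have B2: "sd * (c + ?d u x' + l (ed i) + ?d y' t) \<le> B" "sn * d0 u0 t \<le> B" "sn \<le> B" "sd \<le> B" "Suc 0 \<le> B"
    using scaled_le_B[OF sum] bound_le_B[OF d0b] bs(9)[of 2] bs(9)[of 3] bs(3,4) B_ge10 by auto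
  have hx: "mem s 8 x' = h x'" "h x' < length P" "mem s 8 y' = h y'" "h y' < length P" using h bd by auto
  have d: "mem s 4 (u0 * n + t) = d0 u0 t" "mem s 104 (u * n + x') = ?d u x'" "mem s 104 (y' * n + t) = ?d y' t"
    using D tab bd by (auto simp: dist_ok_def table_def)
  have kh: "mem s 7 (k + h x') = P ! h x'" using r(10) hx by simp
  have kB: "k \<le> B" "h x' \<le> B" "h y' \<le> B" "k + h x' \<le> B" "Suc (k + h x') \<le> B" using hx bd by (auto intro!: two_n_le_B)
  have mB: "mem s 7 j \<le> B" "regs s j \<le> B" "P ! h x' \<le> B" for j using bs(9,10) kh by (auto, metis bs(10))
  have tB: "t \<le> B" "u \<le> B" "u0 \<le> B" "x' \<le> B" "y' \<le> B" "i \<le> B" using bd by (auto simp: le_B)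
  note facts = r(1-9) bs(1,3,4) hx d kh kB mB tB B1 B2 bd
  show ?thesis
  proof (cases "h x' < h y'")
    case True
    then have suc: "mem s 7 (Suc (k + h x')) = P ! Suc (h x')" using r(10) hx(4) by (metis Suc_lessI add_Suc_right less_trans_Suc)
    then have "P ! Suc (h x') \<le> B" using mB(1)[of "Suc (k + h x')"] by simp
    define p1 where "p1 = P ! h x'"
    define p2 where "p2 = P ! Suc (h x')"
    note suc = suc \<open>P ! Suc (h x') \<le> B\<close>
    show ?thesis
      unfolding p1_def[symmetric] p2_def[symmetric]
      by (cases "h x' < regs s 19"; cases "sn * d0 u0 t < sd * (c + ?d u x' + l (ed i) + ?d y' t)")
        (use True in \<open>simp_all add: dev_half_def wp_simps facts[folded p1_def] suc[folded p2_def] le_B min_def not_less\<close>,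
          use hx(1) kB(2) in auto)
  next
    case False
    then show ?thesis by (simp add: dev_half_def wp_simps facts)
  qed
qed

text \<open>Candidates are directed, so both orientations of every edge are examined. By
  \<open>completions_deviation\<close> the least label found is the first position at which
  completions differ.\<close>

lemma run_first_deviation:
  assumes e: "env s" and l: "length_ok l" "\<forall>i<m. mem s 6 i = l (ed i)" and tab: "table s l"
    and r: "regs s 10 = t" "regs s 12 = u" "regs s 13 = c" "regs s 14 = k" "mem s 7 0 = u0"
      "regs s 15 = k + (length P - 1)" "\<forall>i<length P. mem s 7 (k + i) = P ! i"
    and h: "\<And>y. y < n \<Longrightarrow> mem s 8 y = h y \<and> h y < length P"
    and bd: "length P \<le> n" "k < n" "u0 < n" "t < n" "u < n" "c \<le> n * heavy"
    and cand: "\<And>x y. cand x y \<longleftrightarrow> {x, y} \<in> E \<and> h x < h y \<and>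
        sd * (c + ndist l E u x + l {x, y} + ndist l E y t) \<le> sn * d0 u0 t \<and> \<not> (x = P ! h x \<and> y = P ! Suc (h x))"
  shows "run B first_deviation s (190 * m + 20) (\<lambda>s'.
    (regs s' 19 = length P - 1 \<or> (\<exists>x y. cand x y \<and> regs s' 19 = h x)) \<and>
    (\<forall>x y. cand x y \<longrightarrow> regs s' 19 \<le> h x))"
proof -
  define J where "J j s' \<longleftrightarrow> (regs s' 19 = length P - 1 \<or> (\<exists>x y. cand x y \<and> regs s' 19 = h x)) \<and>
    (\<forall>i<j. (cand (eu i) (ev i) \<longrightarrow> regs s' 19 \<le> h (eu i)) \<and> (cand (ev i) (eu i) \<longrightarrow> regs s' 19 \<le> h (ev i)))"
    for j and s' :: state
  let ?c = "Assign 16 (Cell 20 (Reg 11)) ;; Assign 18 (Cell 21 (Reg 11)) ;; dev_half 16 18 ;; dev_half 18 16"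
  let ?s0 = "s\<lparr>regs := (regs s)(19 := length P - 1)\<rparr>"
  have lB: "length P - 1 \<le> B" "k + (length P - 1) \<le> B" "k \<le> B" using bd by (auto intro!: two_n_le_B)
  have "agree B {19} {} s ?s0" using env_base[OF e] lB by (auto simp: agree_def base_def all_words_def)
  then have e0: "env ?s0" by (rule env_agree[OF e]) auto
  have "run B (For 11 21 ?c) ?s0 (m * ((1 + cost (Cell 20 (Reg 11)) + (1 + cost (Cell 21 (Reg 11)) + (80 + 80))) + 8) + 8) (J m)"
  proof (rule run_For[where I = J])
    show "regs ?s0 21 = m" "m < B" using base_regs[OF env_base[OF e0]] m_less_B by auto
    show "J 0 (?s0\<lparr>regs := (regs ?s0)(11 := 0)\<rparr>)" by (simp add: J_def)
    fix j s' assume j: "j < m" "J j s'" "regs s' 11 = j" and ag: "agree B (insert 11 (wr ?c)) (wa ?c) ?s0 s'"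
    have e': "env s'" by (rule env_agree[OF e0 ag]) auto
    note b' = base_regs[OF env_base[OF e']]
    define x where "x = eu j"
    define y where "y = ev j"
    have xy: "x < n" "y < n" "ed j = {x, y}" "ed j = {y, x}" using ed_nodes[OF j(1)] by (auto simp: x_def y_def)
    have xyE: "{x, y} \<in> E" "{y, x} \<in> E" using ed_mem[OF j(1)] xy(3,4) by simp_all
    let ?s1 = "s'\<lparr>regs := (regs s')(16 := x, 18 := y)\<rparr>"
    have "agree B {16, 18} {} s' ?s1" using env_base[OF e'] xy by (auto simp: agree_def base_def all_words_def le_B)
    then have e1: "env ?s1" by (rule env_agree[OF e']) auto
    have f: "regs s' 10 = t" "regs s' 12 = u" "regs s' 13 = c" "regs s' 14 = k" "mem s' 7 = mem s 7"
      "mem s' 6 = mem s 6" "mem s' 8 = mem s 8" "mem s' 104 = mem s 104"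
      using r agree_reg[OF ag] agree_mem[OF ag] by auto
    have c1: "cand x y \<longleftrightarrow> h x < h y \<and> sd * (c + ndist l E u x + l (ed j) + ndist l E y t) \<le> sn * d0 u0 t \<and>
        \<not> (x = P ! h x \<and> y = P ! Suc (h x))" using xyE unfolding cand xy(3) by blast
    have c2: "cand y x \<longleftrightarrow> h y < h x \<and> sd * (c + ndist l E u y + l (ed j) + ndist l E x t) \<le> sn * d0 u0 t \<and>
        \<not> (y = P ! h y \<and> x = P ! Suc (h y))" using xyE unfolding cand xy(4) by blast
    have r19: "regs ?s1 19 = regs s' 19" by simp
    define r1 where "r1 = (if cand x y then min (regs s' 19) (h x) else regs s' 19)"
    have 1: "run B (dev_half 16 18) ?s1 80 (\<lambda>s2. regs s2 19 = r1)"
    proof (rule run_mono[OF run_dev_half[where l = l and P = P and h = h and t = t and i = j and u = u and c = c and k = k and ?u0.0 = u0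
            and x' = x and y' = y]])
      fix s2 assume "regs s2 19 = (if h x < h y \<and> sd * (c + ndist l E u x + l (ed j) + ndist l E y t) \<le> sn * d0 u0 t \<and>
        \<not> (x = P ! h x \<and> y = P ! Suc (h x)) then min (regs ?s1 19) (h x) else regs ?s1 19)"
      then show "regs s2 19 = r1" unfolding r1_def c1 r19 .
    qed (use e1 f r l tab bd h xy j in \<open>auto simp: env_def table_def\<close>)
    have 2: "run B (dev_half 18 16) s2 80 (\<lambda>s3. regs s3 19 = (if cand y x then min r1 (h y) else r1))"
      if s2: "regs s2 19 = r1" "agree B (wr (dev_half 16 18)) (wa (dev_half 16 18)) ?s1 s2" for s2
    proof -
      have e2: "env s2" by (rule env_agree[OF e1 s2(2)]) auto
      have f2: "regs s2 10 = t" "regs s2 11 = j" "regs s2 12 = u" "regs s2 13 = c" "regs s2 14 = k" "mem s2 7 = mem s 7"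
        "mem s2 6 = mem s 6" "mem s2 8 = mem s 8" "mem s2 104 = mem s 104" "regs s2 16 = x" "regs s2 18 = y"
        using f j(3) agree_reg[OF s2(2)] agree_mem[OF s2(2)] by auto
      show ?thesis
      proof (rule run_mono[OF run_dev_half[where l = l and P = P and h = h and t = t and i = j and u = u and c = c and k = k and ?u0.0 = u0
            and x' = y and y' = x]])
        fix s3 assume "regs s3 19 = (if h y < h x \<and> sd * (c + ndist l E u y + l (ed j) + ndist l E x t) \<le> sn * d0 u0 t \<and>
          \<not> (y = P ! h y \<and> x = P ! Suc (h y)) then min (regs s2 19) (h y) else regs s2 19)"
        then show "regs s3 19 = (if cand y x then min r1 (h y) else r1)" unfolding c2 s2(1) .
      qed (use e2 f2 r l tab bd h xy j in \<open>auto simp: env_def table_def\<close>)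
    qed
    have "run B (dev_half 16 18 ;; dev_half 18 16) ?s1 (80 + 80) (\<lambda>s''. J (Suc j) (s''\<lparr>regs := (regs s'')(11 := Suc j)\<rparr>))"
    proof (rule run_Seq[OF 1])
      fix s2 assume s2: "regs s2 19 = r1" "agree B (wr (dev_half 16 18)) (wa (dev_half 16 18)) ?s1 s2"
      show "run B (dev_half 18 16) s2 80 (\<lambda>s''. J (Suc j) (s''\<lparr>regs := (regs s'')(11 := Suc j)\<rparr>))"
      proof (rule run_mono[OF 2[OF s2]])
        fix s3 :: state assume s3: "regs s3 19 = (if cand y x then min r1 (h y) else r1)"
        then have le: "regs s3 19 \<le> regs s' 19" "cand x y \<Longrightarrow> regs s3 19 \<le> h x" "cand y x \<Longrightarrow> regs s3 19 \<le> h y"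
          by (auto simp: r1_def)
        have "regs s3 19 = regs s' 19 \<or> cand x y \<and> regs s3 19 = h x \<or> cand y x \<and> regs s3 19 = h y"
          using s3 by (auto simp: r1_def min_def)
        then have "regs s3 19 = length P - 1 \<or> (\<exists>x y. cand x y \<and> regs s3 19 = h x)"
          using j(2) unfolding J_def by metis
        moreover have "(cand (eu i) (ev i) \<longrightarrow> regs s3 19 \<le> h (eu i)) \<and> (cand (ev i) (eu i) \<longrightarrow> regs s3 19 \<le> h (ev i))"
          if "i < Suc j" for i
        proof (cases "i = j")
          case True
          then show ?thesis using le(2,3) by (simp add: x_def y_def)
        next
          case False
          then show ?thesis using j(2) that le(1) unfolding J_def by (meson less_SucE order_trans)
        qed
        ultimately show "J (Suc j) (s3\<lparr>regs := (regs s3)(11 := Suc j)\<rparr>)" unfolding J_def by simp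
      qed simp
    qed
    then show "run B ?c s' (1 + cost (Cell 20 (Reg 11)) + (1 + cost (Cell 21 (Reg 11)) + (80 + 80)))
        (\<lambda>s''. J (Suc j) (s''\<lparr>regs := (regs s'')(11 := Suc j)\<rparr>))"
      using b'(11,12)[OF j(1)] j(1,3) xy by (intro run_Assign_Seq) (auto simp: le_B x_def y_def)
  qed auto
  then have "run B first_deviation s (1 + cost (Reg 15 \<ominus> Reg 14) + (m * ((1 + cost (Cell 20 (Reg 11)) + (1 + cost (Cell 21 (Reg 11)) + (80 + 80))) + 8) + 8)) (J m)"
    unfolding first_deviation_def using r lB by (intro run_Assign_Seq) auto
  then show ?thesis
  proof (rule run_mono)
    fix s' assume J: "J m s'"
    have "regs s' 19 \<le> h x" if c: "cand x y" for x y
    proof -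
      have "{x, y} \<in> E" using c by (simp add: cand)
      then obtain i where i: "i < m" "{x, y} = ed i" by (rule edE)
      then have "x = eu i \<and> y = ev i \<or> x = ev i \<and> y = eu i" by (auto simp: doubleton_eq_iff)
      then show ?thesis using J i(1) c unfolding J_def by metis
    qed
    with J show "(regs s' 19 = length P - 1 \<or> (\<exists>x y. cand x y \<and> regs s' 19 = h x)) \<and> (\<forall>x y. cand x y \<longrightarrow> regs s' 19 \<le> h x)"
      unfolding J_def by blast
  qed simp
qed

end

definition unique_step :: program where
  "unique_step = add_path ;; restrict ;; Assign 9 (Const 0) ;; push"

text \<open>
  The first child keeps the prefix up to the node at which a second completion leaves the shortest one
  and forbids the next edge of the shortest one; the second child appends that edge. The edges
  at the nodes that became inner nodes of the prefix are blocked, which keeps the paths simple.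
\<close>

definition split_step :: program where
  "split_step = clear_marks ;; mark ;; block ;; block_edge ;; push ;; block_node ;; Assign 9 (Reg 9 \<oplus> Const 1) ;; push"

definition path_step :: program where
  "path_step = prefix_length ;; shortest_path_search ;; labels ;; first_deviation ;;
     If (Reg 19 \<doteq> Reg 15 \<ominus> Reg 14) unique_step split_step"

lemma append_tl: "xs \<noteq> [] \<Longrightarrow> ys \<noteq> [] \<Longrightarrow> hd ys = last xs \<Longrightarrow> xs @ tl ys = butlast xs @ ys"
  by (metis append.assoc append_Cons append_Nil append_butlast_last_id list.collapse)

context spanner
begin

text \<open>A path item has some completion, and a shortest path is no longer than that one.\<close>

lemma shortest_completion:
  assumes p: "path_item F l \<pi> t" and P: "simple_path E (last \<pi>) t P" "path_length l P = ndist l E (last \<pi>) t"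
  shows "P \<in> completions l \<pi> t"
proof -
  obtain R where R: "R \<in> completions l \<pi> t" using p by (auto simp: path_item_def)
  then have "path_length l P \<le> path_length l R"
    using P ndist_le_walk[of "last \<pi>" t R l] by (auto simp: completions_def simple_path_iff_walk)
  then have "sd * (path_length len0 \<pi> + path_length l P) \<le> sd * (path_length len0 \<pi> + path_length l R)" by simp
  also have "\<dots> \<le> sn * d0 (hd \<pi>) t" using R by (simp add: completions_def)
  finally show ?thesis using P by (simp add: completions_def)
qed

text \<open>A completion that avoids the edge of \<open>P\<close> at position \<open>j\<close>
  yields a candidate of label at most \<open>j\<close>, so before the least label \<open>a\<close>
  all completions follow \<open>P\<close>. Conversely, the candidate attaining \<open>a\<close>
  yields a completion that avoids the edge there.\<close>

lemma completions_deviation: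
  assumes p: "path_item F l \<pi> t" and sp: "shortest_path n E l (last \<pi>) t P h"
    and cand: "\<And>x y. cand x y \<longleftrightarrow> {x, y} \<in> E \<and> h x < h y \<and>
        sd * (path_length len0 \<pi> + ndist l E (last \<pi>) x + l {x, y} + ndist l E y t) \<le> sn * d0 (hd \<pi>) t \<and>
        \<not> (x = P ! h x \<and> y = P ! Suc (h x))"
    and a1: "a = length P - 1 \<or> (\<exists>x y. cand x y \<and> a = h x)" and a2: "\<forall>x y. cand x y \<longrightarrow> a \<le> h x"
  shows "a = length P - 1 \<Longrightarrow> completions l \<pi> t = {P}"
    and "a \<noteq> length P - 1 \<Longrightarrow> Suc a < length P \<and>
      (\<forall>R\<in>completions l \<pi> t. take (Suc a) R = take (Suc a) P \<and>
        ({P ! a, P ! Suc a} \<in> set (path_edges R) \<longrightarrow> take (Suc (Suc a)) R = take (Suc (Suc a)) P)) \<and>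
      (\<exists>Q\<in>completions l \<pi> t. {P ! a, P ! Suc a} \<notin> set (path_edges Q))"
proof -
  interpret shortest_path n E l "last \<pi>" t P h by (rule sp)
  note a = a1 a2[rule_format]
  let ?C = "completions l \<pi> t"
  have Pc: "P \<in> ?C" using shortest_completion[OF p P] .
  have edge: "{P ! j, P ! Suc j} \<in> set (path_edges R)"
    if R: "R \<in> ?C" and j: "Suc j < length P" and no: "\<And>x y. cand x y \<Longrightarrow> j < h x" for R j
  proof (rule ccontr)
    assume "{P ! j, P ! Suc j} \<notin> set (path_edges R)"
    moreover have "walk E (last \<pi>) t R" using R by (simp add: completions_def simple_path_iff_walk)
    ultimately obtain x y where xy: "deviating x y" "h x \<le> j" "d (last \<pi>) x + l {x, y} + d y t \<le> path_length l R"
      using avoiding_imp_deviating[OF _ j] by metis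
    then have "sd * (path_length len0 \<pi> + d (last \<pi>) x + l {x, y} + d y t) \<le> sd * (path_length len0 \<pi> + path_length l R)"
      by simp
    also have "\<dots> \<le> sn * d0 (hd \<pi>) t" using R by (simp add: completions_def)
    finally have "cand x y" using xy(1) by (simp add: cand)
    with no xy(2) show False by fastforce
  qed
  have R_sp: "simple_path E (last \<pi>) t R" if "R \<in> ?C" for R using that by (simp add: completions_def)
  have h_less: "h x < length P - 1" if "cand x y" for x y
  proof -
    have "h x < h y" "y < n" using that edge_nodes by (auto simp: cand)
    with h[of y] show ?thesis by linarith
  qed
  show "?C = {P}" if "a = length P - 1"
  proof -
    have none: "\<not> cand x y" for x y using a(2) h_less that by fastforce
    have "R = P" if R: "R \<in> ?C" for R
    proof -
      have e: "{P ! j, P ! Suc j} \<in> set (path_edges R)" if "j < length P - 1" for j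
        using edge[OF R, of j] none that by simp
      have L: "length P - 1 < length P" "Suc (length P - 1) = length P" using P_ends(4) by simp_all
      have "take (length P) R = P" using common_prefix(2)[OF R_sp[OF R] L(1) e] unfolding L(2) by simp
      then obtain R' where R': "R = P @ R'" using append_take_drop_id[of "length P" R] by metis
      \<comment> \<open>\<open>P\<close> already ends in \<open>t\<close>, so a longer simple path
        would visit \<open>t\<close> twice.\<close>
      have "R' = []"
      proof (rule ccontr)
        assume "R' \<noteq> []"
        then have "t \<in> set R'" using R_sp[OF R] R' by (auto simp: simple_path_def)
        moreover have "t \<in> set P" using P(1) by (auto simp: simple_path_def)
        ultimately show False using R_sp[OF R] R' by (auto simp: simple_path_def)
      qed
      with R' show ?thesis by simp
    qed
    with Pc show ?thesis by blast
  qed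
  assume ne: "a \<noteq> length P - 1"
  then obtain x y where xy: "cand x y" "a = h x" using a(1) by blast
  have aP: "Suc a < length P" using h_less[OF xy(1)] xy(2) by simp
  moreover have "take (Suc a) R = take (Suc a) P \<and>
      ({P ! a, P ! Suc a} \<in> set (path_edges R) \<longrightarrow> take (Suc (Suc a)) R = take (Suc (Suc a)) P)" if R: "R \<in> ?C" for R
  proof -
    have *: "{P ! j, P ! Suc j} \<in> set (path_edges R)" if "j < a" for j
    proof (rule edge[OF R])
      show "Suc j < length P" using that aP by simp
      show "j < h x" if "cand x y" for x y using a(2)[OF that] \<open>j < a\<close> by simp
    qed
    have **: "{P ! j, P ! Suc j} \<in> set (path_edges R)" if "{P ! a, P ! Suc a} \<in> set (path_edges R)" "j < Suc a" for j
      using *[of j] that by (cases "j = a") auto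
    have "a < length P" using aP by simp
    from common_prefix(2)[OF R_sp[OF R] this *] common_prefix(2)[OF R_sp[OF R] aP **]
    show ?thesis by blast
  qed
  moreover have "\<exists>Q\<in>?C. {P ! a, P ! Suc a} \<notin> set (path_edges Q)"
  proof -
    have "deviating x y" using xy(1) by (simp add: cand)
    then obtain Q where Q: "simple_path E (last \<pi>) t Q" "path_length l Q \<le> d (last \<pi>) x + l {x, y} + d y t"
      "{P ! h x, P ! Suc (h x)} \<notin> set (path_edges Q)" by (rule deviating_imp_avoiding)
    have "sd * (path_length len0 \<pi> + path_length l Q) \<le> sd * (path_length len0 \<pi> + d (last \<pi>) x + l {x, y} + d y t)"
      using Q(2) by simp
    also have "\<dots> \<le> sn * d0 (hd \<pi>) t" using xy(1) by (simp add: cand)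
    finally show ?thesis using Q xy(2) by (auto simp: completions_def)
  qed
  ultimately show "Suc a < length P \<and>
      (\<forall>R\<in>completions l \<pi> t. take (Suc a) R = take (Suc a) P \<and>
        ({P ! a, P ! Suc a} \<in> set (path_edges R) \<longrightarrow> take (Suc (Suc a)) R = take (Suc (Suc a)) P)) \<and>
      (\<exists>Q\<in>completions l \<pi> t. {P ! a, P ! Suc a} \<notin> set (path_edges Q))" by blast
qed

end

context machine
begin

lemma small_le_B: "Suc 0 \<le> B" "Suc (Suc 0) \<le> B"
  using B_ge10 by simp_all

lemma run_add_path:
  assumes e: "env s" and F: "\<forall>i<m. mem s 5 i = (if ed i \<in> F then 1 else 0)"
    and p: "walk E u v p" "u < n" "length p \<le> n" "length p = Suc (regs s 15)" "\<forall>i<length p. mem s 7 i = p ! i"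
  shows "run B add_path s (40 * n + 8) (\<lambda>s'. \<forall>i<m. mem s' 5 i = (if ed i \<in> F \<union> set (path_edges p) then 1 else 0))"
proof -
  let ?c = "Store 5 (Cell 9 (Cell 7 (Reg 11) \<otimes> Reg 20 \<oplus> Cell 7 (Reg 11 \<oplus> Const 1)) \<ominus> Const 1) (Const 1)"
  have nodes: "p ! i < n" if "i < length p" for i using walk_nodes[OF p(1,2)] that by (auto simp: subset_iff)
  have "run B (For 11 15 ?c) s (regs s 15 * (20 + 8) + 8)
    (\<lambda>s'. \<forall>i<m. mem s' 5 i = (if ed i \<in> F \<union> set (path_edges p) then 1 else 0))"
  proof (rule run_For[where I = "\<lambda>j s'. \<forall>i<m. mem s' 5 i = (if ed i \<in> F \<union> set (path_edges (take (Suc j) p)) then 1 else 0)"])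
    show "regs s 15 < B" using p(3,4) n_less_B by simp
    have "path_edges (take (Suc 0) p) = []" by (cases p) auto
    then show "\<forall>i<m. mem (s\<lparr>regs := (regs s)(11 := 0)\<rparr>) 5 i = (if ed i \<in> F \<union> set (path_edges (take (Suc 0) p)) then 1 else 0)"
      using F by simp
    fix j and s' :: state assume j: "j < regs s 15" "\<forall>i<m. mem s' 5 i = (if ed i \<in> F \<union> set (path_edges (take (Suc j) p)) then 1 else 0)"
      "regs s' 11 = j" and ag: "agree B (insert 11 (wr ?c)) (wa ?c) s s'"
    have e': "env s'" by (rule env_agree[OF e ag]) auto
    have j': "Suc j < length p" using j p(4) by simp
    have xy: "{p ! j, p ! Suc j} \<in> E" using path_edges_nth[OF j'] p(1) by (auto simp: walk_def)
    have "adj_ok s'" using e' by (simp add: env_def)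
    from adjacent_index[OF this xy] obtain i where i: "i < m" "ed i = {p ! j, p ! Suc j}"
      "mem s' 9 (p ! j * n + p ! Suc j) = Suc i" .
    have m7: "mem s' 7 j = p ! j" "mem s' 7 (Suc j) = p ! Suc j" using agree_mem[OF ag, of 7] p(5) j' by auto
    have "run B ?c s' 20 (\<lambda>s''. mem s'' 5 = (mem s' 5)(i := 1))"
      using j(3) m7 i j' p(3) nodes[of j] nodes[of "Suc j"] base_regs(1)[OF env_base[OF e']] two_n_le_B[of j] two_n_le_B[of "Suc j"] B_ge10
      by (simp add: wp_simps le_B)
    moreover have "i' < m \<Longrightarrow> ((mem s' 5)(i := 1)) i' = (if ed i' \<in> F \<union> set (path_edges (take (Suc (Suc j)) p)) then 1 else 0)" for i'
      using j(2) i ed_eq_iff[of i' i] path_edges_take_Suc[OF j'] by auto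
    ultimately show "run B ?c s' 20 (\<lambda>s''. \<forall>i<m. mem (s''\<lparr>regs := (regs s'')(11 := Suc j)\<rparr>) 5 i =
        (if ed i \<in> F \<union> set (path_edges (take (Suc (Suc j)) p)) then 1 else 0))"
      by (elim run_mono) auto
  next
    fix s' :: state
    assume "\<forall>i<m. mem s' 5 i = (if ed i \<in> F \<union> set (path_edges (take (Suc (regs s 15)) p)) then 1 else 0)"
    then show "\<forall>i<m. mem s' 5 i = (if ed i \<in> F \<union> set (path_edges p) then 1 else 0)" using p(4) by simp
  qed auto
  moreover have "regs s 15 * 28 \<le> n * 28" using p(3,4) by (intro mult_right_mono) auto
  ultimately show ?thesis unfolding add_path_def by (elim run_mono) auto
qed

lemma run_restrict:
  assumes b: "base s" and F: "\<forall>i<m. mem s 5 i = (if ed i \<in> F then 1 else 0)"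
  shows "run B restrict s (20 * m + 8) (\<lambda>s'. \<forall>i<m. mem s' 6 i = restricted F (ed i))"
proof -
  let ?c = "If (Cell 5 (Reg 11)) (Store 6 (Reg 11) (Cell 2 (Reg 11))) (Store 6 (Reg 11) (Reg 7))"
  have "run B restrict s (m * (12 + 8) + 8) (\<lambda>s'. \<forall>i<m. mem s' 6 i = restricted F (ed i))"
    unfolding restrict_def
  proof (rule run_For[where I = "\<lambda>j s'. \<forall>i<j. mem s' 6 i = restricted F (ed i)"])
    fix j and s' :: state assume j: "j < m" "\<forall>i<j. mem s' 6 i = restricted F (ed i)" "regs s' 11 = j"
      and ag: "agree B (insert 11 (wr ?c)) (wa ?c) s s'"
    note b' = base_regs[OF base_agree[OF b ag]]
    have "mem s' 5 j = (if ed j \<in> F then 1 else 0)" using F j agree_mem[OF ag, of 5] by simp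
    then show "run B ?c s' 12 (\<lambda>s''. \<forall>i<Suc j. mem (s''\<lparr>regs := (regs s'')(11 := Suc j)\<rparr>) 6 i = restricted F (ed i))"
      using j b'(7,13) B_ge10 by (auto simp: wp_simps less_Suc_eq le_B restricted_def el_def[symmetric])
  qed (use base_regs[OF b] m_less_B in auto)
  then show ?thesis by (rule run_mono) auto
qed

lemma run_marks:
  assumes b: "base s" and r: "regs s 19 = a" "regs s 14 = k" "\<forall>i<length P. mem s 7 (k + i) = P ! i"
    and a: "a \<le> length P" "length P \<le> n" "k < n" "set P \<subseteq> {..<n}"
  shows "run B (clear_marks ;; mark) s (30 * n + 20) (\<lambda>s'. \<forall>y<n. mem s' 16 y = (if y \<in> set (take a P) then 1 else 0))"
proof -
  have 1: "run B clear_marks s (n * (4 + 8) + 8) (\<lambda>s'. \<forall>y<n. mem s' 16 y = 0)"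
    unfolding clear_marks_def
  proof (rule run_For[where I = "\<lambda>j s'. \<forall>i<j. mem s' 16 i = 0"])
    fix j and s' :: state assume "j < n" "\<forall>i<j. mem s' 16 i = 0" "regs s' 11 = j"
    then show "run B (Store 16 (Reg 11) (Const 0)) s' 4
      (\<lambda>s''. \<forall>i<Suc j. mem (s''\<lparr>regs := (regs s'')(11 := Suc j)\<rparr>) 16 i = 0)"
      by (auto simp: wp_simps less_Suc_eq le_B)
  qed (use base_regs[OF b] n_less_B in auto)
  let ?c = "Store 16 (Cell 7 (Reg 14 \<oplus> Reg 11)) (Const 1)"
  have 2: "run B mark s1 (a * (10 + 8) + 8) (\<lambda>s'. \<forall>y<n. mem s' 16 y = (if y \<in> set (take a P) then 1 else 0))"
    if z: "\<forall>y<n. mem s1 16 y = 0" and ag1: "agree B (wr clear_marks) (wa clear_marks) s s1" for s1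
    unfolding mark_def
  proof (rule run_For[where I = "\<lambda>j s'. \<forall>y<n. mem s' 16 y = (if y \<in> set (take j P) then 1 else 0)"])
    show "regs s1 19 = a" "a < B" using agree_reg[OF ag1, of 19] r a n_less_B by auto
    fix j and s' :: state assume j: "j < a" "\<forall>y<n. mem s' 16 y = (if y \<in> set (take j P) then 1 else 0)" "regs s' 11 = j"
      and ag: "agree B (insert 11 (wr ?c)) (wa ?c) s1 s'"
    have s': "regs s' 14 = k" "mem s' 7 = mem s 7"
      using r agree_reg[OF ag1] agree_mem[OF ag1] agree_reg[OF ag] agree_mem[OF ag] by auto
    have jP: "j < length P" using j a by simp
    then have "P ! j < n" using a(4) nth_mem by blast
    then have "run B ?c s' 10 (\<lambda>s''. mem s'' 16 = (mem s' 16)(P ! j := 1))"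
      using j s' r(3) jP a two_n_le_B[of k] two_n_le_B[of j] two_n_le_B[of "k + j"] B_ge10 small_le_B by (simp add: wp_simps le_B)
    then show "run B ?c s' 10 (\<lambda>s''. \<forall>y<n. mem (s''\<lparr>regs := (regs s'')(11 := Suc j)\<rparr>) 16 y =
        (if y \<in> set (take (Suc j) P) then 1 else 0))"
      using j(2) jP by (elim run_mono) (auto simp: take_Suc_conv_app_nth)
  qed (use z in auto)
  have "a * 18 \<le> n * 18" using a by (intro mult_right_mono) auto
  moreover have "run B (clear_marks ;; mark) s ((n * (4 + 8) + 8) + (a * (10 + 8) + 8))
    (\<lambda>s'. \<forall>y<n. mem s' 16 y = (if y \<in> set (take a P) then 1 else 0))"
    by (rule run_Seq[OF 1 2])
  ultimately show ?thesis by (elim run_mono) auto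
qed

lemma run_block:
  assumes b: "base s" and X: "\<forall>i<m. mem s 6 i = l (ed i)" and S: "\<forall>y<n. mem s 16 y = (if y \<in> S then 1 else 0)"
  shows "run B block s (30 * m + 8) (\<lambda>s'. \<forall>i<m. mem s' 6 i = (if ed i \<inter> S \<noteq> {} then heavy else l (ed i)))"
proof -
  let ?c = "If (Cell 16 (Cell 20 (Reg 11)) \<oplus> Cell 16 (Cell 21 (Reg 11))) (Store 6 (Reg 11) (Reg 7)) Skip"
  have "run B block s (m * (20 + 8) + 8) (\<lambda>s'. \<forall>i<m. mem s' 6 i = (if ed i \<inter> S \<noteq> {} then heavy else l (ed i)))"
    unfolding block_def
  proof (rule run_For[where I = "\<lambda>j s'. \<forall>i<m. mem s' 6 i = (if i < j \<and> ed i \<inter> S \<noteq> {} then heavy else l (ed i))"])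
    fix j and s' :: state assume j: "j < m" "\<forall>i<m. mem s' 6 i = (if i < j \<and> ed i \<inter> S \<noteq> {} then heavy else l (ed i))"
      "regs s' 11 = j" and ag: "agree B (insert 11 (wr ?c)) (wa ?c) s s'"
    note b' = base_regs[OF base_agree[OF b ag]]
    have "mem s' 16 (eu j) = (if eu j \<in> S then 1 else 0)" "mem s' 16 (ev j) = (if ev j \<in> S then 1 else 0)"
      using S ed_nodes[OF j(1)] agree_mem[OF ag, of 16] by auto
    then have "run B ?c s' 20 (\<lambda>s''. mem s'' 6 = (if ed j \<inter> S \<noteq> {} then (mem s' 6)(j := heavy) else mem s' 6))"
      using j(1,3) b'(7,11,12) ed_nodes[OF j(1)] B_ge10 small_le_B by (simp add: wp_simps le_B)
    then show "run B ?c s' 20 (\<lambda>s''. \<forall>i<m. mem (s''\<lparr>regs := (regs s'')(11 := Suc j)\<rparr>) 6 i =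
        (if i < Suc j \<and> ed i \<inter> S \<noteq> {} then heavy else l (ed i)))"
      by (rule run_mono) (use j(1,2) in \<open>auto simp: less_Suc_eq\<close>)
  qed (use base_regs[OF b] m_less_B X in auto)
  then show ?thesis by (rule run_mono) auto
qed

lemma run_block_node:
  assumes b: "base s" and X: "\<forall>i<m. mem s 6 i = l (ed i)" and r: "regs s 18 = x" "x < n"
  shows "run B block_node s (30 * m + 8) (\<lambda>s'. \<forall>i<m. mem s' 6 i = (if x \<in> ed i then heavy else l (ed i)))"
proof -
  let ?c = "If ((Cell 20 (Reg 11) \<doteq> Reg 18) \<oplus> (Cell 21 (Reg 11) \<doteq> Reg 18)) (Store 6 (Reg 11) (Reg 7)) Skip"
  have "run B block_node s (m * (20 + 8) + 8) (\<lambda>s'. \<forall>i<m. mem s' 6 i = (if x \<in> ed i then heavy else l (ed i)))"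
    unfolding block_node_def
  proof (rule run_For[where I = "\<lambda>j s'. \<forall>i<m. mem s' 6 i = (if i < j \<and> x \<in> ed i then heavy else l (ed i))"])
    fix j and s' :: state assume j: "j < m" "\<forall>i<m. mem s' 6 i = (if i < j \<and> x \<in> ed i then heavy else l (ed i))"
      "regs s' 11 = j" and ag: "agree B (insert 11 (wr ?c)) (wa ?c) s s'"
    note b' = base_regs[OF base_agree[OF b ag]]
    have "regs s' 18 = x" "x \<le> B" using r agree_reg[OF ag, of 18] by (auto simp: le_B)
    then have "run B ?c s' 20 (\<lambda>s''. mem s'' 6 = (if x \<in> ed j then (mem s' 6)(j := heavy) else mem s' 6))"
      using j(1,3) b'(7,11,12) ed_nodes[OF j(1)] B_ge10 small_le_B by (auto simp: wp_simps le_B)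
    then show "run B ?c s' 20 (\<lambda>s''. \<forall>i<m. mem (s''\<lparr>regs := (regs s'')(11 := Suc j)\<rparr>) 6 i =
        (if i < Suc j \<and> x \<in> ed i then heavy else l (ed i)))"
      by (rule run_mono) (use j(1,2) in \<open>auto simp: less_Suc_eq\<close>)
  qed (use base_regs[OF b] m_less_B X in auto)
  then show ?thesis by (rule run_mono) auto
qed

lemma run_block_edge:
  assumes e: "env s" and X: "\<forall>i<m. mem s 6 i = l (ed i)"
    and r: "regs s 19 = a" "regs s 14 = k" "\<forall>i<length P. mem s 7 (k + i) = P ! i" "regs s 9 = Suc k"
    and a: "Suc a < length P" "length P \<le> n" "k < n" "{P ! a, P ! Suc a} \<in> E"
  shows "run B block_edge s 40 (\<lambda>s'. regs s' 18 = P ! a \<and> regs s' 9 = Suc k + a \<and>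
    (\<forall>i<m. mem s' 6 i = (if ed i = {P ! a, P ! Suc a} then heavy else l (ed i))))"
proof -
  have "adj_ok s" using e by (simp add: env_def)
  from adjacent_index[OF this a(4)] obtain i where i: "i < m" "ed i = {P ! a, P ! Suc a}"
      "mem s 9 (P ! a * n + P ! Suc a) = Suc i" .
  have n: "P ! a < n" "P ! Suc a < n" using edge_nodes[OF a(4)] by auto
  have bd: "k \<le> B" "a \<le> B" "k + a \<le> B" "Suc (k + a) \<le> B" "Suc k \<le> B" using a by (auto intro!: two_n_le_B)
  have v: "mem s 7 (k + a) = P ! a" "mem s 7 (Suc (k + a)) = P ! Suc a" using r(3) a(1) by (auto simp flip: add_Suc_right)
  have "run B block_edge s 40 (\<lambda>s'. regs s' 18 = P ! a \<and> regs s' 9 = Suc k + a \<and> mem s' 6 = (mem s 6)(i := heavy))"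
    using r(1,2,4) v i n bd base_regs(1,7)[OF env_base[OF e]] B_ge10 by (simp add: block_edge_def wp_simps le_B)
  then show ?thesis
  proof (rule run_mono)
    fix s' assume s': "regs s' 18 = P ! a \<and> regs s' 9 = Suc k + a \<and> mem s' 6 = (mem s 6)(i := heavy)"
    have "mem s' 6 i' = (if ed i' = {P ! a, P ! Suc a} then heavy else l (ed i'))" if i': "i' < m" for i'
    proof (cases "i' = i")
      case True
      then show ?thesis using s' i(2) by simp
    next
      case False
      then have "ed i' \<noteq> {P ! a, P ! Suc a}" using ed_eq_iff[OF i' i(1)] i(2) by metis
      then show ?thesis using s' X i' False by simp
    qed
    with s' show "regs s' 18 = P ! a \<and> regs s' 9 = Suc k + a \<and>
      (\<forall>i<m. mem s' 6 i = (if ed i = {P ! a, P ! Suc a} then heavy else l (ed i)))" by blast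
  qed simp
qed


text \<open>The interface between the search for the first deviation and the two kinds of steps that
  may follow it.\<close>

definition deviation_state :: "item list \<Rightarrow> item \<Rightarrow> nat list \<Rightarrow> nat \<Rightarrow> state \<Rightarrow> bool" where
  "deviation_state its it P a s \<longleftrightarrow> (case it of (F, l, \<pi>, t) \<Rightarrow>
     env s \<and> stack s its \<and> regs s 6 = 0 \<and> (\<forall>i<m. mem s 5 i = (if ed i \<in> F then 1 else 0)) \<and>
     (\<forall>i<m. mem s 6 i = l (ed i)) \<and> regs s 10 = t \<and> regs s 9 = length \<pi> \<and> regs s 14 = length \<pi> - 1 \<and>
     regs s 15 = length \<pi> - 1 + (length P - 1) \<and> regs s 19 = a \<and>
     (\<forall>i<length (\<pi> @ tl P). mem s 7 i = (\<pi> @ tl P) ! i))"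

lemma run_unique_step:
  assumes it: "path_item F l \<pi> t" "\<pi> \<noteq> []" and P: "completions l \<pi> t = {P}"
    and s: "deviation_state its (F, l, \<pi>, t) P a s" and h: "length its \<le> max_height"
  shows "run B unique_step s (50 * m + 60 * n + 80) (outcome its (F, l, \<pi>, t))"
proof -
  let ?p = "\<pi> @ tl P"
  let ?F = "F \<union> set (path_edges ?p)"
  let ?it = "(?F, restricted ?F, [], t)"
  have PC: "P \<in> completions l \<pi> t" using P by simp
  note cp = completion_path[OF it(1) PC]
  have w: "walk E (hd \<pi>) t ?p" using cp(1) by (simp add: simple_path_iff_walk)
  have hd: "hd \<pi> < n" "t < n" using it(1) edge_nodes by (auto simp: path_item_def)
  have len: "length ?p \<le> n" using simple_path_length[OF cp(1) hd(1)] .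
  have Pne: "P \<noteq> []" using PC by (auto simp: completions_def simple_path_def)
  have s': "env s" "stack s its" "regs s 6 = 0" "\<forall>i<m. mem s 5 i = (if ed i \<in> F then 1 else 0)" "regs s 10 = t"
    "length ?p = Suc (regs s 15)" "\<forall>i<length ?p. mem s 7 i = ?p ! i"
    using s it(2) Pne by (auto simp: deviation_state_def Suc_le_eq neq_Nil_conv)
  note un = path_item_unique[OF it(1) P refl, of "restricted ?F" t]
  have 1: "run B add_path s (40 * n + 8) (\<lambda>s'. \<forall>i<m. mem s' 5 i = (if ed i \<in> ?F then 1 else 0))"
    by (rule run_add_path[OF s'(1,4) w hd(1) len s'(6,7)])
  have "run B unique_step s ((40 * n + 8) + ((20 * m + 8) + (1 + cost (Const 0) + (30 * m + 20 * n + 40))))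
    (outcome its (F, l, \<pi>, t))"
    unfolding unique_step_def
  proof (rule run_Seq[OF 1])
    fix s1 assume F1: "\<forall>i<m. mem s1 5 i = (if ed i \<in> ?F then 1 else 0)" and ag1: "agree B (wr add_path) (wa add_path) s s1"
    have e1: "env s1" by (rule env_agree[OF s'(1) ag1]) auto
    show "run B (restrict ;; Assign 9 (Const 0) ;; push) s1 ((20 * m + 8) + (1 + cost (Const 0) + (30 * m + 20 * n + 40)))
      (outcome its (F, l, \<pi>, t))"
    proof (rule run_Seq[OF run_restrict[OF env_base[OF e1] F1]])
      fix s2 assume X2: "\<forall>i<m. mem s2 6 i = restricted ?F (ed i)" and ag2: "agree B (wr restrict) (wa restrict) s1 s2"
      let ?s3 = "s2\<lparr>regs := (regs s2)(9 := 0)\<rparr>"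
      have e2: "env s2" by (rule env_agree[OF e1 ag2]) auto
      have "agree B {9} {} s2 ?s3" using env_base[OF e2] by (auto simp: agree_def base_def all_words_def)
      then have e3: "env ?s3" by (rule env_agree[OF e2]) auto
      have c3: "current ?s3 ?it" using F1 X2 agree_mem[OF ag2, of 5] by (auto simp: current_def)
      have st3: "stack ?s3 its" "regs ?s3 6 = 0"
        using s'(2,3) agree_reg[OF ag1] agree_mem[OF ag1] agree_reg[OF ag2] agree_mem[OF ag2]
        by (auto simp: stack_def slot_def)
      have "run B push ?s3 (30 * m + 20 * n + 40) (outcome its (F, l, \<pi>, t))"
      proof (rule run_mono[OF run_agree[OF run_push[OF env_base[OF e3] c3 st3(1) h]]])
        fix s4 assume s4: "stack s4 (its @ [?it]) \<and> agree B (wr push) (wa push) ?s3 s4"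
        then have "regs s4 6 = 0" using agree_reg[of B "wr push" _ ?s3 s4 6] st3 by auto
        then show "outcome its (F, l, \<pi>, t) s4"
          using s4 un it(2) by (intro outcome_single[of s4 its ?it]) (simp_all del: item_ok.simps solvable.simps potential.simps level.simps)
      qed simp
      then show "run B (Assign 9 (Const 0) ;; push) s2 (1 + cost (Const 0) + (30 * m + 20 * n + 40)) (outcome its (F, l, \<pi>, t))"
        by (intro run_Assign_Seq) auto
    qed
  qed
  then show ?thesis by (rule run_mono) auto
qed

lemma run_split_step:
  assumes it: "path_item F l \<pi> t" "\<pi> \<noteq> []" and P: "P \<in> completions l \<pi> t"
    and a: "Suc a < length P"
      "\<And>R. R \<in> completions l \<pi> t \<Longrightarrow> take (Suc a) R = take (Suc a) P"
      "\<And>R. R \<in> completions l \<pi> t \<Longrightarrow> {P ! a, P ! Suc a} \<in> set (path_edges R) \<Longrightarrow>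
        take (Suc (Suc a)) R = take (Suc (Suc a)) P"
      "Q \<in> completions l \<pi> t" "{P ! a, P ! Suc a} \<notin> set (path_edges Q)"
    and s: "deviation_state its (F, l, \<pi>, t) P a s" and h: "length its + 1 \<le> max_height"
  shows "run B split_step s (120 * m + 70 * n + 200) (outcome its (F, l, \<pi>, t))"
proof -
  let ?k = "length \<pi> - 1"
  let ?e = "{P ! a, P ! Suc a}"
  \<comment> \<open>Blocking all edges at \<open>P ! a\<close> on top of \<open>l2\<close> gives the
    lengths of the child that follows \<open>P\<close>; the forbidden edge is among them. So between
    the two pushes only this change and one more node of the prefix are needed, and array 7 already
    holds that node.\<close>
  define l2 where "l2 e = (if e = ?e then heavy else if e \<inter> set (take a P) \<noteq> {} then heavy else l e)" for e
  define l1 where "l1 e = (if P ! a \<in> e then heavy else l2 e)" for e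
  define \<pi>1 where "\<pi>1 = \<pi> @ tl (take (Suc (Suc a)) P)"
  define \<pi>2 where "\<pi>2 = \<pi> @ tl (take (Suc a) P)"
  let ?it1 = "(F, l1, \<pi>1, t)" and ?it2 = "(F, l2, \<pi>2, t)"
  have take_a: "set (take (Suc a) P) = insert (P ! a) (set (take a P))" using a(1) by (simp add: take_Suc_conv_app_nth)
  have l1': "l1 e = (if e \<inter> set (take (Suc a) P) \<noteq> {} then heavy else l e)" for e
    unfolding l1_def l2_def take_a by auto
  have l2': "l2 e = (if e \<inter> set (take a P) \<noteq> {} \<or> e = ?e then heavy else l e)" for e
    unfolding l2_def by auto
  note sp = path_item_split[OF it(1) P it(2) a l1' l2' \<pi>1_def \<pi>2_def]
  have cp: "simple_path E (hd \<pi>) t (\<pi> @ tl P)" by (rule completion_path[OF it(1) P])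
  have hd: "hd \<pi> < n" "t < n" using it(1) edge_nodes by (auto simp: path_item_def)
  have len: "length (\<pi> @ tl P) \<le> n" using simple_path_length[OF cp hd(1)] .
  have Pne: "P \<noteq> []" "hd P = last \<pi>" "set (path_edges P) \<subseteq> E" "distinct P" using P by (auto simp: completions_def simple_path_def)
  have bl: "\<pi> @ tl P = butlast \<pi> @ P" "\<pi>1 = butlast \<pi> @ take (Suc (Suc a)) P" "\<pi>2 = butlast \<pi> @ take (Suc a) P"
    unfolding \<pi>1_def \<pi>2_def using append_tl[OF it(2)] Pne by (auto simp: hd_take)
  have "set (\<pi> @ tl P) \<subseteq> {..<n}" using walk_nodes[OF _ hd(1)] cp unfolding simple_path_iff_walk by blast
  then have Pn: "set P \<subseteq> {..<n}" unfolding bl(1) by simp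
  have "?k + length P \<le> n" using len unfolding bl(1) by simp
  then have lens: "?k < n" "length P \<le> n" using a(1) by linarith+
  have eE: "?e \<in> E" using path_edges_nth[OF a(1)] Pne(3) by blast
  have len12: "length \<pi>1 = Suc ?k + Suc a" "length \<pi>2 = Suc ?k + a" using a(1) it(2) bl(2,3) by auto
  have s': "env s" "stack s its" "regs s 6 = 0" "\<forall>i<m. mem s 5 i = (if ed i \<in> F then 1 else 0)" "\<forall>i<m. mem s 6 i = l (ed i)"
    "regs s 10 = t" "regs s 9 = Suc ?k" "regs s 14 = ?k" "regs s 19 = a" "\<forall>i<length (\<pi> @ tl P). mem s 7 i = (\<pi> @ tl P) ! i"
    using s it(2) by (auto simp: deviation_state_def)
  have m7: "\<forall>i<length P. mem s 7 (?k + i) = P ! i" using s'(10) unfolding bl(1) by (simp add: nth_append)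
  have m7': "mem s 7 i = \<pi>1 ! i" if "i < length \<pi>1" for i
  proof -
    have "\<pi> @ tl P = \<pi>1 @ drop (Suc (Suc a)) P" by (simp add: bl)
    then show ?thesis using s'(10) that by (simp add: nth_append)
  qed
  have m7'': "mem s 7 i = \<pi>2 ! i" if "i < length \<pi>2" for i
  proof -
    have "\<pi> @ tl P = \<pi>2 @ drop (Suc a) P" by (simp add: bl)
    then show ?thesis using s'(10) that by (simp add: nth_append)
  qed
  have 1: "run B (clear_marks ;; mark) s (30 * n + 20) (\<lambda>s'. \<forall>y<n. mem s' 16 y = (if y \<in> set (take a P) then 1 else 0))"
    using a(1) lens Pn by (intro run_marks[OF env_base[OF s'(1)] s'(9,8) m7]) auto
  have "run B ((clear_marks ;; mark) ;; block ;; block_edge ;; push ;; block_node ;; Assign 9 (Reg 9 \<oplus> Const 1) ;; push) s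
    ((30 * n + 20) + ((30 * m + 8) + (40 + ((30 * m + 20 * n + 40) + ((30 * m + 8) + (1 + cost (Reg 9 \<oplus> Const 1) + (30 * m + 20 * n + 40)))))))
    (outcome its (F, l, \<pi>, t))"
  proof (rule run_Seq[OF 1])
    fix s1 assume S1: "\<forall>y<n. mem s1 16 y = (if y \<in> set (take a P) then 1 else 0)"
      and ag1: "agree B (wr (clear_marks ;; mark)) (wa (clear_marks ;; mark)) s s1"
    have e1: "env s1" by (rule env_agree[OF s'(1) ag1]) auto
    have X1: "\<forall>i<m. mem s1 6 i = l (ed i)" using s'(5) agree_mem[OF ag1] by simp
    show "run B (block ;; block_edge ;; push ;; block_node ;; Assign 9 (Reg 9 \<oplus> Const 1) ;; push) s1
      ((30 * m + 8) + (40 + ((30 * m + 20 * n + 40) + ((30 * m + 8) + (1 + cost (Reg 9 \<oplus> Const 1) + (30 * m + 20 * n + 40))))))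
      (outcome its (F, l, \<pi>, t))"
    proof (rule run_Seq[OF run_block[OF env_base[OF e1] X1 S1]])
      fix s2 assume X2: "\<forall>i<m. mem s2 6 i = (if ed i \<inter> set (take a P) \<noteq> {} then heavy else l (ed i))"
        and ag2: "agree B (wr block) (wa block) s1 s2"
      have e2: "env s2" by (rule env_agree[OF e1 ag2]) auto
      have f2: "regs s2 19 = a" "regs s2 14 = ?k" "\<forall>i<length P. mem s2 7 (?k + i) = P ! i" "regs s2 9 = Suc ?k"
        using s' m7 agree_reg[OF ag1] agree_mem[OF ag1] agree_reg[OF ag2] agree_mem[OF ag2] by auto
      show "run B (block_edge ;; push ;; block_node ;; Assign 9 (Reg 9 \<oplus> Const 1) ;; push) s2
        (40 + ((30 * m + 20 * n + 40) + ((30 * m + 8) + (1 + cost (Reg 9 \<oplus> Const 1) + (30 * m + 20 * n + 40)))))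
        (outcome its (F, l, \<pi>, t))"
      proof (rule run_Seq[OF run_block_edge[OF e2 X2 f2 a(1) lens(2,1) eE]])
        fix s3 assume X3: "regs s3 18 = P ! a \<and> regs s3 9 = Suc ?k + a \<and> (\<forall>i<m. mem s3 6 i =
            (if ed i = ?e then heavy else if ed i \<inter> set (take a P) \<noteq> {} then heavy else l (ed i)))"
          and ag3: "agree B (wr block_edge) (wa block_edge) s2 s3"
        have e3: "env s3" by (rule env_agree[OF e2 ag3]) auto
        have f3: "regs s3 6 = 0" "regs s3 10 = t" "mem s3 5 = mem s 5" "mem s3 7 = mem s 7" "regs s3 18 = P ! a"
          "regs s3 9 = length \<pi>2" "\<forall>i<m. mem s3 6 i = l2 (ed i)"
          using s' X3 len12(2) agree_reg[OF ag1] agree_mem[OF ag1] agree_reg[OF ag2] agree_mem[OF ag2]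
            agree_reg[OF ag3] agree_mem[OF ag3] by (auto simp: l2_def)
        have st3: "stack s3 its"
          using s'(2) agree_reg[OF ag1] agree_mem[OF ag1] agree_reg[OF ag2] agree_mem[OF ag2]
            agree_reg[OF ag3] agree_mem[OF ag3] by (auto simp: stack_def slot_def)
        have "length \<pi>2 \<le> n" using len bl a(1) by simp
        then have c3: "current s3 ?it2" using f3 s'(4) m7'' by (auto simp: current_def)
        show "run B (push ;; block_node ;; Assign 9 (Reg 9 \<oplus> Const 1) ;; push) s3
          ((30 * m + 20 * n + 40) + ((30 * m + 8) + (1 + cost (Reg 9 \<oplus> Const 1) + (30 * m + 20 * n + 40))))
          (outcome its (F, l, \<pi>, t))"
        proof (rule run_Seq[OF run_push[OF env_base[OF e3] c3 st3]])
          show "length its \<le> max_height" using h by simp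
          fix s4 assume st4: "stack s4 (its @ [?it2])" and ag4: "agree B (wr push) (wa push) s3 s4"
          have e4: "env s4" by (rule env_agree[OF e3 ag4]) auto
          have f4: "regs s4 6 = 0" "regs s4 10 = t" "mem s4 5 = mem s 5" "mem s4 7 = mem s 7" "regs s4 18 = P ! a"
            "regs s4 9 = length \<pi>2" "\<forall>i<m. mem s4 6 i = l2 (ed i)"
            using f3 agree_reg[OF ag4] agree_mem[OF ag4] by auto
          have Pa: "P ! a < n" using edge_nodes[OF eE] by simp
          show "run B (block_node ;; Assign 9 (Reg 9 \<oplus> Const 1) ;; push) s4
            ((30 * m + 8) + (1 + cost (Reg 9 \<oplus> Const 1) + (30 * m + 20 * n + 40))) (outcome its (F, l, \<pi>, t))"
          proof (rule run_Seq[OF run_block_node[OF env_base[OF e4] f4(7,5) Pa]])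
            fix s5 assume X5: "\<forall>i<m. mem s5 6 i = (if P ! a \<in> ed i then heavy else l2 (ed i))"
              and ag5: "agree B (wr block_node) (wa block_node) s4 s5"
            have e5: "env s5" by (rule env_agree[OF e4 ag5]) auto
            have f5: "regs s5 6 = 0" "regs s5 10 = t" "mem s5 5 = mem s 5" "mem s5 7 = mem s 7" "regs s5 9 = length \<pi>2"
              "\<forall>i<m. mem s5 6 i = l1 (ed i)"
              using f4 X5 agree_reg[OF ag5] agree_mem[OF ag5] by (auto simp: l1_def)
            let ?s6 = "s5\<lparr>regs := (regs s5)(9 := Suc (length \<pi>2))\<rparr>"
            have ln: "length \<pi>1 \<le> n" "length \<pi>1 = Suc (length \<pi>2)" using len bl a(1) len12 by auto
            have lB: "Suc (length \<pi>2) \<le> B" "length \<pi>2 \<le> B" using ln by (auto intro!: two_n_le_B)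
            have "agree B {9} {} s5 ?s6" using env_base[OF e5] lB by (auto simp: agree_def base_def all_words_def)
            then have e6: "env ?s6" by (rule env_agree[OF e5]) auto
            have c6: "current ?s6 ?it1" using f5 s'(4) m7' ln by (auto simp: current_def)
            have st6: "stack ?s6 (its @ [?it2])"
              using st4 agree_reg[OF ag5] agree_mem[OF ag5] by (auto simp: stack_def slot_def)
            have "run B push ?s6 (30 * m + 20 * n + 40) (outcome its (F, l, \<pi>, t))"
            proof (rule run_mono[OF run_agree[OF run_push[OF env_base[OF e6] c6 st6]]])
              show "length (its @ [?it2]) \<le> max_height" using h by simp
              fix s7 assume s7: "stack s7 ((its @ [?it2]) @ [?it1]) \<and> agree B (wr push) (wa push) ?s6 s7"
              then have r7: "regs s7 6 = 0" using agree_reg[of B "wr push" _ ?s6 s7 6] f5 by auto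
              have st7: "stack s7 (its @ [?it2, ?it1])" using s7 by simp
              have pot: "potential ?it2 + potential ?it1 < potential (F, l, \<pi>, t)"
                using sp(4) by (subst add.commute)
              have sol: "solvable (F, l, \<pi>, t) \<Longrightarrow> solvable ?it2 \<or> solvable ?it1" using sp(3) by blast
              show "outcome its (F, l, \<pi>, t) s7"
                by (rule outcome_pair[OF r7 st7 sp(2,1) pot sol sp(6,5)])
            qed simp
            then show "run B (Assign 9 (Reg 9 \<oplus> Const 1) ;; push) s5 (1 + cost (Reg 9 \<oplus> Const 1) + (30 * m + 20 * n + 40))
              (outcome its (F, l, \<pi>, t))"
              using f5(5) lB small_le_B by (intro run_Assign_Seq) auto
          qed
        qed
      qed
    qed
  qed
  then have "run B split_step s ((30 * n + 20) + ((30 * m + 8) + (40 + ((30 * m + 20 * n + 40) + ((30 * m + 8) + (1 + cost (Reg 9 \<oplus> Const 1) + (30 * m + 20 * n + 40)))))))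
    (outcome its (F, l, \<pi>, t))"
    unfolding split_step_def by (simp only: run_wp wp_Seq)
  then show ?thesis by (rule run_mono) auto
qed

lemma run_path_step:
  assumes e: "env s" and it: "path_item F l \<pi> t" "\<pi> \<noteq> []" and cur: "current s (F, l, \<pi>, t)" and tab: "table s l"
    and st: "stack s its" "length its + 1 \<le> max_height" and r6: "regs s 6 = 0"
  shows "run B path_step s (120 * (n * n) + 360 * m + 300 * n + 500) (outcome its (F, l, \<pi>, t))"
proof -
  let ?k = "length \<pi> - 1" and ?s0 = "last \<pi>"
  let ?O = "outcome its (F, l, \<pi>, t)"
  have len: "length_ok l"
    using it(1) len_pos len_less_heavy heavy_pos by (fastforce simp: path_item_def length_ok_def intro: less_imp_le)
  have X: "\<forall>i<m. mem s 6 i = l (ed i)" and F: "\<forall>i<m. mem s 5 i = (if ed i \<in> F then 1 else 0)"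
    and r: "regs s 9 = length \<pi>" "regs s 10 = t" "\<forall>i<length \<pi>. mem s 7 i = \<pi> ! i" and ln: "length \<pi> \<le> n"
    using cur it(2) by (auto simp: current_def)
  have hd: "hd \<pi> < n" "t < n" using it(1) edge_nodes by (auto simp: path_item_def)
  have w: "walk E (hd \<pi>) ?s0 \<pi>" using it(1) by (simp add: path_item_def simple_path_iff_walk)
  have pin: "set \<pi> \<subseteq> {..<n}" using walk_nodes[OF w hd(1)] .
  then have s0: "?s0 < n" using last_in_set[OF it(2)] by blast
  have k: "?k < n" "Suc ?k = length \<pi>" using ln it(2) by (auto simp: Suc_le_eq neq_Nil_conv)
  have m7k: "mem s 7 ?k = ?s0" using r(3) it(2) k by (simp add: last_conv_nth)
  define c where "c = path_length len0 \<pi>"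
  have cb: "c \<le> n * heavy"
  proof -
    have "c \<le> (length \<pi> - 1) * heavy" unfolding c_def
      using w len_less_heavy by (intro path_length_le) (auto simp: walk_def subset_iff intro: less_imp_le)
    also have "\<dots> \<le> n * heavy" using k(1) by (intro mult_right_mono) auto
    finally show ?thesis .
  qed
  let ?T = "50 * m + 60 * n + 80 + (120 * m + 70 * n + 200)"
  have "run B path_step s ((40 * n + 30) + ((60 * (n * n) + 60 * n + 30) + ((60 * (n * n) + 60 * n + 40) + ((190 * m + 20) +
      (1 + cost (Reg 19 \<doteq> Reg 15 \<ominus> Reg 14) + ?T))))) ?O"
    unfolding path_step_def
  proof (rule run_Seq[OF run_prefix_length[OF e w hd(1) ln r(1,3)]])
    fix s1 assume s1: "regs s1 13 = path_length len0 \<pi> \<and> regs s1 14 = ?k"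
      and ag1: "agree B (wr prefix_length) (wa prefix_length) s s1"
    have e1: "env s1" by (rule env_agree[OF e ag1]) auto
    note f1 = agree_reg[OF ag1, unfolded frame_sets_path] agree_mem[OF ag1, unfolded frame_sets_path]
    have X1: "\<forall>i<m. mem s1 6 i = l (ed i)" and tab1: "table s1 l" and r1: "regs s1 14 = ?k" "regs s1 10 = t" "mem s1 7 ?k = ?s0"
      using X tab s1 f1 r m7k by (auto simp: table_def)
    show "run B (shortest_path_search ;; labels ;; first_deviation ;; If (Reg 19 \<doteq> Reg 15 \<ominus> Reg 14) unique_step split_step) s1
      ((60 * (n * n) + 60 * n + 30) + ((60 * (n * n) + 60 * n + 40) + ((190 * m + 20) + (1 + cost (Reg 19 \<doteq> Reg 15 \<ominus> Reg 14) + ?T)))) ?O"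
    proof (rule run_Seq[OF run_shortest_path_search[OF e1 len X1 tab1 r1 k(1) hd(2) s0]])
      fix s2 assume s2: "regs s2 12 = ?s0 \<and> (\<forall>i<?k. mem s2 7 i = mem s1 7 i) \<and>
          (\<exists>P. simple_path E ?s0 t P \<and> path_length l P = ndist l E ?s0 t \<and> regs s2 15 = ?k + (length P - 1) \<and>
            (\<forall>i<length P. mem s2 7 (?k + i) = P ! i))"
        and ag2: "agree B (wr shortest_path_search) (wa shortest_path_search) s1 s2"
      then obtain P where P: "simple_path E ?s0 t P" "path_length l P = ndist l E ?s0 t" "regs s2 15 = ?k + (length P - 1)"
        "\<forall>i<length P. mem s2 7 (?k + i) = P ! i" by blast
      have e2: "env s2" by (rule env_agree[OF e1 ag2]) auto
      note f2 = agree_reg[OF ag2, unfolded frame_sets_path] agree_mem[OF ag2, unfolded frame_sets_path]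
      have P': "P \<noteq> []" "P ! 0 = ?s0" "set P \<subseteq> {..<n}" "length P \<le> n" "hd P = ?s0"
        using P(1) walk_nodes[of ?s0 t P] simple_path_length[of ?s0 t P] s0
        by (auto simp: simple_path_iff_walk walk_def hd_conv_nth)
      have bl: "\<pi> @ tl P = butlast \<pi> @ P" by (rule append_tl[OF it(2) P'(1,5)])
      have m7: "mem s2 7 i = (\<pi> @ tl P) ! i" if i: "i < length (\<pi> @ tl P)" for i
      proof (cases "i < ?k")
        case True
        then have "mem s2 7 i = \<pi> ! i" using s2 f1 r(3) k(2) by simp
        then show ?thesis using True k(2) by (simp add: nth_append)
      next
        case False
        then obtain j where j: "i = ?k + j" using le_Suc_ex by (metis not_less)
        then have "j < length P" using i unfolding bl by simp
        then show ?thesis using P(4) unfolding bl j by (simp add: nth_append)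
      qed
      have r2: "regs s2 12 = ?s0" "regs s2 14 = ?k" and tab2: "table s2 l" using s2 r1 f2 tab1 by (auto simp: table_def)
      show "run B (labels ;; first_deviation ;; If (Reg 19 \<doteq> Reg 15 \<ominus> Reg 14) unique_step split_step) s2
        ((60 * (n * n) + 60 * n + 40) + ((190 * m + 20) + (1 + cost (Reg 19 \<doteq> Reg 15 \<ominus> Reg 14) + ?T))) ?O"
      proof (rule run_Seq[OF run_labels[OF env_base[OF e2] len tab2 r2 P(3,4) P'(1-4) k(1)]])
        fix s3 assume s3: "\<forall>y<n. mem s3 8 y < length P \<and> ndist l E ?s0 (P ! mem s3 8 y) + ndist l E (P ! mem s3 8 y) y = ndist l E ?s0 y \<and>
            (\<forall>j. mem s3 8 y < j \<longrightarrow> j < length P \<longrightarrow> ndist l E ?s0 (P ! j) + ndist l E (P ! j) y \<noteq> ndist l E ?s0 y)"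
          and ag3: "agree B (wr labels) (wa labels) s2 s3"
        have e3: "env s3" by (rule env_agree[OF e2 ag3]) auto
        note f3 = agree_reg[OF ag3, unfolded frame_sets_step] agree_mem[OF ag3, unfolded frame_sets_step]
        define h where "h = mem s3 8"
        interpret sp: shortest_path n E l ?s0 t P h
          using s3 P(1,2) s0 hd(2) len by unfold_locales (auto simp: h_def length_ok_def)
        have X3: "\<forall>i<m. mem s3 6 i = l (ed i)" and tab3: "table s3 l" using X1 tab1 f2 f3 by (auto simp: table_def)
        have m70: "mem s3 7 0 = hd \<pi>"
        proof -
          have "mem s3 7 0 = (\<pi> @ tl P) ! 0" using m7[of 0] it(2) f3 by simp
          then show ?thesis using it(2) by (simp add: nth_append hd_conv_nth)
        qed
        have r3: "regs s3 10 = t" "regs s3 12 = ?s0" "regs s3 13 = c" "regs s3 14 = ?k" "mem s3 7 0 = hd \<pi>"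
          "regs s3 15 = ?k + (length P - 1)" "\<forall>i<length P. mem s3 7 (?k + i) = P ! i"
          using r1 r2 P(3,4) s1 f2 f3 m70 by (auto simp: c_def)
        have h3: "mem s3 8 y = h y \<and> h y < length P" if "y < n" for y using s3 that by (simp add: h_def)
        define cand where "cand x y \<longleftrightarrow> {x, y} \<in> E \<and> h x < h y \<and>
          sd * (c + ndist l E ?s0 x + l {x, y} + ndist l E y t) \<le> sn * d0 (hd \<pi>) t \<and>
          \<not> (x = P ! h x \<and> y = P ! Suc (h x))" for x y
        show "run B (first_deviation ;; If (Reg 19 \<doteq> Reg 15 \<ominus> Reg 14) unique_step split_step) s3
          ((190 * m + 20) + (1 + cost (Reg 19 \<doteq> Reg 15 \<ominus> Reg 14) + ?T)) ?O"
        proof (rule run_Seq[OF run_first_deviation[OF e3 len X3 tab3 r3 h3 P'(4) k(1) hd(1,2) s0 cb cand_def]])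
          fix s4 assume s4: "(regs s4 19 = length P - 1 \<or> (\<exists>x y. cand x y \<and> regs s4 19 = h x)) \<and>
              (\<forall>x y. cand x y \<longrightarrow> regs s4 19 \<le> h x)"
            and ag4: "agree B (wr first_deviation) (wa first_deviation) s3 s4"
          have e4: "env s4" by (rule env_agree[OF e3 ag4]) auto
          note f4 = agree_reg[OF ag4, unfolded frame_sets_step] agree_mem[OF ag4, unfolded frame_sets_step]
          define a where "a = regs s4 19"
          have Pc: "P \<in> completions l \<pi> t" by (rule shortest_completion[OF it(1) P(1,2)])
          have ds: "deviation_state its (F, l, \<pi>, t) P a s4"
            unfolding deviation_state_def a_def
            using e4 st(1) r6 F X r(1) r1(1,2) P(3) m7 s1 f1 f2 f3 f4
            by (simp add: stack_def slot_def)
          have dev: "a = length P - 1 \<or> (\<exists>x y. cand x y \<and> a = h x)" "\<forall>x y. cand x y \<longrightarrow> a \<le> h x"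
            using s4 by (auto simp: a_def)
          note cd = completions_deviation[OF it(1) sp.shortest_path_axioms cand_def[unfolded c_def] dev]
          show "run B (If (Reg 19 \<doteq> Reg 15 \<ominus> Reg 14) unique_step split_step) s4 (1 + cost (Reg 19 \<doteq> Reg 15 \<ominus> Reg 14) + ?T) ?O"
          proof (rule run_If)
            have rs: "regs s4 15 = ?k + (length P - 1)" "regs s4 14 = ?k" using r3 f4 by auto
            have "length P - 1 \<le> B" using base_regs(9)[OF env_base[OF e4], of 15] rs by simp
            then show "fits B (Reg 19 \<doteq> Reg 15 \<ominus> Reg 14) s4"
              using base_regs(9)[OF env_base[OF e4], of 15] base_regs(9)[OF env_base[OF e4], of 14]
                base_regs(9)[OF env_base[OF e4], of 19] rs small_le_B by (simp del: One_nat_def)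
            {
              assume "value_of (Reg 19 \<doteq> Reg 15 \<ominus> Reg 14) s4 \<noteq> 0"
              then have "a = length P - 1" using rs by (simp add: a_def split: if_splits)
              from cd(1)[OF this] have P1: "completions l \<pi> t = {P}" .
              have "length its \<le> max_height" using st(2) by simp
              from run_unique_step[OF it P1 ds this] show "run B unique_step s4 ?T ?O" by (rule run_mono) auto
            next
              assume "value_of (Reg 19 \<doteq> Reg 15 \<ominus> Reg 14) s4 = 0"
              then have "a \<noteq> length P - 1" using rs by (simp add: a_def split: if_splits)
              from cd(2)[OF this] obtain Q where sp: "Suc a < length P"
                "\<And>R. R \<in> completions l \<pi> t \<Longrightarrow> take (Suc a) R = take (Suc a) P"
                "\<And>R. R \<in> completions l \<pi> t \<Longrightarrow> {P ! a, P ! Suc a} \<in> set (path_edges R) \<Longrightarrow>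
                  take (Suc (Suc a)) R = take (Suc (Suc a)) P"
                "Q \<in> completions l \<pi> t" "{P ! a, P ! Suc a} \<notin> set (path_edges Q)" by blast
              have "run B split_step s4 (120 * m + 70 * n + 200) ?O"
                by (rule run_split_step[OF it Pc sp ds st(2)])
              then show "run B split_step s4 ?T ?O" by (rule run_mono) auto
            }
          qed
        qed
      qed
    qed
  qed
  then show ?thesis by (rule run_mono) auto
qed

end

section \<open>The main program\<close>

definition setup_copy :: program where
  "setup_copy = For 11 21 (Store 20 (Reg 11) (Cell 0 (Reg 11)) ;; Store 21 (Reg 11) (Cell 1 (Reg 11)) ;;
     Assign 7 (Reg 7 \<oplus> Cell 2 (Reg 11)))"

definition setup_base :: program where
  "setup_base = Assign 20 (Reg 0) ;; Assign 21 (Reg 1) ;; Assign 22 (Reg 0 \<otimes> Reg 0) ;; Assign 7 (Const 0) ;;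
     setup_copy ;; Assign 7 (Reg 7 \<otimes> Reg 2 \<oplus> Const 1)"

definition trivial_flags :: program where
  "trivial_flags = For 11 21 (Store 5 (Reg 11) (Const 1 \<ominus> Cell 10 (Reg 11)))"

definition reset :: program where
  "reset = Assign 9 (Const 0) ;; Assign 10 (Const 0) ;; Assign 6 (Const 0) ;; Assign 8 (Const 0)"

text \<open>The matrix is computed before the kind of the item matters, because both kinds need it
  for their lengths. So each item costs one call.\<close>

definition search_body :: "program \<Rightarrow> program" where
  "search_body A = pop ;; call_apsp A ;; If (Reg 9) path_step set_step"

definition preprocess :: "program \<Rightarrow> program" where
  "preprocess A = setup_base ;; adjacency ;; copy_lengths ;; call_apsp A ;; save_distances ;; tops ;;
     clear_flags ;; alternatives ;; drop_weightless"

definition spanner_program :: "program \<Rightarrow> program" where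
  "spanner_program A = preprocess A ;; trivial_flags ;; restrict ;; reset ;; push ;; While (Reg 8) (search_body A)"

lemma frame_sets_main [simp]:
  "wr setup_copy = {7, 11}" "wa setup_copy = {20, 21}"
  "wr trivial_flags = {11}" "wa trivial_flags = {5}" "wr reset = {6, 8, 9, 10}" "wa reset = {}"
  by (auto simp: setup_copy_def trivial_flags_def reset_def)

lemma frame_sets_steps:
  "wr set_step \<subseteq> {6, 8, 9, 10, 11, 12, 13, 14}" "wa set_step \<subseteq> {6, 7, 11, 12, 13, 14, 15}"
  "wr path_step \<subseteq> {8, 9, 11, 12, 13, 14, 15, 16, 17, 18, 19}" "wa path_step \<subseteq> {5, 6, 7, 8, 11, 12, 13, 14, 15, 16}"
  by (auto simp: set_step_def path_step_def unique_step_def split_step_def)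

context machine
begin

lemma call_agree: "agree B (wr (call_apsp A)) (wa (call_apsp A)) s s' \<Longrightarrow> agree B ({11} \<union> {100..}) {100..} s s'"
  by (rule agree_mono[OF _ wr_call wa_call])

lemma env_call: "env s \<Longrightarrow> agree B (wr (call_apsp A)) (wa (call_apsp A)) s s' \<Longrightarrow> env s'"
  by (rule env_agree[OF _ call_agree]) auto

lemma base_call: "base s \<Longrightarrow> agree B (wr (call_apsp A)) (wa (call_apsp A)) s s' \<Longrightarrow> base s'"
  by (rule base_agree[OF _ call_agree]) auto

definition accepted :: "state \<Rightarrow> bool" where
  "accepted s \<longleftrightarrow> regs s 8 = 0 \<and> regs s 6 = 1 \<and> is_solution I {ed i | i. i < m \<and> mem s 5 i = 1}"

text \<open>The index bounds the total potential of the stack and serves as the variant of the main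
  loop. That position \<open>k\<close> holds an item of level at least \<open>k\<close> bounds the
  height of the stack.\<close>

definition searching :: "nat \<Rightarrow> state \<Rightarrow> bool" where
  "searching \<phi> s \<longleftrightarrow> env s \<and> (accepted s \<or> regs s 6 = 0 \<and> (\<exists>its. stack s its \<and> (\<forall>it\<in>set its. item_ok it) \<and>
     (\<forall>k<length its. k \<le> level (its ! k)) \<and> sum_list (map potential its) \<le> \<phi> \<and>
     ((\<exists>S. is_solution I S) \<longrightarrow> (\<exists>it\<in>set its. solvable it))))"

lemma item_ok_length: "item_ok (F, l, \<pi>, t) \<Longrightarrow> length_ok l"
proof -
  assume ok: "item_ok (F, l, \<pi>, t)"
  have "1 \<le> l e \<and> l e \<le> heavy" if e: "e \<in> E" for e
  proof -
    have "l e = len0 e \<or> l e = heavy"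
      using ok e by (auto simp: set_item_def path_item_def restricted_def split: if_splits)
    then show ?thesis using len_pos[OF e] len_less_heavy[OF e] heavy_pos by auto
  qed
  then show ?thesis by (simp add: length_ok_def)
qed

lemma item_ok_level: "item_ok it \<Longrightarrow> level it \<le> (m + 1) * (m + 2)"
proof (cases it)
  case (fields F l \<pi> t)
  assume "item_ok it"
  then have "F \<subseteq> E" by (auto simp: fields set_item_def path_item_def split: if_splits)
  then show ?thesis unfolding fields by (rule level_bound)
qed

lemma run_step:
  assumes e: "env s" and r6: "regs s 6 = 0" and st: "stack s (its @ [it])" and ok: "item_ok it"
    and h: "length its + 1 \<le> max_height"
  shows "run B (search_body A) s (TA + 120 * (n * n) + 420 * m + 320 * n + 600) (\<lambda>s'. env s' \<and> outcome its it s')"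
proof -
  obtain F l \<pi> t where it: "it = (F, l, \<pi>, t)" by (metis surj_pair)
  have len: "length_ok l" using item_ok_length ok by (simp only: it)
  have h': "length its \<le> max_height" using h by simp
  let ?T = "120 * (n * n) + 360 * m + 300 * n + 500"
  have "run B (search_body A) s ((30 * m + 20 * n + 40) + ((30 * m + 30 + TA) + (1 + cost (Reg 9) + ?T)))
    (\<lambda>s'. env s' \<and> outcome its it s')"
    unfolding search_body_def
  proof (rule run_Seq[OF run_pop[OF env_base[OF e] st h']])
    fix s1 assume s1: "current s1 it \<and> stack s1 its" and ag1: "agree B (wr pop) (wa pop) s s1"
    have e1: "env s1" by (rule env_agree[OF e ag1]) auto
    have X1: "mem s1 6 i = l (ed i)" if "i < m" for i using s1 that by (auto simp: current_def it)
    have l: "1 \<le> l e \<and> l e \<le> heavy" if "e \<in> E" for e using len that by (simp add: length_ok_def)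
    have r61: "regs s1 6 = 0" using agree_reg[OF ag1, of 6] r6 by simp
    show "run B (call_apsp A ;; If (Reg 9) path_step set_step) s1 ((30 * m + 30 + TA) + (1 + cost (Reg 9) + ?T))
      (\<lambda>s'. env s' \<and> outcome its it s')"
    proof (rule run_Seq[OF run_call[OF env_base[OF e1] l X1]])
      fix s2 assume tab: "\<forall>u<n. \<forall>v<n. mem s2 104 (u * n + v) = ndist l E u v"
        and ag2: "agree B (wr (call_apsp A)) (wa (call_apsp A)) s1 s2"
      have e2: "env s2" by (rule env_call[OF e1 ag2])
      have tab2: "table s2 l" using tab by (simp add: table_def)
      note f2 = agree_reg[OF call_agree[OF ag2]] agree_mem[OF call_agree[OF ag2]]
      have c2: "current s2 (F, l, \<pi>, t)" and st2: "stack s2 its" and r62: "regs s2 6 = 0"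
        using s1 r61 f2 by (auto simp: current_def stack_def slot_def it)
      show "run B (If (Reg 9) path_step set_step) s2 (1 + cost (Reg 9) + ?T) (\<lambda>s'. env s' \<and> outcome its it s')"
      proof (rule run_If)
        show "fits B (Reg 9) s2" using base_regs(9)[OF env_base[OF e2]] by simp
        have r9: "regs s2 9 = length \<pi>" using c2 by (simp add: current_def)
        {
          assume "value_of (Reg 9) s2 \<noteq> 0"
          then have ne: "\<pi> \<noteq> []" using r9 by auto
          then have "path_item F l \<pi> t" using ok by (simp add: it)
          from run_agree[OF run_path_step[OF e2 this ne c2 tab2 st2 h r62]]
          show "run B path_step s2 ?T (\<lambda>s'. env s' \<and> outcome its it s')"
          proof (rule run_mono)
            fix s3 assume s3: "outcome its (F, l, \<pi>, t) s3 \<and> agree B (wr path_step) (wa path_step) s2 s3"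
            then have "env s3" by (intro env_agree[OF e2 agree_mono[OF _ frame_sets_steps(3,4)]]) auto
            with s3 show "env s3 \<and> outcome its it s3" by (simp add: it)
          qed simp
        next
          assume "value_of (Reg 9) s2 = 0"
          then have "\<pi> = []" using r9 by auto
          then have "set_item F l" "current s2 (F, l, [], t)" "it = (F, l, [], t)" using ok c2 by (simp_all add: it)
          from run_agree[OF run_set_step[OF e2 this(1,2) tab2 st2 h' r62]] this(3)
          show "run B set_step s2 ?T (\<lambda>s'. env s' \<and> outcome its it s')"
          proof (elim run_mono)
            fix s3 assume s3: "outcome its (F, l, [], t) s3 \<and> agree B (wr set_step) (wa set_step) s2 s3"
            then have "env s3" by (intro env_agree[OF e2 agree_mono[OF _ frame_sets_steps(1,2)]]) auto
            with s3 show "env s3 \<and> outcome its it s3" using \<open>it = (F, l, [], t)\<close> by simp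
          qed simp
        }
      qed
    qed
  qed
  then show ?thesis by (rule run_mono) auto
qed

text \<open>When an item is replaced by two, the upper one sits one position higher than its parent
  did. This is why a branching has to increase the level strictly, while a single child may keep
  it.\<close>

lemma outcome_searching:
  assumes "env s'" and out: "outcome its it s'"
    and old: "\<forall>it'\<in>set (its @ [it]). item_ok it'" "\<forall>k<length (its @ [it]). k \<le> level ((its @ [it]) ! k)"
      "sum_list (map potential (its @ [it])) \<le> \<phi>"
      "(\<exists>S. is_solution I S) \<longrightarrow> (\<exists>it'\<in>set (its @ [it]). solvable it')"
  shows "\<exists>\<psi><\<phi>. searching \<psi> s'"
proof -
  have lev: "length its \<le> level it" using old(2) by (auto simp: nth_append dest!: spec[of _ "length its"])
  have levs: "k \<le> level (its ! k)" if "k < length its" for k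
    using old(2) that by (auto simp: nth_append dest!: spec[of _ k])
  from out consider "accepted s'" | cs where "regs s' 6 = 0" "stack s' (its @ cs)" "\<forall>c\<in>set cs. item_ok c"
    "sum_list (map potential cs) < potential it" "solvable it \<longrightarrow> (\<exists>c\<in>set cs. solvable c)"
    "cs = [] \<or> (\<exists>c. cs = [c] \<and> level it \<le> level c) \<or> (\<exists>c d. cs = [c, d] \<and> level it < level c \<and> level it < level d)"
    unfolding outcome_def accepted_def by blast
  then show ?thesis
  proof cases
    case 1
    \<comment> \<open>An accepted state gets variant 0. That this is a decrease needs the potential
      of the popped item to be positive.\<close>
    have "0 < potential it \<or> potential it = 0" by auto
    moreover have "0 < \<phi>" if "0 < potential it" using old(3) that by simp
    moreover have "potential it > 0"
    proof (cases it)
      case (fields F l \<pi> t)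
      have ok: "item_ok it" using old(1) by simp
      show ?thesis
      proof (cases "\<pi> = []")
        case True
        have "b ^ (\<mu> - card (F \<inter> N)) \<ge> 1" using breadth_pos by simp
        with True show ?thesis by (simp add: fields)
      next
        case False
        then have p: "path_item F l \<pi> t" using ok by (simp add: fields)
        have "b ^ (\<mu> - Suc (card (F \<inter> N))) \<ge> 1" using path_item_pot(1)[OF p] by simp
        then have "3 \<le> 5 * b ^ (\<mu> - Suc (card (F \<inter> N))) - 2" by simp
        with path_item_pot(2)[OF p]
        have "1 * 3 \<le> card (completions l \<pi> t) * (5 * b ^ (\<mu> - Suc (card (F \<inter> N))) - 2)" by (rule mult_le_mono)
        with False show ?thesis by (simp add: fields)
      qed
    qed
    ultimately have "0 < \<phi>" by blast
    then show ?thesis using 1 assms(1) by (intro exI[of _ 0]) (simp add: searching_def)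
  next
    case (2 cs)
    have "k \<le> level ((its @ cs) ! k)" if k: "k < length (its @ cs)" for k
    proof (cases "k < length its")
      case False
      then obtain j where j: "k = length its + j" using le_Suc_ex by (metis not_less)
      then have "j < length cs" using k by simp
      then have "length its + j \<le> level (cs ! j)"
        using 2(6) lev by (auto simp: less_Suc_eq)
      then show ?thesis by (simp add: j)
    qed (use levs in \<open>simp add: nth_append\<close>)
    moreover have "(\<exists>S. is_solution I S) \<longrightarrow> (\<exists>c\<in>set (its @ cs). solvable c)" using old(4) 2(5) by auto
    moreover have "sum_list (map potential (its @ cs)) < \<phi>" using old(3) 2(4) by simp
    moreover have "\<forall>c\<in>set (its @ cs). item_ok c" using old(1) 2(3) unfolding set_append by blast
    moreover have "sum_list (map potential (its @ cs)) \<le> sum_list (map potential (its @ cs))" by (rule order_refl)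
    ultimately show ?thesis using 2(1,2) assms(1) unfolding searching_def by blast
  qed
qed

abbreviation "step_time \<equiv> TA + 120 * (n * n) + 420 * m + 320 * n + 600"

text \<open>If the stack runs empty without acceptance, no solvable item is left, and by the
  invariant there is no solution.\<close>

lemma run_search:
  assumes "searching \<phi> s"
  shows "run B (While (Reg 8) (search_body A)) s (\<phi> * (2 + step_time) + 2)
    (\<lambda>s'. if \<exists>S. is_solution I S then regs s' 6 = 1 \<and> is_solution I {ed i | i. i < m \<and> mem s' 5 i = 1} else regs s' 6 = 0)"
proof -
  have "run B (While (Reg 8) (search_body A)) s (\<phi> * (1 + cost (Reg 8) + step_time) + (1 + cost (Reg 8)))
    (\<lambda>s'. \<exists>\<psi>. searching \<psi> s' \<and> value_of (Reg 8) s' = 0)"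
  proof (rule run_While[where I = searching, OF assms])
    fix \<phi> s assume s: "searching \<phi> s"
    then show "fits B (Reg 8) s" using base_regs(9)[OF env_base] by (auto simp: searching_def)
    assume r8: "value_of (Reg 8) s \<noteq> 0"
    then obtain its0 where its0: "env s" "regs s 6 = 0" "stack s its0" "\<forall>it\<in>set its0. item_ok it"
       "\<forall>k<length its0. k \<le> level (its0 ! k)" "sum_list (map potential its0) \<le> \<phi>"
       "(\<exists>S. is_solution I S) \<longrightarrow> (\<exists>it\<in>set its0. solvable it)"
      using s by (auto simp: searching_def accepted_def)
    have "its0 \<noteq> []" using r8 its0(3) by (auto simp: stack_def)
    then obtain its it where its: "its0 = its @ [it]" by (metis rev_exhaust)
    have "length its \<le> level it" using its0(5) by (auto simp: its nth_append dest!: spec[of _ "length its"])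
    also have "\<dots> \<le> (m + 1) * (m + 2)" using its0(4) by (intro item_ok_level) (simp add: its)
    finally have h: "length its + 1 \<le> max_height" by simp
    have "item_ok it" using its0(4) by (simp add: its)
    from run_step[OF its0(1,2) its0(3)[unfolded its] this h]
    show "run B (search_body A) s step_time (\<lambda>s'. \<exists>\<psi><\<phi>. searching \<psi> s')"
    proof (rule run_mono)
      fix s' assume "env s' \<and> outcome its it s'"
      then show "\<exists>\<psi><\<phi>. searching \<psi> s'" using outcome_searching[OF _ _ its0(4-7)[unfolded its]] by blast
    qed simp
  qed
  then show ?thesis
  proof (rule run_mono)
    fix s' assume "\<exists>\<psi>. searching \<psi> s' \<and> value_of (Reg 8) s' = 0"
    then obtain \<psi> where "searching \<psi> s'" "regs s' 8 = 0" by auto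
    then show "if \<exists>S. is_solution I S then regs s' 6 = 1 \<and> is_solution I {ed i | i. i < m \<and> mem s' 5 i = 1} else regs s' 6 = 0"
      by (auto simp: searching_def accepted_def stack_def)
  qed simp
qed

definition input_ok :: "state \<Rightarrow> bool" where
  "input_ok s \<longleftrightarrow> all_words B s \<and> regs s 0 = n \<and> regs s 1 = m \<and> regs s 2 = sn \<and> regs s 3 = sd \<and>
     regs s 4 = weight_bound I \<and> regs s 5 = \<mu> \<and>
     (\<forall>i<m. mem s 0 i = eu i \<and> mem s 1 i = ev i \<and> mem s 2 i = el i \<and> mem s 3 i = ew i)"

lemma run_setup_base:
  assumes s: "input_ok s"
  shows "run B setup_base s (30 * m + 40) base"
proof -
  let ?s0 = "s\<lparr>regs := (regs s)(20 := n, 21 := m, 22 := n * n, 7 := 0)\<rparr>"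
  let ?c = "Store 20 (Reg 11) (Cell 0 (Reg 11)) ;; Store 21 (Reg 11) (Cell 1 (Reg 11)) ;;
     Assign 7 (Reg 7 \<oplus> Cell 2 (Reg 11))"
  have aw: "all_words B ?s0" using s size_le_B by (auto simp: input_ok_def all_words_def)
  have sum_le: "(\<Sum>i<j. el i) \<le> sum len0 E" if "j \<le> m" for j
  proof -
    have "(\<Sum>i<j. el i) \<le> (\<Sum>i<m. el i)" using that by (intro sum_mono2) auto
    also have "\<dots> = sum len0 E" unfolding el_def by (rule sum_edges)
    finally show ?thesis .
  qed
  have hB: "sum len0 E * sn + 1 \<le> B" using heavy_le_B by (simp add: heavy_def mult.commute)
  then have hB': "sum len0 E * sn \<le> B" by simp
  have "sum len0 E * 1 \<le> sum len0 E * sn" using sn_pos by (rule mult_le_mono2)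
  then have "sum len0 E \<le> sum len0 E * sn" unfolding mult_1_right .
  from this hB' have sB: "sum len0 E \<le> B" by (rule order_trans)
  have 1: "run B setup_copy ?s0 (m * (14 + 8) + 8) (\<lambda>s'. regs s' 7 = sum len0 E \<and>
      (\<forall>i<m. mem s' 20 i = eu i \<and> mem s' 21 i = ev i))"
    unfolding setup_copy_def
  proof (rule run_For[where I = "\<lambda>j s'. regs s' 7 = (\<Sum>i<j. el i) \<and> (\<forall>i<j. mem s' 20 i = eu i \<and> mem s' 21 i = ev i)"])
    fix j s' assume j: "j < m" "regs s' 7 = (\<Sum>i<j. el i) \<and> (\<forall>i<j. mem s' 20 i = eu i \<and> mem s' 21 i = ev i)"
      "regs s' 11 = j" and ag: "agree B (insert 11 (wr ?c)) (wa ?c) ?s0 s'"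
    have v: "mem s' 0 j = eu j" "mem s' (Suc 0) j = ev j" "mem s' 2 j = el j"
      using s j(1) agree_mem[OF ag] by (auto simp: input_ok_def)
    have "(\<Sum>i<j. el i) \<le> B" "(\<Sum>i<j. el i) + el j \<le> B"
      using sum_le[of j] sum_le[of "Suc j"] j(1) sB by auto
    then show "run B ?c s' 14 (\<lambda>s''. regs (s''\<lparr>regs := (regs s'')(11 := Suc j)\<rparr>) 7 = (\<Sum>i<Suc j. el i) \<and>
      (\<forall>i<Suc j. mem (s''\<lparr>regs := (regs s'')(11 := Suc j)\<rparr>) 20 i = eu i \<and>
        mem (s''\<lparr>regs := (regs s'')(11 := Suc j)\<rparr>) 21 i = ev i))"
      using j v ed_nodes[OF j(1)] el_le_B[OF j(1)] by (auto simp: wp_simps le_B less_Suc_eq)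
  next
    fix s' :: state assume "regs s' 7 = (\<Sum>i<m. el i) \<and> (\<forall>i<m. mem s' 20 i = eu i \<and> mem s' 21 i = ev i)"
    moreover have "(\<Sum>i<m. el i) = sum len0 E" unfolding el_def by (rule sum_edges)
    ultimately show "regs s' 7 = sum len0 E \<and> (\<forall>i<m. mem s' 20 i = eu i \<and> mem s' 21 i = ev i)" by simp
  qed (use m_less_B in auto)
  have "run B (setup_copy ;; Assign 7 (Reg 7 \<otimes> Reg 2 \<oplus> Const 1)) ?s0 ((m * (14 + 8) + 8) + 10) base"
  proof (rule run_Seq[OF 1])
    fix s1 assume s1: "regs s1 7 = sum len0 E \<and> (\<forall>i<m. mem s1 20 i = eu i \<and> mem s1 21 i = ev i)"
      and ag: "agree B (wr setup_copy) (wa setup_copy) ?s0 s1"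
    note f = agree_reg[OF ag, unfolded frame_sets_main] agree_mem[OF ag, unfolded frame_sets_main]
    have aw1: "all_words B s1" by (rule agree_words[OF ag aw])
    have sn: "regs s1 2 = sn" "sn \<le> B" using s f all_words_reg[OF aw1, of 2] by (auto simp: input_ok_def)
    have "base (s1\<lparr>regs := (regs s1)(7 := heavy)\<rparr>)"
      using s s1 f aw1 heavy_le_B by (auto simp: base_def input_ok_def all_words_def)
    then have "base (s1\<lparr>regs := (regs s1)(7 := Suc (sum len0 E * sn))\<rparr>)" by (simp add: heavy_def mult.commute)
    then show "run B (Assign 7 (Reg 7 \<otimes> Reg 2 \<oplus> Const 1)) s1 10 base"
      using s1 sn hB hB' sB by (simp add: wp_simps)
  qed
  then have "run B setup_base s (1 + cost (Reg 0) + (1 + cost (Reg 1) + (1 + cost (Reg 0 \<otimes> Reg 0) + (1 + cost (Const 0) +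
      ((m * (14 + 8) + 8) + 10))))) base"
    unfolding setup_base_def using s size_le_B
    by (intro run_Assign_Seq) (auto simp: input_ok_def fun_upd_twist)
  then show ?thesis by (rule run_mono) auto
qed

lemma run_preprocess:
  assumes s: "input_ok s"
  shows "run B (preprocess A) s (TA + 25 * (n * n) + 320 * (n * m) + 250 * m + 200) env"
proof -
  have "run B (preprocess A) s ((30 * m + 40) + ((12 * (n * n) + 30 * m + 16) + ((13 * m + 8) + ((30 * m + 30 + TA) +
    ((13 * (n * n) + 8) + ((100 * (n * m) + 30 * m + 8) + ((12 * m + 8) + ((220 * (n * m) + 30 * m + 8) + (18 * m + 8))))))))) env"
    unfolding preprocess_def
  proof (rule run_Seq[OF run_setup_base[OF s]])
    fix s1 assume b1: "base s1"
    show "run B (adjacency ;; copy_lengths ;; call_apsp A ;; save_distances ;; tops ;; clear_flags ;; alternatives ;; drop_weightless) s1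
      ((12 * (n * n) + 30 * m + 16) + ((13 * m + 8) + ((30 * m + 30 + TA) +
      ((13 * (n * n) + 8) + ((100 * (n * m) + 30 * m + 8) + ((12 * m + 8) + ((220 * (n * m) + 30 * m + 8) + (18 * m + 8)))))))) env"
    proof (rule run_Seq[OF run_adjacency[OF b1]])
      fix s2 assume a2: "adj_ok s2" and ag2: "agree B (wr adjacency) (wa adjacency) s1 s2"
      have b2: "base s2" by (rule base_agree[OF b1 ag2]) auto
      show "run B (copy_lengths ;; call_apsp A ;; save_distances ;; tops ;; clear_flags ;; alternatives ;; drop_weightless) s2
        ((13 * m + 8) + ((30 * m + 30 + TA) +
        ((13 * (n * n) + 8) + ((100 * (n * m) + 30 * m + 8) + ((12 * m + 8) + ((220 * (n * m) + 30 * m + 8) + (18 * m + 8))))))) env"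
      proof (rule run_Seq[OF run_copy_lengths[OF b2]])
        fix s3 assume X3: "\<forall>i<m. mem s3 6 i = el i" and ag3: "agree B (wr copy_lengths) (wa copy_lengths) s2 s3"
        have b3: "base s3" by (rule base_agree[OF b2 ag3]) auto
        have l: "1 \<le> len0 e \<and> len0 e \<le> heavy" if "e \<in> E" for e
          using len_pos[OF that] len_less_heavy[OF that] by simp
        have X3': "mem s3 6 i = len0 (ed i)" if "i < m" for i using X3 that by (simp add: el_def)
        show "run B (call_apsp A ;; save_distances ;; tops ;; clear_flags ;; alternatives ;; drop_weightless) s3
          ((30 * m + 30 + TA) + ((13 * (n * n) + 8) + ((100 * (n * m) + 30 * m + 8) + ((12 * m + 8) +
          ((220 * (n * m) + 30 * m + 8) + (18 * m + 8)))))) env"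
        proof (rule run_Seq[OF run_call[OF b3 l X3']])
          fix s4 assume t4: "\<forall>u<n. \<forall>v<n. mem s4 104 (u * n + v) = d0 u v"
            and ag4: "agree B (wr (call_apsp A)) (wa (call_apsp A)) s3 s4"
          have b4: "base s4" by (rule base_call[OF b3 ag4])
          show "run B (save_distances ;; tops ;; clear_flags ;; alternatives ;; drop_weightless) s4
            ((13 * (n * n) + 8) + ((100 * (n * m) + 30 * m + 8) + ((12 * m + 8) + ((220 * (n * m) + 30 * m + 8) + (18 * m + 8))))) env"
          proof (rule run_Seq[OF run_save_distances[OF b4]])
            fix s5 assume s5: "\<forall>i<n * n. mem s5 4 i = mem s4 104 i" and ag5: "agree B (wr save_distances) (wa save_distances) s4 s5"
            have b5: "base s5" by (rule base_agree[OF b4 ag5]) auto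
            have D5: "dist_ok s5" using s5 t4 index_bound by (simp add: dist_ok_def)
            show "run B (tops ;; clear_flags ;; alternatives ;; drop_weightless) s5
              ((100 * (n * m) + 30 * m + 8) + ((12 * m + 8) + ((220 * (n * m) + 30 * m + 8) + (18 * m + 8)))) env"
            proof (rule run_Seq[OF run_tops[OF b5 D5]])
              fix s6 assume tp: "tops_ok (\<lambda>u z. mem s6 17 (u * n + z))" and ag6: "agree B (wr tops) (wa tops) s5 s6"
              have b6: "base s6" by (rule base_agree[OF b5 ag6]) auto
              have D6: "dist_ok s6" using D5 agree_mem[OF ag6, of 4] by (simp add: dist_ok_def)
              show "run B (clear_flags ;; alternatives ;; drop_weightless) s6
                ((12 * m + 8) + ((220 * (n * m) + 30 * m + 8) + (18 * m + 8))) env"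
              proof (rule run_Seq[OF run_clear_flags[OF b6]])
                fix s7 assume Z: "\<forall>i<m. mem s7 10 i = 0" and ag7: "agree B (wr clear_flags) (wa clear_flags) s6 s7"
                have b7: "base s7" by (rule base_agree[OF b6 ag7]) auto
                have D7: "dist_ok s7" using D6 agree_mem[OF ag7, of 4] by (simp add: dist_ok_def)
                have "mem s7 17 = mem s6 17" using agree_mem[OF ag7, of 17] by simp
                then have t7: "mem s6 17 (u * n + z) = mem s7 17 (u * n + z)" for u z by simp
                show "run B (alternatives ;; drop_weightless) s7 ((220 * (n * m) + 30 * m + 8) + (18 * m + 8)) env"
                proof (rule run_Seq[OF run_alternatives[OF b7 D7 tp t7 Z]])
                  fix s8 assume M: "\<forall>i<m. mem s8 10 i = (if ed i \<in> mandatory_edges I then 0 else 1)"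
                    and ag8: "agree B (wr alternatives) (wa alternatives) s7 s8"
                  have b8: "base s8" by (rule base_agree[OF b7 ag8]) auto
                  have "mem s8 4 = mem s5 4" using agree_mem[OF ag8, of 4] agree_mem[OF ag7, of 4] agree_mem[OF ag6, of 4] by simp
                  then have D8: "dist_ok s8" using D5 by (simp add: dist_ok_def)
                  have "mem s8 9 = mem s2 9"
                    using agree_mem[OF ag8, of 9] agree_mem[OF ag7, of 9] agree_mem[OF ag6, of 9] agree_mem[OF ag5, of 9]
                      agree_mem[OF call_agree[OF ag4], of 9] agree_mem[OF ag3, of 9] by simp
                  then have a8: "adj_ok s8" using a2 by (simp add: adj_ok_def)
                  show "run B drop_weightless s8 (18 * m + 8) env"
                  proof (rule run_mono[OF run_agree[OF run_drop_weightless[OF b8 M]]])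
                    fix s9 assume s9: "nontrivial_ok s9 \<and> agree B (wr drop_weightless) (wa drop_weightless) s8 s9"
                    then have "base s9" by (intro base_agree[OF b8]) auto
                    moreover have "mem s9 4 = mem s8 4" "mem s9 9 = mem s8 9"
                      using s9 agree_mem[of B "wr drop_weightless" "wa drop_weightless" s8 s9] by auto
                    ultimately show "env s9" using s9 D8 a8 by (simp add: env_def dist_ok_def adj_ok_def)
                  qed simp
                qed
              qed
            qed
          qed
        qed
      qed
    qed
  qed
  then show ?thesis by (rule run_mono) auto
qed

lemma run_trivial_flags:
  assumes e: "env s"
  shows "run B trivial_flags s (14 * m + 8) (\<lambda>s'. \<forall>i<m. mem s' 5 i = (if ed i \<in> T then 1 else 0))"
proof -
  let ?c = "Store 5 (Reg 11) (Const 1 \<ominus> Cell 10 (Reg 11))"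
  have "run B trivial_flags s (m * (6 + 8) + 8) (\<lambda>s'. \<forall>i<m. mem s' 5 i = (if ed i \<in> T then 1 else 0))"
    unfolding trivial_flags_def
  proof (rule run_For[where I = "\<lambda>j s'. \<forall>i<j. mem s' 5 i = (if ed i \<in> T then 1 else 0)"])
    fix j and s' :: state assume j: "j < m" "\<forall>i<j. mem s' 5 i = (if ed i \<in> T then 1 else 0)" "regs s' 11 = j"
      and ag: "agree B (insert 11 (wr ?c)) (wa ?c) s s'"
    have "mem s' 10 j = (if ed j \<in> T then 0 else 1)"
      using e j(1) ed_mem[OF j(1)] agree_mem[OF ag, of 10] by (simp add: env_def nontrivial_ok_def nontrivial_edges_def)
    then show "run B ?c s' 6 (\<lambda>s''. \<forall>i<Suc j. mem (s''\<lparr>regs := (regs s'')(11 := Suc j)\<rparr>) 5 i = (if ed i \<in> T then 1 else 0))"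
      using j small_le_B by (auto simp: wp_simps less_Suc_eq le_B)
  qed (use base_regs[OF env_base[OF e]] m_less_B in auto)
  then show ?thesis by (rule run_mono) auto
qed

lemma run_spanner_program:
  assumes s: "input_ok s"
  shows "run B (spanner_program A) s
    (TA + 25 * (n * n) + 320 * (n * m) + 400 * m + 50 * n + 400 + 5 * b ^ \<mu> * (2 + step_time))
    (\<lambda>s'. if \<exists>S. is_solution I S then regs s' 6 = 1 \<and> is_solution I {ed i | i. i < m \<and> mem s' 5 i = 1} else regs s' 6 = 0)"
    (is "run B _ s _ ?Q")
proof -
  let ?it = "(T, restricted T, [], 0)"
  let ?\<phi> = "5 * b ^ \<mu>"
  have "run B (spanner_program A) s ((TA + 25 * (n * n) + 320 * (n * m) + 250 * m + 200) + ((14 * m + 8) + ((20 * m + 8) + (20 +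
    ((30 * m + 20 * n + 40) + (?\<phi> * (2 + step_time) + 2)))))) ?Q"
    unfolding spanner_program_def
  proof (rule run_Seq[OF run_preprocess[OF s]])
    fix s1 assume e1: "env s1"
    show "run B (trivial_flags ;; restrict ;; reset ;; push ;; While (Reg 8) (search_body A)) s1
      ((14 * m + 8) + ((20 * m + 8) + (20 + ((30 * m + 20 * n + 40) + (?\<phi> * (2 + step_time) + 2))))) ?Q"
    proof (rule run_Seq[OF run_trivial_flags[OF e1]])
      fix s2 assume F2: "\<forall>i<m. mem s2 5 i = (if ed i \<in> T then 1 else 0)" and ag2: "agree B (wr trivial_flags) (wa trivial_flags) s1 s2"
      have e2: "env s2" by (rule env_agree[OF e1 ag2]) auto
      show "run B (restrict ;; reset ;; push ;; While (Reg 8) (search_body A)) s2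
        ((20 * m + 8) + (20 + ((30 * m + 20 * n + 40) + (?\<phi> * (2 + step_time) + 2)))) ?Q"
      proof (rule run_Seq[OF run_restrict[OF env_base[OF e2] F2]])
        fix s3 assume X3: "\<forall>i<m. mem s3 6 i = restricted T (ed i)" and ag3: "agree B (wr restrict) (wa restrict) s2 s3"
        have e3: "env s3" by (rule env_agree[OF e2 ag3]) auto
        have F3: "\<forall>i<m. mem s3 5 i = (if ed i \<in> T then 1 else 0)" using F2 agree_mem[OF ag3, of 5] by simp
        let ?s4 = "s3\<lparr>regs := (regs s3)(9 := 0, 10 := 0, 6 := 0, 8 := 0)\<rparr>"
        have r4: "run B reset s3 20 (\<lambda>s'. s' = ?s4)" by (simp add: reset_def wp_simps)
        show "run B (reset ;; push ;; While (Reg 8) (search_body A)) s3 (20 + ((30 * m + 20 * n + 40) + (?\<phi> * (2 + step_time) + 2))) ?Q"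
        proof (rule run_Seq[OF r4], hypsubst)
          assume ag4: "agree B (wr reset) (wa reset) s3 ?s4"
          have e4: "env ?s4" by (rule env_agree[OF e3 ag4]) auto
          have c4: "current ?s4 ?it" using F3 X3 by (simp add: current_def)
          have st4: "stack ?s4 []" by (simp add: stack_def)
          have h4: "length [] \<le> max_height" by simp
          show "run B (push ;; While (Reg 8) (search_body A)) ?s4 ((30 * m + 20 * n + 40) + (?\<phi> * (2 + step_time) + 2)) ?Q"
          proof (rule run_Seq[OF run_push[OF env_base[OF e4] c4 st4 h4]])
            fix s5 assume st5: "stack s5 ([] @ [?it])" and ag5: "agree B (wr push) (wa push) ?s4 s5"
            have e5: "env s5" by (rule env_agree[OF e4 ag5]) auto
            have r65: "regs s5 6 = 0" using agree_reg[OF ag5, of 6] by simp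
            have "item_ok ?it" using trivial_subset by (simp add: set_item_def)
            \<comment> \<open>The root contains no nontrivial edge, so the whole budget
              \<open>\<mu>\<close> appears in the exponent of its potential.\<close>
            moreover have "T \<inter> N = {}" by (auto simp: nontrivial_edges_def)
            then have "potential ?it \<le> ?\<phi>" by simp
            moreover have "solvable ?it" if S: "is_solution I S" for S
              using solution_with_trivial[OF S] by auto
            ultimately have "searching ?\<phi> s5"
              unfolding searching_def using e5 r65 st5
              by (intro conjI disjI2 exI[of _ "[?it]"]) (auto simp del: item_ok.simps potential.simps solvable.simps)
            then show "run B (While (Reg 8) (search_body A)) s5 (?\<phi> * (2 + step_time) + 2) ?Q" by (rule run_search)
          qed
        qed
      qed
    qed
  qed
  then show ?thesis by (rule run_mono) auto
qed

end

section \<open>The Floyd-Warshall algorithm\<close>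

definition fw_init_sum :: program where
  "fw_init_sum = For 4 7 (Assign 3 (Reg 3 \<oplus> Cell 2 (Reg 4)))"

definition fw_init_all :: program where
  "fw_init_all = For 4 2 (Store 4 (Reg 4) (Reg 3))"

definition fw_init_edges :: program where
  "fw_init_edges = For 4 7 (Store 4 (Cell 0 (Reg 4) \<otimes> Reg 0 \<oplus> Cell 1 (Reg 4)) (Cell 2 (Reg 4)) ;;
     Store 4 (Cell 1 (Reg 4) \<otimes> Reg 0 \<oplus> Cell 0 (Reg 4)) (Cell 2 (Reg 4)))"

definition fw_init_diag :: program where
  "fw_init_diag = For 4 0 (Store 4 (Reg 4 \<otimes> Reg 0 \<oplus> Reg 4) (Const 0))"

definition fw_relax :: program where
  "fw_relax = If (Cell 4 (Reg 5 \<otimes> Reg 0 \<oplus> Reg 4) \<oplus> Cell 4 (Reg 4 \<otimes> Reg 0 \<oplus> Reg 6) \<prec> Cell 4 (Reg 5 \<otimes> Reg 0 \<oplus> Reg 6))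
     (Store 4 (Reg 5 \<otimes> Reg 0 \<oplus> Reg 6) (Cell 4 (Reg 5 \<otimes> Reg 0 \<oplus> Reg 4) \<oplus> Cell 4 (Reg 4 \<otimes> Reg 0 \<oplus> Reg 6))) Skip"

definition fw_main :: program where
  "fw_main = For 4 0 (For 5 0 (For 6 0 fw_relax))"

text \<open>A concrete algorithm is needed for the unconditional existence claim, where any
  polynomial running time will do.\<close>

definition floyd_warshall :: program where
  "floyd_warshall = Assign 7 (Reg 1) ;; Assign 2 (Reg 0 \<otimes> Reg 0) ;; Assign 3 (Const 1) ;; fw_init_sum ;;
     Assign 3 (Reg 3 \<otimes> Reg 0) ;; fw_init_all ;; fw_init_edges ;; fw_init_diag ;; fw_main"

lemma frame_sets_fw [simp]:
  "wr fw_init_sum = {3, 4}" "wa fw_init_sum = {}" "wr fw_init_all = {4}" "wa fw_init_all = {4}"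
  "wr fw_init_edges = {4}" "wa fw_init_edges = {4}" "wr fw_init_diag = {4}" "wa fw_init_diag = {4}"
  "wr fw_relax = {}" "wa fw_relax = {4}" "wr fw_main = {4, 5, 6}" "wa fw_main = {4}"
  by (auto simp: fw_init_sum_def fw_init_all_def fw_init_edges_def fw_init_diag_def fw_relax_def fw_main_def)

lemma index_less: "u < n \<Longrightarrow> v < n \<Longrightarrow> u * n + v < n * (n::nat)"
proof -
  assume "u < n" "v < n"
  then have "u * n + v < (u + 1) * n" by simp
  also have "\<dots> \<le> n * n" using \<open>u < n\<close> by (intro mult_right_mono) auto
  finally show ?thesis .
qed

lemma index_inj: "v < n \<Longrightarrow> v' < n \<Longrightarrow> u * n + v = u' * n + v' \<longleftrightarrow> u = u' \<and> v = (v'::nat)"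
proof
  assume v: "v < n" "v' < n" and eq: "u * n + v = u' * n + v'"
  have "(u * n + v) div n = u" "(u' * n + v') div n = u'" using v by auto
  with eq have "u = u'" by simp
  with eq show "u = u' \<and> v = v'" by simp
qed simp

definition inner :: "nat list \<Rightarrow> nat set" where
  "inner p = set (butlast (tl p))"

text \<open>\<open>B1\<close> lets the sum of two matrix entries fit, each of which is at most
  \<open>infinite_dist\<close>.\<close>

locale floyd = cgraph +
  fixes l :: "nat set \<Rightarrow> nat" and B :: nat and eu ev :: "nat \<Rightarrow> nat"
  assumes ed: "bij_betw (\<lambda>i. {eu i, ev i}) {..<card E} E"
    and B1: "2 * ((1 + sum l E) * n) \<le> B" and B2: "n * n + n + card E + sum l E + 10 \<le> B"
begin

abbreviation "m \<equiv> card E"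
abbreviation "ed i \<equiv> {eu i, ev i}"
abbreviation "infinite_dist \<equiv> (1 + sum l E) * n"
abbreviation "d \<equiv> ndist l E"

lemma ed_mem: "i < m \<Longrightarrow> {eu i, ev i} \<in> E"
  using ed by (auto simp: bij_betw_def)

lemma ed_nodes: "i < m \<Longrightarrow> eu i < n" "i < m \<Longrightarrow> ev i < n" "i < m \<Longrightarrow> eu i \<noteq> ev i"
  using ed_mem edge_nodes by blast+

lemma sum_edges: "(\<Sum>i<m. f (ed i)) = sum f E"
  using sum.reindex_bij_betw[OF ed] by simp

lemma index_le_B: "u < n \<Longrightarrow> v < n \<Longrightarrow> u * n + v \<le> B"
  using index_less[of u n v] B2 by linarith

lemma index_le_B': "u < n \<Longrightarrow> u * n \<le> B"
  using B2 mult_le_mono1[of u n n] by linarith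

lemma node_le_B: "u < n \<Longrightarrow> u \<le> B" and edge_le_B: "i < m \<Longrightarrow> i \<le> B" and sizes_le_B: "n \<le> B" "m \<le> B" "n * n \<le> B"
  "n < B" "m < B" "n * n < B" "Suc 0 \<le> B"
  using B2 by linarith+

lemmas le_B = index_le_B index_le_B' node_le_B edge_le_B sizes_le_B ed_nodes

definition ready :: "state \<Rightarrow> bool" where
  "ready s \<longleftrightarrow> all_words B s \<and> regs s 0 = n \<and> regs s 7 = m \<and> regs s 2 = n * n \<and>
     (\<forall>i<m. mem s 0 i = eu i \<and> mem s 1 i = ev i \<and> mem s 2 i = l (ed i))"

lemma ready_agree:
  assumes "ready s" "agree B W X s s'" "0 \<notin> W \<and> 7 \<notin> W \<and> 2 \<notin> W" "0 \<notin> X \<and> 1 \<notin> X \<and> 2 \<notin> X"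
  shows "ready s'"
proof -
  have "all_words B s'" using agree_words[OF assms(2)] assms(1) by (simp add: ready_def)
  moreover have "regs s' 0 = regs s 0" "regs s' 7 = regs s 7" "regs s' 2 = regs s 2"
    "mem s' 0 = mem s 0" "mem s' 1 = mem s 1" "mem s' 2 = mem s 2"
    using agree_reg[OF assms(2)] agree_mem[OF assms(2)] assms(3,4) by auto
  ultimately show ?thesis using assms(1) unfolding ready_def by simp
qed

lemma readyD:
  assumes "ready s"
  shows "regs s 0 = n" "regs s 7 = m" "regs s 2 = n * n" "\<And>r. regs s r \<le> B" "\<And>a i. mem s a i \<le> B"
    "\<And>i. i < m \<Longrightarrow> mem s 0 i = eu i" "\<And>i. i < m \<Longrightarrow> mem s (Suc 0) i = ev i" "\<And>i. i < m \<Longrightarrow> mem s 2 i = l (ed i)"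
  using assms by (auto simp: ready_def all_words_def)

text \<open>Lower and upper bounds replace the usual equation for stage \<open>k\<close>. The matrix
  is updated in place, so an entry may already belong to the next stage when it is used, which only
  improves it.\<close>

definition good :: "nat \<Rightarrow> (nat \<Rightarrow> nat) \<Rightarrow> nat \<Rightarrow> nat \<Rightarrow> bool" where
  "good k M x y \<longleftrightarrow> d x y \<le> M (x * n + y) \<and> M (x * n + y) \<le> infinite_dist \<and>
     (\<forall>p. simple_path E x y p \<longrightarrow> inner p \<subseteq> {..<k} \<longrightarrow> M (x * n + y) \<le> path_length l p)"

lemma good_mono: "good k M x y \<Longrightarrow> j \<le> k \<Longrightarrow> good j M x y"
proof -
  assume g: "good k M x y" and jk: "j \<le> k"
  have "inner p \<subseteq> {..<k}" if "inner p \<subseteq> {..<j}" for p using that jk by auto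
  then show ?thesis using g unfolding good_def by simp
qed

text \<open>A simple path passes \<open>k\<close> at most once. If it has \<open>k\<close> as an
  inner node, both parts have only inner nodes below \<open>k\<close>, so the estimates of stage
  \<open>k\<close> apply to them.\<close>

lemma relax_good:
  assumes g: "good k M u k" "good k M k v" "good k M u v" and n: "k < n" "u < n" "v < n"
    and M': "M' (u * n + v) = min (M (u * n + v)) (M (u * n + k) + M (k * n + v))"
  shows "good (Suc k) M' u v"
  unfolding good_def
proof (intro conjI allI impI)
  have "d u v \<le> d u k + d k v" using ndist_triangle n by blast
  then show "d u v \<le> M' (u * n + v)" using g unfolding M' good_def by linarith
  show "M' (u * n + v) \<le> infinite_dist" using g unfolding M' good_def by linarith
  fix p assume p: "simple_path E u v p" "inner p \<subseteq> {..<Suc k}"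
  show "M' (u * n + v) \<le> path_length l p"
  proof (cases "k \<in> inner p")
    case False
    then have "inner p \<subseteq> {..<k}" using p(2) by (auto simp: less_Suc_eq)
    then have "M (u * n + v) \<le> path_length l p" using g(3) p(1) by (simp add: good_def)
    then show ?thesis unfolding M' by simp
  next
    case True
    then obtain q1 q2 where q: "butlast (tl p) = q1 @ k # q2" unfolding inner_def by (meson split_list)
    then have "tl p \<noteq> []" by auto
    then have "tl p = butlast (tl p) @ [last (tl p)]" "p = hd p # tl p" by (auto, metis list.collapse list.sel(2))
    then have p': "p = (hd p # q1) @ k # (q2 @ [last (tl p)])" using q by (metis append.assoc append_Cons)
    define a where "a = hd p"
    define z where "z = last (tl p)"
    have p'': "p = (a # q1) @ k # (q2 @ [z])" using p' by (simp add: a_def z_def)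
    have w: "walk E u v p" "distinct p" using p(1) by (auto simp: simple_path_iff_walk)
    have w12: "walk E u k ((a # q1) @ [k])" "walk E k v (k # q2 @ [z])"
      using w(1) unfolding p'' by (metis walk_split)+
    have inn: "inner p = set q1 \<union> {k} \<union> set q2" unfolding inner_def q by auto
    have "k \<notin> set q1" "k \<notin> set q2" using w(2) unfolding p'' by auto
    then have sub: "set q1 \<subseteq> {..<k}" "set q2 \<subseteq> {..<k}"
      using p(2) unfolding inn by (auto simp: less_Suc_eq)
    have "simple_path E u k ((a # q1) @ [k])" "simple_path E k v (k # q2 @ [z])"
      using w12 w(2) unfolding simple_path_iff_walk p'' by auto
    moreover have "inner ((a # q1) @ [k]) = set q1" "inner (k # q2 @ [z]) = set q2" by (auto simp: inner_def butlast_append)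
    ultimately have "M (u * n + k) \<le> path_length l ((a # q1) @ [k])" "M (k * n + v) \<le> path_length l (k # q2 @ [z])"
      using g(1,2) sub unfolding good_def by metis+
    moreover have "path_length l p = path_length l ((a # q1) @ [k]) + path_length l (k # q2 @ [z])"
      unfolding p'' by (rule path_length_append)
    ultimately show ?thesis unfolding M' by linarith
  qed
qed

lemma good_final:
  assumes "good n M x y" "x < n" "y < n"
  shows "M (x * n + y) = d x y"
proof -
  obtain p where p: "simple_path E x y p" "path_length l p = d x y" using ndist_attained[OF assms(2,3)] .
  have "set p \<subseteq> {..<n}" using p(1) walk_nodes[OF _ assms(2)] by (auto simp: simple_path_iff_walk)
  moreover have "inner p \<subseteq> set p" unfolding inner_def by (cases p) (auto dest: in_set_butlastD)
  ultimately have "inner p \<subseteq> {..<n}" by (rule subset_trans[rotated])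
  then have "M (x * n + y) \<le> path_length l p" using assms(1) p(1) unfolding good_def by simp
  then have "M (x * n + y) \<le> d x y" using p(2) by simp
  moreover have "d x y \<le> M (x * n + y)" using assms(1) by (simp add: good_def)
  ultimately show ?thesis by (rule le_antisym)
qed

lemma run_fw_main:
  assumes r: "ready s" and g: "\<forall>x<n. \<forall>y<n. good 0 (mem s 4) x y"
  shows "run B fw_main s (50 * (n * n * n) + 16 * (n * n) + 16 * n + 8) (\<lambda>s'. \<forall>x<n. \<forall>y<n. mem s' 4 (x * n + y) = d x y)"
proof -
  \<comment> \<open>Entries in front of \<open>(u, v)\<close> in row-wise order have reached the
    next stage.\<close>
  define G where "G k u v s' \<longleftrightarrow> (\<forall>x<n. \<forall>y<n. good (if x < u \<or> x = u \<and> y < v then Suc k else k) (mem s' 4) x y)"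
    for k u v and s' :: state
  have step: "run B fw_relax s' 42 (\<lambda>s''. G k u (Suc v) s'')"
    if s': "ready s'" "G k u v s'" "regs s' 4 = k" "regs s' 5 = u" "regs s' 6 = v" and n: "k < n" "u < n" "v < n" for s' k u v
  proof -
    define M where "M = mem s' 4"
    define M' where "M' = (if M (u * n + k) + M (k * n + v) < M (u * n + v)
      then M(u * n + v := M (u * n + k) + M (k * n + v)) else M)"
    have gs: "good k M x y" if "x < n" "y < n" for x y
    proof -
      have "good (if x < u \<or> x = u \<and> y < v then Suc k else k) M x y" using s'(2) that by (simp add: G_def M_def)
      then show ?thesis by (rule good_mono) simp
    qed
    have le: "M (x * n + y) \<le> infinite_dist" if "x < n" "y < n" for x y using gs[OF that] by (simp add: good_def)
    have "M (u * n + k) + M (k * n + v) \<le> B" "M (u * n + v) \<le> B" "M (u * n + k) \<le> B" "M (k * n + v) \<le> B"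
      using le[of u k] le[of k v] le[of u v] n B1 by linarith+
    then have "run B fw_relax s' 42 (\<lambda>s''. mem s'' 4 = M')"
      using s'(3-5) n readyD(1)[OF s'(1)] by (simp add: fw_relax_def wp_simps le_B M'_def M_def)
    moreover have "good (if x < u \<or> x = u \<and> y < Suc v then Suc k else k) M' x y" if xy: "x < n" "y < n" for x y
    proof (cases "x = u \<and> y = v")
      case True
      have "M' (u * n + v) = min (M (u * n + v)) (M (u * n + k) + M (k * n + v))" by (simp add: M'_def)
      with n have "good (Suc k) M' u v" by (intro relax_good) (simp_all add: gs)
      then show ?thesis using True by simp
    next
      case False
      then have "x * n + y \<noteq> u * n + v" using index_inj[OF xy(2) n(3), of x u] by simp
      then have "M' (x * n + y) = M (x * n + y)" by (simp add: M'_def)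
      moreover have "good (if x < u \<or> x = u \<and> y < v then Suc k else k) M x y" using s'(2) xy by (simp add: G_def M_def)
      ultimately show ?thesis using False by (auto simp: good_def less_Suc_eq)
    qed
    ultimately show ?thesis by (elim run_mono) (auto simp: G_def)
  qed
  have "run B fw_main s (n * ((n * ((n * (42 + 8) + 8) + 8) + 8) + 8) + 8) (G n 0 0)"
    unfolding fw_main_def
  proof (rule run_For[where I = "\<lambda>k. G k 0 0"])
    fix k s1 assume k: "k < n" "G k 0 0 s1" "regs s1 4 = k" and ag1: "agree B (insert 4 (wr (For 5 0 (For 6 0 fw_relax)))) (wa (For 5 0 (For 6 0 fw_relax))) s s1"
    have r1: "ready s1" by (rule ready_agree[OF r ag1]) auto
    show "run B (For 5 0 (For 6 0 fw_relax)) s1 (n * ((n * (42 + 8) + 8) + 8) + 8)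
       (\<lambda>s''. G (Suc k) 0 0 (s''\<lparr>regs := (regs s'')(4 := Suc k)\<rparr>))"
    proof (rule run_For[where I = "\<lambda>u. G k u 0"])
      fix u s2 assume u: "u < n" "G k u 0 s2" "regs s2 5 = u" and ag2: "agree B (insert 5 (wr (For 6 0 fw_relax))) (wa (For 6 0 fw_relax)) s1 s2"
      have r2: "ready s2" by (rule ready_agree[OF r1 ag2]) auto
      have s2: "regs s2 4 = k" using agree_reg[OF ag2, of 4] k by simp
      show "run B (For 6 0 fw_relax) s2 (n * (42 + 8) + 8) (\<lambda>s''. G k (Suc u) 0 (s''\<lparr>regs := (regs s'')(5 := Suc u)\<rparr>))"
      proof (rule run_For[where I = "\<lambda>v. G k u v"])
        fix v s3 assume v: "v < n" "G k u v s3" "regs s3 6 = v" and ag3: "agree B (insert 6 (wr fw_relax)) (wa fw_relax) s2 s3"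
        have r3: "ready s3" by (rule ready_agree[OF r2 ag3]) auto
        have "regs s3 4 = k" "regs s3 5 = u" using agree_reg[OF ag3] s2 u by auto
        from step[OF r3 v(2) this v(3) k(1) u(1) v(1)]
        show "run B fw_relax s3 42 (\<lambda>s''. G k u (Suc v) (s''\<lparr>regs := (regs s'')(6 := Suc v)\<rparr>))"
          by (rule run_mono) (auto simp: G_def)
      next
        fix s3 assume G: "G k u n s3"
        have "(x < u \<or> x = u \<and> y < n) \<longleftrightarrow> (x < Suc u \<or> x = Suc u \<and> y < 0)" if "y < n" for x y
          using that by (auto simp: less_Suc_eq)
        with G show "G k (Suc u) 0 (s3\<lparr>regs := (regs s3)(5 := Suc u)\<rparr>)" unfolding G_def by simp
      qed (use readyD(1)[OF r2] sizes_le_B u in \<open>auto simp: G_def\<close>)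
    next
      fix s2 assume "G k n 0 s2"
      then show "G (Suc k) 0 0 (s2\<lparr>regs := (regs s2)(4 := Suc k)\<rparr>)" by (simp add: G_def)
    qed (use readyD(1)[OF r1] sizes_le_B k in \<open>auto simp: G_def\<close>)
  qed (use readyD(1)[OF r] sizes_le_B g in \<open>auto simp: G_def\<close>)
  then show ?thesis
  proof (rule run_mono)
    fix s' assume "G n 0 0 s'"
    then show "\<forall>x<n. \<forall>y<n. mem s' 4 (x * n + y) = d x y" using good_final by (simp add: G_def)
  qed (simp add: algebra_simps)
qed

lemma run_fw_init_all:
  assumes r: "ready s" and r3: "regs s 3 = c"
  shows "run B fw_init_all s (12 * (n * n) + 8) (\<lambda>s'. \<forall>i<n*n. mem s' 4 i = c)"
proof -
  have "run B fw_init_all s (n * n * (4 + 8) + 8) (\<lambda>s'. \<forall>i<n*n. mem s' 4 i = c)"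
    unfolding fw_init_all_def
  proof (rule run_For[where I = "\<lambda>j s'. \<forall>i<j. mem s' 4 i = c"])
    fix j s' assume j: "j < n * n" "\<forall>i<j. mem s' 4 i = c" "regs s' 4 = j"
      and ag: "agree B (insert 4 (wr (Store 4 (Reg 4) (Reg 3)))) (wa (Store 4 (Reg 4) (Reg 3))) s s'"
    have "regs s' 3 = c" "c \<le> B" "j \<le> B" using agree_reg[OF ag, of 3] r3 readyD(4)[OF r, of 3] j(1) sizes_le_B(3) by auto
    then show "run B (Store 4 (Reg 4) (Reg 3)) s' 4 (\<lambda>s''. \<forall>i<Suc j. mem (s''\<lparr>regs := (regs s'')(4 := Suc j)\<rparr>) 4 i = c)"
      using j by (auto simp: wp_simps less_Suc_eq)
  qed (use readyD[OF r] sizes_le_B in auto)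
  then show ?thesis by (rule run_mono) auto
qed

lemma run_fw_init_edges:
  assumes r: "ready s" and c: "\<forall>i<n*n. mem s 4 i = c"
  shows "run B fw_init_edges s (40 * m + 8)
    (\<lambda>s'. \<forall>x<n. \<forall>y<n. mem s' 4 (x * n + y) = (if {x, y} \<in> E then l {x, y} else c))"
proof -
  let ?c = "Store 4 (Cell 0 (Reg 4) \<otimes> Reg 0 \<oplus> Cell 1 (Reg 4)) (Cell 2 (Reg 4)) ;;
     Store 4 (Cell 1 (Reg 4) \<otimes> Reg 0 \<oplus> Cell 0 (Reg 4)) (Cell 2 (Reg 4))"
  have "run B fw_init_edges s (m * (30 + 8) + 8)
    (\<lambda>s'. \<forall>x<n. \<forall>y<n. mem s' 4 (x * n + y) = (if {x, y} \<in> E then l {x, y} else c))"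
    unfolding fw_init_edges_def
  proof (rule run_For[where I = "\<lambda>j s'. \<forall>x<n. \<forall>y<n. mem s' 4 (x * n + y) = (if \<exists>i<j. {x, y} = ed i then l {x, y} else c)"])
    fix j and s' :: state assume j: "j < m" "\<forall>x<n. \<forall>y<n. mem s' 4 (x * n + y) = (if \<exists>i<j. {x, y} = ed i then l {x, y} else c)" "regs s' 4 = j"
      and ag: "agree B (insert 4 (wr ?c)) (wa ?c) s s'"
    have r': "ready s'" by (rule ready_agree[OF r ag]) auto
    note rd = readyD(6,7,8)[OF r' j(1)]
    have uv: "eu j < n" "ev j < n" "eu j \<noteq> ev j" using ed_nodes[OF j(1)] by auto
    define M where "M = (mem s' 4)(eu j * n + ev j := l (ed j), ev j * n + eu j := l (ed j))"
    have lB: "l (ed j) \<le> B" using readyD(5)[OF r', of 2 j] rd by simp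
    have run: "run B ?c s' 30 (\<lambda>s''. mem s'' 4 = M)"
      using j(1,3) rd uv lB readyD(1)[OF r'] by (simp add: wp_simps le_B M_def)
    have M: "M (x * n + y) = (if \<exists>i<Suc j. {x, y} = ed i then l {x, y} else c)" if xy: "x < n" "y < n" for x y
    proof (cases "{x, y} = ed j")
      case True
      then have "M (x * n + y) = l (ed j)" by (auto simp: M_def doubleton_eq_iff)
      then show ?thesis using True by auto
    next
      case False
      then have "x * n + y \<noteq> eu j * n + ev j" "x * n + y \<noteq> ev j * n + eu j"
        using index_inj[OF xy(2) uv(2), of x "eu j"] index_inj[OF xy(2) uv(1), of x "ev j"] by auto
      then have "M (x * n + y) = mem s' 4 (x * n + y)" by (simp add: M_def)
      moreover have "(\<exists>i<Suc j. {x, y} = ed i) \<longleftrightarrow> (\<exists>i<j. {x, y} = ed i)" using False by (metis less_Suc_eq)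
      ultimately show ?thesis using j(2) xy by simp
    qed
    show "run B ?c s' 30 (\<lambda>s''. \<forall>x<n. \<forall>y<n. mem (s''\<lparr>regs := (regs s'')(4 := Suc j)\<rparr>) 4 (x * n + y) =
        (if \<exists>i<Suc j. {x, y} = ed i then l {x, y} else c))"
    proof (rule run_mono[OF run], rule order_refl, intro allI impI)
      fix s'' :: state and x y assume "mem s'' 4 = M" and xy: "x < n" "y < n"
      then have eq: "mem (s''\<lparr>regs := (regs s'')(4 := Suc j)\<rparr>) 4 = M" by simp
      show "mem (s''\<lparr>regs := (regs s'')(4 := Suc j)\<rparr>) 4 (x * n + y) =
        (if \<exists>i<Suc j. {x, y} = ed i then l {x, y} else c)" unfolding eq by (rule M[OF xy])
    qed
  next
    fix s' :: state assume I: "\<forall>x<n. \<forall>y<n. mem s' 4 (x * n + y) = (if \<exists>i<m. {x, y} = ed i then l {x, y} else c)"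
    have "(\<exists>i<m. e = ed i) \<longleftrightarrow> e \<in> E" for e using ed by (auto simp: bij_betw_def)
    then show "\<forall>x<n. \<forall>y<n. mem s' 4 (x * n + y) = (if {x, y} \<in> E then l {x, y} else c)" using I by simp
  qed (use readyD[OF r] sizes_le_B c index_less in auto)
  then show ?thesis by (rule run_mono) auto
qed

lemma run_fw_init_diag:
  assumes r: "ready s"
  shows "run B fw_init_diag s (20 * n + 8)
    (\<lambda>s'. \<forall>x<n. \<forall>y<n. mem s' 4 (x * n + y) = (if x = y then 0 else mem s 4 (x * n + y)))"
proof -
  let ?c = "Store 4 (Reg 4 \<otimes> Reg 0 \<oplus> Reg 4) (Const 0)"
  have "run B fw_init_diag s (n * (12 + 8) + 8)
    (\<lambda>s'. \<forall>x<n. \<forall>y<n. mem s' 4 (x * n + y) = (if x = y then 0 else mem s 4 (x * n + y)))"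
    unfolding fw_init_diag_def
  proof (rule run_For[where I = "\<lambda>j s'. \<forall>x<n. \<forall>y<n. mem s' 4 (x * n + y) = (if x = y \<and> x < j then 0 else mem s 4 (x * n + y))"])
    fix j and s' :: state assume j: "j < n" "\<forall>x<n. \<forall>y<n. mem s' 4 (x * n + y) = (if x = y \<and> x < j then 0 else mem s 4 (x * n + y))"
      "regs s' 4 = j" and ag: "agree B (insert 4 (wr ?c)) (wa ?c) s s'"
    have r': "ready s'" by (rule ready_agree[OF r ag]) auto
    have "run B ?c s' 12 (\<lambda>s''. mem s'' 4 = (mem s' 4)(j * n + j := 0))"
      using j(1,3) readyD(1)[OF r'] by (simp add: wp_simps le_B)
    moreover have "((mem s' 4)(j * n + j := 0)) (x * n + y) = (if x = y \<and> x < Suc j then 0 else mem s 4 (x * n + y))"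
      if "x < n" "y < n" for x y
      using j that index_inj[of y n j x j] by (auto simp: less_Suc_eq)
    ultimately show "run B ?c s' 12 (\<lambda>s''. \<forall>x<n. \<forall>y<n. mem (s''\<lparr>regs := (regs s'')(4 := Suc j)\<rparr>) 4 (x * n + y) =
        (if x = y \<and> x < Suc j then 0 else mem s 4 (x * n + y)))"
      by (elim run_mono) auto
  qed (use readyD[OF r] sizes_le_B in auto)
  then show ?thesis by (rule run_mono) auto
qed

lemma run_fw_init_sum:
  assumes r: "ready s" "regs s 3 = 1"
  shows "run B fw_init_sum s (13 * m + 8) (\<lambda>s'. regs s' 3 = 1 + sum l E)"
proof -
  let ?c = "Assign 3 (Reg 3 \<oplus> Cell 2 (Reg 4))"
  have le: "(\<Sum>i<j. l (ed i)) \<le> sum l E" if "j \<le> m" for j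
  proof -
    have "(\<Sum>i<j. l (ed i)) \<le> (\<Sum>i<m. l (ed i))" using that by (intro sum_mono2) auto
    then show ?thesis by (simp add: sum_edges)
  qed
  have "run B fw_init_sum s (m * (5 + 8) + 8) (\<lambda>s'. regs s' 3 = 1 + sum l E)"
    unfolding fw_init_sum_def
  proof (rule run_For[where I = "\<lambda>j s'. regs s' 3 = 1 + (\<Sum>i<j. l (ed i))"])
    fix j s' assume j: "j < m" "regs s' 3 = 1 + (\<Sum>i<j. l (ed i))" "regs s' 4 = j"
      and ag: "agree B (insert 4 (wr ?c)) (wa ?c) s s'"
    have "mem s' 2 j = l (ed j)" using readyD(8)[OF r(1) j(1)] agree_mem[OF ag, of 2] by simp
    moreover have "Suc (\<Sum>i<j. l (ed i)) \<le> B" "Suc ((\<Sum>i<j. l (ed i)) + l (ed j)) \<le> B"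
      using le[of j] le[of "Suc j"] j(1) B2 by auto
    then have "l (ed j) \<le> B" by simp
    ultimately show "run B ?c s' 5 (\<lambda>s''. regs (s''\<lparr>regs := (regs s'')(4 := Suc j)\<rparr>) 3 = 1 + (\<Sum>i<Suc j. l (ed i)))"
      using j \<open>Suc ((\<Sum>i<j. l (ed i)) + l (ed j)) \<le> B\<close> by (simp add: wp_simps le_B)
  qed (use readyD[OF r(1)] r(2) sizes_le_B in \<open>auto simp: sum_edges\<close>)
  then show ?thesis by (rule run_mono) auto
qed

text \<open>A simple path without inner nodes is a single node or an edge.
  \<open>infinite_dist\<close> bounds all distances, as the graph is connected.\<close>

lemma initial_good:
  assumes M: "\<And>x y. x < n \<Longrightarrow> y < n \<Longrightarrow> M (x * n + y) = (if x = y then 0 else if {x, y} \<in> E then l {x, y} else infinite_dist)"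
    and xy: "x < n" "y < n"
  shows "good 0 M x y"
  unfolding good_def M[OF xy]
proof (intro conjI allI impI)
  have le: "l e \<le> sum l E" if "e \<in> E" for e using finite_E that by (simp add: member_le_sum)
  have "sum l E * 1 \<le> (1 + sum l E) * n" using n_pos by (intro mult_le_mono) auto
  then have sumle: "sum l E \<le> infinite_dist" by simp
  have "d x y \<le> n * sum l E" using ndist_bound[OF xy le] .
  then have "d x y \<le> infinite_dist" by (simp add: algebra_simps)
  then show "d x y \<le> (if x = y then 0 else if {x, y} \<in> E then l {x, y} else infinite_dist)"
    using ndist_edge[of x y l] by simp
  show "(if x = y then 0 else if {x, y} \<in> E then l {x, y} else infinite_dist) \<le> infinite_dist"
    using le[of "{x, y}"] sumle by auto
  fix p assume p: "simple_path E x y p" "inner p \<subseteq> {..<0}"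
  show "(if x = y then 0 else if {x, y} \<in> E then l {x, y} else infinite_dist) \<le> path_length l p"
  proof (cases "x = y")
    case False
    have "p \<noteq> []" "hd p = x" "last p = y" using p(1) by (auto simp: simple_path_def)
    then have "\<exists>a q. p = x # a # q" using False by (cases p rule: list.exhaust; cases "tl p") auto
    then obtain a q where pq: "p = x # a # q" by blast
    have "q = []" using p(2) unfolding pq inner_def by (cases q) auto
    then have "p = [x, y]" using pq \<open>last p = y\<close> by simp
    then show ?thesis using p(1) False by (simp add: simple_path_def)
  qed simp
qed

lemma run_floyd_warshall:
  assumes s: "all_words B s" "regs s 0 = n" "regs s 1 = m" "\<forall>i<m. mem s 0 i = eu i \<and> mem s 1 i = ev i \<and> mem s 2 i = l (ed i)"
  shows "run B floyd_warshall s (200 * (n + m + 1) ^ 3) (\<lambda>s'. \<forall>x<n. \<forall>y<n. mem s' 4 (x * n + y) = d x y)"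
    (is "run B _ s _ ?Q")
proof -
  let ?s0 = "s\<lparr>regs := (regs s)(7 := m, 2 := n * n, 3 := 1)\<rparr>"
  have r0: "ready ?s0" using s sizes_le_B by (auto simp: ready_def all_words_def)
  have r03: "regs ?s0 3 = 1" by simp
  let ?t = "50 * (n * n * n) + 16 * (n * n) + 16 * n + 8"
  have "run B (fw_init_sum ;; Assign 3 (Reg 3 \<otimes> Reg 0) ;; fw_init_all ;; fw_init_edges ;; fw_init_diag ;; fw_main) ?s0
    ((13 * m + 8) + (1 + cost (Reg 3 \<otimes> Reg 0) + ((12 * (n * n) + 8) + ((40 * m + 8) + ((20 * n + 8) + ?t))))) ?Q"
  proof (rule run_Seq[OF run_fw_init_sum[OF r0 r03]])
    fix s1 assume s1: "regs s1 3 = 1 + sum l E" and ag1: "agree B (wr fw_init_sum) (wa fw_init_sum) ?s0 s1"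
    have r1: "ready s1" by (rule ready_agree[OF r0 ag1]) auto
    let ?s2 = "s1\<lparr>regs := (regs s1)(3 := infinite_dist)\<rparr>"
    have iB: "infinite_dist \<le> B" "1 + sum l E \<le> B" using B1 B2 by linarith+
    have r2: "ready ?s2" using r1 iB by (auto simp: ready_def all_words_def)
    have r23: "regs ?s2 3 = infinite_dist" by simp
    have "run B (fw_init_all ;; fw_init_edges ;; fw_init_diag ;; fw_main) ?s2
      ((12 * (n * n) + 8) + ((40 * m + 8) + ((20 * n + 8) + ?t))) ?Q"
    proof (rule run_Seq[OF run_fw_init_all[OF r2 r23]])
      fix s3 assume s3: "\<forall>i<n*n. mem s3 4 i = infinite_dist" and ag3: "agree B (wr fw_init_all) (wa fw_init_all) ?s2 s3"
      have r3: "ready s3" by (rule ready_agree[OF r2 ag3]) auto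
      show "run B (fw_init_edges ;; fw_init_diag ;; fw_main) s3 ((40 * m + 8) + ((20 * n + 8) + ?t)) ?Q"
      proof (rule run_Seq[OF run_fw_init_edges[OF r3 s3]])
        fix s4 assume s4: "\<forall>x<n. \<forall>y<n. mem s4 4 (x * n + y) = (if {x, y} \<in> E then l {x, y} else infinite_dist)"
          and ag4: "agree B (wr fw_init_edges) (wa fw_init_edges) s3 s4"
        have r4: "ready s4" by (rule ready_agree[OF r3 ag4]) auto
        show "run B (fw_init_diag ;; fw_main) s4 ((20 * n + 8) + ?t) ?Q"
        proof (rule run_Seq[OF run_fw_init_diag[OF r4]])
          fix s5 assume s5: "\<forall>x<n. \<forall>y<n. mem s5 4 (x * n + y) = (if x = y then 0 else mem s4 4 (x * n + y))"
            and ag5: "agree B (wr fw_init_diag) (wa fw_init_diag) s4 s5"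
          have r5: "ready s5" by (rule ready_agree[OF r4 ag5]) auto
          have "\<forall>x<n. \<forall>y<n. good 0 (mem s5 4) x y"
            by (intro allI impI initial_good) (use s4 s5 in simp_all)
          then show "run B fw_main s5 ?t ?Q" by (rule run_fw_main[OF r5])
        qed
      qed
    qed
    then show "run B (Assign 3 (Reg 3 \<otimes> Reg 0) ;; fw_init_all ;; fw_init_edges ;; fw_init_diag ;; fw_main) s1
      (1 + cost (Reg 3 \<otimes> Reg 0) + ((12 * (n * n) + 8) + ((40 * m + 8) + ((20 * n + 8) + ?t)))) ?Q"
      using s1 readyD(1)[OF r1] iB sizes_le_B by (intro run_Assign_Seq) auto
  qed
  then have "run B floyd_warshall s (1 + cost (Reg 1) + (1 + cost (Reg 0 \<otimes> Reg 0) + (1 + cost (Const 1) +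
    ((13 * m + 8) + (1 + cost (Reg 3 \<otimes> Reg 0) + ((12 * (n * n) + 8) + ((40 * m + 8) + ((20 * n + 8) + ?t)))))))) ?Q"
    unfolding floyd_warshall_def using s(2,3) sizes_le_B by (intro run_Assign_Seq) auto
  then show ?thesis
  proof (rule run_mono)
    \<comment> \<open>The expanded cube contains every monomial of the accumulated bound, so
      comparing coefficients suffices.\<close>
    have "(n + m + 1) ^ 3 = n * n * n + 3 * (n * n * m) + 3 * (n * m * m) + m * m * m + 3 * (n * n) + 6 * (n * m) + 3 * (m * m) + 3 * n + 3 * m + 1"
      by (simp add: power3_eq_cube algebra_simps)
    then show "1 + cost (Reg 1) + (1 + cost (Reg 0 \<otimes> Reg 0) + (1 + cost (Const 1) +
      ((13 * m + 8) + (1 + cost (Reg 3 \<otimes> Reg 0) + ((12 * (n * n) + 8) + ((40 * m + 8) + ((20 * n + 8) + ?t))))))) \<le> 200 * (n + m + 1) ^ 3"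
      by simp
  qed simp
qed

end

section \<open>Running times\<close>

lemma poly_mono_nat: "x \<le> y \<Longrightarrow> poly p x \<le> poly (p :: nat poly) y"
  by (induction p) (auto intro!: add_mono mult_mono)

text \<open>The parameter-dependent factor of the running time; the first argument is \<mu>, the
  second one \<open>b\<close>.\<close>

lemma computable2_power: "computable2 (\<lambda>x y. y ^ x)"
  unfolding computable2_def
proof (intro exI[of _ "Assign 2 (Const 1) ;; For 3 0 (Assign 2 (Reg 2 \<otimes> Reg 1))"] allI)
  fix x y :: nat
  \<comment> \<open>The base \<open>y + 1\<close> takes care of \<open>y = 0\<close>, whose powers
    do not increase with the exponent.\<close>
  let ?B = "(y + 1) ^ x + y + x + 2"
  have le: "y ^ j \<le> ?B" if "j \<le> x" for j
  proof -
    have "y ^ j \<le> (y + 1) ^ j" by (intro power_mono) auto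
    also have "\<dots> \<le> (y + 1) ^ x" using that by (intro power_increasing) auto
    finally show ?thesis by simp
  qed
  show "\<exists>B. \<forall>s. regs s 0 = x \<and> regs s 1 = y \<longrightarrow>
    (\<exists>t s'. exec B (Assign 2 (Const 1) ;; For 3 0 (Assign 2 (Reg 2 \<otimes> Reg 1))) s t s' \<and> regs s' 2 = y ^ x)"
  proof (rule exI[of _ ?B], intro allI impI)
    fix s :: state assume s: "regs s 0 = x \<and> regs s 1 = y"
    let ?s = "s\<lparr>regs := (regs s)(2 := 1)\<rparr>"
    have "run ?B (For 3 0 (Assign 2 (Reg 2 \<otimes> Reg 1))) ?s (x * (4 + 8) + 8) (\<lambda>s'. regs s' 2 = y ^ x)"
    proof (rule run_For[where I = "\<lambda>j s'. regs s' 2 = y ^ j"])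
      fix j s' assume j: "j < x" "regs s' 2 = y ^ j"
        and ag: "agree ?B (insert 3 (wr (Assign 2 (Reg 2 \<otimes> Reg 1)))) (wa (Assign 2 (Reg 2 \<otimes> Reg 1))) ?s s'"
      have y: "regs s' 1 = y" using agree_reg[OF ag, of 1] s by simp
      show "run ?B (Assign 2 (Reg 2 \<otimes> Reg 1)) s' 4 (\<lambda>s''. regs (s''\<lparr>regs := (regs s'')(3 := Suc j)\<rparr>) 2 = y ^ Suc j)"
        using j y le[of j] le[of "Suc j"] by (simp add: wp_simps mult.commute)
    qed (use s in auto)
    then have "run ?B (Assign 2 (Const 1) ;; For 3 0 (Assign 2 (Reg 2 \<otimes> Reg 1))) s
        (1 + cost (Const 1) + (x * (4 + 8) + 8)) (\<lambda>s'. regs s' 2 = y ^ x)"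
      by (intro run_Assign_Seq) auto
    then show "\<exists>t s'. exec ?B (Assign 2 (Const 1) ;; For 3 0 (Assign 2 (Reg 2 \<otimes> Reg 1))) s t s' \<and> regs s' 2 = y ^ x"
      unfolding run_def by blast
  qed
qed

section \<open>Sizes of connected graphs and the cost of writing a distance matrix\<close>

context cgraph
begin


text \<open>In a connected graph with more than one node every node lies on an edge. The number
  \<open>n\<close> itself contributes only its logarithm to the encoding length, so it has to be
  bounded through the number of edges.\<close>

lemma card_nodes_le: "n \<le> 2 * card E + 1"
proof (cases "n = 1")
  case False
  have "{..<n} \<subseteq> \<Union>E"
  proof
    fix u assume "u \<in> {..<n}"
    then have u: "u < n" by simp
    obtain v where v: "v < n" "u \<noteq> v"
    proof (cases "u = 0")
      case True
      then show thesis using that[of 1] False n_pos by simp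
    next
      case False
      then show thesis using that[of 0] u by simp
    qed
    obtain y where "{u, y} \<in> E" using ndist_step[OF u v] .
    then show "u \<in> \<Union>E" by blast
  qed
  moreover have card2: "finite e \<and> card e = 2" if e: "e \<in> E" for e
  proof -
    obtain u v where "e = {u, v}" "u \<noteq> v" using e simple_graph by (auto simp: simple_graph_def)
    then show ?thesis by simp
  qed
  then have "finite (\<Union>E)" using finite_E by auto
  ultimately have "n \<le> card (\<Union>E)" using card_mono[of "\<Union>E" "{..<n}"] by simp
  also have "\<dots> \<le> (\<Sum>e\<in>E. card e)" by (rule card_Union_le_sum_card)
  also have "\<dots> = 2 * card E" using card2 by simp
  finally show ?thesis by simp
qed simp

lemma card_edges_le_sum: "(\<And>e. e \<in> E \<Longrightarrow> 1 \<le> l e) \<Longrightarrow> card E \<le> sum l E"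
  using sum_mono[of E "\<lambda>_. 1" l] by simp

text \<open>Started with an array that differs from the distance matrix everywhere, the algorithm has to
  overwrite each of the \<open>n\<^sup>2\<close> entries. So the time bound of \<open>theorem12\<close> absorbs a term \<open>n\<^sup>2\<close>.\<close>

lemma apsp_time_lower_bound:
  assumes A: "\<And>s. stores_graph s n E l \<Longrightarrow> all_words B s \<Longrightarrow>
      run B A s t (\<lambda>s'. \<forall>u<n. \<forall>v<n. mem s' 4 (u * n + v) = ndist l E u v)"
    and s: "stores_graph s n E l" "all_words B s" and B: "1 \<le> B"
  shows "n * n \<le> t"
proof -
  \<comment> \<open>The values 0 and 1 are enough to differ from every distance, and they fit into a
    word.\<close>
  let ?s = "s\<lparr>mem := (mem s)(4 := \<lambda>i. if ndist l E (i div n) (i mod n) = 0 then 1 else 0)\<rparr>"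
  have "stored_edge ?s = stored_edge s" by (auto simp: stored_edge_def)
  then have "stores_graph ?s n E l" using s(1) by (simp add: stores_graph_def)
  moreover have "all_words B ?s" using s(2) B by (auto simp: all_words_def)
  ultimately obtain t' s' where s': "exec B A ?s t' s'" "t' \<le> t"
    "\<forall>u<n. \<forall>v<n. mem s' 4 (u * n + v) = ndist l E u v"
    using A unfolding run_def by blast
  have "{..<n * n} \<subseteq> {i. mem s' 4 i \<noteq> mem ?s 4 i}"
  proof
    fix i assume "i \<in> {..<n * n}"
    then have "i div n < n" "i mod n < n" using n_pos by (auto simp: less_mult_imp_div_less)
    with s'(3) have "mem s' 4 (i div n * n + i mod n) = ndist l E (i div n) (i mod n)" by blast
    then show "i \<in> {i. mem s' 4 i \<noteq> mem ?s 4 i}" by simp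
  qed
  then have "n * n \<le> card {i. mem s' 4 i \<noteq> mem ?s 4 i}"
    using card_mono[of _ "{..<n * n}"] exec_changed_cells[OF s'(1), of 4] by fastforce
  also have "\<dots> \<le> t'" using exec_changed_cells[OF s'(1), of 4] by blast
  finally show ?thesis using s'(2) by simp
qed

end

lemma apsp_floyd_warshall: "apsp_algorithm floyd_warshall (\<lambda>n m. 200 * (n + m + 1) ^ 3)"
  unfolding apsp_algorithm_def
proof (rule exI[of _ 4], intro allI impI, elim conjE)
  fix n E l B s
  assume g: "simple_graph n E" "connected_graph n E" and l: "\<forall>e\<in>E. 1 \<le> l e" and s: "stores_graph s n E l"
    and B: "(2 + n + sum l E) ^ 4 \<le> B" and w: "all_words B s"
  interpret cgraph n E using g by unfold_locales
  let ?S = "2 + n + sum l E"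
  have m: "card E \<le> sum l E" using l by (intro card_edges_le_sum) auto
  have S: "?S ^ 4 = (?S * ?S) * (?S * ?S)" by (simp only: power4_eq_xxxx mult.assoc)
  \<comment> \<open>This absorbs the factor 4 in the two estimates below, so that the exponent 4
    suffices.\<close>
  have S4: "4 \<le> ?S * ?S" using mult_le_mono[of 2 ?S 2 ?S] by simp
  have "2 * ((1 + sum l E) * n) \<le> 4 * (?S * ?S)" by (intro mult_le_mono) auto
  then have B1: "2 * ((1 + sum l E) * n) \<le> B" using mult_le_mono1[OF S4, of "?S * ?S"] B unfolding S by linarith
  have "n * n + n + card E + sum l E + 10 \<le> 4 * (?S * ?S)" using m by (simp add: algebra_simps)
  then have B2: "n * n + n + card E + sum l E + 10 \<le> B" using mult_le_mono1[OF S4, of "?S * ?S"] B unfolding S by linarith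
  interpret floyd n E l B "mem s 0" "mem s 1"
    using s B1 B2 by unfold_locales (auto simp: stores_graph_def stored_edge_def[abs_def])
  have "run B floyd_warshall s (200 * (n + card E + 1) ^ 3)
    (\<lambda>s'. \<forall>x<n. \<forall>y<n. mem s' 4 (x * n + y) = ndist l E x y)"
    using s w by (intro run_floyd_warshall) (auto simp: stores_graph_def stored_edge_def)
  then obtain t s' where "exec B floyd_warshall s t s'" "t \<le> 200 * (n + card E + 1) ^ 3"
    "\<forall>x<n. \<forall>y<n. mem s' 4 (x * n + y) = ndist l E x y"
    unfolding run_def by blast
  moreover from this(3) have "\<forall>u<n. \<forall>v<n. distance l E u v = ereal (real (mem s' 4 (u * n + v)))"
    by (simp add: distance_ndist)
  ultimately show "\<exists>t s'. exec B floyd_warshall s t s' \<and> t \<le> 200 * (n + card E + 1) ^ 3 \<and>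
    (\<forall>u<n. \<forall>v<n. distance l E u v = ereal (real (mem s' 4 (u * n + v))))" by blast
qed

lemma polynomially_bounded_floyd_warshall: "polynomially_bounded (\<lambda>n m. 200 * (n + m + 1) ^ 3)"
  unfolding polynomially_bounded_def by (rule exI[of _ "smult 200 ([:1, 1:] ^ 3)"]) (simp add: add.commute)

text \<open>Kept as a bound on natural numbers, from which both the stated running time and the FPT
  bound are derived.\<close>

lemma spanner_program_correct:
  assumes "apsp_algorithm A APSP"
  obtains k where "\<And>I B s. valid_instance I \<Longrightarrow> stores_instance s I \<Longrightarrow> magnitude I ^ k \<le> B \<Longrightarrow> all_words B s \<Longrightarrow>
    \<exists>t s'. exec B (spanner_program A) s t s' \<and> correct_output I s s' \<and>
      t \<le> 8200 * (bundle_breadth I ^ max_nontrivial I * APSP (num_nodes I) (card (edges I))) +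
        320 * (num_nodes I * card (edges I))"
proof -
  obtain kA where kA: "\<forall>n E l B s. simple_graph n E \<and> connected_graph n E \<and> (\<forall>e\<in>E. 1 \<le> l e) \<and>
      stores_graph s n E l \<and> (2 + n + sum l E) ^ kA \<le> B \<and> all_words B s \<longrightarrow>
      (\<exists>t s'. exec B A s t s' \<and> t \<le> APSP n (card E) \<and>
        (\<forall>u<n. \<forall>v<n. distance l E u v = ereal (real (mem s' 4 (u * n + v)))))"
    using assms unfolding apsp_algorithm_def by (rule exE)
  show thesis
  \<comment> \<open>The summand \<open>4 * kA\<close> is due to calls with modified lengths, for
    which the numbers of the input add up to at most \<open>?M ^ 4\<close>; the 7 is due to the
    scaled sums in \<open>B1\<close>.\<close>
  proof (rule that[of "4 * kA + 7"])
    fix I B s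
    assume I: "valid_instance I" and s: "stores_instance s I" and B: "magnitude I ^ (4 * kA + 7) \<le> B" and w: "all_words B s"
    interpret spanner I by unfold_locales (rule I)
    let ?m = "card E" and ?TA = "APSP n (card E)" and ?M = "magnitude I"
    have M2: "2 \<le> ?M" by (simp add: magnitude_def)
    have pow: "?M ^ j \<le> B" if "j \<le> 4 * kA + 7" for j
      using power_increasing[OF that, of ?M] M2 B by linarith
    have m: "?m \<le> sum len0 E" by (rule card_edges_le_sum) (rule len_pos)
    have M: "n + sum len0 E + 2 \<le> ?M" "sn \<le> ?M" "sd \<le> ?M" "sum (weight I) E \<le> ?M" by (auto simp: magnitude_def)
    have heavy: "heavy \<le> ?M ^ 2"
    proof -
      have "heavy \<le> ?M * sum len0 E + ?M" unfolding heavy_def using M2 M(2) by (intro add_mono mult_right_mono) auto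
      also have "\<dots> = ?M * (sum len0 E + 1)" by simp
      also have "\<dots> \<le> ?M * ?M" using M(1) by (intro mult_left_mono) auto
      finally show ?thesis by (simp add: power2_eq_square)
    qed
    have nM: "n \<le> ?M" and mM: "?m + 2 \<le> ?M" "n + ?m + 1 \<le> ?M" using M(1) m by linarith+
    have nh: "n * heavy \<le> ?M ^ 3" using mult_le_mono[OF nM heavy] by (simp add: power_Suc[symmetric])
    have A: "run B A s' ?TA (\<lambda>s''. \<forall>u<n. \<forall>v<n. mem s'' 4 (u * n + v) = ndist l E u v)"
      if l: "\<And>e. e \<in> E \<Longrightarrow> 1 \<le> l e \<and> l e \<le> heavy" and s': "stores_graph s' n E l" "all_words B s'" for l s'
    proof -
      have "sum l E \<le> ?m * heavy" using sum_bounded_above[of E l heavy] l by simp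
      also have "\<dots> \<le> ?m * ?M ^ 2" using heavy by (intro mult_left_mono) auto
      finally have "2 + n + sum l E \<le> ?M + ?m * ?M ^ 2" using M(1) by linarith
      also have "\<dots> \<le> ?M * ?M ^ 2 + ?m * ?M ^ 2" using M2 by (intro add_mono) auto
      also have "\<dots> = (?m + ?M) * ?M ^ 2" by (simp add: algebra_simps)
      also have "\<dots> \<le> (?M + ?M) * ?M ^ 2" using mM by (intro mult_right_mono) auto
      also have "\<dots> \<le> (?M * ?M) * ?M ^ 2" using mult_le_mono1[OF M2, of ?M] by (intro mult_right_mono) linarith+
      also have "\<dots> = ?M ^ 4" by (simp add: eval_nat_numeral algebra_simps)
      finally have "(2 + n + sum l E) ^ kA \<le> (?M ^ 4) ^ kA" by (rule power_mono) simp
      then have "(2 + n + sum l E) ^ kA \<le> B" using pow[of "4 * kA"] by (simp add: power_mult)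
      then have "simple_graph n E \<and> connected_graph n E \<and> (\<forall>e\<in>E. 1 \<le> l e) \<and>
          stores_graph s' n E l \<and> (2 + n + sum l E) ^ kA \<le> B \<and> all_words B s'"
        using simple_graph connected s' l by simp
      from kA[rule_format, OF this]
      obtain t s'' where "exec B A s' t s''" "t \<le> ?TA"
        "\<forall>u<n. \<forall>v<n. distance l E u v = ereal (real (mem s'' 4 (u * n + v)))" by blast
      moreover from this(3) have "\<forall>u<n. \<forall>v<n. mem s'' 4 (u * n + v) = ndist l E u v" by (simp add: distance_ndist)
      ultimately show ?thesis unfolding run_def by blast
    qed
    have B1: "sd * (5 * (n * heavy)) \<le> B"
    proof -
      have "5 \<le> ?M ^ 3" using power_mono[OF M2, of 3] by simp
      then have "sd * (5 * (n * heavy)) \<le> ?M * (?M ^ 3 * ?M ^ 3)" using M(3) nh by (intro mult_le_mono)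
      also have "\<dots> = ?M ^ 7" by (simp add: eval_nat_numeral algebra_simps)
      also have "\<dots> \<le> B" by (rule pow) simp
      finally show ?thesis .
    qed
    have B2: "sn * (n * heavy) \<le> B"
    proof -
      have "sn * (n * heavy) \<le> ?M * ?M ^ 3" using M(2) nh by (rule mult_le_mono)
      also have "\<dots> = ?M ^ 4" by (simp add: eval_nat_numeral)
      also have "\<dots> \<le> B" by (rule pow) simp
      finally show ?thesis .
    qed
    have M4: "4 \<le> ?M ^ 2" using power_mono[OF M2, of 2] by simp
    have B3: "((?m + 1) * (?m + 2) + 3) * (n + ?m + 1) \<le> B"
    proof -
      have "(?m + 1) * (?m + 2) \<le> ?M * ?M" using mM by (intro mult_le_mono) auto
      then have "(?m + 1) * (?m + 2) + 3 \<le> 2 * ?M ^ 2" using M4 unfolding power2_eq_square by linarith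
      also have "\<dots> \<le> ?M * ?M ^ 2" using M2 by (intro mult_right_mono) auto
      finally have "((?m + 1) * (?m + 2) + 3) * (n + ?m + 1) \<le> (?M * ?M ^ 2) * ?M" using mM(2) by (rule mult_le_mono)
      also have "\<dots> = ?M ^ 4" by (simp add: eval_nat_numeral algebra_simps)
      also have "\<dots> \<le> B" by (rule pow) simp
      finally show ?thesis .
    qed
    have B4: "n * n + n + ?m + 10 \<le> B"
    proof -
      have "n * n \<le> ?M ^ 2" using mult_le_mono[OF nM nM] by (simp add: power2_eq_square)
      moreover have "2 * ?M \<le> ?M ^ 2" using mult_le_mono1[OF M2, of ?M] by (simp add: power2_eq_square)
      ultimately have "n * n + n + ?m + 10 \<le> 4 * ?M ^ 2" using mM(2) M4 by linarith
      also have "\<dots> \<le> ?M ^ 2 * ?M ^ 2" using M4 by (intro mult_right_mono) auto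
      also have "\<dots> = ?M ^ 4" by (simp add: eval_nat_numeral algebra_simps)
      also have "\<dots> \<le> B" by (rule pow) simp
      finally show ?thesis .
    qed
    have B5: "sum (weight I) E \<le> B" using M(4) pow[of 1] by simp
    have g: "stores_graph s n E len0" using s by (simp add: stores_instance_def)
    then have ed: "bij_betw (\<lambda>i. {mem s 0 i, mem s 1 i}) {..<card E} E"
      by (simp add: stores_graph_def stored_edge_def[abs_def])
    interpret machine I A ?TA B "mem s 0" "mem s 1"
      by unfold_locales (fact A ed B1 B2 B3 B4 B5)+
    have "input_ok s"
      unfolding input_ok_def el_def ew_def
      using s w by (auto simp: stores_instance_def stores_graph_def stored_edge_def)
    from run_spanner_program[OF this] obtain t s' where t: "exec B (spanner_program A) s t s'"
      "t \<le> ?TA + 25 * (n * n) + 320 * (n * ?m) + 400 * ?m + 50 * n + 400 +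
         5 * b ^ \<mu> * (2 + (?TA + 120 * (n * n) + 420 * ?m + 320 * n + 600))"
      "if \<exists>S. is_solution I S then regs s' 6 = 1 \<and> is_solution I {{mem s 0 i, mem s 1 i} | i. i < ?m \<and> mem s' 5 i = 1}
       else regs s' 6 = 0"
      unfolding run_def by blast
    have out: "stored_edge s ` {i. i < ?m \<and> mem s' 5 i = 1} = {{mem s 0 i, mem s 1 i} | i. i < ?m \<and> mem s' 5 i = 1}"
      by (auto simp: stored_edge_def)
    have "correct_output I s s'" unfolding correct_output_def out by (rule t(3))
    moreover have "t \<le> 8200 * (b ^ \<mu> * ?TA) + 320 * (n * ?m)"
    proof -
      have len_heavy: "len0 e \<le> heavy" if "e \<in> E" for e
      proof -
        have "len0 e \<le> sum len0 E" using that finite_E by (simp add: member_le_sum)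
        also have "\<dots> \<le> sn * sum len0 E" using sn_pos by simp
        finally show ?thesis by (simp add: heavy_def)
      qed
      \<comment> \<open>The original lengths form an admissible input, and the given state stores
        it, so the lower bound applies to \<open>?TA\<close>.\<close>
      have nn: "n * n \<le> ?TA"
        by (rule apsp_time_lower_bound[OF A g w]) (use len_pos len_heavy B4 in auto)
      have small: "?m \<le> ?TA" "n \<le> ?TA" "1 \<le> ?TA" using card_E nn n_pos le_square[of n] by linarith+
      have b: "?TA \<le> b ^ \<mu> * ?TA" using breadth_pos by simp
      \<comment> \<open>1463 is the sum of 1, 120, 420, 320 and the constant 602.\<close>
      have "2 + (?TA + 120 * (n * n) + 420 * ?m + 320 * n + 600) \<le> 1463 * ?TA" using nn small by linarith
      then have "5 * b ^ \<mu> * (2 + (?TA + 120 * (n * n) + 420 * ?m + 320 * n + 600)) \<le> 5 * b ^ \<mu> * (1463 * ?TA)"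
        by (intro mult_left_mono) auto
      also have "\<dots> = 7315 * (b ^ \<mu> * ?TA)" by simp
      \<comment> \<open>The coefficients 1, 25, 400, 50 and 400 of the remaining terms together with
        7315 give 8191.\<close>
      finally show ?thesis using t(2) nn small b by linarith
    qed
    ultimately show "\<exists>t s'. exec B (spanner_program A) s t s' \<and> correct_output I s s' \<and>
      t \<le> 8200 * (bundle_breadth I ^ max_nontrivial I * APSP (num_nodes I) (card (edges I))) +
        320 * (num_nodes I * card (edges I))"
      using t(1) by blast
  qed
qed

lemma spanner_program_time:
  assumes "apsp_algorithm A APSP"
  shows "spanner_algorithm (spanner_program A) (\<lambda>I. 8200 * spanner_time_bound APSP I)"
proof -
  obtain k where k: "\<And>I B s. valid_instance I \<Longrightarrow> stores_instance s I \<Longrightarrow> magnitude I ^ k \<le> B \<Longrightarrow> all_words B s \<Longrightarrow>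
    \<exists>t s'. exec B (spanner_program A) s t s' \<and> correct_output I s s' \<and>
      t \<le> 8200 * (bundle_breadth I ^ max_nontrivial I * APSP (num_nodes I) (card (edges I))) +
        320 * (num_nodes I * card (edges I))"
    using spanner_program_correct[OF assms] by blast
  have "real t \<le> 8200 * spanner_time_bound APSP I"
    if I: "valid_instance I" and t: "t \<le> 8200 * (bundle_breadth I ^ max_nontrivial I * APSP (num_nodes I) (card (edges I))) +
        320 * (num_nodes I * card (edges I))" for I t
  proof -
    have "real (num_nodes I) \<ge> 1" using I by (auto simp: valid_instance_def connected_graph_def)
    then have "0 \<le> real (num_nodes I) ^ 2 * log 2 (real (num_nodes I))" by (intro mult_nonneg_nonneg) auto
    moreover have "0 \<le> real (num_nodes I) * real (card (edges I))" by simp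
    moreover have "real t \<le> 8200 * (real (bundle_breadth I) ^ max_nontrivial I * real (APSP (num_nodes I) (card (edges I)))) +
        320 * (real (num_nodes I) * real (card (edges I)))"
      using of_nat_mono[OF t, where 'a = real] by simp
    ultimately show ?thesis unfolding spanner_time_bound_def Let_def distrib_left by linarith
  qed
  then show ?thesis unfolding spanner_algorithm_def using k by (intro exI[of _ k]) blast
qed

text \<open>The FPT bound is a product, so the term nm is multiplied by b^\<mu>, which is at least
  1.\<close>

lemma spanner_program_fpt:
  assumes "apsp_algorithm A APSP" "polynomially_bounded APSP"
  shows "fpt_spanner_algorithm (spanner_program A)"
proof -
  obtain k where k: "\<And>I B s. valid_instance I \<Longrightarrow> stores_instance s I \<Longrightarrow> magnitude I ^ k \<le> B \<Longrightarrow> all_words B s \<Longrightarrow>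
    \<exists>t s'. exec B (spanner_program A) s t s' \<and> correct_output I s s' \<and>
      t \<le> 8200 * (bundle_breadth I ^ max_nontrivial I * APSP (num_nodes I) (card (edges I))) +
        320 * (num_nodes I * card (edges I))"
    using spanner_program_correct[OF assms(1)] by blast
  obtain q where q: "\<And>n m. APSP n m \<le> poly q (n + m)" using assms(2) by (auto simp: polynomially_bounded_def)
  let ?p = "smult 8200 q + monom 320 2"
  have "real t \<le> real (bundle_breadth I ^ max_nontrivial I) * real (poly ?p (encoding_length I))"
    if I: "valid_instance I" and t: "t \<le> 8200 * (bundle_breadth I ^ max_nontrivial I * APSP (num_nodes I) (card (edges I))) +
        320 * (num_nodes I * card (edges I))" for I t
  proof -
    interpret spanner I by unfold_locales (rule I)
    \<comment> \<open>Every edge takes at least 4 bits: two for its ends, one for its length and one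
      for its weight.\<close>
    have "4 * card E = (\<Sum>e\<in>E. 4)" by simp
    also have "\<dots> \<le> (\<Sum>e\<in>E. 2 * bits n + bits (len I e) + bits (weight I e))"
      by (intro sum_mono) (auto simp: bits_def)
    finally have "4 * card E + 1 \<le> encoding_length I" unfolding encoding_length_def by (simp add: bits_def)
    then have enc: "n + card E \<le> encoding_length I" using card_nodes_le by linarith
    then have "APSP n (card E) \<le> poly q (encoding_length I)" using q[of n "card E"] poly_mono_nat[OF enc, of q] by linarith
    moreover have "n * card E \<le> encoding_length I * encoding_length I" using enc by (intro mult_le_mono) auto
    moreover have "n * card E \<le> b ^ \<mu> * (n * card E)" using breadth_pos by simp
    ultimately have "t \<le> 8200 * (b ^ \<mu> * poly q (encoding_length I)) + 320 * (b ^ \<mu> * (encoding_length I * encoding_length I))"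
      using t mult_le_mono2[of "APSP n (card E)" "poly q (encoding_length I)" "b ^ \<mu>"]
        mult_le_mono2[of "n * card E" "encoding_length I * encoding_length I" "b ^ \<mu>"] by linarith
    also have "\<dots> = b ^ \<mu> * poly ?p (encoding_length I)"
      by (simp add: poly_monom power2_eq_square algebra_simps)
    finally show ?thesis unfolding of_nat_mult[symmetric] of_nat_le_iff .
  qed
  then have "spanner_algorithm (spanner_program A) (\<lambda>I.
      real (bundle_breadth I ^ max_nontrivial I) * real (poly ?p (encoding_length I)))"
    unfolding spanner_algorithm_def using k by (intro exI[of _ k]) blast
  then show ?thesis unfolding fpt_spanner_algorithm_def using computable2_power by blast
qed

theorem theorem12:
  shows "(\<exists>P. fpt_spanner_algorithm P) \<and>
    (\<forall>A APSP. apsp_algorithm A APSP \<longrightarrow>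
       (\<exists>P. (\<exists>c. spanner_algorithm P (\<lambda>I. c * spanner_time_bound APSP I)) \<and>
            (polynomially_bounded APSP \<longrightarrow> fpt_spanner_algorithm P)))"
  using spanner_program_time spanner_program_fpt apsp_floyd_warshall polynomially_bounded_floyd_warshall by blast

end
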